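(* Let $U=U(0,1)$ be the open unit ball in $\mathbb{R}^m$, let $1<p<\infty$, and let $g:\partial U\to\mathcal{Q}_Q(\ell_2)$ be Lipschitz. Then the minimization problem $$\begin{cases}\text{minimize } \int_U |Df|^p\,d\mathcal{L}^m\\ \text{among } f\in W^1_p(U;\mathcal{Q}_Q(\ell_2)) \text{ such that } \mathcal{T}(f)=g\end{cases}$$ admits a solution.
   Context: $Q,m\ge 1$ are integers; $\mathbb{R}^m$ has its Euclidean norm; $\ell_2$ is the infinite dimensional separable real Hilbert space; $\mathcal{L}^m$ is Lebesgue measure and $\mathcal{H}^{m-1}$ Hausdorff measure. For a metric space $(Z,d)$, $\mathcal{Q}_Q(Z)$ is the quotient of $Z^Q$ by the permutation action of the symmetric group $S_Q$; the class of $(z_1,\dots,z_Q)$ is written $[\![z_1,\dots,z_Q]\!]$, and $Q[\![z]\!]=[\![z,\dots,z]\!]$. It carries the metric $\mathcal{G}([\![z_1,\dots,z_Q]\!],[\![z_1',\dots,z_Q']\!])=\min_{\sigma\in S_Q}\big(\sum_{i} d(z_i,z'_{\sigma(i)})^2\big)^{1/2}$. For a measure space $(S,\mu)$ with $S$ a Borel subset of $\mathbb{R}^m$ and $\mu$ a Borel measure, $L_p(S;\mathcal{Q}_Q(\ell_2))$ is the set of Borel measurable $f:S\to\mathcal{Q}_Q(\ell_2)$ with $\int_S |f|^p d\mu<\infty$, where $|f(x)|=\mathcal{G}(f(x),Q[\![0]\!])$; its semimetric is $d_p(f_1,f_2)=(\int_S\mathcal{G}(f_1,f_2)^p d\mu)^{1/p}$.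 On $U$ we use $\mu=\mathcal{L}^m$, on $\partial U$ we use $\mu=\mathcal{H}^{m-1}$. A Borel map $f:U\to\mathcal{Q}_Q(\ell_2)$ is approximately differentiable at $a\in U$ if there are affine maps $A_1,\dots,A_Q:\mathbb{R}^m\to\ell_2$ such that for every $\varepsilon>0$ the set $\{x:\mathcal{G}(f(x),[\![A_1(x),\dots,A_Q(x)]\!])>\varepsilon\|x-a\|\}$ has $m$-dimensional density $0$ at $a$; the unordered tuple of the $A_i$ is then unique. With $L_i=A_i-A_i(0)$ put $Df(a)=[\![L_1,\dots,L_Q]\!]$ and $|Df(a)|=\big(\sum_{i=1}^Q\sum_{j=1}^m\|L_i(e_j)\|^2\big)^{1/2}$, with $e_1,\dots,e_m$ the canonical basis of $\mathbb{R}^m$. Lipschitz maps are approximately differentiable almost everywhere. $W^1_p(U;\mathcal{Q}_Q(\ell_2))$ is the set of $f\in L_p(U;\mathcal{Q}_Q(\ell_2))$ for which there are Lipschitz maps $f_j:\mathbb{R}^m\to\mathcal{Q}_Q(\ell_2)$ with $\sup_j\int_U|Df_j|^p d\mathcal{L}^m<\infty$ and $d_p(f,f_j)\to0$. Such $f$ are approximately differentiable $\mathcal{L}^m$-almost everywhere in $U$. Trace: $\mathcal{T}:W^1_p(U;\mathcal{Q}_Q(\ell_2))\to L_p(\partial U;\mathcal{Q}_Q(\ell_2))$ is the map (determined up to $\mathcal{H}^{m-1}$-a.e. equality) such that (a) $\mathcal{T}(f)=f|_{\partial U}$ if $f:\overline U\to\mathcal{Q}_Q(\ell_2)$ is Lipschitz,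 and (b) for every $\varepsilon>0$ there is $\theta>0$ with $\int_{\partial U}\mathcal{G}(\mathcal{T}(f_1),\mathcal{T}(f_2))^p d\mathcal{H}^{m-1}\le\theta\int_U\mathcal{G}(f_1,f_2)^pd\mathcal{L}^m+\varepsilon\int_U(|Df_1|^p+|Df_2|^p)d\mathcal{L}^m$ for all $f_1,f_2\in W^1_p(U;\mathcal{Q}_Q(\ell_2))$. Equivalently, $\mathcal{T}(f)$ is the $L_p(\partial U)$-limit of $f_j|_{\partial U}$ for any Lipschitz $f_j:\overline U\to\mathcal{Q}_Q(\ell_2)$ with $d_p(f,f_j)\to0$ and $\sup_j\int_U|Df_j|^p d\mathcal{L}^m<\infty$. The condition $\mathcal{T}(f)=g$ is understood $\mathcal{H}^{m-1}$-almost everywhere on $\partial U$. *)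

theory Defs
  imports "HOL-Analysis.Analysis"
begin

section \<open>The Hilbert space of square summable sequences\<close>

typedef l2 = "{x :: nat \<Rightarrow> real. summable (\<lambda>n. (x n)\<^sup>2)}"
  morphisms l2_nth Abs_l2
  by (rule exI[of _ "\<lambda>_. 0"]) simp

setup_lifting type_definition_l2

lemma summable_l2: "summable (\<lambda>n. (l2_nth x n)\<^sup>2)"
  using l2_nth[of x] by simp

lemma summable_mult_l2:
  fixes x y :: "nat \<Rightarrow> real"
  assumes "summable (\<lambda>n. (x n)\<^sup>2)" "summable (\<lambda>n. (y n)\<^sup>2)"
  shows "summable (\<lambda>n. x n * y n)"
proof (rule summable_comparison_test[OF _ summable_add[OF assms]], intro exI allI impI)
  fix n :: nat
  have "0 \<le> (\<bar>x n\<bar> - \<bar>y n\<bar>)\<^sup>2" by simp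
  then have "2 * (\<bar>x n\<bar> * \<bar>y n\<bar>) \<le> (x n)\<^sup>2 + (y n)\<^sup>2"
    by (simp add: power2_diff)
  moreover have "0 \<le> \<bar>x n\<bar> * \<bar>y n\<bar>" by simp
  ultimately show "norm (x n * y n) \<le> (x n)\<^sup>2 + (y n)\<^sup>2"
    by (simp only: real_norm_def abs_mult)
qed

instantiation l2 :: real_vector
begin

lift_definition zero_l2 :: l2 is "\<lambda>_. 0" by simp

lift_definition plus_l2 :: "l2 \<Rightarrow> l2 \<Rightarrow> l2" is "\<lambda>x y n. x n + y n"
proof -
  fix x y :: "nat \<Rightarrow> real"
  assume x: "summable (\<lambda>n. (x n)\<^sup>2)" and y: "summable (\<lambda>n. (y n)\<^sup>2)"
  have "summable (\<lambda>n. ((x n)\<^sup>2 + (y n)\<^sup>2) + 2 * (x n * y n))"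
    by (intro summable_add x y summable_mult summable_mult_l2)
  then show "summable (\<lambda>n. (x n + y n)\<^sup>2)"
    by (simp add: power2_sum mult.assoc)
qed

lift_definition uminus_l2 :: "l2 \<Rightarrow> l2" is "\<lambda>x n. - x n" by simp

lift_definition scaleR_l2 :: "real \<Rightarrow> l2 \<Rightarrow> l2" is "\<lambda>c x n. c * x n"
  by (simp add: power_mult_distrib summable_mult)

definition minus_l2 :: "l2 \<Rightarrow> l2 \<Rightarrow> l2" where "minus_l2 x y = x + - y"

instance
  by standard (unfold minus_l2_def, (transfer, simp add: algebra_simps)+)

end

instantiation l2 :: real_inner
begin

lift_definition inner_l2 :: "l2 \<Rightarrow> l2 \<Rightarrow> real" is "\<lambda>x y. \<Sum>n. x n * y n" .

definition norm_l2 :: "l2 \<Rightarrow> real" where "norm_l2 x = sqrt (inner x x)"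
definition dist_l2 :: "l2 \<Rightarrow> l2 \<Rightarrow> real" where "dist_l2 x y = norm (x - y)"
definition sgn_l2 :: "l2 \<Rightarrow> l2" where "sgn_l2 x = inverse (norm x) *\<^sub>R x"
definition uniformity_l2 :: "(l2 \<times> l2) filter"
  where "uniformity_l2 = (INF e\<in>{0<..}. principal {(x, y). dist x y < e})"
definition open_l2 :: "l2 set \<Rightarrow> bool"
  where "open_l2 S \<longleftrightarrow> (\<forall>x\<in>S. \<forall>\<^sub>F (x', y) in uniformity. x' = x \<longrightarrow> y \<in> S)"

instance
proof
  fix x y z :: l2 and r :: real and S :: "l2 set"
  show "dist x y = norm (x - y)" "sgn x = x /\<^sub>R norm x" "norm x = sqrt (inner x x)"
    by (simp_all add: dist_l2_def sgn_l2_def norm_l2_def)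
  show "uniformity = (INF e\<in>{0<..}. principal {(x, y :: l2). dist x y < e})"
    by (rule uniformity_l2_def)
  show "open S \<longleftrightarrow> (\<forall>x\<in>S. \<forall>\<^sub>F (x', y) in uniformity. x' = x \<longrightarrow> y \<in> S)"
    by (rule open_l2_def)
  show "inner x y = inner y x"
    by transfer (simp add: mult.commute)
  show "inner (x + y) z = inner x z + inner y z"
    by transfer (simp add: suminf_add summable_mult_l2 distrib_right)
  show "inner (r *\<^sub>R x) y = r * inner x y"
    by transfer (simp add: suminf_mult summable_mult_l2 mult.assoc)
  show "0 \<le> inner x x"
    by transfer (intro suminf_nonneg summable_mult_l2, simp_all)
  show "inner x x = 0 \<longleftrightarrow> x = 0"
  proof transfer
    fix x :: "nat \<Rightarrow> real" assume x: "summable (\<lambda>n. (x n)\<^sup>2)"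
    have "(\<Sum>n. (x n)\<^sup>2) = 0 \<longleftrightarrow> (\<forall>n. (x n)\<^sup>2 = 0)"
      by (rule suminf_eq_zero_iff[OF x]) simp
    then show "(\<Sum>n. x n * x n) = 0 \<longleftrightarrow> x = (\<lambda>_. 0)"
      by (auto simp: power2_eq_square fun_eq_iff)
  qed
qed

end

section \<open>Unordered tuples\<close>

text \<open>
  The index type \<open>'q\<close> has \<open>Q\<close> elements, so that \<open>('a, 'q) qtuple\<close> is the quotient of the \<open>Q\<close>-fold
  power of \<open>'a\<close> by the symmetric group.
\<close>

definition perm_equiv :: "('q::finite \<Rightarrow> 'a) \<Rightarrow> ('q \<Rightarrow> 'a) \<Rightarrow> bool"
  where "perm_equiv z w \<longleftrightarrow> (\<exists>\<sigma>. bij \<sigma> \<and> w = z \<circ> \<sigma>)"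

lemma perm_equiv_sym: "perm_equiv z w \<Longrightarrow> perm_equiv w z"
proof -
  assume "perm_equiv z w"
  then obtain \<sigma> where \<sigma>: "bij \<sigma>" "w = z \<circ> \<sigma>" unfolding perm_equiv_def by auto
  then have "z = w \<circ> inv \<sigma>"
    by (simp add: fun_eq_iff bij_is_surj surj_f_inv_f)
  with \<sigma> show "perm_equiv w z" unfolding perm_equiv_def using bij_imp_bij_inv by blast
qed

lemma perm_equiv_trans: "perm_equiv x y \<Longrightarrow> perm_equiv y z \<Longrightarrow> perm_equiv x z"
  unfolding perm_equiv_def by (metis bij_comp comp_assoc)

lemma equivp_perm_equiv: "equivp perm_equiv"
proof (rule equivpI)
  show "reflp perm_equiv"
    unfolding perm_equiv_def by (intro reflpI exI[of _ id]) simp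
  show "symp perm_equiv"
    by (rule sympI) (rule perm_equiv_sym)
  show "transp perm_equiv"
    by (rule transpI) (rule perm_equiv_trans)
qed

quotient_type ('a, 'q) qtuple = "'q::finite \<Rightarrow> 'a" / perm_equiv
  morphisms rep_qtuple qtuple
  by (rule equivp_perm_equiv)

definition qconst :: "'a \<Rightarrow> ('a, 'q::finite) qtuple"
  where "qconst z = qtuple (\<lambda>_. z)"

lift_definition qsum :: "('a \<Rightarrow> real) \<Rightarrow> ('a, 'q::finite) qtuple \<Rightarrow> real"
  is "\<lambda>\<phi> z. \<Sum>i\<in>UNIV. \<phi> (z i)"
proof -
  fix \<phi> :: "'a \<Rightarrow> real" and z w :: "'q \<Rightarrow> 'a" assume "perm_equiv z w"
  then obtain \<sigma> where "bij \<sigma>" "w = z \<circ> \<sigma>" unfolding perm_equiv_def by auto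
  then show "(\<Sum>i\<in>UNIV. \<phi> (z i)) = (\<Sum>i\<in>UNIV. \<phi> (w i))"
    using sum.reindex_bij_betw[of \<sigma> UNIV UNIV "\<lambda>i. \<phi> (z i)"] by simp
qed

definition tuple_dist :: "('q::finite \<Rightarrow> 'a::metric_space) \<Rightarrow> ('q \<Rightarrow> 'a) \<Rightarrow> real"
  where "tuple_dist z w =
    Min ((\<lambda>\<sigma>. sqrt (\<Sum>i\<in>UNIV. (dist (z i) (w (\<sigma> i)))\<^sup>2)) ` {\<sigma>. bij \<sigma>})"

lemma tuple_dist_le:
  "bij \<sigma> \<Longrightarrow> tuple_dist z w \<le> sqrt (\<Sum>i\<in>UNIV. (dist (z i) (w (\<sigma> i)))\<^sup>2)"
  unfolding tuple_dist_def by (rule Min_le) auto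

lemma tuple_dist_attained:
  obtains \<sigma> where "bij \<sigma>" "tuple_dist z w = sqrt (\<Sum>i\<in>UNIV. (dist (z i) (w (\<sigma> i)))\<^sup>2)"
proof -
  have "tuple_dist z w \<in> (\<lambda>\<sigma>. sqrt (\<Sum>i\<in>UNIV. (dist (z i) (w (\<sigma> i)))\<^sup>2)) ` {\<sigma>. bij \<sigma>}"
    unfolding tuple_dist_def by (rule Min_in) (auto intro: exI[of _ id])
  then show ?thesis using that by auto
qed

lemma tuple_dist_commute_le: "tuple_dist z w \<le> tuple_dist w z"
proof -
  obtain \<sigma> where \<sigma>: "bij \<sigma>" "tuple_dist w z = sqrt (\<Sum>i\<in>UNIV. (dist (w i) (z (\<sigma> i)))\<^sup>2)"
    by (rule tuple_dist_attained)
  have "(\<Sum>i\<in>UNIV. (dist (w i) (z (\<sigma> i)))\<^sup>2) = (\<Sum>i\<in>UNIV. (dist (z i) (w (inv \<sigma> i)))\<^sup>2)"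
    using sum.reindex_bij_betw[OF \<sigma>(1), of "\<lambda>i. (dist (z i) (w (inv \<sigma> i)))\<^sup>2"] \<sigma>(1)
    by (simp add: bij_is_inj dist_commute)
  then show ?thesis using \<sigma> tuple_dist_le[OF bij_imp_bij_inv[OF \<sigma>(1)], of z w] by simp
qed

lemma tuple_dist_triangle: "tuple_dist x z \<le> tuple_dist x y + tuple_dist y z"
proof -
  obtain \<sigma> where \<sigma>: "bij \<sigma>" "tuple_dist x y = sqrt (\<Sum>i\<in>UNIV. (dist (x i) (y (\<sigma> i)))\<^sup>2)"
    by (rule tuple_dist_attained)
  obtain \<tau> where \<tau>: "bij \<tau>" "tuple_dist y z = sqrt (\<Sum>i\<in>UNIV. (dist (y i) (z (\<tau> i)))\<^sup>2)"
    by (rule tuple_dist_attained)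
  have "tuple_dist x z \<le> L2_set (\<lambda>i. dist (x i) (z (\<tau> (\<sigma> i)))) UNIV"
    using tuple_dist_le[OF bij_comp[OF \<sigma>(1) \<tau>(1)], of x z] by (simp add: L2_set_def)
  also have "\<dots> \<le> L2_set (\<lambda>i. dist (x i) (y (\<sigma> i)) + dist (y (\<sigma> i)) (z (\<tau> (\<sigma> i)))) UNIV"
    by (intro L2_set_mono dist_triangle) auto
  also have "\<dots> \<le> L2_set (\<lambda>i. dist (x i) (y (\<sigma> i))) UNIV
      + L2_set (\<lambda>i. dist (y (\<sigma> i)) (z (\<tau> (\<sigma> i)))) UNIV"
    by (rule L2_set_triangle_ineq)
  also have "L2_set (\<lambda>i. dist (y (\<sigma> i)) (z (\<tau> (\<sigma> i)))) UNIV = tuple_dist y z"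
    using sum.reindex_bij_betw[OF \<sigma>(1), of "\<lambda>i. (dist (y i) (z (\<tau> i)))\<^sup>2"] \<tau>
    by (simp add: L2_set_def)
  finally show ?thesis using \<sigma> by (simp add: L2_set_def)
qed

lemma tuple_dist_eq_0_iff: "tuple_dist z w = 0 \<longleftrightarrow> perm_equiv z w"
proof
  assume "tuple_dist z w = 0"
  moreover obtain \<sigma> where "bij \<sigma>" "tuple_dist z w = sqrt (\<Sum>i\<in>UNIV. (dist (z i) (w (\<sigma> i)))\<^sup>2)"
    by (rule tuple_dist_attained)
  ultimately have \<sigma>: "bij \<sigma>" "(\<Sum>i\<in>UNIV. (dist (z i) (w (\<sigma> i)))\<^sup>2) = 0" by simp_all
  then have "z = w \<circ> \<sigma>" by (simp add: sum_nonneg_eq_0_iff fun_eq_iff)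
  with \<sigma> show "perm_equiv z w"
    by (intro perm_equiv_sym[of w z]) (auto simp: perm_equiv_def)
next
  assume "perm_equiv z w"
  then have "perm_equiv w z" by (rule perm_equiv_sym)
  then obtain \<sigma> where \<sigma>: "bij \<sigma>" "z = w \<circ> \<sigma>" unfolding perm_equiv_def by auto
  then have "tuple_dist z w \<le> 0" using tuple_dist_le[OF \<sigma>(1), of z w] by simp
  moreover have "0 \<le> tuple_dist z w"
    by (rule tuple_dist_attained[of z w]) (simp add: sum_nonneg)
  ultimately show "tuple_dist z w = 0" by simp
qed

instantiation qtuple :: (metric_space, finite) metric_space
begin

lift_definition dist_qtuple :: "('a, 'b) qtuple \<Rightarrow> ('a, 'b) qtuple \<Rightarrow> real" is tuple_dist
proof -
  fix x x' y y' :: "'b \<Rightarrow> 'a"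
  assume "perm_equiv x x'" "perm_equiv y y'"
  then have "tuple_dist x x' = 0" "tuple_dist y y' = 0" by (simp_all add: tuple_dist_eq_0_iff)
  moreover have "tuple_dist x' x = 0" "tuple_dist y' y = 0"
    using \<open>perm_equiv x x'\<close> \<open>perm_equiv y y'\<close>
    by (simp_all add: tuple_dist_eq_0_iff perm_equiv_sym)
  ultimately show "tuple_dist x y = tuple_dist x' y'"
    using tuple_dist_triangle[of x y x'] tuple_dist_triangle[of x' y y']
      tuple_dist_triangle[of x' y' x] tuple_dist_triangle[of x y' y] by linarith
qed

definition uniformity_qtuple :: "(('a, 'b) qtuple \<times> ('a, 'b) qtuple) filter"
  where "uniformity_qtuple = (INF e\<in>{0<..}. principal {(x, y). dist x y < e})"
definition open_qtuple :: "('a, 'b) qtuple set \<Rightarrow> bool"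
  where "open_qtuple S \<longleftrightarrow> (\<forall>x\<in>S. \<forall>\<^sub>F (x', y) in uniformity. x' = x \<longrightarrow> y \<in> S)"

instance
proof
  fix x y z :: "('a, 'b) qtuple" and S :: "('a, 'b) qtuple set"
  show "uniformity = (INF e\<in>{0<..}. principal {(x, y :: ('a, 'b) qtuple). dist x y < e})"
    by (rule uniformity_qtuple_def)
  show "open S \<longleftrightarrow> (\<forall>x\<in>S. \<forall>\<^sub>F (x', y) in uniformity. x' = x \<longrightarrow> y \<in> S)"
    by (rule open_qtuple_def)
  show "dist x y = 0 \<longleftrightarrow> x = y"
    by transfer (rule tuple_dist_eq_0_iff)
  have "dist y z \<le> dist z y"
    by transfer (rule tuple_dist_commute_le)
  moreover have "dist x y \<le> dist x z + dist z y"
    by transfer (rule tuple_dist_triangle)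
  moreover have "dist z y \<le> dist y z"
    by transfer (rule tuple_dist_commute_le)
  ultimately show "dist x y \<le> dist x z + dist y z" by simp
qed

end

section \<open>Hausdorff measure\<close>

text \<open>
  The normalisation is such that the \<open>k\<close>-dimensional Hausdorff measure on a \<open>k\<close>-dimensional space
  agrees with Lebesgue measure. The gauge of the empty set is 0 also for \<open>k = 0\<close>, where \<open>0 ^ 0 = 1\<close>
  counts points. Boundedness is required since \<^const>\<open>diameter\<close> is unspecified on unbounded sets.
\<close>

definition hausdorff_gauge :: "nat \<Rightarrow> 'a::metric_space set \<Rightarrow> ennreal"
  where "hausdorff_gauge k A =
    (if A = {} then 0 else ennreal (unit_ball_vol (real k) * (diameter A / 2) ^ k))"

definition hausdorff_content :: "nat \<Rightarrow> real \<Rightarrow> 'a::metric_space set \<Rightarrow> ennreal"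
  where "hausdorff_content k \<delta> E =
    (INF A\<in>{A :: nat \<Rightarrow> 'a set. E \<subseteq> (\<Union>i. A i) \<and> (\<forall>i. bounded (A i) \<and> diameter (A i) \<le> \<delta>)}.
      \<Sum>i. hausdorff_gauge k (A i))"

definition hausdorff_outer :: "nat \<Rightarrow> 'a::metric_space set \<Rightarrow> ennreal"
  where "hausdorff_outer k E = (SUP \<delta>\<in>{0<..}. hausdorff_content k \<delta> E)"

text \<open>
  Borel sets are Caratheodory measurable for the metric outer measure \<^const>\<open>hausdorff_outer\<close>, so
  that \<^const>\<open>measure_of\<close> does not fall back to the zero measure here.
\<close>

definition hausdorff_measure :: "nat \<Rightarrow> 'a::metric_space measure"
  where "hausdorff_measure k = measure_of UNIV (sets borel) (hausdorff_outer k)"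

section \<open>Lebesgue spaces of functions with values in unordered tuples\<close>

definition Lp :: "'x measure \<Rightarrow> real \<Rightarrow> ('x \<Rightarrow> ('a::real_normed_vector, 'q::finite) qtuple) set"
  where "Lp M p = {f \<in> borel_measurable M. (\<integral>\<^sup>+x. ennreal (dist (f x) (qconst 0) powr p) \<partial>M) < \<infinity>}"

definition Lp_dist ::
    "'x measure \<Rightarrow> real \<Rightarrow> ('x \<Rightarrow> ('a::metric_space, 'q::finite) qtuple) \<Rightarrow> ('x \<Rightarrow> ('a, 'q) qtuple) \<Rightarrow> ennreal"
  where "Lp_dist M p f g = (let I = \<integral>\<^sup>+x. ennreal (dist (f x) (g x) powr p) \<partial>M
    in if I = \<infinity> then \<infinity> else ennreal (enn2real I powr (1 / p)))"

text \<open>The measures on an open set \<open>U\<close> and on its boundary.\<close>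

abbreviation dom_measure :: "(real ^ 'm) set \<Rightarrow> (real ^ 'm) measure"
  where "dom_measure U \<equiv> restrict_space lborel U"

abbreviation bd_measure :: "(real ^ 'm) set \<Rightarrow> (real ^ 'm) measure"
  where "bd_measure U \<equiv> restrict_space (hausdorff_measure (CARD('m) - 1)) (frontier U)"

section \<open>Approximate differentiability\<close>

definition density_zero :: "(real ^ 'm) set \<Rightarrow> real ^ 'm \<Rightarrow> bool"
  where "density_zero S a \<longleftrightarrow>
    ((\<lambda>r. measure lebesgue (S \<inter> cball a r) / (unit_ball_vol (real CARD('m)) * r ^ CARD('m)))
      \<longlongrightarrow> 0) (at_right 0)"

definition affine_map :: "('v::real_vector \<Rightarrow> 'w::real_vector) \<Rightarrow> bool"
  where "affine_map A \<longleftrightarrow> linear (\<lambda>x. A x - A 0)"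

definition approx_affine ::
    "(real ^ 'm) set \<Rightarrow> (real ^ 'm \<Rightarrow> ('a::real_normed_vector, 'q::finite) qtuple) \<Rightarrow> real ^ 'm
      \<Rightarrow> ('q \<Rightarrow> real ^ 'm \<Rightarrow> 'a) \<Rightarrow> bool"
  where "approx_affine U f a A \<longleftrightarrow>
    f \<in> borel_measurable (restrict_space borel U) \<and> (\<forall>i. affine_map (A i)) \<and>
    (\<forall>\<epsilon>>0. density_zero {x\<in>U. dist (f x) (qtuple (\<lambda>i. A i x)) > \<epsilon> * norm (x - a)} a)"

text \<open>
  \<open>Df\<close> is the unordered tuple of the linear parts, which is unique for \<open>a\<close> in an open \<open>U\<close>.
  It is unspecified where \<open>f\<close> is not approximately differentiable; for Sobolev maps this is a null set.
\<close>

definition Df ::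
    "(real ^ 'm) set \<Rightarrow> (real ^ 'm \<Rightarrow> ('a::real_normed_vector, 'q::finite) qtuple) \<Rightarrow> real ^ 'm
      \<Rightarrow> (real ^ 'm \<Rightarrow> 'a, 'q) qtuple"
  where "Df U f a = (THE D. \<exists>A. approx_affine U f a A \<and> D = qtuple (\<lambda>i x. A i x - A i 0))"

definition Df_norm :: "(real ^ 'm \<Rightarrow> 'a::real_normed_vector, 'q::finite) qtuple \<Rightarrow> real"
  where "Df_norm D = sqrt (qsum (\<lambda>L. \<Sum>j\<in>UNIV. (norm (L (axis j 1)))\<^sup>2) D)"

definition energy ::
    "(real ^ 'm) set \<Rightarrow> real \<Rightarrow> (real ^ 'm \<Rightarrow> ('a::real_normed_vector, 'q::finite) qtuple) \<Rightarrow> ennreal"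
  where "energy U p f = (\<integral>\<^sup>+x. ennreal (Df_norm (Df U f x) powr p) \<partial>dom_measure U)"

section \<open>Sobolev maps and their traces\<close>

text \<open>
  Maps on \<open>U\<close> or on its boundary are represented by total functions whose values elsewhere do not
  matter.
\<close>

definition Sobolev ::
    "(real ^ 'm) set \<Rightarrow> real \<Rightarrow> (real ^ 'm \<Rightarrow> ('a::real_normed_vector, 'q::finite) qtuple) set"
  where "Sobolev U p = {f \<in> Lp (dom_measure U) p.
    \<exists>F :: nat \<Rightarrow> real ^ 'm \<Rightarrow> ('a, 'q) qtuple.
      (\<forall>j. \<exists>L. L-lipschitz_on UNIV (F j)) \<and>
      (SUP j. energy U p (F j)) < \<infinity> \<and>
      (\<lambda>j. Lp_dist (dom_measure U) p f (F j)) \<longlonglongrightarrow> 0}"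

definition is_trace ::
    "(real ^ 'm) set \<Rightarrow> real
      \<Rightarrow> ((real ^ 'm \<Rightarrow> ('a::real_normed_vector, 'q::finite) qtuple) \<Rightarrow> real ^ 'm \<Rightarrow> ('a, 'q) qtuple)
      \<Rightarrow> bool"
  where "is_trace U p T \<longleftrightarrow>
    (\<forall>f \<in> Sobolev U p. T f \<in> Lp (bd_measure U) p) \<and>
    (\<forall>f L. L-lipschitz_on (closure U) f \<longrightarrow> (AE x in bd_measure U. T f x = f x)) \<and>
    (\<forall>\<epsilon>>0. \<exists>\<theta>>0. \<forall>f\<^sub>1 \<in> Sobolev U p. \<forall>f\<^sub>2 \<in> Sobolev U p.
      (\<integral>\<^sup>+x. ennreal (dist (T f\<^sub>1 x) (T f\<^sub>2 x) powr p) \<partial>bd_measure U)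
        \<le> ennreal \<theta> * (\<integral>\<^sup>+x. ennreal (dist (f\<^sub>1 x) (f\<^sub>2 x) powr p) \<partial>dom_measure U)
          + ennreal \<epsilon> * (energy U p f\<^sub>1 + energy U p f\<^sub>2))"

text \<open>The three properties determine \<open>T f\<close> almost everywhere for every Sobolev map \<open>f\<close>.\<close>

definition sobolev_trace ::
    "(real ^ 'm) set \<Rightarrow> real
      \<Rightarrow> (real ^ 'm \<Rightarrow> ('a::real_normed_vector, 'q::finite) qtuple) \<Rightarrow> real ^ 'm \<Rightarrow> ('a, 'q) qtuple"
  where "sobolev_trace U p = (SOME T. is_trace U p T)"

end

(* Direct method. Composition with the 1-Lipschitz nearest point map onto a compact convex set containing the
values of g lowers the energy, so a minimizing sequence may be assumed to take values in a compact set. A bound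
int dist(f(x+h), f x)^p <= K |h|^p (nik) gives L_p compactness, and on the ball it characterizes Sobolev maps: the
harder half, from translations to Lipschitz approximation, interpolates good values on a grid cubically, coning over
cluster centres. Lower semicontinuity goes through metric upper gradients and convex combinations of them (a
Komlos argument), which avoids weak topologies; traces pass to the limit by a mean value chain towards the sphere. *)
theory Submission imports Defs "HOL-Library.Diagonal_Subsequence" begin

text \<open>Nothing ties the pointwise tuple \<open>Df\<close> to the map itself, and tuples of
  linear maps can neither be averaged nor tested against functionals; this obstacle shapes the
  proof. The link used instead: in a direction e, the size of the corresponding part of
  \<open>Df\<close> is the least w for which dist (f (x + t e)) (f x) is at most the integral of w
  along the segment. Such an inequality concerns real functions only and survives limits and
  averaging, and one w per axis gives a vector whose Euclidean norm is exactly the norm of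
  \<open>Df\<close>. Lower semicontinuity thus becomes convexity of the p-th power of the norm on a
  finite dimensional space. Truncation supplies what \<open>l2\<close> lacks: its bounded sets are
  not precompact, so translation bounds alone yield no convergent subsequence. Interpolation has no
  linear structure to rely on either, because the entries of tuples cannot be labelled consistently;
  the cones over clusters avoid any labelling. Finally \<open>sobolev_trace\<close> is a Hilbert
  choice, of which nothing is known until an operator with the three required properties has been
  constructed.\<close>

abbreviation nn_lborel :: "('a::euclidean_space \<Rightarrow> ennreal) \<Rightarrow> ennreal" (binder "NN " 10)
 where "nn_lborel f \<equiv> nn_integral lborel f"

abbreviation vol :: "'a::euclidean_space set \<Rightarrow> ennreal"
 where "vol \<equiv> emeasure lborel"

abbreviation BM :: "('a::topological_space \<Rightarrow> 'b::topological_space) set"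
 where "BM \<equiv> borel_measurable borel"

abbreviation seq_tendsto :: "(nat \<Rightarrow> 'a::topological_space) \<Rightarrow> 'a \<Rightarrow> bool" (infixr "~~>" 60)
 where "f ~~> l \<equiv> f \<longlonglongrightarrow> l"

syntax "_nn_lborel_set" :: "pttrn \<Rightarrow> 'a set \<Rightarrow> ennreal \<Rightarrow> ennreal" ("(NN _:_./ _)" [0, 51, 10] 10)
translations "NN x:A. f" => "CONST nn_integral CONST lborel (\<lambda>x. f * CONST indicator A x)"

text \<open>Second countability makes the distance of two Borel maps a Borel function; every
  integral below rests on this.\<close>

class sep_metric = metric_space + second_countable_topology

abbreviation en :: "real \<Rightarrow> ennreal" where "en \<equiv> ennreal"

abbreviation ind :: "'a set \<Rightarrow> 'a \<Rightarrow> 'b::zero_neq_one" where "ind \<equiv> indicator"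

abbreviation ae :: "('a::euclidean_space \<Rightarrow> bool) \<Rightarrow> bool" (binder "AA " 10)
 where "AA x. P x \<equiv> AE x in lborel. P x"

abbreviation scale_by (infixr "*:" 75) where "c *: x \<equiv> c *\<^sub>R x"

abbreviation seg :: "'a::plus set \<Rightarrow> 'a \<Rightarrow> 'a set" where "seg U h \<equiv> {x\<in>U. x + h \<in> U}"

syntax "_ae_seg" :: "pttrn \<Rightarrow> 'a set \<Rightarrow> 'a \<Rightarrow> bool \<Rightarrow> bool" ("(AA _:_;_./ _)" [0, 51, 51, 10] 10)
translations "AA x:U;h. P" => "CONST almost_everywhere CONST lborel (\<lambda>x. x \<in> U \<and> x + h \<in> U \<longrightarrow> P)"

notation infinity ("oo")

section \<open>Completeness and separability of the space of square summable sequences\<close>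

lemma l2_nth_simps [simp]:
 "l2_nth (x + y) n = l2_nth x n + l2_nth y n" "l2_nth (x - y) n = l2_nth x n - l2_nth y n"
 "l2_nth (c *: x) n = c * l2_nth x n" "l2_nth 0 n = 0"
 by (simp_all add: plus_l2.rep_eq minus_l2_def uminus_l2.rep_eq scaleR_l2.rep_eq zero_l2.rep_eq
   del: add_uminus_conv_diff)

lemma norm_l2_sq: "(norm (x::l2))^2 = (\<Sum>n. (l2_nth x n)^2)"
 unfolding power2_norm_eq_inner inner_l2.rep_eq by (simp add: power2_eq_square)

lemma sum_l2_le: "(SUM n<N. (l2_nth x n)^2) <= (norm (x::l2))^2"
 unfolding norm_l2_sq by (rule sum_le_suminf[OF summable_l2]) auto

lemma abs_l2_nth_le: "\<bar>l2_nth x n\<bar> <= norm x"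
proof -
 have "(l2_nth x n)^2 <= (SUM k<Suc n. (l2_nth x k)^2)" by (simp add: sum_nonneg)
 then have "(l2_nth x n)^2 <= (norm x)^2" using sum_l2_le[where N="Suc n" and x=x] by simp
 then show ?thesis by (metis abs_le_square_iff abs_norm_cancel)
qed

lemma norm_l2_leI:
 assumes "!!N. (SUM n<N. (l2_nth x n)^2) <= c^2" "0 <= c"
 shows "norm (x::l2) <= c"
proof -
 have "(norm x)^2 <= c^2" unfolding norm_l2_sq
  by (rule suminf_le_const[OF summable_l2]) (rule assms(1))
 then show ?thesis using assms(2) by simp
qed

instance l2 :: banach
proof
 fix X :: "nat => l2" assume X: "Cauchy X"
 have "Cauchy (%j. l2_nth (X j) n)" for n
 proof (rule metric_CauchyI)
  fix e :: real assume "0 < e"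
  then obtain M where "!!i j. i >= M ==> j >= M ==> dist (X i) (X j) < e"
   using metric_CauchyD[OF X] by blast
  moreover have "dist (l2_nth (X i) n) (l2_nth (X j) n) <= dist (X i) (X j)" for i j
   using abs_l2_nth_le[of "X i - X j" n] by (simp add: dist_norm)
  ultimately show "EX M. ALL m>=M. ALL k>=M. dist (l2_nth (X m) n) (l2_nth (X k) n) < e"
   by (meson le_less_trans)
 qed
 then have "ALL n. EX y. (%j. l2_nth (X j) n) ~~> y"
  by (simp add: Cauchy_convergent_iff convergent_def)
 then obtain y where y: "!!n. (%j. l2_nth (X j) n) ~~> y n" by metis
 have bd: "(SUM n<N. (y n - l2_nth (X i) n)^2) <= e^2"
  if "0 < e" "!!i j. i >= M ==> j >= M ==> dist (X i) (X j) < e" "i >= M" for e M i N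
 proof (rule LIMSEQ_le_const2)
  show "(%j. SUM n<N. (l2_nth (X j) n - l2_nth (X i) n)^2) ~~> (SUM n<N. (y n - l2_nth (X i) n)^2)"
   by (intro tendsto_intros y)
  have "(SUM n<N. (l2_nth (X j) n - l2_nth (X i) n)^2) <= e^2" if "j >= M" for j
  proof -
   have "(SUM n<N. (l2_nth (X j) n - l2_nth (X i) n)^2) <= (norm (X j - X i))^2"
    using sum_l2_le[of "X j - X i" N] by simp
   also have "... <= e^2"
    using `!!i j. i >= M ==> j >= M ==> dist (X i) (X j) < e`[OF that `i >= M`]
    by (intro power_mono) (auto simp: dist_norm)
   finally show ?thesis .
  qed
  then show "EX M'. ALL j>=M'. (SUM n<N. (l2_nth (X j) n - l2_nth (X i) n)^2) <= e^2" by blast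
 qed
 \<comment> \<open>The coordinatewise limit \<open>y\<close> is shown to be square summable through
   its difference from the single term \<open>X M1\<close>, whose partial sums are at most 1 by
   \<open>bd\<close> with \<open>e = 1\<close>; adding \<open>X M1\<close> back stays in the
   space.\<close>
 obtain M1 where M1: "!!i j. i >= M1 ==> j >= M1 ==> dist (X i) (X j) < 1"
  using metric_CauchyD[OF X, of 1] by auto
 have "summable (%n. (y n - l2_nth (X M1) n)^2)"
 proof (rule bounded_imp_summable)
  fix n show "(SUM k<=n. (y k - l2_nth (X M1) k)^2) <= 1^2"
   unfolding lessThan_Suc_atMost[symmetric] by (rule bd[OF _ M1]) auto
 qed simp
 then obtain d where d: "l2_nth d = (%n. y n - l2_nth (X M1) n)"
  using Abs_l2_inverse[of "%n. y n - l2_nth (X M1) n"] by auto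
 define Y where "Y = d + X M1"
 have Y: "l2_nth Y n = y n" for n by (simp add: Y_def d)
 have "X ~~> Y"
 proof (rule metric_LIMSEQ_I)
  fix r :: real assume "0 < r"
  then obtain M where M: "!!i j. i >= M ==> j >= M ==> dist (X i) (X j) < r/2"
   using metric_CauchyD[OF X, of "r/2"] by auto
  have "dist (X i) Y < r" if "i >= M" for i
  proof -
   have "norm (Y - X i) <= r/2"
    by (rule norm_l2_leI) (use bd[OF _ M that] `0 < r` in "auto simp: Y")
   then show ?thesis using `0 < r` by (simp add: dist_norm norm_minus_commute)
  qed
  then show "EX no. ALL n>=no. dist (X n) Y < r" by blast
 qed
 then show "convergent X" by (rule convergentI)
qed

lemma countable_dense_l2: "EX D::l2 set. countable D & (ALL x. ALL e>0. EX d:D. dist x d < e)"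
proof -
 define F where "F = (%q::rat list. Abs_l2 (%n. if n < length q then of_rat (q ! n) else 0))"
 have nF: "l2_nth (F q) n = (if n < length q then of_rat (q ! n) else 0)" for q n
 proof -
  have "summable (%n. (if n < length q then of_rat (q ! n) else 0 :: real)^2)"
   by (rule summable_finite[of "{..<length q}"]) auto
  then show ?thesis unfolding F_def by (subst Abs_l2_inverse) auto
 qed
 have "EX q. dist x (F q) < e" if "0 < e" for x e
 proof -
  \<comment> \<open>The tail and the first \<open>N\<close> coordinates contribute at most
    \<open>e'\<close> each, which together give \<open>(e/2)^2\<close>; \<open>r\<close> below
    spreads the second share over \<open>N\<close> coordinates.\<close>
  define e' where "e' = e^2 / 8"
  have e': "0 < e'" using that by (simp add: e'_def)
  let ?B = "\<Sum>n. (l2_nth x n)^2"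
  have "(%N. SUM n<N. (l2_nth x n)^2) ~~> ?B"
   using summable_LIMSEQ[OF summable_l2] .
  then obtain N where N: "\<bar>(SUM n<N. (l2_nth x n)^2) - ?B\<bar> < e'"
   using LIMSEQ_D[of _ _ e'] e' by (metis order_refl real_norm_def)
  define r where "r = sqrt (e' / (N+1))"
  have r: "0 < r" using e' by (simp add: r_def)
  have "EX q. \<bar>y - of_rat q\<bar> < r" for y :: real
  proof -
   have "y - r < y + r" using r by simp
   then obtain q where "y - r < of_rat q" "of_rat q < y + r" using of_rat_dense by blast
   then show ?thesis by (intro exI[of _ q]) simp
  qed
  then obtain Q where Q: "!!y. \<bar>y - of_rat (Q y)\<bar> < r" by metis
  define q where "q = map (%n. Q (l2_nth x n)) [0..<N]"
  let ?A = "%n. l2_nth (x - F q) n"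
  have "norm (x - F q) <= e/2"
  proof (rule norm_l2_leI)
   fix M
   have "(SUM n<M. ((?A n))^2) <= (SUM n<M + N. ((?A n))^2)"
    by (rule sum_mono2) auto
   also have "... = (SUM n<N. ((?A n))^2) + (SUM n:{N..<M+N}. ((?A n))^2)"
    by (subst sum.union_disjoint[symmetric]) (auto intro!: sum.cong)
   also have "(SUM n:{N..<M+N}. ((?A n))^2) = (SUM n:{N..<M+N}. (l2_nth x n)^2)"
    by (rule sum.cong) (auto simp: nF q_def)
   also have "(SUM n:{N..<M+N}. (l2_nth x n)^2) = (SUM n<M+N. (l2_nth x n)^2) - (SUM n<N. (l2_nth x n)^2)"
    by (subst sum_diff[symmetric]) auto
   also have "... <= ?B - (SUM n<N. (l2_nth x n)^2)"
    using sum_le_suminf[OF summable_l2[of x], of "{..<M+N}"] by auto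
   also have "... <= e'" using N by simp
   also have "(SUM n<N. ((?A n))^2) <= (SUM n<N. r^2)"
   proof (rule sum_mono)
    fix n assume "n : {..<N}"
    then have "\<bar>l2_nth (x - F q) n\<bar> < r" using Q by (simp add: nF q_def)
    then show "(l2_nth (x - F q) n)^2 <= r^2" by (simp add: power2_le_iff_abs_le)
   qed
   also have "... <= e'"
   proof -
    have "(SUM n<N. r^2) = real N * (e'/(N+1))" using e' by (simp add: r_def)
    also have "... <= e'" using e' by (simp add: field_simps)
    finally show ?thesis .
   qed
   finally show "(SUM n<M. ((?A n))^2) <= (e/2)^2"
    by (simp add: e'_def power_divide)
  qed (use that in simp)
  then show ?thesis using that by (intro exI[of _ q]) (simp add: dist_norm)
 qed
 then show ?thesis by (intro exI[of _ "range F"]) auto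
qed

lemma second_countable_basis_from_dense:
 fixes D :: "'a::metric_space set"
 assumes "countable D" "!!x e. 0 < e ==> EX d:D. dist x d < e"
 shows "EX B::'a set set. countable B & open = generate_topology B"
proof -
 define B where "B = (%(d, n). ball d (1 / real (Suc n))) ` (D \<times> UNIV)"
 have "topological_basis B"
 proof (rule topological_basisI)
  fix O' and x :: 'a assume "open O'" "x : O'"
  then obtain e where e: "0 < e" "ball x e <= O'" by (meson open_contains_ball)
  obtain n where n: "inverse (real (Suc n)) < e/2" using reals_Archimedean[of "e/2"] e by auto
  obtain d where d: "d : D" "dist x d < inverse (real (Suc n))"
   using assms(2)[of "inverse (real (Suc n))" x] by auto
  let ?A = "ball d (1 / real (Suc n))"
  have "?A <= ball x e"
  proof
   fix y assume "y : ?A"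
   then have "dist d y < inverse (real (Suc n))" by (simp add: inverse_eq_divide)
   then show "y : ball x e" using d n dist_triangle[of x y d] by auto
  qed
  then show "EX B':B. x : B' & B' <= O'"
   using d e unfolding B_def
   by (intro bexI[of _ "?A"]) (auto simp: dist_commute inverse_eq_divide)
 qed (auto simp: B_def)
 then show ?thesis
  using assms(1) topological_basis_imp_subbasis[of B] by (intro exI[of _ B]) (auto simp: B_def)
qed

instance l2 :: second_countable_topology
proof
 obtain D :: "l2 set" where "countable D" "!!x e. 0 < e ==> EX d:D. dist x d < e"
  using countable_dense_l2 by metis
 then show "EX B::l2 set set. countable B & open = generate_topology B"
  by (rule second_countable_basis_from_dense)
qed

section \<open>Optimal matchings; separability and completeness of the space of tuples\<close>

lemma dist_qtuple_le:
 "dist (qtuple z) (qtuple w) <= sqrt (SUM i:UNIV. (dist (z i) (w i))^2)"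
 using tuple_dist_le[of id z w] by (simp add: dist_qtuple.abs_eq)

lemma dist_qtuple_le_sum:
 "dist (qtuple z) (qtuple w) <= (SUM i:UNIV. dist (z i) (w i))"
 using dist_qtuple_le[of z w] L2_set_le_sum[of UNIV "%i. dist (z i) (w i)"]
 by (simp add: L2_set_def)

text \<open>Reordering the second representative by an optimal permutation turns the identity into
  an optimal matching. Estimates between tuples become coordinatewise after this choice.\<close>

lemma dist_qtuple_attained:
 obtains w' where "qtuple w' = qtuple w"
  "dist (qtuple z) (qtuple w) = sqrt (SUM i:UNIV. (dist (z i) (w' i))^2)"
  "!!i. dist (z i) (w' i) <= dist (qtuple z) (qtuple w)"
  "EX sg. bij sg & w' = w \<circ> sg"
proof -
 obtain sg where sg: "bij sg" "tuple_dist z w = sqrt (SUM i:UNIV. (dist (z i) (w (sg i)))^2)"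
  by (rule tuple_dist_attained)
 have q: "qtuple (w \<circ> sg) = qtuple w"
  unfolding qtuple.abs_eq_iff by (rule perm_equiv_sym) (use sg(1) in "auto simp: perm_equiv_def")
 have "dist (z i) (w (sg i)) <= tuple_dist z w" for i
  unfolding sg(2) by (rule real_le_rsqrt) (rule member_le_sum, auto)
 with sg q show ?thesis by (intro that[of "w \<circ> sg"]) (auto simp: dist_qtuple.abs_eq)
qed

lemma qtuple_rep [simp]: "qtuple (rep_qtuple S) = S"
 by (metis Quotient3_abs_rep Quotient3_qtuple)

lemma qtuple_exhaust: obtains z where "S = qtuple z"
 by (metis qtuple_rep)

instance qtuple :: ("sep_metric", finite) second_countable_topology
proof
 obtain D :: "'a set" where D: "countable D" "!!X. open X ==> X ~= {} ==> EX d:D. d : X"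
  using countable_dense_exists by blast
 have "EX d:qtuple ` {z. range z <= D}. dist S d < e" if "0 < e" for S :: "('a, 'b) qtuple" and e
 proof -
  obtain z where S: "S = qtuple z" by (rule qtuple_exhaust)
  define r where "r = e / (real CARD('b) + 1)"
  have r: "0 < r" using that by (simp add: r_def)
  have "EX d. d : D & dist (z i) d < r" for i
   using D(2)[of "ball (z i) r"] r by auto
  then obtain w where w: "!!i. w i : D" "!!i. dist (z i) (w i) < r" by metis
  have "dist S (qtuple w) <= (SUM i:(UNIV::'b set). r)"
   unfolding S using dist_qtuple_le_sum[of z w] sum_mono[of UNIV "%i. dist (z i) (w i)" "%_. r"] w(2)
   by (meson less_imp_le order_trans)
  also have "... < e" using that by (simp add: r_def field_simps)
  finally show ?thesis using w(1) by auto
 qed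
 moreover have "countable (qtuple ` {z :: 'b => 'a. range z <= D})"
 proof -
  have "{z :: 'b => 'a. range z <= D} = PiE UNIV (%_. D)" by auto
  then show ?thesis using countable_PiE[of "UNIV :: 'b set" "%_. D"] D(1) by simp
 qed
 ultimately show "EX B::('a, 'b) qtuple set set. countable B & open = generate_topology B"
  by (intro second_countable_basis_from_dense)
qed

lemma Cauchy_geometric:
 assumes "!!n. dist (y n) (y (Suc n)) <= (1/2)^n"
 shows "Cauchy y"
proof -
 have d: "dist (y n) (y (n + k)) <= 2 * (1/2)^n - 2 * (1/2)^(n + k)" for n k
 proof (induction k)
  case (Suc k)
  then show ?case
   using assms[of "n + k"] dist_triangle[of "y n" "y (n + Suc k)" "y (n + k)"] by simp
 qed simp
 show ?thesis
 proof (rule metric_CauchyI)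
  fix e :: real assume "0 < e"
  then obtain N where N: "(1/2)^N < e/4" using real_arch_pow_inv[of "e/4" "1/2"] by auto
  have "dist (y N) (y m) < e/2" if "m >= N" for m
  proof -
   have "dist (y N) (y m) <= 2 * (1/2)^N"
    using d[of N "m - N"] that zero_le_power[of "1/2::real" m] by (simp del: zero_le_power)
   then show ?thesis using N by simp
  qed
  then show "EX M. ALL m>=M. ALL n>=M. dist (y m) (y n) < e"
   using dist_triangle_half_r by (intro exI[of _ N]) blast
 qed
qed

text \<open>A rapidly converging subsequence is lifted one term at a time: each new representative
  is ordered by an optimal matching with the previous one, so that every coordinate is a Cauchy
  sequence. A convergent subsequence suffices for a Cauchy sequence.\<close>

instance qtuple :: (complete_space, finite) complete_space
proof
 fix X :: "nat => ('a, 'b) qtuple" assume X: "Cauchy X"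
 obtain r :: "nat => nat" where r: "strict_mono r" "!!n. dist (X (r (Suc n))) (X (r n)) < (1/2)^n"
 proof -
  have "EX r::nat=>nat. ALL n. (ALL i>=r n. ALL j>=r n. dist (X i) (X j) < (1/2)^n) & r n < r (Suc n)"
  proof (rule dependent_nat_choice)
   show "EX x. ALL i>=x. ALL j>=x. dist (X i) (X j) < (1 / 2) ^ 0"
    using metric_CauchyD[OF X, of 1] by auto
   fix x n
   obtain M where "ALL i>=M. ALL j>=M. dist (X i) (X j) < (1/2)^Suc n"
    using metric_CauchyD[OF X, of "(1/2)^Suc n"] by auto
   then show "EX y. (ALL i>=y. ALL j>=y. dist (X i) (X j) < (1 / 2) ^ Suc n) & x < y"
    by (intro exI[of _ "max M (Suc x)"]) auto
  qed
  then obtain r :: "nat => nat" where "!!n. (ALL i>=r n. ALL j>=r n. dist (X i) (X j) < (1/2)^n) & r n < r (Suc n)"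
   by blast
  then show ?thesis by (intro that[of r]) (auto simp: strict_mono_Suc_iff less_imp_le)
 qed
 have "EX z. ALL n. qtuple (z n) = X (r n) & (ALL i. dist (z n i) (z (Suc n) i) <= (1/2)^n)"
 proof (rule dependent_nat_choice)
  show "EX x. qtuple x = X (r 0)" by (metis qtuple_rep)
  fix z :: "'b => 'a" and n assume z: "qtuple z = X (r n)"
  obtain w where "qtuple w = qtuple (rep_qtuple (X (r (Suc n))))"
   "!!i. dist (z i) (w i) <= dist (qtuple z) (qtuple (rep_qtuple (X (r (Suc n)))))"
   by (rule dist_qtuple_attained[of "rep_qtuple (X (r (Suc n)))" z]) blast
  moreover have "dist (X (r n)) (X (r (Suc n))) <= (1/2)^n"
   using r(2)[of n] by (simp add: dist_commute)
  ultimately show "EX y. qtuple y = X (r (Suc n)) & (ALL i. dist (z i) (y i) <= (1 / 2) ^ n)"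
   unfolding z by (intro exI[of _ w]) (auto intro: order_trans)
 qed
 then obtain z where z: "!!n. qtuple (z n) = X (r n)" "!!n i. dist (z n i) (z (Suc n) i) <= (1/2)^n"
  by blast
 have "Cauchy (%n. z n i)" for i
  by (rule Cauchy_geometric) (rule z(2))
 then have "ALL i. EX y. (%n. z n i) ~~> y" by (simp add: Cauchy_convergent_iff convergent_def)
 then obtain y where y: "!!i. (%n. z n i) ~~> y i" by metis
 have "(%n. X (r n)) ~~> qtuple y"
 proof (rule metric_tendsto_imp_tendsto)
  show "(%n. SUM i:UNIV. dist (z n i) (y i)) ~~> 0"
  proof (rule tendsto_null_sum)
   show "(%n. dist (z n i) (y i)) ~~> 0" for i using y[of i] by (rule tendsto_dist_iff[THEN iffD1])
  qed
  show "\<forall>\<^sub>F n in sequentially. dist (X (r n)) (qtuple y) <= dist (SUM i:UNIV. dist (z n i) (y i)) 0"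
   using dist_qtuple_le_sum[of _ y] by (simp add: z(1)[symmetric] sum_nonneg)
 qed
 then have "convergent (X \<circ> r)" by (auto simp: convergent_def o_def)
 then show "convergent X"
  using X r(1) Cauchy_converges_subseq[of X r] by (auto simp: convergent_def)
qed

text \<open>Completeness and separability are what Bochner integrals require. \<open>real\<close>
  and \<open>real ^ 'm\<close> are instances too, so that the results on line integrals serve
  derivatives of scalar functions and vectors of directional upper gradients alike.\<close>

class hilbert = real_inner + banach + second_countable_topology

instance l2 :: hilbert ..

instance real :: hilbert ..

instance vec :: (euclidean_space, finite) hilbert ..

instance hilbert \<subseteq> sep_metric ..

instance qtuple :: (sep_metric, finite) sep_metric ..

section \<open>Lebesgue points by Vitali coverings\<close>

lemmas [measurable] = borel_open[OF open_ball] borel_closed[OF closed_cball]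

lemma AE_lborel_if_negligible:
 assumes "negligible {x. ~ P x}"
 shows "AA x. P x"
proof -
 have "{x. ~ P x} : null_sets lebesgue" using assms by (simp add: negligible_iff_null_sets)
 then have "AE x in lebesgue. P x" by (auto simp: eventually_ae_filter)
 then show ?thesis by (simp add: AE_completion_iff)
qed

text \<open>Vitali's covering theorem applied to balls inside an open \<open>G\<close> that exceeds
  the set \<open>A\<close> where \<open>f < al\<close> by \<open>mu\<close>-measure at most
  \<open>et\<close>. The disjoint balls have a union \<open>V\<close> with be |V| <= mu V <= al |V|
  + et, and \<open>et = e * (be - al)\<close> turns this into |V| <= e.\<close>

lemma density_upper_ball_null:
 assumes [measurable]: "f : BM" and nn: "!!x. 0 <= f x"
  and int: "integrable lborel f" and ab: "al < be" "0 < be"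
 defines "mu \<equiv> density lborel (%x. en (f x))"
 shows "negligible {a. f a < al &
  (ALL r0>0. EX r. 0 < r & r < r0 & en be * vol (ball a r) < emeasure mu (ball a r))}"
  (is "negligible ?S")
 unfolding negligible_outer_le
proof (intro allI impI)
 fix e :: real assume "0 < e"
 define et where "et = e * (be - al)"
 have et: "0 < et" using `0 < e` ab by (simp add: et_def)
 have setsmu [simp]: "sets mu = sets borel" by (simp add: mu_def)
 have fin: "emeasure mu UNIV ~= oo"
  using integrableD(2)[OF int] by (simp add: mu_def emeasure_density)
 have fin': "emeasure mu X < oo" for X
  using emeasure_space[of mu X] fin by (simp add: mu_def top.not_eq_extremum)
 interpret finite_measure mu by standard (use fin in "simp add: mu_def")
 define A where "A = {x. f x < al}"
 have A [measurable]: "A : sets borel" by (simp add: A_def)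
 let ?A = "%i. ball (fst i) (snd i)"
 show "EX T. ?S <= T & T : lmeasurable & measure lebesgue T <= e"
 proof (cases "A = {}")
  case True
  then show ?thesis using `0 < e` by (intro exI[of _ "{}"]) (auto simp: A_def)
 next
  case False
  then have al: "0 < al" using nn by (force simp: A_def intro: le_less_trans)
  have "(INF G\<in>{G. A <= G & open G}. emeasure mu G) < emeasure mu A + en et"
  proof -
   have "emeasure mu A < emeasure mu A + en et"
    using et by simp
   then show ?thesis using outer_regular[of mu A] by simp
  qed
  then obtain G where G: "A <= G" "open G" "emeasure mu G < emeasure mu A + en et"
   by (auto simp: INF_less_iff)
  have [measurable]: "G : sets borel" using G by auto
  have GA: "measure mu (G - A) <= et"
  proof -
   have "measure mu G = measure mu A + measure mu (G - A)"
    using finite_measure_Diff[of G A] G by simp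
   moreover have "measure mu G < measure mu A + et"
   proof -
    have "en (measure mu G) < en (measure mu A + et)"
     using G(3) et by (simp add: emeasure_eq_measure)
    then show ?thesis by (simp add: ennreal_less_iff)
   qed
   ultimately show ?thesis by simp
  qed
  define K where "K = {(a, r). a : ?S & 0 < r & ball a r <= G &
    en be * vol (ball a r) < emeasure mu (ball a r)}"
  obtain C where C: "countable C" "C <= K"
   "pairwise (%i j. disjnt ((?A i)) (ball (fst j) (snd j))) C"
   "negligible (?S - (UN i:C. (?A i)))"
  proof (rule Vitali_covering_theorem_balls[of ?S K fst snd])
   fix x d assume x: "x : ?S" and "0 < (d::real)"
   then have "x : G" using G by (auto simp: A_def)
   then obtain s where s: "0 < s" "ball x s <= G" using G(2) by (meson open_contains_ball)
   then obtain r where "0 < r" "r < min s d"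
    "en be * vol (ball x r) < emeasure mu (ball x r)"
    using x `0 < d` by (smt (verit) mem_Collect_eq min_less_iff_conj)
   with s x show "EX i. i : K & x : (?A i) & snd i < d"
    by (intro exI[of _ "(x, r)"]) (auto simp: K_def)
  qed blast
  define V where "V = (UN i:C. (?A i))"
  have VG: "V <= G"
 proof
  fix x assume "x : V"
  then obtain i where "i : C" "x : ball (fst i) (snd i)" by (auto simp: V_def)
  moreover from this have "i : K" using C(2) by auto
  ultimately show "x : G" by (cases i) (auto simp: K_def)
 qed
  have V [measurable]: "V : sets borel" unfolding V_def using C(1) by auto
  have dis: "disjoint_family_on (%i. (?A i)) C"
   using C(3) by (auto simp: disjoint_family_on_def pairwise_def disjnt_def)
  have "en be * vol V
    = (\<integral>\<^sup>+i. en be * vol ((?A i)) \<partial>count_space C)"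
   unfolding V_def using dis C(1) by (subst emeasure_UN_countable) (auto simp: nn_integral_cmult)
  also have "... <= (\<integral>\<^sup>+i. emeasure mu ((?A i)) \<partial>count_space C)"
  proof (intro nn_integral_mono)
   fix i assume "i : space (count_space C)"
   then have "i : K" using C(2) by auto
   then show "en be * vol (ball (fst i) (snd i)) <= emeasure mu (ball (fst i) (snd i))"
    by (cases i) (simp add: K_def less_imp_le)
  qed
  also have "... = emeasure mu V"
   unfolding V_def using dis C(1) by (subst emeasure_UN_countable) auto
  finally have le1: "en be * vol V <= emeasure mu V" .
  have Vfin: "vol V < oo"
  proof (rule ccontr)
   assume "~ ?thesis"
   then have "vol V = oo" by (metis infinity_ennreal_def less_top)
   then show False using le1 fin'[of V] ab by simp
  qed
  have eqV: "vol V = en (measure lborel V)"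
   using Vfin by (simp add: emeasure_eq_ennreal_measure)
  have b1: "be * measure lborel V <= measure mu V"
   using le1 ab unfolding eqV emeasure_eq_measure by (simp flip: ennreal_mult')
  have "measure mu V = measure mu (V Int A) + measure mu (V - A)"
   using finite_measure_Union[of "V Int A" "V - A"] by (simp add: Int_Diff_disjoint Int_Diff_Un)
  also have "measure mu (V - A) <= measure mu (G - A)"
   using VG by (intro finite_measure_mono) auto
  also have "measure mu (V Int A) <= al * measure lborel V"
  proof -
   have "emeasure mu (V Int A) = (NN x:(V Int A). en (f x))"
    unfolding mu_def by (rule emeasure_density) auto
   also have "... <= (NN x:V. en al)"
    by (intro nn_integral_mono) (auto simp: A_def indicator_def intro: ennreal_leI)
   also have "... = en al * vol V"
    by (simp add: nn_integral_cmult)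
   finally show ?thesis
    using al unfolding eqV emeasure_eq_measure by (simp flip: ennreal_mult')
  qed
  finally have "measure mu V <= al * measure lborel V + et" using GA by simp
  with b1 have "(be - al) * measure lborel V <= (be - al) * e" by (simp add: et_def algebra_simps)
  then have Ve: "measure lborel V <= e" using ab by simp
  have Vl: "V : lmeasurable" using Vfin by (auto simp: fmeasurable_def)
  let ?N = "?S - V"
  have N: "negligible ?N" using C(4) by (simp add: V_def)
  have "V Un ?N : lmeasurable" by (rule fmeasurable.Un[OF Vl negligible_imp_measurable[OF N]])
  moreover have "measure lebesgue (V Un ?N) <= measure lebesgue V + measure lebesgue ?N"
   by (rule measure_Un_le[OF fmeasurableD[OF Vl] negligible_imp_sets[OF N]])
  moreover have "measure lebesgue ?N = 0" using N by (rule negligible_imp_measure0)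
  ultimately show ?thesis using Ve by (intro exI[of _ "V Un ?N"]) auto
 qed
qed

definition lebesgue_point :: "('a::euclidean_space => 'b::real_normed_vector) => 'a => bool"
 where "lebesgue_point w a \<longleftrightarrow> (ALL eps>0. EX r0>0. ALL r. 0 < r & r < r0 -->
  (NN x:ball a r. en (norm (w x - w a))) <= en eps * vol (ball a r))"

text \<open>Any \<open>be > f a\<close> is separated from \<open>f a\<close> by two rationals, so
  the exceptional set is a countable union of null sets from the preceding lemma.\<close>

lemma AE_ball_average_le:
 assumes f[measurable]: "f : BM" and nn: "!!x. 0 <= f x" and int: "integrable lborel f"
 shows "AA a. ALL be>f a. EX r0>0. ALL r. 0 < r & r < r0 -->
  (NN x:ball a r. en (f x)) <= en be * vol (ball a r)"
proof -
 let ?mu = "density lborel (%x. en (f x))"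
 have eq: "emeasure ?mu (ball a r) = (NN x:ball a r. en (f x))" for a r
  by (rule emeasure_density) auto
 define bad where "bad p a \<longleftrightarrow> (ALL r0>0. EX r. 0 < r & r < r0 &
  en (of_rat (snd p)) * vol (ball a r) < emeasure ?mu (ball a r))" for p :: "rat \<times> rat" and a
 have "AA a. ALL p::rat \<times> rat. fst p < snd p & 0 < snd p --> ~ (f a < of_rat (fst p) & bad p a)"
  unfolding AE_all_countable
 proof
  fix p :: "rat \<times> rat"
  show "AA a. fst p < snd p & 0 < snd p --> ~ (f a < of_rat (fst p) & bad p a)"
  proof (cases "fst p < snd p & 0 < snd p")
   case True
   then have "negligible {a. f a < of_rat (fst p) & bad p a}"
    unfolding bad_def by (intro density_upper_ball_null nn int) (auto simp: of_rat_less)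
   then have "AA a. ~ (f a < of_rat (fst p) & bad p a)"
    by (intro AE_lborel_if_negligible) simp
   then show ?thesis by auto
  next
   case False
   then show ?thesis by auto
  qed
 qed
 then show ?thesis
 proof (rule AE_mp, intro AE_I2 impI allI)
  fix a be assume a: "ALL p::rat \<times> rat. fst p < snd p & 0 < snd p --> ~ (f a < of_rat (fst p) & bad p a)"
   and "f a < be"
  obtain q1 where q1: "f a < of_rat q1" "of_rat q1 < be" using of_rat_dense `f a < be` by blast
  obtain q2 where q2: "of_rat q1 < (of_rat q2 :: real)" "of_rat q2 < be" using of_rat_dense q1(2) by blast
  have "0 < (of_rat q2 :: real)" using nn[of a] q1 q2 by linarith
  then have "~ bad (q1, q2) a" using a[rule_format, of "(q1, q2)"] q1 q2 by (auto simp: of_rat_less)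
  then obtain r0 where "0 < r0" and r0: "!!r. 0 < r ==> r < r0 ==>
    emeasure ?mu (ball a r) <= en (of_rat q2) * vol (ball a r)"
   unfolding bad_def by (metis not_less snd_conv)
  show "EX r0>0. ALL r. 0 < r & r < r0 -->
   (NN x:ball a r. en (f x)) <= en be * vol (ball a r)"
  proof (intro exI[of _ r0] conjI allI impI `0 < r0`)
   fix r assume "0 < r & r < r0"
   then have "(NN x:ball a r. en (f x))
     <= en (of_rat q2) * vol (ball a r)"
    using r0[of r] unfolding eq by simp
   also have "... <= en be * vol (ball a r)"
    using q2 by (intro mult_right_mono ennreal_leI) auto
   finally show "(NN x:ball a r. en (f x)) <= en be * vol (ball a r)" .
  qed
 qed
qed

text \<open>The scalar result is applied to \<open>norm (w x - q)\<close> for \<open>q\<close> in a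
  countable dense set, and \<open>q\<close> is then taken close to \<open>w a\<close>. Cutting off
  to balls of radius \<open>n\<close> is necessary because a constant \<open>q\<close> is not
  integrable on the whole space.\<close>

theorem AE_lebesgue_point:
 fixes w :: "'a::euclidean_space => 'b::hilbert"
 assumes int: "integrable lborel w"
 shows "AA a. lebesgue_point w a"
proof -
 have [measurable]: "w : BM" using borel_measurable_integrable[OF int] by simp
 obtain D :: "'b set" where D: "countable D" "!!X. open X ==> X ~= {} ==> EX d:D. d : X"
  using countable_dense_exists by blast
 define P where "P n q a \<longleftrightarrow> (a : ball 0 (real n) --> (ALL be>norm (w a - q). EX r0>0. ALL r. 0 < r & r < r0 -->
  (NN x:ball a r. en (norm (w x - q))) <= en be * vol (ball a r)))" for n q a
 have P: "AA a. P n q a" for n q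
 proof -
  define f where "f x = ind (ball 0 (real n)) x * norm (w x - q)" for x
  have f0: "0 <= f x" for x by (simp add: f_def)
  have [measurable]: "f : BM" unfolding f_def
   by simp
  have "integrable lborel f"
  proof (rule Bochner_Integration.integrable_bound)
   show "integrable lborel (%x. norm (w x) + ind (ball 0 (real n)) x * norm q)"
    using int emeasure_bounded_finite[of "ball (0::'a) (real n)"] by simp
   show "AA x. norm (f x) <= norm (norm (w x) + ind (ball 0 (real n)) x * norm q)"
    using norm_triangle_ineq4[of "w _" q] by (intro AE_I2) (auto simp: f_def indicator_def)
  qed simp
  then have "AA a. ALL be>f a. EX r0>0. ALL r. 0 < r & r < r0 -->
    (NN x:ball a r. en (f x)) <= en be * vol (ball a r)"
   using `f : BM` by (intro AE_ball_average_le f0)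
  then show ?thesis
  proof (rule AE_mp, intro AE_I2 impI)
   fix a assume a: "ALL be>f a. EX r0>0. ALL r. 0 < r & r < r0 -->
    (NN x:ball a r. en (f x)) <= en be * vol (ball a r)"
   show "P n q a" unfolding P_def
   proof (intro impI allI)
    fix be assume an: "a : ball 0 (real n)" and "norm (w a - q) < be"
    then have "f a < be" by (simp add: f_def)
    then obtain r0 where "0 < r0" and r0: "!!r. 0 < r & r < r0 ==>
     (NN x:ball a r. en (f x)) <= en be * vol (ball a r)"
     using a by blast
    obtain s where s: "0 < s" "ball a s <= ball 0 (real n)"
     using an open_contains_ball by blast
    have "(NN x:ball a r. en (norm (w x - q))) <= en be * vol (ball a r)"
     if r: "0 < r" "r < min r0 s" for r
    proof -
     have "ball a r <= ball 0 (real n)" using r s(2) by auto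
     then have "(NN x:ball a r. en (norm (w x - q)))
       = (NN x:ball a r. en (f x))"
      by (intro nn_integral_cong) (auto simp: f_def indicator_def)
     then show ?thesis using r0[of r] r by simp
    qed
    then show "EX r0>0. ALL r. 0 < r & r < r0 -->
     (NN x:ball a r. en (norm (w x - q))) <= en be * vol (ball a r)"
     using `0 < r0` s(1) by (intro exI[of _ "min r0 s"]) auto
   qed
  qed
 qed
 have "AA a. ALL n. ALL q:D. P n q a"
  using P D(1) by (auto simp: AE_all_countable AE_ball_countable)
 then show ?thesis
 proof (rule AE_mp, intro AE_I2 impI)
  fix a assume a: "ALL n. ALL q:D. P n q a"
  show "lebesgue_point w a" unfolding lebesgue_point_def
  proof (intro allI impI)
   fix eps :: real assume "0 < eps"
   obtain q where q: "q : D" "dist (w a) q < eps/2"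
    using D(2)[of "ball (w a) (eps/2)"] `0 < eps` by auto
   obtain n where n: "norm a < real n" using reals_Archimedean2 by blast
   obtain r0 where "0 < r0" and r0: "!!r. 0 < r & r < r0 ==>
     (NN x:ball a r. en (norm (w x - q))) <= en (eps/2) * vol (ball a r)"
   proof -
    have "P n q a" "a : ball 0 (real n)" "norm (w a - q) < eps/2" using a q n by (auto simp: dist_norm)
    then show ?thesis using that unfolding P_def by blast
   qed
   have "(NN x:ball a r. en (norm (w x - w a))) <= en eps * vol (ball a r)"
    if r: "0 < r" "r < r0" for r
   proof -
    have "(NN x:ball a r. en (norm (w x - w a)))
     <= (NN x. en (norm (w x - q)) * ind (ball a r) x + en (eps/2) * ind (ball a r) x)"
    proof (intro nn_integral_mono)
     fix x
     have "norm (w x - w a) <= norm (w x - q) + eps/2"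
      using norm_triangle_ineq[of "w x - q" "q - w a"] q(2) by (simp add: dist_norm norm_minus_commute)
     then have "en (norm (w x - w a)) <= en (norm (w x - q)) + en (eps/2)"
      using `0 < eps` by (simp flip: ennreal_plus)
     then show "en (norm (w x - w a)) * ind (ball a r) x
       <= en (norm (w x - q)) * ind (ball a r) x + en (eps/2) * ind (ball a r) x"
      by (auto simp: indicator_def)
    qed
    also have "... = (NN x:ball a r. en (norm (w x - q))) + en (eps/2) * vol (ball a r)"
     by (subst nn_integral_add) (auto simp: nn_integral_cmult)
    also have "... <= en (eps/2) * vol (ball a r) + en (eps/2) * vol (ball a r)"
     using r0[of r] r by simp
    also have "... = en eps * vol (ball a r)"
     using `0 < eps` by (simp flip: distrib_right ennreal_plus)
    finally show ?thesis .
   qed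
   then show "EX r0>0. ALL r. 0 < r & r < r0 -->
    (NN x:ball a r. en (norm (w x - w a))) <= en eps * vol (ball a r)"
    using `0 < r0` by blast
  qed
 qed
qed

section \<open>Inequalities for powers and uniform convexity of the graph norm\<close>

lemma powr_tangent:
 fixes m x p :: real
 assumes "0 <= m" "0 <= x" "1 < p"
 shows "m powr p + p * m powr (p - 1) * (x - m) <= x powr p"
proof -
 have "x * m powr (p - 1) <= x powr p / p + (m powr (p - 1)) powr (p / (p - 1)) / (p / (p - 1))"
  using assms by (intro Youngs_inequality) (auto simp: field_simps)
 also have "(m powr (p - 1)) powr (p / (p - 1)) = m powr p"
  using assms by (simp add: powr_powr)
 finally have "p * (x * m powr (p - 1)) <= p * (x powr p / p + m powr p / (p / (p - 1)))"
  using assms by simp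
 also have "... = x powr p + (p - 1) * m powr p" using assms by (simp add: field_simps)
 also have "m powr p = m * m powr (p - 1)"
  using assms by (cases "m = 0") (auto simp: powr_diff)
 finally show ?thesis
  using `m powr p = m * m powr (p - 1)` by (simp add: algebra_simps)
qed

lemma powr_convex_combination:
 fixes a b p s :: real
 assumes "0 <= a" "0 <= b" "1 < p" "0 <= s" "s <= 1"
 shows "((1 - s) * a + s * b) powr p <= (1 - s) * a powr p + s * b powr p"
proof -
 define m where "m = (1 - s) * a + s * b"
 have m: "0 <= m" using assms by (simp add: m_def)
 let ?A = "m powr p + p * m powr (p - 1) * (b - m)"
 let ?B = "m powr p + p * m powr (p - 1) * (a - m)"
 have "(1 - s) * ?B + s * ?A
   <= (1 - s) * a powr p + s * b powr p"
  using powr_tangent[OF m _ assms(3)] assms by (intro add_mono mult_left_mono) auto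
 moreover have "(1 - s) * ?B + s * ?A
  = m powr p + p * m powr (p - 1) * ((1 - s) * a + s * b - m)"
  by (simp add: algebra_simps)
 ultimately show ?thesis by (simp add: m_def)
qed

lemma powr_midpoint_le:
 fixes a b p :: real
 assumes "0 <= a" "0 <= b" "1 < p"
 shows "((a + b) / 2) powr p <= (a powr p + b powr p) / 2"
 using powr_convex_combination[of a b p "1/2"] assms by (simp add: field_simps)

lemma powr_add_le:
 fixes a b p :: real
 assumes "0 <= a" "0 <= b" "1 < p"
 shows "(a + b) powr p <= 2 powr p * (a powr p + b powr p)"
proof -
 have "(a + b) powr p = 2 powr p * ((a + b) / 2) powr p"
 proof -
  define c where "c = (a + b) / 2"
  have "a + b = 2 * c" by (simp add: c_def)
  then show ?thesis unfolding c_def[symmetric] by (simp add: powr_mult)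
 qed
 also have "... <= 2 powr p * ((a powr p + b powr p) / 2)"
  using assms by (intro mult_left_mono powr_midpoint_le) auto
 also have "... <= 2 powr p * (a powr p + b powr p)"
  by simp
 finally show ?thesis .
qed

text \<open>A substitute for Hoelder's inequality: the free threshold \<open>c\<close> trades the
  measure of the domain against the integral of the p-th power.\<close>

lemma le_add_powr:
 fixes x c p :: real
 assumes "0 <= x" "0 < c" "1 < p"
 shows "x <= c + x powr p / c powr (p - 1)"
proof (cases "x <= c")
 case False
 then have "x * c powr (p - 1) <= x * x powr (p - 1)"
  using assms by (intro mult_left_mono powr_mono2) auto
 also have "... = x powr p" using assms by (simp add: powr_diff)
 finally have "x <= x powr p / c powr (p - 1)" using assms by (simp add: field_simps)
 then show ?thesis using assms by simp
next
 case True
 moreover have "0 <= x powr p / c powr (p - 1)" by simp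
 ultimately show ?thesis by linarith
qed

text \<open>The graph norm \<open>sqrt (1 + \<bar>v\<bar>^2)\<close> is uniformly convex on bounded sets.\<close>

definition graph_norm :: "'a::real_inner => real"
 where "graph_norm v = sqrt (1 + (norm v)^2)"

lemma graph_norm_ge_1: "1 <= graph_norm v" and graph_norm_le: "graph_norm v <= 1 + norm v"
 by (auto simp: graph_norm_def intro!: real_le_lsqrt simp: power2_eq_square algebra_simps)

text \<open>\<open>graph_norm v\<close> is the norm of the lifted vector (1, v). The Gram
  determinant t^2 - u^2 of the lifts of \<open>a\<close> and \<open>b\<close> is at least |a - b|^2
  by Cauchy-Schwarz, and twice the graph norm of the midpoint, \<open>M\<close>, satisfies P^2 - M^2
  = 2 (t - u). Factoring both differences of squares gives the claim.\<close>

lemma graph_norm_defect: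
 shows "(norm (a - b))^2 / (4 * graph_norm a * graph_norm b * (graph_norm a + graph_norm b))
  <= (graph_norm a + graph_norm b) / 2 - graph_norm ((1/2) *: (a + b))"
proof -
 define P where "P = graph_norm a + graph_norm b"
 define M where "M = 2 * graph_norm ((1/2) *: (a + b))"
 define t where "t = graph_norm a * graph_norm b"
 define u where "u = 1 + a \<bullet> b"
 have sq: "(graph_norm v)^2 = 1 + v \<bullet> v" for v :: 'a
  by (simp add: graph_norm_def power2_norm_eq_inner)
 have ge: "1 <= graph_norm a" "1 <= graph_norm b" by (rule graph_norm_ge_1)+
 have t: "1 <= t" unfolding t_def using ge by (metis mult_mono' mult_1 zero_le_one)
 have P: "0 < P" "0 < M" using ge graph_norm_ge_1[of "(1/2) *: (a + b)"] by (auto simp: P_def M_def)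
 have tsq: "t^2 = (1 + a \<bullet> a) * (1 + b \<bullet> b)" by (simp add: t_def power_mult_distrib sq)
 have CS: "(a \<bullet> b)^2 <= (a \<bullet> a) * (b \<bullet> b)" by (rule Cauchy_Schwarz_ineq)
 let ?A = "norm (a - b)"
 have n2: "?A^2 = a \<bullet> a - 2 * (a \<bullet> b) + b \<bullet> b"
  by (simp add: power2_norm_eq_inner inner_diff_right inner_commute)
 have tu: "?A^2 <= t^2 - u^2"
  using CS unfolding n2 tsq u_def by (simp add: power2_eq_square algebra_simps)
 then have "u^2 <= t^2" using zero_le_power2[of "norm (a - b)"] by linarith
 then have ut: "\<bar>u\<bar> <= t" using t abs_le_square_iff[of u t] by simp
 have "(t - u) * (t + u) <= (t - u) * (2 * t)" using ut by (intro mult_left_mono) auto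
 then have *: "?A^2 <= 2 * t * (t - u)"
  using tu by (simp add: power2_eq_square algebra_simps)
 have PM: "P^2 - M^2 = 2 * (t - u)"
  by (simp add: P_def M_def power2_sum sq t_def u_def inner_add_left inner_commute algebra_simps)
 have "M^2 <= P^2" using PM ut by simp
 then have MP: "M <= P" using P by simp
 have "(P - M) * (P + M) <= (P - M) * (2 * P)" using MP by (intro mult_left_mono) auto
 then have "2 * (t - u) <= (P - M) * (2 * P)" using PM by (simp add: power2_eq_square algebra_simps)
 then have "t * (2 * (t - u)) <= t * ((P - M) * (2 * P))" using t by simp
 then have "?A^2 <= (4 * t * P) * ((P - M) / 2)" using * by (simp add: algebra_simps)
 then have "?A^2 / (4 * t * P) <= (P - M) / 2" using t P by (simp add: field_simps)
 then show ?thesis by (simp add: P_def M_def t_def diff_divide_distrib)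
qed

text \<open>If both norms are at most \<open>R\<close>, the denominator of the defect is bounded by
  8 (1 + R)^3 and the square of the difference is made linear by an arithmetic-geometric mean with
  \<open>et\<close>. Otherwise the larger norm exceeds \<open>R\<close> and is paid for by p-th
  powers.\<close>

lemma norm_diff_le_defect:
 assumes "0 < et" "0 < R" "1 < p"
 shows "norm (a - b) <= et
  + 8 * (1 + R) ^ 3 / et * ((graph_norm a + graph_norm b) / 2 - graph_norm ((1/2) *: (a + b)))
  + 2 / R powr (p - 1) * (norm a powr p + norm b powr p)"
proof -
 let ?A = "graph_norm a + graph_norm b"
 let ?D = "?A / 2 - graph_norm ((1/2) *: (a + b))"
 have ge: "1 <= graph_norm a" "1 <= graph_norm b" by (rule graph_norm_ge_1)+
 have D: "0 <= ?D"
  using graph_norm_defect[of a b] ge by (smt (verit) divide_nonneg_nonneg mult_nonneg_nonneg zero_le_power2)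
 have T: "0 <= 8 * (1 + R) ^ 3 / et * ?D" "0 <= 2 / R powr (p - 1) * (norm a powr p + norm b powr p)"
  using assms D by auto
 let ?B = "norm (a - b)"
 consider "norm a <= R" "norm b <= R" | "R < max (norm a) (norm b)" by linarith
 then show ?thesis
 proof cases
  case 1
  have gle: "graph_norm a <= 1 + R" "graph_norm b <= 1 + R"
   using graph_norm_le[of a] graph_norm_le[of b] 1 by auto
  have "4 * graph_norm a * graph_norm b * ?A <= 4 * (1 + R) * (1 + R) * ((1 + R) + (1 + R))"
   using gle ge by (intro mult_mono) auto
  also have "... = 8 * (1 + R) ^ 3" by (simp add: power3_eq_cube algebra_simps)
  finally have le: "4 * graph_norm a * graph_norm b * ?A <= 8 * (1 + R) ^ 3" .
  have "?B^2 / (8 * (1 + R) ^ 3) <= ?B^2 / (4 * graph_norm a * graph_norm b * ?A)"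
   using assms ge by (intro divide_left_mono[OF le]) auto
  also have "... <= ?D" by (rule graph_norm_defect)
  finally have "?B^2 <= 8 * (1 + R) ^ 3 * ?D"
   using assms by (simp add: pos_divide_le_eq mult.commute)
  then have "?B^2 / et <= 8 * (1 + R) ^ 3 / et * ?D"
   using assms by (simp add: divide_right_mono)
  moreover have "norm (a - b) <= et + ?B^2 / et"
  proof -
   have "2 * (et * norm (a - b)) <= et * et + ?B^2"
    using zero_le_power2[of "norm (a - b) - et"] by (simp add: power2_eq_square algebra_simps)
   moreover have "0 <= et * norm (a - b)" using assms by simp
   ultimately have "et * norm (a - b) <= et * et + ?B^2" by simp
   then show ?thesis using assms by (simp add: field_simps)
  qed
  ultimately show ?thesis using T by linarith
 next
  case 2
  define m where "m = max (norm a) (norm b)"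
  have m: "0 < m" "R < m" using 2 assms by (auto simp: m_def)
  have "norm (a - b) <= 2 * m" using norm_triangle_ineq4[of a b] by (simp add: m_def)
  also have "m * R powr (p - 1) <= m * m powr (p - 1)"
   using m assms by (intro mult_left_mono powr_mono2) auto
  then have "2 * m <= 2 / R powr (p - 1) * m powr p"
   using m assms by (simp add: powr_diff field_simps)
  also have "... <= 2 / R powr (p - 1) * (norm a powr p + norm b powr p)"
   by (intro mult_left_mono) (auto simp: m_def max_def)
  finally show ?thesis using T assms by simp
 qed
qed

section \<open>Strong convergence of iterated midpoints\<close>

text \<open>Convex combinations of the tail of a sequence; iterated midpoints suffice.\<close>

inductive_set mconv :: "(nat => 'x => 'b::real_vector) => nat => ('x => 'b) set"
 for w n where
 mconv_base: "n <= j ==> w j : mconv w n"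
| mconv_mid: "a : mconv w n ==> b : mconv w n ==> (%x. (1/2) *: (a x + b x)) : mconv w n"

lemma mconv_mono: "v : mconv w n ==> m <= n ==> v : mconv w m"
 by (induction rule: mconv.induct) (auto intro: mconv.intros)

lemma ennreal_lincomb:
 "0 <= a ==> 0 <= u ==> 0 <= b ==> 0 <= v ==> ennreal (a * u + b * v) = en a * en u + en b * en v"
 by (simp add: ennreal_mult)

lemma nn_integral_powr_midpoint_le:
 fixes a b :: "'x => 'b::hilbert"
 assumes [measurable]: "a : borel_measurable M" "b : borel_measurable M" and "1 < p" "0 <= K"
  and a: "(\<integral>\<^sup>+x. en (norm (a x) powr p) \<partial>M) <= en K"
  and b: "(\<integral>\<^sup>+x. en (norm (b x) powr p) \<partial>M) <= en K"
 shows "(\<integral>\<^sup>+x. en (norm ((1/2) *: (a x + b x)) powr p) \<partial>M) <= en K"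
proof -
 have "(\<integral>\<^sup>+x. en (norm ((1/2) *: (a x + b x)) powr p) \<partial>M)
   <= (\<integral>\<^sup>+x. en (1/2) * en (norm (a x) powr p) + en (1/2) * en (norm (b x) powr p) \<partial>M)"
 proof (rule nn_integral_mono)
  fix x
  have "norm ((1/2) *: (a x + b x)) powr p <= ((norm (a x) + norm (b x)) / 2) powr p"
   using norm_triangle_ineq[of "a x" "b x"] assms by (intro powr_mono2) auto
  also have "... <= (norm (a x) powr p + norm (b x) powr p) / 2"
   using assms by (intro powr_midpoint_le) auto
  finally show "en (norm ((1/2) *: (a x + b x)) powr p)
    <= en (1/2) * en (norm (a x) powr p) + en (1/2) * en (norm (b x) powr p)"
   by (subst ennreal_lincomb[symmetric]) (auto intro!: ennreal_leI simp del: ennreal_plus)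
 qed
 also have "... = en (1/2) * (\<integral>\<^sup>+x. en (norm (a x) powr p) \<partial>M) + en (1/2) * (\<integral>\<^sup>+x. en (norm (b x) powr p) \<partial>M)"
  by (simp add: nn_integral_add nn_integral_cmult)
 also have "... <= en (1/2) * en K + en (1/2) * en K"
  by (intro add_mono mult_left_mono a b) auto
 also have "... = en K" using `0 <= K` by (subst ennreal_lincomb[symmetric]) auto
 finally show ?thesis .
qed

text \<open>A Komlos type argument: \<open>v0 n\<close> nearly minimizes the uniformly convex
  functional \<open>Ph\<close> among midpoints of the tail from \<open>n\<close>. The infima
  \<open>I n\<close> increase and stay bounded, so late near-minimizers have a midpoint with almost
  no convexity defect, and a small defect forces a small L1 distance. No weak topology and no
  duality enters.\<close>

theorem mconv_L1_convergent:
 fixes w :: "nat => 'x => 'b::hilbert"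
 assumes A[measurable]: "A : sets M" "emeasure M A < oo" and p: "1 < p"
  and w: "!!j. w j : borel_measurable M" "!!j x. x ~: A ==> w j x = 0"
  and bd: "!!j. (\<integral>\<^sup>+x. en (norm (w j x) powr p) \<partial>M) <= en K"
 obtains v u where "!!n. v n : mconv w n" "integrable M u" "u : borel_measurable M" "!!x. x ~: A ==> u x = 0"
  "!!n. integrable M (v n)"
  "(%n. \<integral>\<^sup>+x. en (norm (v n x - u x)) \<partial>M) ~~> 0"
  "AE x in M. (%n. v n x) ~~> u x"
proof -
 define K' where "K' = max K 0"
 have K': "0 <= K'" "!!j. (\<integral>\<^sup>+x. en (norm (w j x) powr p) \<partial>M) <= en K'"
  using bd by (auto simp: K'_def max_def ennreal_neg)
 define muA where "muA = measure M A"
 have muA: "emeasure M A = en muA" using A by (simp add: muA_def emeasure_eq_ennreal_measure)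
 let ?A = "borel_measurable M"
 define ok where "ok v \<longleftrightarrow> v : ?A & (ALL x. x ~: A --> v x = 0) &
   (\<integral>\<^sup>+x. en (norm (v x) powr p) \<partial>M) <= en K'" for v :: "'x => 'b"
 have ok: "ok v" if "v : mconv w n" for v n
  using that
 proof induction
  case (mconv_base j) then show ?case using w K' by (simp add: ok_def)
 next
  case (mconv_mid a b) then show ?case
   using nn_integral_powr_midpoint_le[of a M b p K'] p K' by (auto simp: ok_def)
 qed
 have meas: "v : ?A" if "v : mconv w n" for v n using ok[OF that] by (simp add: ok_def)
 have intp: "integrable M (%x. norm (v x) powr p)" "(LINT x|M. norm (v x) powr p) <= K'" if "v : mconv w n" for v n
 proof -
  note [measurable] = meas[OF that]
  have le: "(\<integral>\<^sup>+x. en (norm (v x) powr p) \<partial>M) <= en K'" using ok[OF that] by (simp add: ok_def)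
  show i: "integrable M (%x. norm (v x) powr p)"
   by (rule integrableI_bounded) (use le in "auto simp: le_less_trans")
  show "(LINT x|M. norm (v x) powr p) <= K'"
   using le K' by (subst (asm) nn_integral_eq_integral[OF i]) auto
 qed
 have indA: "integrable M (ind A :: 'x => real)" using A by simp
 have int: "integrable M v" if "v : mconv w n" for v n
 proof (rule Bochner_Integration.integrable_bound)
  show "integrable M (%x. ind A x + norm (v x) powr p)"
   using indA intp(1)[OF that] by simp
  have "norm (v x) <= ind A x + norm (v x) powr p" for x
   using le_add_powr[of "norm (v x)" 1 p] p ok[OF that] by (cases "x : A") (auto simp: ok_def)
  then show "AE x in M. norm (v x) <= norm (ind A x + norm (v x) powr p)" by simp
 qed (rule meas[OF that])
 \<comment> \<open>Subtracting 1 makes the integrand vanish off \<open>A\<close>, where all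
   functions are 0; without it the functional would be infinite.\<close>
 define Ph where "Ph v = (LINT x|M. graph_norm (v x) - 1)" for v :: "'x => 'b"
 have gm [measurable]: "graph_norm : borel_measurable (borel :: 'b measure)"
  unfolding graph_norm_def[abs_def] by simp
 have gint: "integrable M (%x. graph_norm (v x) - 1)" if "v : mconv w n" for v n
 proof (rule Bochner_Integration.integrable_bound[OF integrable_norm[OF int[OF that]]])
  note [measurable] = meas[OF that]
  show "(%x. graph_norm (v x) - 1) : ?A" by simp
  show "AE x in M. norm (graph_norm (v x) - 1) <= norm (norm (v x))"
  proof (intro AE_I2)
   fix x show "norm (graph_norm (v x) - 1) <= norm (norm (v x))"
    using graph_norm_ge_1[of "v x"] graph_norm_le[of "v x"] by simp
  qed
 qed
 have Ph_nonneg: "0 <= Ph v" for v unfolding Ph_def using graph_norm_ge_1 by (intro integral_nonneg_AE) auto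
 define B where "B = muA + K'"
 have Ph_le: "Ph v <= B" if "v : mconv w n" for v n
 proof -
  have "Ph v <= (LINT x|M. ind A x + norm (v x) powr p)"
   unfolding Ph_def
  proof (rule integral_mono[OF gint[OF that]])
   show "integrable M (%x. ind A x + norm (v x) powr p)" using indA intp(1)[OF that] by simp
   fix x
   have "norm (v x) <= ind A x + norm (v x) powr p"
    using le_add_powr[of "norm (v x)" 1 p] p ok[OF that] by (cases "x : A") (auto simp: ok_def)
   then show "graph_norm (v x) - 1 <= ind A x + norm (v x) powr p" using graph_norm_le[of "v x"] by simp
  qed
  also have "... <= B" using intp[OF that] indA by (simp add: B_def muA_def)
  finally show ?thesis .
 qed
 define I where "I n = Inf (Ph ` mconv w n)" for n
 have ne: "mconv w n ~= {}" for n using mconv_base[of n n w] by auto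
 have I_le: "I n <= Ph v" if "v : mconv w n" for v n
  unfolding I_def using Ph_nonneg that by (intro cInf_lower bdd_belowI[where m=0]) auto
 have I_inc: "incseq I"
 proof (rule incseq_SucI)
  fix n show "I n <= I (Suc n)" unfolding I_def[of "Suc n"]
   using ne I_le[of _ n] mconv_mono[of _ w "Suc n" n] by (intro cInf_greatest) auto
 qed
 have "I n <= B" for n using I_le Ph_le ne by (meson all_not_in_conv order_trans)
 then obtain I0 where I0: "I ~~> I0" using incseq_convergent[OF I_inc] by metis
 have I_I0: "I n <= I0" for n using incseq_le[OF I_inc I0] .
 have "EX v. v : mconv w n & Ph v < I n + 1 / real (Suc n)" for n
  using cInf_lessD[of "Ph ` mconv w n" "I n + 1 / real (Suc n)"] ne by (auto simp: I_def)
 then obtain v0 where v0: "!!n. v0 n : mconv w n" "!!n. Ph (v0 n) < I n + 1 / real (Suc n)" by metis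
 \<comment> \<open>The midpoint \<open>d\<close> lies in the tail from \<open>N\<close>, hence
   \<open>Ph d\<close> is at least \<open>I N\<close>, while \<open>Ph (v0 m)\<close> and
   \<open>Ph (v0 n)\<close> exceed \<open>I0\<close> by at most 1/(N+1); this bounds the integrated
   defect.\<close>
 have L1: "(LINT x|M. norm (v0 m x - v0 n x)) <= et * muA
   + 8 * (1 + R) ^ 3 / et * (I0 - I N + 1 / real (Suc N)) + 4 * K' / R powr (p - 1)"
  if "N <= m" "N <= n" "0 < et" "0 < R" for m n N et R
 proof -
  have mN: "v0 m : mconv w N" "v0 n : mconv w N" using v0(1) that mconv_mono by blast+
  define d where "d x = (1/2) *: (v0 m x + v0 n x)" for x
  have dN: "d : mconv w N" unfolding d_def[abs_def] by (rule mconv_mid[OF mN])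
  define G where "G v x = graph_norm (v x) - 1" for v :: "'x => 'b" and x
  define def where "def x = (G (v0 m) x + G (v0 n) x) / 2 - G d x" for x
  have G: "integrable M (G v)" if "v : mconv w n" for v n using gint[OF that] by (simp add: G_def[abs_def])
  have di: "integrable M def" unfolding def_def using G[OF mN(1)] G[OF mN(2)] G[OF dN] by simp
  have "(LINT x|M. def x) = (Ph (v0 m) + Ph (v0 n)) / 2 - Ph d"
   unfolding def_def Ph_def G_def[symmetric] using G[OF mN(1)] G[OF mN(2)] G[OF dN] by simp
  also have "... <= I0 - I N + 1 / real (Suc N)"
  proof -
   have "Ph (v0 m) <= I0 + 1 / real (Suc N)" "Ph (v0 n) <= I0 + 1 / real (Suc N)"
    using v0(2)[of m] v0(2)[of n] I_I0[of m] I_I0[of n] that frac_le[of 1 1 "real (Suc N)" "real (Suc m)"]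
     frac_le[of 1 1 "real (Suc N)" "real (Suc n)"] by auto
   moreover have "(a + b) / 2 - c <= I - i + k" if "a <= I + k" "b <= I + k" "i <= c" for a b c i I k :: real
    using that by argo
   ultimately show ?thesis using I_le[OF dN] by blast
  qed
  finally have def_le: "(LINT x|M. def x) <= I0 - I N + 1 / real (Suc N)" .
  let ?rhs = "%x. et * ind A x + 8 * (1 + R) ^ 3 / et * def x
    + 2 / R powr (p - 1) * (norm (v0 m x) powr p + norm (v0 n x) powr p)"
  have ri: "integrable M ?rhs" using di indA intp(1)[OF mN(1)] intp(1)[OF mN(2)] by simp
  have "(LINT x|M. norm (v0 m x - v0 n x)) <= (LINT x|M. ?rhs x)"
  proof (rule integral_mono[OF _ ri])
   show "integrable M (%x. norm (v0 m x - v0 n x))" using int[OF mN(1)] int[OF mN(2)] by simp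
   fix x
   show "norm (v0 m x - v0 n x) <= ?rhs x"
   proof (cases "x : A")
    case True
    have "def x = (graph_norm (v0 m x) + graph_norm (v0 n x)) / 2 - graph_norm ((1/2) *: (v0 m x + v0 n x))"
     by (simp add: def_def d_def G_def field_simps)
    then show ?thesis using norm_diff_le_defect[of et R p "v0 m x" "v0 n x"] that p True by simp
   next
    case False
    then have "v0 m x = 0" "v0 n x = 0" using ok[OF mN(1)] ok[OF mN(2)] by (auto simp: ok_def)
    moreover from this have "def x = 0" by (simp add: def_def d_def G_def)
    ultimately show ?thesis using `0 < et` by simp
   qed
  qed
  also have "... = et * muA + 8 * (1 + R) ^ 3 / et * (LINT x|M. def x)
    + 2 / R powr (p - 1) * ((LINT x|M. norm (v0 m x) powr p) + (LINT x|M. norm (v0 n x) powr p))"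
   using di indA intp(1)[OF mN(1)] intp(1)[OF mN(2)] by (simp add: muA_def)
  also have "... <= et * muA + 8 * (1 + R) ^ 3 / et * (I0 - I N + 1 / real (Suc N))
    + 2 / R powr (p - 1) * (K' + K')"
   using intp(2)[OF mN(1)] intp(2)[OF mN(2)] that def_le by (intro add_mono mult_left_mono) auto
  finally show ?thesis by simp
 qed
 have cau: "EX N. ALL i>=N. ALL j>=N. (LINT x|M. norm (v0 i x - v0 j x)) < e" if "0 < e" for e
 proof -
  \<comment> \<open>Each of the three terms of \<open>L1\<close> receives e/4. The order matters:
    \<open>N\<close> is chosen last since the coefficient of the middle term depends on
    \<open>et\<close> and \<open>R\<close>.\<close>
  define et where "et = e / (4 * (muA + 1))"
  have mA: "0 <= muA" by (simp add: muA_def)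
  have et: "0 < et" using that mA by (simp add: et_def)
  have e1: "et * muA <= e / 4"
   using mA that by (simp add: et_def field_simps)
  define R where "R = (16 * (K' + 1) / e) powr (1 / (p - 1))"
  have R: "0 < R" using that K' by (simp add: R_def)
  have Rp: "R powr (p - 1) = 16 * (K' + 1) / e"
   using that K' p by (simp add: R_def powr_powr)
  have e2: "4 * K' / R powr (p - 1) <= e / 4"
   unfolding Rp using that K'(1) by (simp add: field_simps)
  have "(%N. 8 * (1 + R) ^ 3 / et * (I0 - I N + 1 / real (Suc N))) ~~> 8 * (1 + R) ^ 3 / et * (I0 - I0 + 0)"
   by (intro tendsto_intros I0 LIMSEQ_Suc[OF lim_1_over_n])
  then have "\<forall>\<^sub>F N in sequentially. 8 * (1 + R) ^ 3 / et * (I0 - I N + 1 / real (Suc N)) < e / 4"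
   using that by (intro order_tendstoD(2)) auto
  then obtain N where "8 * (1 + R) ^ 3 / et * (I0 - I N + 1 / real (Suc N)) < e / 4"
   by (auto simp: eventually_sequentially)
  then have "(LINT x|M. norm (v0 i x - v0 j x)) < e" if "i >= N" "j >= N" for i j
   using L1[OF that et R] e1 e2 `0 < e` by simp
  then show ?thesis by blast
 qed
 obtain r where r: "strict_mono r" "AE x in M. Cauchy (%i. v0 (r i) x)"
  using cauchy_L1_AE_cauchy_subseq[OF int[OF v0(1)] cau] by blast
 define v where "v n = v0 (r n)" for n
 have rn: "n <= r n" for n using r(1) by (rule strict_mono_imp_increasing)
 have v: "v n : mconv w n" for n unfolding v_def using v0(1) rn mconv_mono by blast
 note [measurable] = meas[OF v]
 define u where "u x = lim (%n. v n x)" for x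
 have [measurable]: "u : ?A" unfolding u_def[abs_def] by simp
 have uA: "u x = 0" if "x ~: A" for x
  using ok[OF v] that by (simp add: u_def ok_def)
 have ae: "AE x in M. (%n. v n x) ~~> u x"
  using r(2) by eventually_elim (auto simp: u_def v_def Cauchy_convergent_iff convergent_LIMSEQ_iff)
 have lim: "(%n. \<integral>\<^sup>+x. en (norm (v n x - u x)) \<partial>M) ~~> 0"
 proof (rule order_tendstoI)
  fix y :: ennreal assume "0 < y"
  then obtain e where e: "0 < e" "en e < y"
   by (metis dense ennreal_0 ennreal_cases ennreal_less_iff less_le not_less_zero order_less_trans top_greatest zero_less_iff_neq_zero)
  obtain N where N: "!!i j. N <= i ==> N <= j ==> (LINT x|M. norm (v0 i x - v0 j x)) < e" using cau[OF e(1)] by blast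
  have "(\<integral>\<^sup>+x. en (norm (v n x - u x)) \<partial>M) < y" if "N <= n" for n
  proof -
   have "(\<integral>\<^sup>+x. en (norm (v n x - u x)) \<partial>M) = (\<integral>\<^sup>+x. liminf (%j. en (norm (v n x - v j x))) \<partial>M)"
   proof (rule nn_integral_cong_AE)
    show "AE x in M. en (norm (v n x - u x)) = liminf (%j. en (norm (v n x - v j x)))"
     using ae
    proof eventually_elim
     case (elim x)
     have "(%j. en (norm (v n x - v j x))) ~~> en (norm (v n x - u x))"
      using elim by (intro tendsto_intros)
     from lim_imp_Liminf[OF sequentially_bot this] show ?case by simp
    qed
   qed
   also have "... <= liminf (%j. \<integral>\<^sup>+x. en (norm (v n x - v j x)) \<partial>M)"
    by (rule nn_integral_liminf) auto
   also have "... <= en e"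
   proof (rule Liminf_le)
    show "\<forall>\<^sub>F j in sequentially. (\<integral>\<^sup>+x. en (norm (v n x - v j x)) \<partial>M) <= en e"
    proof (rule eventually_sequentiallyI[of N])
     fix j assume "N <= j"
     then have "N <= r n" "N <= r j" using that rn le_trans by blast+
     then have "(LINT x|M. norm (v n x - v j x)) <= e" unfolding v_def using N less_imp_le by blast
     moreover have "(\<integral>\<^sup>+x. en (norm (v n x - v j x)) \<partial>M) = en (LINT x|M. norm (v n x - v j x))"
      using int[OF v] by (intro nn_integral_eq_integral) auto
     ultimately show "(\<integral>\<^sup>+x. en (norm (v n x - v j x)) \<partial>M) <= en e"
      by (simp add: ennreal_leI)
    qed
   qed simp
   finally show ?thesis using e(2) by simp
  qed
  then show "\<forall>\<^sub>F n in sequentially. (\<integral>\<^sup>+x. en (norm (v n x - u x)) \<partial>M) < y"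
   by (auto simp: eventually_sequentially)
 qed simp
 have "integrable M u"
 proof -
  have "\<forall>\<^sub>F n in sequentially. (\<integral>\<^sup>+x. en (norm (v n x - u x)) \<partial>M) < 1"
   using lim by (rule order_tendstoD) simp
  then obtain n where "(\<integral>\<^sup>+x. en (norm (v n x - u x)) \<partial>M) < 1" by (auto simp: eventually_sequentially)
  then have "integrable M (%x. v n x - u x)" by (intro integrableI_bounded) (auto intro: order_less_trans)
  from Bochner_Integration.integrable_diff[OF int[OF v[of n]] this]
  have "integrable M (%x. v n x - (v n x - u x))" .
  then show ?thesis by simp
 qed
 with v uA ae lim show ?thesis using int[OF v] by (intro that[of v u]) auto
qed

section \<open>Integrals along parallel segments\<close>

lemma nn_integral_translate:
 assumes [measurable]: "f : BM"
 shows "(NN x. f (x + c)) = (NN x. f x)"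
proof -
 have "(NN x. f x) = (\<integral>\<^sup>+x. f x \<partial>(distr lborel borel ((+) c)))"
  by (simp add: lborel_distr_plus)
 also have "... = (NN x. f (c + x))" by (subst nn_integral_distr) auto
 finally show ?thesis by (simp add: add.commute)
qed

text \<open>Tonelli in (x, s) and translation invariance for each fixed \<open>s\<close>.
  \<open>B'\<close> only has to contain the segments that start in \<open>B\<close>.\<close>

lemma nn_integral_line_le:
 assumes [measurable]: "g : BM" "B : sets borel" "B' : sets borel"
  and sub: "!!x s. x : B ==> 0 <= s ==> s <= t ==> x + s *: e : B'" and "0 <= t"
 shows "(NN x:B. NN s:{0..t}. g (x + s *: e))
  <= en t * (NN x. g x * ind B' x)"
proof -
 let ?B = "NN x. g x * ind B' x"
 have "(NN x:B. NN s:{0..t}. g (x + s *: e))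
  = (NN x. (NN s. g (x + s *: e) * ind {0..t} s * ind B x))"
  by (intro nn_integral_cong) (simp add: nn_integral_multc)
 also have "... = (NN s. (NN x:B. g (x + s *: e) * ind {0..t} s))"
  by (rule lborel_pair.Fubini'[symmetric]) simp
 also have "... <= (NN s:{0..t}. NN x. g x * ind B' x)"
 proof (rule nn_integral_mono)
  fix s
  let ?A = "NN x. g (x + s *: e) * ind B' (x + s *: e)"
  let ?C = "NN x:B. g (x + s *: e) * ind {0..t} s"
  have "?C
   <= (NN x. (g (x + s *: e) * ind B' (x + s *: e)) * ind {0..t} s)"
   using sub by (intro nn_integral_mono) (auto simp: indicator_def)
  also have "... = ?A * ind {0..t} s"
   by (rule nn_integral_multc) simp
  also have "?A = ?B"
   by (rule nn_integral_translate[of "%x. g x * ind B' x"]) simp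
  finally show "?C
   <= ?B * ind {0..t} s" .
 qed
 also have "... = en t * ?B"
  using `0 <= t` by (subst nn_integral_cmult) (auto simp: mult.commute)
 finally show ?thesis .
qed

definition line_int :: "'a::euclidean_space => real => ('a => 'b::hilbert) => 'a => 'b"
 where "line_int e t w x = (LINT s:{0..t}|lborel. w (x + s *: e))"

text \<open>An upper gradient tested on segments in the single direction \<open>e\<close>. The
  exceptional null set may depend on \<open>t\<close>, which is the form that limits in L1
  preserve.\<close>

abbreviation upper_grad
 where "upper_grad U e t f w == AA x:U;t *: e. dist (f (x + t *: e)) (f x) <= line_int e t w x"

lemma borel_measurable_line_int [measurable]:
 assumes [measurable]: "w : BM"
 shows "line_int e t w : BM"
proof -
 have "(%x. LINT s|lborel. ind {0..t} s *: w (x + s *: e)) : borel_measurable (lborel :: 'a measure)"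
  by simp
 then show ?thesis by (simp add: line_int_def[abs_def] set_lebesgue_integral_def)
qed

lemma AE_set_integrable_line:
 fixes w :: "'a::euclidean_space => 'b::hilbert"
 assumes [measurable]: "w : BM" and int: "integrable lborel w"
 shows "AA x. set_integrable lborel {0..t} (%s. w (x + s *: e))"
proof (cases "0 <= t")
 case True
 have "(NN x:UNIV. NN s:{0..t}. en (norm (w (x + s *: e))))
  <= en t * (NN x:UNIV. en (norm (w x)))"
  using True by (intro nn_integral_line_le) auto
 also have "... < oo" using int by (simp add: ennreal_mult_less_top integrable_iff_bounded)
 finally have "AA x. (NN s:{0..t}. en (norm (w (x + s *: e)))) ~= oo"
  by (intro nn_integral_PInf_AE) auto
 then show ?thesis
 proof eventually_elim
  case (elim x)
  have "(NN s. en (norm (ind {0..t} s *: w (x + s *: e))))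
   = (NN s:{0..t}. en (norm (w (x + s *: e))))"
   by (intro nn_integral_cong) (auto simp: indicator_def)
  then show ?case using elim unfolding set_integrable_def
   by (intro integrableI_bounded) (auto simp: less_top)
 qed
qed (simp add: set_integrable_def)

lemma norm_line_int_le:
 assumes [measurable]: "w : BM"
 shows "en (norm (line_int e t w x)) <= (NN s:{0..t}. en (norm (w (x + s *: e))))"
proof (cases "set_integrable lborel {0..t} (%s. w (x + s *: e))")
 case True
 have "en (norm (line_int e t w x)) <= (NN s. en (norm (ind {0..t} s *: w (x + s *: e))))"
  unfolding line_int_def set_lebesgue_integral_def
  by (rule integral_norm_bound_ennreal) (use True in "simp add: set_integrable_def")
 also have "... = (NN s:{0..t}. en (norm (w (x + s *: e))))"
  by (intro nn_integral_cong) (auto simp: indicator_def)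
 finally show ?thesis .
next
 case False
 then have "line_int e t w x = 0"
  unfolding line_int_def set_lebesgue_integral_def set_integrable_def by (rule not_integrable_integral_eq)
 then show ?thesis by simp
qed

lemma nn_integral_line_int_le:
 assumes [measurable]: "w : BM" "B : sets borel" and "0 <= t"
 shows "(NN x:B. en (norm (line_int e t w x))) <= en t * (NN x. en (norm (w x)))"
proof -
 have "(NN x:B. en (norm (line_int e t w x)))
  <= (NN x:B. NN s:{0..t}. en (norm (w (x + s *: e))))"
  by (intro nn_integral_mono mult_right_mono norm_line_int_le) auto
 also have "... <= en t * (NN x:UNIV. en (norm (w x)))"
  using `0 <= t` by (intro nn_integral_line_le) auto
 finally show ?thesis by simp
qed

text \<open>Linearity holds only almost everywhere because a Bochner integral takes the default
  value 0 on lines along which the function is not integrable.\<close>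

lemma AE_line_int_lin:
 assumes "a : BM" "integrable lborel a" "b : BM" "integrable lborel b"
 shows "AA x. line_int e t (%x. c *: (a x + b x)) x = c *: (line_int e t a x + line_int e t b x)"
  and "AA x. line_int e t (%x. a x - b x) x = line_int e t a x - line_int e t b x"
 using AE_set_integrable_line[OF assms(1,2), of t e] AE_set_integrable_line[OF assms(3,4), of t e]
 by (eventually_elim, simp add: line_int_def)+

section \<open>Translation bounds and difference quotients\<close>

text \<open>A Nikolskii condition of the full order one. \<open>K\<close> bounds the p-th power of
  the increments, not their norm, and its sign is recorded because \<open>en\<close> sends negative
  numbers to 0.\<close>

definition nik :: "'a::euclidean_space set => real => real => ('a => 'c::metric_space) => bool"
 where "nik U p K f \<longleftrightarrow> 0 <= K & (ALL h. (NN x:(seg U h). en (dist (f (x + h)) (f x) powr p))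
  <= en (K * norm h powr p))"

text \<open>The threshold \<open>c = norm h\<close> in \<open>le_add_powr\<close> makes both
  resulting terms linear in \<open>norm h\<close>.\<close>

lemma nik_L1:
 fixes f :: "'a::euclidean_space => 'c::sep_metric"
 assumes [measurable]: "f : BM" "U : sets borel" and U: "vol U < oo"
  and n: "nik U p K f" and p: "1 < p"
 shows "(NN x:(seg U h). en (dist (f (x + h)) (f x)))
  <= en ((measure lborel U + K) * norm h)"
proof (cases "h = 0")
 case False
 define c where "c = norm h"
 have c: "0 < c" using False by (simp add: c_def)
 have K: "0 <= K" using n by (simp add: nik_def)
 have "(NN x:(seg U h). en (dist (f (x + h)) (f x)))
  <= (NN x. en c * ind U x + en (1 / c powr (p - 1)) *
    (en (dist (f (x + h)) (f x) powr p) * ind (seg U h) x))"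
 proof (rule nn_integral_mono)
  fix x
  have "dist (f (x + h)) (f x) <= c * 1 + 1 / c powr (p - 1) * dist (f (x + h)) (f x) powr p"
   using le_add_powr[of "dist (f (x + h)) (f x)" c p] c p by simp
  then have "en (dist (f (x + h)) (f x)) <= en (c * 1 + 1 / c powr (p - 1) * dist (f (x + h)) (f x) powr p)"
   by (rule ennreal_leI)
  also have "... = en c * en 1 + en (1 / c powr (p - 1)) * en (dist (f (x + h)) (f x) powr p)"
   using c by (intro ennreal_lincomb) auto
  finally show "en (dist (f (x + h)) (f x)) * ind (seg U h) x <= en c * ind U x + en (1 / c powr (p - 1)) *
    (en (dist (f (x + h)) (f x) powr p) * ind (seg U h) x)"
   by (auto simp: indicator_def)
 qed
 also have "... = en c * vol U + en (1 / c powr (p - 1)) *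
    (NN x:(seg U h). en (dist (f (x + h)) (f x) powr p))"
  by (subst nn_integral_add) (auto simp: nn_integral_cmult)
 also have "... <= en c * vol U + en (1 / c powr (p - 1)) * en (K * norm h powr p)"
  using n by (intro add_left_mono mult_left_mono) (auto simp: nik_def)
 also have "vol U = en (measure lborel U)"
  using U by (simp add: emeasure_eq_ennreal_measure)
 also have "en c * en (measure lborel U) + en (1 / c powr (p - 1)) * en (K * norm h powr p)
   = en (c * measure lborel U + 1 / c powr (p - 1) * (K * norm h powr p))"
  using c K by (intro ennreal_lincomb[symmetric]) auto
 also have "c * measure lborel U + 1 / c powr (p - 1) * (K * norm h powr p) = (measure lborel U + K) * norm h"
  using c by (simp add: c_def[symmetric] powr_diff field_simps)
 finally show ?thesis .
qed simp

lemma nik_comp_lipschitz: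
 fixes f :: "'a::euclidean_space => 'c::sep_metric" and g :: "'c => 'd::metric_space"
 assumes n: "nik U p K f" and L: "!!a b. dist (g a) (g b) <= L * dist a b" "0 <= L" and p: "1 < p"
  and [measurable]: "f : BM" "U : sets borel"
 shows "nik U p (L powr p * K) (%x. g (f x))"
 unfolding nik_def
proof (intro conjI allI)
 have K: "0 <= K" using n by (simp add: nik_def)
 then show "0 <= L powr p * K" by simp
 fix h
 let ?A = "%x. en (dist (g (f (x + h))) (g (f x)) powr p)"
 let ?B = "%x. en (dist (f (x + h)) (f x) powr p)"
 have "(NN x:(seg U h). (?A x))
  <= (NN x. en (L powr p) * ((?B x) * ind (seg U h) x))"
 proof (rule nn_integral_mono)
  fix x
  have "dist (g (f (x + h))) (g (f x)) powr p <= (L * dist (f (x + h)) (f x)) powr p"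
   using L p by (intro powr_mono2) auto
  also have "... = L powr p * dist (f (x + h)) (f x) powr p" by (simp add: powr_mult)
  finally show "(?A x) * ind (seg U h) x
   <= en (L powr p) * ((?B x) * ind (seg U h) x)"
   by (auto simp: indicator_def ennreal_mult'[symmetric])
 qed
 also have "... = en (L powr p) * (NN x:(seg U h). (?B x))"
  by (rule nn_integral_cmult) simp
 also have "... <= en (L powr p) * en (K * norm h powr p)"
  using n by (intro mult_left_mono) (auto simp: nik_def)
 also have "... = en (L powr p * K * norm h powr p)"
  using K by (simp add: ennreal_mult'[symmetric])
 finally show "(NN x:(seg U h). (?A x))
  <= en (L powr p * K * norm h powr p)" .
qed

text \<open>After a shift both sides are differences of integrals of \<open>ph\<close> over
  intervals; the common part cancels and leaves the interval from t to t + dl minus the one from 0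
  to dl. Thus a long integral of increments of length \<open>dl\<close> becomes a short integral of
  increments of length \<open>t\<close>.\<close>

lemma integral_shift_swap:
 fixes ph :: "real => 'b::hilbert"
 assumes int: "integrable lborel ph" and "0 <= t" "0 <= dl"
 shows "(LINT s:{0..t}|lborel. ph (s + dl) - ph s) = (LINT s:{0..dl}|lborel. ph (s + t) - ph s)"
proof -
 have [measurable]: "ph : BM" using borel_measurable_integrable[OF int] by simp
 have ind: "integrable lborel (%s. ind {a..b} s *: ph s)" for a b
  by (rule integrable_mult_indicator[OF _ int]) auto
 have tr: "integrable lborel (%s. ph (s + c))" for c
  using lborel_integrable_real_affine[OF int, of 1 c] by (simp add: add.commute)
 have sh: "(LINT s:{0..a}|lborel. ph (s + c)) = (LINT s|lborel. ind {c..a + c} s *: ph s)" for a c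
 proof -
  have "(LINT s|lborel. ind {c..a + c} s *: ph s) = (LINT s|lborel. ind {c..a + c} (c + s) *: ph (c + s))"
   using lborel_integral_real_affine[of 1 "%s. ind {c..a + c} s *: ph s" c] by simp
  also have "... = (LINT s:{0..a}|lborel. ph (s + c))"
   unfolding set_lebesgue_integral_def
   by (intro Bochner_Integration.integral_cong) (auto simp: indicator_def add.commute)
  finally show ?thesis by simp
 qed
 have D: "(LINT s:{0..a}|lborel. ph (s + c) - ph s)
   = (LINT s|lborel. ind {c..a + c} s *: ph s - ind {0..a} s *: ph s)" for a c
 proof -
  have "(LINT s:{0..a}|lborel. ph (s + c) - ph s) = (LINT s:{0..a}|lborel. ph (s + c)) - (LINT s:{0..a}|lborel. ph s)"
   using tr int by (intro set_integral_diff) (auto simp: set_integrable_def intro: integrable_mult_indicator)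
  also have "... = (LINT s|lborel. ind {c..a + c} s *: ph s) - (LINT s|lborel. ind {0..a} s *: ph s)"
   by (simp add: sh) (simp add: set_lebesgue_integral_def)
  also have "... = (LINT s|lborel. ind {c..a + c} s *: ph s - ind {0..a} s *: ph s)"
   by (rule Bochner_Integration.integral_diff[OF ind ind, symmetric])
  finally show ?thesis .
 qed
 have "AA s. s ~= 0 & s ~= t & s ~= dl & s ~= t + dl"
  using AE_lborel_singleton[of 0] AE_lborel_singleton[of t] AE_lborel_singleton[of dl] AE_lborel_singleton[of "t + dl"]
  by simp
 then have "AA s. ind {dl..t + dl} s *: ph s - ind {0..t} s *: ph s
   = ind {t..dl + t} s *: ph s - ind {0..dl} s *: ph s"
  by eventually_elim (use assms(2,3) in "auto simp: indicator_def")
 then show ?thesis unfolding D by (rule integral_cong_AE[rotated 2]) auto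
qed

definition diff_quot :: "'a::euclidean_space set => ('a => 'b::real_vector) => 'a => real => 'a => 'b"
 where "diff_quot U u e dl x = (if x : U & x + dl *: e : U then (1/dl) *: (u (x + dl *: e) - u x) else 0)"

lemma convex_line_mem:
 assumes "convex U" "x : U" "x + t *: e : U" "0 <= s" "s <= t"
 shows "x + s *: e : U"
proof (cases "t = 0")
 case False
 then have "0 < t" using assms by simp
 have "(1 - s / t) *: x + (s / t) *: (x + t *: e) : U"
  using assms `0 < t` by (intro convexD) auto
 moreover have "(1 - s / t) *: x + (s / t) *: (x + t *: e) = x + s *: e"
  using `0 < t` by (simp add: algebra_simps)
 ultimately show ?thesis by simp
qed (use assms in auto)

text \<open>By \<open>integral_shift_swap\<close> the integrated difference quotient is the mean
  over s in [0, dl] of the increments u (x + (s + t) e) - u (x + s e). These differ from the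
  increment at s = 0 by two increments of length at most \<open>dl\<close>, which
  \<open>nik_L1\<close> bounds by a multiple of \<open>dl\<close>. The reserve
  \<open>t + dl <= t'\<close> keeps all points in \<open>U\<close>.\<close>

lemma line_int_diff_quot:
 assumes [measurable]: "u : BM" and int: "integrable lborel u"
  and U[measurable]: "U : sets borel" "convex U" "vol U < oo" and p: "1 < p" and n: "nik U p K u"
  and t: "0 < t" "0 < dl" "t + dl <= t'"
 shows "(NN x:(seg U (t' *: e)). en (norm (line_int e t (diff_quot U u e dl) x - (u (x + t *: e) - u x)))
  )
  <= en (2 * ((measure lborel U + K) * norm e) * dl)"
proof -
 let ?J = "measure lborel U + K"
 define C where "C = ?J * norm e"
 have K: "0 <= K" using n by (simp add: nik_def)
 then have C: "0 <= C" by (simp add: C_def)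
 let ?Om = "(seg U (t' *: e))"
 define G where "G x s = en (norm (u (x + (s + t) *: e) - u (x + t *: e))) + en (norm (u (x + s *: e) - u x))" for x s
 have Gm: "case_prod G : borel_measurable (lborel \<Otimes>\<^sub>M lborel)" unfolding G_def by simp
 let ?E = "%x. en (norm (line_int e t (diff_quot U u e dl) x - (u (x + t *: e) - u x)))"
 let ?G = "en (2 * C * dl)"
 have "AA x. x : ?Om --> (?E x)
   <= en (1/dl) * (NN s:{0..dl}. G x s)"
  using AE_set_integrable_line[OF assms(1) int, of t' e]
 proof eventually_elim
  case (elim x)
  let ?B = "line_int e t (diff_quot U u e dl) x"
  show ?case
  proof
   assume x: "x : ?Om"
   then have xU: "x + s *: e : U" if "0 <= s" "s <= t'" for s using convex_line_mem[OF U(2)] that by auto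
   \<comment> \<open>The cutoff makes \<open>ph\<close> integrable on the whole line, as the swap
     lemma requires; it is invisible because only parameters up to t + dl <= t' occur.\<close>
   define ph where "ph s = ind {0..t'} s *: u (x + s *: e)" for s
   have ph: "integrable lborel ph" using elim by (simp add: ph_def[abs_def] set_integrable_def)
   have phs: "ph s = u (x + s *: e)" if "0 <= s" "s <= t'" for s using that by (simp add: ph_def)
   have phi: "set_integrable lborel {0..a} (%s. ph (s + b) - ph s)" for a b
    using ph lborel_integrable_real_affine[OF ph, of 1 b] unfolding set_integrable_def
    by (intro integrable_mult_indicator) (auto simp: add.commute)
   let ?I = "LINT s:{0..dl}|lborel. ph (s + t) - ph s"
   have "?B = (LINT s:{0..t}|lborel. (1/dl) *: (ph (s + dl) - ph s))"
    unfolding line_int_def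
   proof (intro set_lebesgue_integral_cong, simp, intro allI impI)
    fix s assume s: "s : {0..t}"
    have "x + s *: e : U" "x + s *: e + dl *: e : U"
     using xU[of s] xU[of "s + dl"] s t by (auto simp: algebra_simps)
    then show "diff_quot U u e dl (x + s *: e) = (1/dl) *: (ph (s + dl) - ph s)"
     using s t by (simp add: diff_quot_def phs algebra_simps)
   qed
   also have "... = (1/dl) *: ?I"
    using integral_shift_swap[OF ph, of t dl] t by simp
   finally have eq1: "?B = (1/dl) *: ?I" .
   define c where "c = u (x + t *: e) - u x"
   have ci: "set_integrable lborel {0..dl} (%s. c)"
    unfolding set_integrable_def by (intro integrable_scaleR_left) (auto simp: emeasure_lborel_Icc_eq)
   let ?H = "LINT s:{0..dl}|lborel. (ph (s + t) - ph s) - c"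
   have "c = (1/dl) *: (LINT s:{0..dl}|lborel. c)"
    using t by (simp add: set_lebesgue_integral_def)
   with eq1 have "?B - c = (1/dl) *: ?H"
    using set_integral_diff(2)[OF phi ci] by (simp add: scaleR_diff_right)
   then have "en (norm (?B - c))
     = en (1/dl) * en (norm ?H)"
    using t by (simp add: ennreal_mult'[symmetric])
   also have "... <= en (1/dl) * (NN s. en (norm (ind {0..dl} s *: ((ph (s + t) - ph s) - c))))"
    using set_integral_diff(1)[OF phi ci] unfolding set_lebesgue_integral_def set_integrable_def
    by (intro mult_left_mono integral_norm_bound_ennreal) auto
   also have "... <= en (1/dl) * (NN s:{0..dl}. G x s)"
   proof (intro mult_left_mono nn_integral_mono)
    fix s
    show "en (norm (ind {0..dl} s *: ((ph (s + t) - ph s) - c))) <= G x s * ind {0..dl} s"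
    proof (cases "s : {0..dl}")
     case True
     have "(ph (s + t) - ph s) - c = (u (x + (s + t) *: e) - u (x + t *: e)) - (u (x + s *: e) - u x)"
      using True t by (simp add: phs c_def)
     then have "norm ((ph (s + t) - ph s) - c) <= norm (u (x + (s + t) *: e) - u (x + t *: e)) + norm (u (x + s *: e) - u x)"
      by (simp only: norm_triangle_ineq4)
     then show ?thesis using True by (simp add: G_def flip: ennreal_plus)
    qed simp
   qed simp
   finally show "en (norm (?B - (u (x + t *: e) - u x)))
     <= en (1/dl) * (NN s:{0..dl}. G x s)" unfolding c_def .
  qed
 qed
 then have "(NN x:?Om. (?E x))
   <= (NN x:?Om. en (1/dl) * (NN s:{0..dl}. G x s))"
  by (intro nn_integral_mono_AE) (auto simp: indicator_def)
 also have "... = en (1/dl) * (NN x. (NN s. G x s * ind {0..dl} s * ind ?Om x))"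
 proof -
  have [measurable]: "(%s. G x s) : BM" "(%x. NN s:{0..dl}. G x s) : BM" for x
   unfolding G_def by auto
  have "(NN s. G x s * ind {0..dl} s * ind ?Om x) = (NN s:{0..dl}. G x s) * ind ?Om x" for x
   by (rule nn_integral_multc) simp
  then show ?thesis unfolding mult.assoc by (subst nn_integral_cmult[symmetric]) auto
 qed
 also have "(NN x. (NN s. G x s * ind {0..dl} s * ind ?Om x))
   = (NN s. (NN x:?Om. G x s * ind {0..dl} s))"
  unfolding G_def by (intro lborel_pair.Fubini'[symmetric]) simp
 also have "... <= (NN s:{0..dl}. ?G)"
 proof (rule nn_integral_mono)
  fix s
  let ?A = "%x. en (norm (u (x + s *: e) - u x))"
  let ?C = "%x. en (norm (u ((x + t *: e) + s *: e) - u (x + t *: e)))"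
  show "(NN x:?Om. G x s * ind {0..dl} s) <= ?G * ind {0..dl} s"
  proof (cases "s : {0..dl}")
   case True
   let ?D = "(seg U (s *: e))"
   let ?F = "NN x:?D. (?A x)"
   have L1: "?F <= en (C * dl)"
   proof -
    have "?F <= en (?J * norm (s *: e))"
     using nik_L1[OF assms(1) U(1,3) n p, of "s *: e"] by (simp add: dist_norm)
    also have "... <= en (C * dl)"
    proof (rule ennreal_leI)
     have "norm (s *: e) <= norm e * dl"
      using True mult_right_mono[of s dl "norm e"] by (simp add: mult.commute)
     then show "?J * norm (s *: e) <= C * dl"
      unfolding C_def mult.assoc using K by (intro mult_left_mono) auto
    qed
    finally show ?thesis .
   qed
   have "(NN x:?Om. G x s * ind {0..dl} s)
     <= (NN x. (?C x) * ind ?D (x + t *: e)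
       + (?A x) * ind ?D x)"
   proof (rule nn_integral_mono)
    fix x
    show "G x s * ind {0..dl} s * ind ?Om x <=
     en (norm (u ((x + t *: e) + s *: e) - u (x + t *: e))) * ind ?D (x + t *: e)
       + en (norm (u (x + s *: e) - u x)) * ind ?D x"
    proof (cases "x : ?Om")
     case x: True
     then have xU: "x + s *: e : U" if "0 <= s" "s <= t'" for s using convex_line_mem[OF U(2)] that by auto
     have "x + t *: e : ?D" "x : ?D"
      using xU[of s] xU[of t] xU[of "t + s"] True t x by (auto simp: algebra_simps)
     then show ?thesis using True x by (simp add: G_def algebra_simps)
    qed simp
   qed
   also have "... = (NN x. (?C x) * ind ?D (x + t *: e))
     + ?F"
    by (rule nn_integral_add) auto
   also have "(NN x. (?C x) * ind ?D (x + t *: e))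
     = ?F"
    by (rule nn_integral_translate[of "%x. (?A x) * ind ?D x"]) simp
   also have "?F
     + ?F <= en (C * dl) + en (C * dl)"
    by (intro add_mono L1)
   also have "... = ?G" using C t by (simp flip: ennreal_plus)
   finally show ?thesis using True by simp
  qed simp
 qed
 also have "... = ?G * en dl" using t by (simp add: nn_integral_cmult)
 also have "en (1/dl) * (?G * en dl) = ?G"
  using t C by (simp flip: ennreal_mult)
 finally show ?thesis unfolding C_def by (simp add: mult_left_mono)
qed

lemma integrable_if_Lp:
 fixes w :: "'x => 'b::hilbert"
 assumes [measurable]: "w : borel_measurable M" "A : sets M" and A: "emeasure M A < oo" and p: "1 < p"
  and off: "!!x. x ~: A ==> w x = 0" and bd: "(\<integral>\<^sup>+x. en (norm (w x) powr p) \<partial>M) < oo"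
 shows "integrable M w"
proof (rule integrableI_bounded)
 let ?A = "\<integral>\<^sup>+x. en (norm (w x)) \<partial>M"
 have "?A <= (\<integral>\<^sup>+x. ind A x + en (norm (w x) powr p) \<partial>M)"
 proof (rule nn_integral_mono)
  fix x
  have "norm (w x) <= ind A x + norm (w x) powr p"
   using le_add_powr[of "norm (w x)" 1 p] p off[of x] by (cases "x : A") auto
  then have "en (norm (w x)) <= en (ind A x + norm (w x) powr p)" by (rule ennreal_leI)
  then show "en (norm (w x)) <= ind A x + en (norm (w x) powr p)"
   by (simp add: ennreal_indicator)
 qed
 also have "... = emeasure M A + (\<integral>\<^sup>+x. en (norm (w x) powr p) \<partial>M)"
  by (subst nn_integral_add) auto
 also have "... < oo" using A bd by simp
 finally show "?A < oo" .
qed measurable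

lemma AE_line_int_mono:
 fixes a b :: "'a::euclidean_space => real"
 assumes "a : BM" "integrable lborel a" "b : BM" "integrable lborel b"
  and "!!x. a x <= b x"
 shows "AA x. line_int e t a x <= line_int e t b x"
 using AE_set_integrable_line[OF assms(1,2), of t e] AE_set_integrable_line[OF assms(3,4), of t e]
 by eventually_elim (auto simp: line_int_def intro!: set_integral_mono assms(5))

text \<open>A closedness principle: a constraint on line integrals, expressed by a function
  \<open>ps x\<close> that is nonnegative, 1-Lipschitz and midpoint convex, passes to
  \<open>u\<close> as soon as it holds for \<open>w j\<close> asymptotically in L1. Taking
  \<open>ps\<close> as the distance to an increment yields an equation, a positive part yields an
  inequality. Quantifying over \<open>ps\<close> afterwards lets one limit \<open>u\<close> satisfy
  all constraints at once.\<close>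

definition line_limit :: "(nat => 'a::euclidean_space => 'b::hilbert) => ('a => 'b) => bool"
 where "line_limit w u \<longleftrightarrow> (ALL e t Om ps. 0 <= t --> Om : sets borel --> (ALL x y. 0 <= ps x y) -->
   (ALL x y z. ps x y <= ps x z + norm (y - z)) --> (ALL x y z. ps x ((1/2) *: (y + z)) <= (ps x y + ps x z) / 2) -->
   (ALL z. z : BM --> (%x. ps x (z x)) : BM) -->
   (ALL eps>0. EX N. ALL j>=N. (NN x:Om. en (ps x (line_int e t (w j) x))) <= en eps) -->
   (AA x. x : Om --> ps x (line_int e t u x) = 0))"

lemma line_limitD:
 assumes "line_limit w u" "0 <= t" "Om : sets borel" "!!x y. 0 <= ps x y"
  "!!x y z. ps x y <= ps x z + norm (y - z)" "!!x y z. ps x ((1/2) *: (y + z)) <= (ps x y + ps x z) / 2"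
  "!!z. z : BM ==> (%x. ps x (z x)) : BM"
  "!!eps. 0 < eps ==> EX N. ALL j>=N. (NN x:Om. en (ps x (line_int e t (w j) x))) <= en eps"
 shows "AA x. x : Om --> ps x (line_int e t u x) = 0"
 using assms(1) unfolding line_limit_def by (elim allE[of _ e] allE[of _ t] allE[of _ Om] allE[of _ ps] impE) (use assms in auto)

text \<open>Convexity of \<open>ps\<close> carries the small integral from the tail of
  \<open>w\<close> to its midpoints, and the Lipschitz bound carries it from these to their L1
  limit; the bound being arbitrary, the integral for \<open>u\<close> is 0.\<close>

theorem mconv_line_limit:
 assumes A[measurable]: "A : sets borel" and A': "vol A < oo" and p: "1 < p"
  and w: "!!j. w j : BM" "!!j x. x ~: A ==> w j x = 0"
  and bd: "!!j. (NN x. en (norm (w j x) powr p)) <= en K"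
 obtains v u where "!!n. v n : mconv w n" "integrable lborel u" "u : BM" "!!x. x ~: A ==> u x = 0"
  "AA x. (%n. v n x) ~~> u x"
  "line_limit w u"
proof -
 have wi: "integrable lborel (w j)" for j
  by (rule integrable_if_Lp[of _ _ A p]) (use w A A' p bd[of j] in "auto intro: le_less_trans")
 have w': "w j : borel_measurable lborel" for j using w(1) by simp
 obtain v u where v: "!!n. v n : mconv w n" and u: "integrable lborel u" "u : borel_measurable lborel" "!!x. x ~: A ==> u x = 0"
  and vi: "!!n. integrable lborel (v n)"
  and lim: "(%n. NN x. en (norm (v n x - u x))) ~~> 0"
  and ae: "AA x. (%n. v n x) ~~> u x"
 proof (rule mconv_L1_convergent[of A lborel p w K])
  show "A : sets lborel" by simp
 qed (use A' p w' w(2) bd in auto)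
 have ub [measurable]: "u : BM" using u(2) by simp
 have vb [measurable]: "v n : BM" for n using borel_measurable_integrable[OF vi] by simp
 show ?thesis
 proof (rule that[OF v u(1) ub u(3) ae])
  show "line_limit w u" unfolding line_limit_def
  proof (intro allI impI, goal_cases)
   case (1 e t Om ps)
  then have t: "0 <= t" and Om [measurable]: "Om : sets borel" and ps0: "!!x y. 0 <= ps x y"
   and psL: "!!x y z. ps x y <= ps x z + norm (y - z)" and psC: "!!x y z. ps x ((1/2) *: (y + z)) <= (ps x y + ps x z) / 2"
   and psm [measurable]: "!!z. z : BM ==> (%x. ps x (z x)) : BM"
   and small: "!!eps. 0 < eps ==> EX N. ALL j>=N. (NN x:Om. en (ps x (line_int e t (w j) x))) <= en eps"
   by blast+
  define E where "E z = (NN x:Om. en (ps x (line_int e t z x)))" for z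
  have mid: "z : BM & integrable lborel z & E z <= en eps"
   if "z : mconv w N" and le: "!!j. N <= j ==> E (w j) <= en eps" and "0 < eps" for z N eps
   using that(1)
  proof induction
   case (mconv_base j) then show ?case using wi le by auto
  next
   case (mconv_mid a b)
   then have [measurable]: "a : BM" "b : BM" by auto
   let ?A = "%x. (1/2) *: (a x + b x)"
   have "E ?A <= (NN x. en (1/2) * (en (ps x (line_int e t a x)) * ind Om x)
     + en (1/2) * (en (ps x (line_int e t b x)) * ind Om x))"
    unfolding E_def
   proof (rule nn_integral_mono_AE)
    show "AA x. en (ps x (line_int e t ?A x)) * ind Om x
     <= en (1/2) * (en (ps x (line_int e t a x)) * ind Om x)
     + en (1/2) * (en (ps x (line_int e t b x)) * ind Om x)"
    proof -
     have "AA x. line_int e t ?A x = (1/2) *: (line_int e t a x + line_int e t b x)"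
      by (rule AE_line_int_lin(1)) (use mconv_mid.IH in auto)
     then show ?thesis
    proof eventually_elim
     case (elim x)
     have "ps x (line_int e t ?A x) <= 1/2 * ps x (line_int e t a x) + 1/2 * ps x (line_int e t b x)"
      unfolding elim using psC[of x "line_int e t a x" "line_int e t b x"] by simp
     then have "en (ps x (line_int e t ?A x)) <= en (1/2 * ps x (line_int e t a x) + 1/2 * ps x (line_int e t b x))"
      by (rule ennreal_leI)
     also have "... = en (1/2) * en (ps x (line_int e t a x)) + en (1/2) * en (ps x (line_int e t b x))"
      using ps0 by (intro ennreal_lincomb) auto
     finally show ?case by (auto simp: indicator_def)
    qed
    qed
   qed
   also have "... = en (1/2) * E a + en (1/2) * E b"
    unfolding E_def by (subst nn_integral_add) (auto simp: nn_integral_cmult)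
   also have "... <= en (1/2) * en eps + en (1/2) * en eps"
    using mconv_mid.IH by (intro add_mono mult_left_mono) auto
   also have "... = en eps" using `0 < eps` by (subst ennreal_lincomb[symmetric]) auto
   finally show ?case using mconv_mid.IH by auto
  qed
  have bound: "E u <= en eps" if eps: "0 < eps" for eps
  proof -
   obtain N where N: "!!j. N <= j ==> E (w j) <= en (eps/2)" using small[of "eps/2"] eps unfolding E_def by auto
   have "\<forall>\<^sub>F n in sequentially. (NN x. en (norm (v n x - u x))) < en (eps / (2 * (t + 1)))"
    using lim by (rule order_tendstoD) (use that t in auto)
   then have "\<forall>\<^sub>F n in sequentially. N <= n & (NN x. en (norm (v n x - u x))) <= en (eps / (2 * (t + 1)))"
    using eventually_ge_at_top[of N] by eventually_elim auto
   then obtain n where n: "N <= n" "(NN x. en (norm (v n x - u x))) <= en (eps / (2 * (t + 1)))"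
    using eventually_happens'[OF sequentially_bot] by blast
   have vn: "E (v n) <= en (eps/2)"
    using mid[of "v n" N "eps/2"] N v[of n] mconv_mono[of "v n" w n N] n(1) that by auto
   let ?B = "%x. v n x - u x"
   have "E u <= (NN x. en (ps x (line_int e t (v n) x)) * ind Om x + en (norm (line_int e t ?B x)) * ind Om x)"
    unfolding E_def
   proof (rule nn_integral_mono_AE)
    show "AA x. en (ps x (line_int e t u x)) * ind Om x <=
     en (ps x (line_int e t (v n) x)) * ind Om x + en (norm (line_int e t ?B x)) * ind Om x"
     using AE_line_int_lin(2)[OF vb[of n] vi[of n] ub u(1), of e t]
    proof eventually_elim
     case (elim x)
     have "ps x (line_int e t u x) <= ps x (line_int e t (v n) x) + norm (line_int e t ?B x)"
      using psL[of x "line_int e t u x" "line_int e t (v n) x"] by (simp add: elim norm_minus_commute)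
     then have "en (ps x (line_int e t u x)) <= en (ps x (line_int e t (v n) x) + norm (line_int e t ?B x))"
      by (rule ennreal_leI)
     then show ?case using ps0 by (auto simp: indicator_def)
    qed
   qed
   also have "... = E (v n) + (NN x:Om. en (norm (line_int e t ?B x)))"
    unfolding E_def by (rule nn_integral_add) auto
   also have "... <= en (eps/2) + en t * (NN x. en (norm (v n x - u x)))"
    by (intro add_mono vn nn_integral_line_int_le) (use t in auto)
   also have "... <= en (eps/2) + en t * en (eps / (2 * (t + 1)))"
    by (intro add_left_mono mult_left_mono n(2)) auto
   also have "... <= en eps"
   proof -
    define c where "c = eps / (2 * (t + 1))"
    have c: "0 <= c" using that t by (simp add: c_def)
    have "eps/2 + t * c <= eps" using that t by (simp add: c_def field_simps)
    moreover have "en (eps/2) + en t * en c = en (eps/2 + t * c)"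
     using that t c by (simp add: ennreal_mult)
    ultimately show ?thesis unfolding c_def[symmetric] by (simp add: ennreal_leI)
   qed
   finally show ?thesis .
  qed
  have "E u = 0"
  proof (rule ccontr)
   assume "E u ~= 0"
   moreover have "E u < oo" using bound[of 1] by (auto intro: le_less_trans)
   ultimately obtain r where r: "E u = en r" "0 < r" by (cases "E u") auto
   show False using bound[of "r/2"] r by simp
  qed
  then have "AA x. en (ps x (line_int e t u x)) * ind Om x = 0"
   unfolding E_def by (subst (asm) nn_integral_0_iff_AE) auto
  then show ?case
   by eventually_elim (use ps0 in "auto intro: antisym split: if_splits")
  qed
 qed
qed

section \<open>Directional derivatives and metric upper gradients\<close>

lemma borel_measurable_diff_quot [measurable]:
 fixes u :: "'a::euclidean_space => 'b::hilbert"
 assumes [measurable]: "u : BM" "U : sets borel"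
 shows "diff_quot U u e dl : BM"
 unfolding diff_quot_def[abs_def] by simp

definition metric_quot :: "'a::euclidean_space set => ('a => 'c::metric_space) => 'a => real => 'a => real"
 where "metric_quot U f e dl x = (if x : U & x + dl *: e : U then (1/dl) * dist (f (x + dl *: e)) (f x) else 0)"

lemma borel_measurable_metric_quot [measurable]:
 fixes f :: "'a::euclidean_space => 'c::sep_metric"
 assumes [measurable]: "f : BM" "U : sets borel"
 shows "metric_quot U f e dl : BM"
 unfolding metric_quot_def[abs_def] by simp

lemma metric_quot_Lp:
 fixes f :: "'a::euclidean_space => 'c::sep_metric"
 assumes [measurable]: "f : BM" "U : sets borel" and n: "nik U p K f" and dl: "0 < dl" and p: "1 < p"
 shows "(NN x. en (norm (metric_quot U f e dl x) powr p)) <= en (K * norm e powr p)"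
proof -
 let ?A = "%x. en (dist (f (x + dl *: e)) (f x) powr p)"
 let ?B = "en ((1/dl) powr p)"
 have "(NN x. en (norm (metric_quot U f e dl x) powr p))
  = (NN x. ?B * ((?A x) * ind (seg U (dl *: e)) x))"
 proof (rule nn_integral_cong)
  fix x
  show "en (norm (metric_quot U f e dl x) powr p) = ?B * ((?A x) * ind (seg U (dl *: e)) x)"
   using dl powr_mult[of "1/dl" "dist (f (x + dl *: e)) (f x)" p]
   by (auto simp: metric_quot_def ennreal_mult'[symmetric])
 qed
 also have "... = ?B * (NN x:(seg U (dl *: e)). (?A x))"
  by (rule nn_integral_cmult) simp
 also have "... <= ?B * en (K * norm (dl *: e) powr p)"
  by (intro mult_left_mono n[unfolded nik_def, THEN conjunct2, rule_format]) simp
 also have "... = en (K * norm e powr p)"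
 proof -
  have nrm: "norm (dl *: e) = dl * norm e" using dl by simp
  have "(1/dl) powr p * (dl * norm e) powr p = norm e powr p"
   using dl by (simp flip: powr_mult)
  then have "(1/dl) powr p * (K * (dl * norm e) powr p) = K * norm e powr p" by simp
  then show ?thesis unfolding nrm ennreal_mult'[symmetric, OF powr_ge_zero] by (simp only:)
 qed
 finally show ?thesis .
qed

lemma norm_diff_quot: "0 < dl ==> norm (diff_quot U u e dl x) = metric_quot U u e dl x"
 by (simp add: diff_quot_def metric_quot_def dist_norm)

lemma small_eventually:
 assumes "0 <= C" "0 < (s::real)" "0 < eps"
 shows "EX N. ALL j>=N. 1 / real (Suc j) <= s & C * (1 / real (Suc j)) <= eps"
proof -
 obtain N where N: "max (1 / s) (C / eps) < real N" using reals_Archimedean2 by blast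
 have "1 / real (Suc j) <= s & C * (1 / real (Suc j)) <= eps" if "N <= j" for j
 proof -
  have "1 / s < real (Suc j)" "C / eps < real (Suc j)" using N that by auto
  then show ?thesis using assms by (simp add: field_simps)
 qed
 then show ?thesis by blast
qed

text \<open>The estimates on difference quotients need a margin t' > t. Since \<open>U\<close> is
  open, a point with x + t e in \<open>U\<close> leaves room for some slightly larger t', and
  countably many values of t' suffice.\<close>

lemma AE_overlap_if_AE_larger:
 assumes "open U" "!!t'. t < t' ==> AA x:U;t' *: e. P x"
 shows "AA x:U;t *: e. P (x :: 'a::euclidean_space)"
proof -
 have "AA x. ALL n. x : U & x + (t + 1 / real (Suc n)) *: e : U --> P x"
  unfolding AE_all_countable by (intro allI assms(2)) simp
 then show ?thesis
 proof eventually_elim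
  case (elim x)
  show ?case
  proof
   assume x: "x : U & x + t *: e : U"
   have "(%n. x + (t + 1 / real (Suc n)) *: e) ~~> x + (t + 0) *: e"
    by (intro tendsto_intros LIMSEQ_Suc[OF lim_1_over_n])
   then have "\<forall>\<^sub>F n in sequentially. x + (t + 1 / real (Suc n)) *: e : U"
    using assms(1) x by (auto intro: topological_tendstoD)
   then show "P x" using elim x by auto
  qed
 qed
qed

text \<open>The difference quotients with step 1/(j+1) are bounded in L_p; for the limit of their
  midpoints, the principle \<open>line_limit\<close> is used with the distance to the increment of
  \<open>u\<close>.\<close>

theorem hilbert_directional_derivative:
 assumes u[measurable]: "u : BM" and int: "integrable lborel u"
  and U: "open U" "convex U" "vol U < oo" and p: "1 < p" and n: "nik U p K u"
 obtains w where "w : BM" "integrable lborel w" "!!x. x ~: U ==> w x = 0"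
  "!!t. 0 < t ==> AA x:U;t *: e. u (x + t *: e) - u x = line_int e t w x"
proof -
 have Ub [measurable]: "U : sets borel" using U by simp
 define w where "w j = diff_quot U u e (1 / real (Suc j))" for j
 define C where "C = 2 * ((measure lborel U + K) * norm e)"
 have K: "0 <= K" using n by (simp add: nik_def)
 then have C: "0 <= C" by (simp add: C_def)
 have wm: "w j : BM" for j unfolding w_def by simp
 have w0: "w j x = 0" if "x ~: U" for j x using that by (simp add: w_def diff_quot_def)
 have bd: "(NN x. en (norm (w j x) powr p)) <= en (K * norm e powr p)" for j
 proof -
  have "norm (w j x) = norm (metric_quot U u e (1 / real (Suc j)) x)" for x
   unfolding w_def by (subst norm_diff_quot) (auto simp: metric_quot_def)
  then show ?thesis using metric_quot_Lp[OF u Ub n _ p, of "1 / real (Suc j)" e] by simp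
 qed
 obtain v z where "!!n. v n : mconv w n" and z: "integrable lborel z" "z : BM" "!!x. x ~: U ==> z x = 0"
  and "AA x. (%n. v n x) ~~> z x"
  and lim: "line_limit w z"
 proof (rule mconv_line_limit[OF Ub U(3) p wm _ bd])
  show "!!j x. x ~: U ==> w j x = 0" by (rule w0)
 qed (rule that)
 have "AA x:U;t *: e. u (x + t *: e) - u x = line_int e t z x" if t: "0 < t" for t
 proof (rule AE_overlap_if_AE_larger[OF U(1)])
  fix t' assume t': "t < t'"
  let ?B = "%x. u (x + t *: e) - u x"
  let ?C = "seg U (t' *: e)"
  have "AA x. x : ?C --> norm (line_int e t z x - (?B x)) = 0"
  proof (rule line_limitD[OF lim])
   fix a y z' :: 'b and x
   let ?A = "u (x + t *: e) - u x"
   show "norm (y - ?A) <= norm (z' - ?A) + norm (y - z')"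
    using dist_triangle[of y "u (x + t *: e) - u x" z'] unfolding dist_norm by simp
   have "(1/2) *: (y + z') - ?A = (1/2) *: ((y - ?A) + (z' - ?A))"
    by (simp add: algebra_simps) (simp flip: scaleR_add_left)
   then show "norm ((1/2) *: (y + z') - ?A) <= (norm (y - ?A) + norm (z' - ?A)) / 2"
    using norm_triangle_ineq[of "y - ?A" "z' - ?A"] by simp
  next
   fix eps :: real assume "0 < eps"
   obtain N where N: "!!j. N <= j ==> 1 / real (Suc j) <= t' - t & C * (1 / real (Suc j)) <= eps"
    using small_eventually[OF C, of "t' - t" eps] t' `0 < eps` by auto
   have "(NN x:?C. en (norm (line_int e t (w j) x - (?B x)))) <= en eps"
    if "N <= j" for j
   proof -
    have "(NN x:?C. en (norm (line_int e t (w j) x - (?B x)))) <= en (C * (1 / real (Suc j)))"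
     unfolding w_def C_def by (rule line_int_diff_quot[OF u int Ub U(2,3) p n t]) (use N[OF that] in auto)
    also have "... <= en eps" using N[OF that] by (intro ennreal_leI) auto
    finally show ?thesis .
   qed
   then show "EX N. ALL j>=N. (NN x:?C. en (norm (line_int e t (w j) x - (?B x)))) <= en eps"
    by blast
  qed (use t in auto)
  then show "AA x:U;t' *: e. u (x + t *: e) - u x = line_int e t z x"
   by auto
 qed
 with z show ?thesis by (intro that[of z])
qed

lemma dist_le_if_countable_dense:
 assumes D: "!!X. open X ==> X ~= {} ==> EX d:D. d : X"
  and le: "!!T. T : D ==> dist a T - dist b T <= c"
 shows "dist a b <= c"
proof (rule field_le_epsilon)
 fix e :: real assume "0 < e"
 then obtain T where "T : D" "dist b T < e / 2" using D[of "ball b (e/2)"] by auto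
 with le[of T] dist_triangle2[of a b T] show "dist a b <= c + e" by simp
qed

text \<open>For a fixed \<open>T\<close> the scalar function dist (f x) T has increments that are
  limits of integrated difference quotients, and these quotients lie below the metric quotients
  \<open>w j\<close>. The limit \<open>z\<close> of midpoints of \<open>w\<close> does not depend on
  \<open>T\<close>, so it bounds the increments for all \<open>T\<close> of a countable dense set
  simultaneously; \<open>T\<close> close to the value \<open>f x\<close> gives the distance
  itself.\<close>

theorem metric_upper_gradient:
 fixes f :: "'a::euclidean_space => 'c::sep_metric"
 assumes f[measurable]: "f : BM"
  and int: "!!T. integrable lborel (%x. ind U x * dist (f x) T)"
  and U: "open U" "convex U" "vol U < oo" and p: "1 < p" and n: "nik U p K f"
 obtains w :: "'a => real" where "w : BM" "integrable lborel w" "!!x. x ~: U ==> w x = 0"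
  "!!t. 0 < t ==> upper_grad U e t f w"
proof -
 have Ub [measurable]: "U : sets borel" using U by simp
 obtain D :: "'c set" where D: "countable D" "!!X. open X ==> X ~= {} ==> EX d:D. d : X"
  using countable_dense_exists by blast
 define w where "w j = metric_quot U f e (1 / real (Suc j))" for j
 define C where "C = 2 * ((measure lborel U + K) * norm e)"
 have K: "0 <= K" using n by (simp add: nik_def)
 then have C: "0 <= C" by (simp add: C_def)
 have wm [measurable]: "w j : BM" for j unfolding w_def by simp
 have w0: "w j x = 0" if "x ~: U" for j x using that by (simp add: w_def metric_quot_def)
 have bd: "(NN x. en (norm (w j x) powr p)) <= en (K * norm e powr p)" for j
  unfolding w_def by (rule metric_quot_Lp[OF f Ub n _ p]) auto
 have wi: "integrable lborel (w j)" for j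
  by (rule integrable_if_Lp[of _ _ U p]) (use wm w0 U p bd[of j] in "auto intro: le_less_trans")
 obtain v z where "!!n. v n : mconv w n" and z: "integrable lborel z" "z : BM" "!!x. x ~: U ==> z x = 0"
  and "AA x. (%n. v n x) ~~> z x"
  and lim: "line_limit w z"
 proof (rule mconv_line_limit[OF Ub U(3) p wm _ bd])
  show "!!j x. x ~: U ==> w j x = 0" by (rule w0)
 qed (rule that)
 have one: "AA x:U;t *: e. dist (f (x + t *: e)) T - dist (f x) T <= line_int e t z x" if t: "0 < t" for t T
 proof (rule AE_overlap_if_AE_larger[OF U(1)])
  fix t' assume t': "t < t'"
  let ?ps = "%x y. max 0 (dist (f (x + t *: e)) T - dist (f x) T - y)"
  define u where "u x = ind U x * dist (f x) T" for x
  have um [measurable]: "u : BM" unfolding u_def by simp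
  have ui: "integrable lborel u" unfolding u_def by (rule int)
  have uU: "dist (u (x + h)) (u x) <= dist (f (x + h)) (f x)" if "x : U" "x + h : U" for x h
   using that abs_dist_diff_le[of "f (x + h)" T "f x"] by (simp add: u_def dist_real_def dist_commute[of T])
  have nu: "nik U p K u"
   unfolding nik_def
  proof (intro conjI allI)
   fix h
   let ?B = "NN x:(seg U h). en (dist (u (x + h)) (u x) powr p)"
   have "?B
    <= (NN x:(seg U h). en (dist (f (x + h)) (f x) powr p))"
    using uU p by (intro nn_integral_mono) (auto simp: indicator_def intro!: powr_mono2)
   also have "... <= en (K * norm h powr p)" using n by (simp add: nik_def)
   finally show "?B <= en (K * norm h powr p)" .
  qed (rule K)
  have qm: "diff_quot U u e dl : BM" for dl by simp
  have qle: "diff_quot U u e (1 / real (Suc j)) x <= w j x" for j x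
   using uU[of x "(1 / real (Suc j)) *: e"]
   by (auto simp: diff_quot_def w_def metric_quot_def dist_real_def)
  have qi: "integrable lborel (diff_quot U u e (1 / real (Suc j)))" for j
  proof (rule Bochner_Integration.integrable_bound[OF wi[of j]])
   show "AA x. norm (diff_quot U u e (1 / real (Suc j)) x) <= norm (w j x)"
   proof (intro AE_I2)
    fix x
    show "norm (diff_quot U u e (1 / real (Suc j)) x) <= norm (w j x)"
     using uU[of x "(1 / real (Suc j)) *: e"]
     by (auto simp: diff_quot_def w_def metric_quot_def dist_real_def abs_mult)
   qed
  qed measurable
  let ?C = "seg U (t' *: e)"
  have "AA x. x : ?C --> ?ps x (line_int e t z x) = 0"
  proof (rule line_limitD[OF lim])
   fix x and y z' :: real
   show "?ps x y <= ?ps x z' + norm (y - z')" by simp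
   show "?ps x ((1/2) *: (y + z')) <= (?ps x y + ?ps x z') / 2" by (auto simp: max_def field_simps)
  next
   fix eps :: real assume "0 < eps"
   obtain N where N: "!!j. N <= j ==> 1 / real (Suc j) <= t' - t & C * (1 / real (Suc j)) <= eps"
    using small_eventually[OF C, of "t' - t" eps] t' `0 < eps` by auto
   have "(NN x:?C. en (?ps x (line_int e t (w j) x))) <= en eps"
    if "N <= j" for j
   proof -
    let ?A = "%x. en (norm (line_int e t (diff_quot U u e (1 / real (Suc j))) x - (u (x + t *: e) - u x)))"
    have "(NN x:?C. en (?ps x (line_int e t (w j) x)))
     <= (NN x:?C. (?A x))"
    proof (rule nn_integral_mono_AE)
     show "AA x. en (?ps x (line_int e t (w j) x)) * ind ?C x
      <= (?A x) * ind ?C x"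
      using AE_line_int_mono[OF qm qi wm wi qle, of e t j]
     proof eventually_elim
      case (elim x)
      show ?case
      proof (cases "x : ?C")
       case True
       then have "x + t *: e : U" using convex_line_mem[OF U(2), of x t' e t] t t' by auto
       then have "u (x + t *: e) - u x = dist (f (x + t *: e)) T - dist (f x) T" using True by (simp add: u_def)
       then show ?thesis using elim True by simp
      qed simp
     qed
    qed
    also have "... <= en (C * (1 / real (Suc j)))"
     unfolding C_def by (rule line_int_diff_quot[OF um ui Ub U(2,3) p nu t]) (use N[OF that] in auto)
    also have "... <= en eps" using N[OF that] by (intro ennreal_leI) auto
    finally show ?thesis .
   qed
   then show "EX N. ALL j>=N. (NN x:?C. en (?ps x (line_int e t (w j) x))) <= en eps"
    by blast
  qed (use t in auto)
  then show "AA x:U;t' *: e. dist (f (x + t *: e)) T - dist (f x) T <= line_int e t z x"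
   by auto
 qed
 have "upper_grad U e t f z" if t: "0 < t" for t
 proof -
  have "AA x. ALL T:D. x : U & x + t *: e : U --> dist (f (x + t *: e)) T - dist (f x) T <= line_int e t z x"
   unfolding AE_ball_countable[OF D(1)] using one[OF t] by blast
  then show ?thesis
   by eventually_elim (use dist_le_if_countable_dense[OF D(2)] in blast)
 qed
 with z show ?thesis by (intro that[of z])
qed

section \<open>First order expansion in the mean of Hilbert space valued maps\<close>

lemma derivative_L1_pos:
 assumes [measurable]: "u : BM" "w : BM" and wi: "integrable lborel w"
  and der: "AA x:U;t *: e. u (x + t *: e) - u x = line_int e t w x"
  and [measurable]: "B : sets borel" "B' : sets borel" and B'U: "B' <= U"
  and sub: "!!x s. x : B ==> 0 <= s ==> s <= t ==> x + s *: e : B'" and t: "0 < t"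
 shows "(NN x:B. en (norm (u (x + t *: e) - u x - t *: c)))
  <= en t * (NN x. en (norm (w x - c)) * ind B' x)"
proof -
 have "(NN x:B. en (norm (u (x + t *: e) - u x - t *: c)))
  <= (NN x:B. NN s:{0..t}. en (norm (w (x + s *: e) - c)))"
 proof (rule nn_integral_mono_AE)
  show "AA x. en (norm (u (x + t *: e) - u x - t *: c)) * ind B x
   <= (NN s:{0..t}. en (norm (w (x + s *: e) - c))) * ind B x"
   using der AE_set_integrable_line[OF assms(2) wi, of t e]
  proof eventually_elim
   case (elim x)
   show ?case
   proof (cases "x : B")
    case True
    have "x : U" "x + t *: e : U" using sub[OF True, of 0] sub[OF True, of t] t B'U by auto
    then have eq: "u (x + t *: e) - u x = line_int e t w x" using elim(1) by blast
    have ci: "set_integrable lborel {0..t} (%s. c)"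
     unfolding set_integrable_def by (intro integrable_scaleR_left) (auto simp: emeasure_lborel_Icc_eq)
    have cI: "t *: c = (LINT s:{0..t}|lborel. c)" using t by (simp add: set_lebesgue_integral_def)
    have "u (x + t *: e) - u x - t *: c = (LINT s:{0..t}|lborel. w (x + s *: e) - c)"
     unfolding eq cI line_int_def by (rule set_integral_diff(2)[OF elim(2) ci, symmetric])
    then have "en (norm (u (x + t *: e) - u x - t *: c)) <= (NN s. en (norm (ind {0..t} s *: (w (x + s *: e) - c))))"
     using set_integral_diff(1)[OF elim(2) ci] unfolding set_integrable_def set_lebesgue_integral_def
     by (simp only: integral_norm_bound_ennreal)
    also have "... = (NN s:{0..t}. en (norm (w (x + s *: e) - c)))"
     by (intro nn_integral_cong) (auto simp: indicator_def)
    finally show ?thesis using True by simp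
   qed simp
  qed
 qed
 also have "... <= en t * (NN x. en (norm (w x - c)) * ind B' x)"
  by (rule nn_integral_line_le) (use sub t in auto)
 finally show ?thesis .
qed

text \<open>For t < 0 the substitution of x + s e for x, with s = -t, turns the increment into the
  negative of a forward one on a translated ball.\<close>

lemma derivative_L1:
 assumes [measurable]: "u : BM" "w : BM" and wi: "integrable lborel w"
  and der: "!!t. 0 < t ==> AA x:U;t *: e. u (x + t *: e) - u x = line_int e t w x"
  and BU: "ball a R <= U" and e: "norm e <= 1" and r: "dist a b + r + \<bar>t\<bar> <= R"
 shows "(NN x:ball b r. en (norm (u (x + t *: e) - u x - t *: c)))
  <= en \<bar>t\<bar> * (NN x:ball a R. en (norm (w x - c)))"
proof -
 have in_ball: "y : ball a R" if "x : ball b r" "dist x y <= \<bar>t\<bar>" for x y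
  using that r dist_triangle[of a y b] dist_triangle[of b y x] by auto
 consider "0 < t" | "t = 0" | "t < 0" by linarith
 then show ?thesis
 proof cases
  case 1
  have "x + s *: e : ball a R" if "x : ball b r" "0 <= s" "s <= t" for x s
  proof (rule in_ball[OF that(1)])
   have "s * norm e <= s * 1" using that e by (intro mult_left_mono)
   then show "dist x (x + s *: e) <= \<bar>t\<bar>" using that by (simp add: dist_norm)
  qed
  then show ?thesis using 1 BU
   using derivative_L1_pos[OF assms(1,2) wi der[OF 1], of "ball b r" "ball a R" c] by simp
 next
  case 2
  then show ?thesis by simp
 next
  case 3
  define s where "s = - t"
  have s: "0 < s" "t = - s" using 3 by (auto simp: s_def)
  define B where "B = {y. y + s *: e : ball b r}"
  have [measurable]: "B : sets borel" unfolding B_def by simp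
  have "(NN x:ball b r. en (norm (u (x + t *: e) - u x - t *: c)))
   = (NN x. en (norm (u ((x + s *: e) + t *: e) - u (x + s *: e) - t *: c)) * ind (ball b r) (x + s *: e))"
   by (rule nn_integral_translate[symmetric]) simp
  also have "... = (NN x:B. en (norm (u (x + s *: e) - u x - s *: c)))"
  proof (intro nn_integral_cong arg_cong2[where f="(*)"])
   fix x
   have "u ((x + s *: e) + t *: e) - u (x + s *: e) - t *: c = - (u (x + s *: e) - u x - s *: c)"
    by (simp add: s(2))
   then show "en (norm (u ((x + s *: e) + t *: e) - u (x + s *: e) - t *: c)) = en (norm (u (x + s *: e) - u x - s *: c))"
    by (simp only: norm_minus_cancel)
   show "ind (ball b r) (x + s *: e) = ind B x" by (simp add: B_def indicator_def)
  qed
  also have "... <= en s * (NN x:ball a R. en (norm (w x - c)))"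
  proof (rule derivative_L1_pos[OF assms(1,2) wi der[OF s(1)] _ _ BU _ s(1)])
   fix x s' assume x: "x : B" "0 <= s'" "s' <= s"
   show "x + s' *: e : ball a R"
   proof (rule in_ball)
    show "x + s *: e : ball b r" using x by (simp add: B_def)
    have "x + s *: e - (x + s' *: e) = (s - s') *: e" by (simp add: algebra_simps)
    moreover have "(s - s') * norm e <= (s - s') * 1" using x e by (intro mult_left_mono) auto
    ultimately show "dist (x + s *: e) (x + s' *: e) <= \<bar>t\<bar>" using x s by simp
   qed
  qed measurable
  finally show ?thesis using s by simp
 qed
qed

definition coord_lin :: "('m => 'b::real_vector) => real ^ 'm => 'b"
 where "coord_lin c y = (SUM k:UNIV. y $ k *: c k)"

lemma linear_coord_lin: "linear (coord_lin c)"
 by (rule linearI) (simp_all add: coord_lin_def scaleR_add_left sum.distrib scaleR_sum_right)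

lemma norm_coord_lin_le: "norm (coord_lin c y) <= (SUM k:UNIV. norm (c k)) * norm y"
proof -
 have "norm (coord_lin c y) <= (SUM k:UNIV. norm (y $ k *: c k))" unfolding coord_lin_def by (rule norm_sum)
 also have "... <= (SUM k:UNIV. norm (c k) * norm y)"
 proof (rule sum_mono)
  fix k
  show "norm (y $ k *: c k) <= norm (c k) * norm y"
   using mult_left_mono[OF component_le_norm_cart[of y k] norm_ge_zero[of "c k"]] by (simp add: mult.commute)
 qed
 finally show ?thesis by (simp add: sum_distrib_right)
qed

text \<open>The displacement \<open>h\<close> is performed one coordinate at a time. Each partial
  displacement has norm at most the number of coordinates used times \<open>norm h\<close>, which is
  the room demanded of \<open>R\<close>.\<close>

lemma staircase_L1:
 fixes u :: "real ^ 'm => 'b::hilbert"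
 assumes [measurable]: "u : BM" "!!k. w k : BM" and wi: "!!k. integrable lborel (w k)"
  and der: "!!k t. 0 < t ==> AA x:U;t *: axis k 1. u (x + t *: axis k 1) - u x = line_int (axis k 1) t (w k) x"
  and BU: "ball a R <= U" and r: "r + real CARD('m) * norm h <= R"
 shows "(NN x:ball a r. en (norm (u (x + h) - u x - coord_lin c h)))
  <= en (norm h) * (SUM k:UNIV. NN x:ball a R. en (norm (w k x - c k)))"
proof -
 define hS where "hS S = (SUM k:S. h $ k *: axis k (1::real))" for S
 define LS where "LS S = (SUM k:S. h $ k *: c k)" for S
 define W where "W k = (NN x:ball a R. en (norm (w k x - c k)))" for k
 have "(NN x:ball a r. en (norm (u (x + hS S) - u x - LS S))) <= en (norm h) * (SUM k:S. W k)"
  if "finite S" for S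
  using that
 proof induction
  case empty
  then show ?case by (simp add: hS_def LS_def)
 next
  case (insert k S)
  have hk: "\<bar>h $ k\<bar> <= norm h" for k by (rule component_le_norm_cart)
  have "norm (hS S) <= (SUM k:S. norm h)"
   unfolding hS_def using hk by (intro order_trans[OF norm_sum] sum_mono) simp
  also have "... = real (card S) * norm h" by simp
  finally have n1: "norm (hS S) <= real (card S) * norm h" .
  have "card (insert k S) <= CARD('m)" by (rule card_mono) auto
  then have "real (card S) + 1 <= real CARD('m)" using insert by simp
  then have "(real (card S) + 1) * norm h <= real CARD('m) * norm h" by (intro mult_right_mono) auto
  then have n2: "dist a (a + hS S) + r + \<bar>h $ k\<bar> <= R"
   using n1 hk[of k] r by (simp add: dist_norm algebra_simps)
  let ?C = "%x. en (norm (u ((x + hS S) + h $ k *: axis k 1) - u (x + hS S) - h $ k *: c k))"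
  let ?G = "ball (a + hS S) r"
  let ?E = "%x. ind (?G) (x + hS S)"
  let ?F = "%x. en (norm (u (x + h $ k *: axis k 1) - u x - h $ k *: c k))"
  have "(NN x:ball a r. en (norm (u (x + hS (insert k S)) - u x - LS (insert k S))))
   <= (NN x. (?C x) * (?E x)
    + en (norm (u (x + hS S) - u x - LS S)) * ind (ball a r) x)"
  proof (rule nn_integral_mono)
   fix x
   let ?A = "u ((x + hS S) + h $ k *: axis k 1) - u (x + hS S) - h $ k *: c k"
   let ?D = "u (x + hS S) - u x - LS S"
   have eq: "u (x + hS (insert k S)) - u x - LS (insert k S) = ?A + ?D"
    using insert by (simp add: hS_def LS_def add.commute add.left_commute)
   let ?B = "norm (u (x + hS (insert k S)) - u x - LS (insert k S))"
   have "?B <= norm ?A + norm ?D"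
    unfolding eq by (rule norm_triangle_ineq)
   then have "en (?B) <= en (norm ?A) + en (norm ?D)"
    by (subst ennreal_plus[symmetric]) (auto simp del: ennreal_plus intro: ennreal_leI)
   moreover have "x + hS S : ?G \<longleftrightarrow> x : ball a r" by (simp add: dist_norm)
   ultimately show "en (?B) * ind (ball a r) x
    <= en (norm ?A) * ind (?G) (x + hS S)
    + en (norm ?D) * ind (ball a r) x"
    by (simp add: indicator_def)
  qed
  also have "... = (NN x. (?C x) * (?E x))
   + (NN x:ball a r. en (norm (u (x + hS S) - u x - LS S)))"
   by (rule nn_integral_add) measurable
  also have "(NN x. (?C x) * (?E x))
   = (NN x:?G. (?F x))"
   by (rule nn_integral_translate[of "%x. (?F x) * ind (?G) x"]) measurable
  also have "... <= en \<bar>h $ k\<bar> * W k"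
   unfolding W_def by (rule derivative_L1[OF assms(1,2) wi der BU _ n2]) (auto simp: norm_axis_1)
  also have "... <= en (norm h) * W k" by (intro mult_right_mono ennreal_leI hk) simp
  also note insert.IH
  finally show ?case using insert by (simp add: distrib_left)
 qed
 from this[of UNIV] have "(NN x:ball a r. en (norm (u (x + hS UNIV) - u x - LS UNIV))) <= en (norm h) * (SUM k:UNIV. W k)" by simp
 moreover have "hS UNIV = h" using basis_expansion[of h] by (simp add: hS_def scalar_mult_eq_scaleR)
 ultimately show ?thesis by (simp add: LS_def coord_lin_def W_def)
qed

text \<open>Integrate |v y| <= |v x| + |v y - v x| over x in the half ball and y in the full ball;
  the differences y - x lie in the ball of radius 2 r. The result compares the mean of |v| at scale
  r with the mean at scale r/2.\<close>

lemma doubling_estimate: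
 fixes v :: "'a::euclidean_space => 'b::hilbert"
 assumes [measurable]: "v : BM" and r: "0 < r"
  and pair: "!!h. norm h < 2 * r ==> (NN x:ball a (r/2). en (norm (v (x + h) - v x))) <= en (2 * r) * W"
 shows "vol (ball a (r/2)) * (NN x:ball a r. en (norm (v x)))
  <= vol (ball a r) * (NN x:ball a (r/2). en (norm (v x)))
   + vol (ball (0::'a) (2 * r)) * (en (2 * r) * W)"
proof -
 let ?b = "%r. NN x:ball a r. en (norm (v x))"
 let ?G = "ball a (r/2)"
 let ?B = "%x. ind ?G x"
 let ?C = "ball 0 (2*r)"
 let ?F = "NN y:ball a r. en (norm (v y))"
 have "vol ?G * ?b r
  = (NN x. (?B x) * ?F)"
  by (subst nn_integral_multc) auto
 also have "... <= (NN x. (NN y. en (norm (v x)) * (?B x) * ind (ball a r) y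
   + en (norm (v y - v x)) * (?B x) * ind ?C (y - x)))"
 proof (rule nn_integral_mono)
  fix x
  let ?A = "ind ?G x"
  let ?D = "NN y. en (norm (v x)) * ?A * ind (ball a r) y + en (norm (v y - v x)) * ?A * ind ?C (y - x)"
  have "?A * ?F
   = (NN y. ?A * (en (norm (v y)) * ind (ball a r) y))"
   by (rule nn_integral_cmult[symmetric]) simp
  also have "... <= ?D"
  proof (rule nn_integral_mono)
   fix y
   show "?A * (en (norm (v y)) * ind (ball a r) y) <= en (norm (v x)) * ?A * ind (ball a r) y
    + en (norm (v y - v x)) * ?A * ind ?C (y - x)"
   proof (cases "x : ball a (r/2) & y : ball a r")
    case True
    then have "dist a x < r/2" "dist a y < r" by auto
    then have "dist x y < 2 * r" using dist_triangle3[of x y a] zero_le_dist[of a x] by linarith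
    then have "y - x : ball 0 (2*r)" by (simp add: dist_norm)
    moreover have "en (norm (v y)) <= en (norm (v x)) + en (norm (v y - v x))"
     using norm_triangle_ineq[of "v x" "v y - v x"] by (subst ennreal_plus[symmetric]) (auto simp del: ennreal_plus intro: ennreal_leI)
    ultimately show ?thesis using True by (simp add: indicator_def)
   qed (auto simp: indicator_def)
  qed
  finally show "?A * ?F <= ?D" .
 qed
 also have "... = (NN x. (NN y:ball a r. en (norm (v x)) * (?B x)))
   + (NN x. (NN y. en (norm (v y - v x)) * (?B x) * ind ?C (y - x)))"
  by (simp add: nn_integral_add)
 also have "(NN x. (NN y:ball a r. en (norm (v x)) * (?B x)))
   = vol (ball a r) * ?b (r/2)"
  by (simp add: nn_integral_cmult nn_integral_multc mult.commute)
 also have "(NN x. (NN y. en (norm (v y - v x)) * (?B x) * ind ?C (y - x)))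
   = (NN x. (NN h:ball 0 (2*r). en (norm (v (x + h) - v x)) * (?B x)))"
 proof (rule nn_integral_cong)
  fix x
  let ?E = "NN y. en (norm (v y - v x)) * ind ?G x * ind ?C (y - x)"
  have "?E
   = (NN h. en (norm (v (h + x) - v x)) * ind ?G x * ind ?C (h + x - x))"
   by (rule nn_integral_translate[symmetric]) measurable
  then show "?E
   = (NN h:ball 0 (2*r). en (norm (v (x + h) - v x)) * ind ?G x)"
   by (simp add: add.commute)
 qed
 also have "... = (NN h. (NN x. en (norm (v (x + h) - v x)) * (?B x) * ind ?C h))"
  by (rule lborel_pair.Fubini'[symmetric]) measurable
 also have "... <= (NN h:ball (0::'a) (2*r). en (2 * r) * W)"
 proof (rule nn_integral_mono)
  fix h
  show "(NN x. en (norm (v (x + h) - v x)) * (?B x) * ind ?C h) <= (en (2 * r) * W) * ind ?C h"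
   using pair[of h] by (cases "h : ball 0 (2*r)") auto
 qed
 also have "... = vol (ball (0::'a) (2 * r)) * (en (2 * r) * W)"
  by (subst nn_integral_cmult) (auto simp: mult.commute)
 finally show ?thesis by (simp add: add_left_mono)
qed

text \<open>Halving the scale repeatedly accumulates the errors c r (1 + 1/2 + 1/4 + ...), at most 2
  c r, until \<open>be\<close> itself is negligible.\<close>

lemma halving_series:
 fixes be :: "real => real"
 assumes r: "0 < r" "r < R" and step: "!!s. 0 < s ==> s < R ==> be s <= be (s/2) + c * s" and c: "0 <= c"
  and small: "!!e. 0 < e ==> EX s0>0. ALL s. 0 < s & s < s0 --> be s <= e"
 shows "be r <= 2 * c * r"
proof (rule field_le_epsilon)
 fix e :: real assume "0 < e"
 have it: "be r <= be (r / 2 ^ n) + c * r * (2 - 2 / 2 ^ n)" for n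
 proof (induction n)
  case (Suc n)
  have "r / 2 ^ n <= r / 1" using r by (intro divide_left_mono) auto
  then have "be (r / 2 ^ n) <= be (r / 2 ^ n / 2) + c * (r / 2 ^ n)" using r by (intro step) auto
  then show ?case using Suc by (simp add: field_simps)
 qed (use r in simp)
 obtain s0 where s0: "0 < s0" "!!s. 0 < s ==> s < s0 ==> be s <= e" using small[OF `0 < e`] by auto
 obtain n where "(1/2) ^ n < s0 / r" using real_arch_pow_inv[of "s0 / r" "1/2"] s0 r by auto
 then have "be (r / 2 ^ n) <= e" using r by (intro s0) (auto simp: field_simps)
 moreover have "c * r * (2 - 2 / 2 ^ n) <= c * r * 2" using c r by (intro mult_left_mono) auto
 ultimately show "be r <= 2 * c * r + e" using it[of n] by simp
qed

text \<open>\<open>be s\<close> is the mean over the ball of radius s of the remainder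
  \<open>v\<close> of the affine candidate. Increments of \<open>v\<close> are controlled by the
  staircase and the Lebesgue points of the partial derivatives, so passing from s/2 to s costs at
  most c s with c = e/2. The Lebesgue point of \<open>u\<close> only gives that \<open>be\<close>
  tends to 0, which is what starts the halving argument.\<close>

theorem hilbert_L1_differentiable:
 fixes u :: "real ^ 'm => 'b::hilbert"
 assumes u[measurable]: "u : BM" and w[measurable]: "!!k. w k : BM" and wi: "!!k. integrable lborel (w k)"
  and der: "!!k t. 0 < t ==> AA x:U;t *: axis k 1. u (x + t *: axis k 1) - u x = line_int (axis k 1) t (w k) x"
  and U: "open U" "a : U" and pu: "lebesgue_point u a" and pw: "!!k. lebesgue_point (w k) a" and e: "0 < e"
 shows "EX r0>0. ALL r. 0 < r & r < r0 -->
  (NN x:ball a r. en (norm (u x - u a - coord_lin (%k. w k a) (x - a)))) <= en (e * r) * vol (ball a r)"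
proof -
 define M where "M = CARD('m)"
 define om where "om = unit_ball_vol (real M)"
 have om: "0 < om" by (simp add: om_def)
 have vol: "vol (ball b r) = en (om * r ^ M)" if "0 <= r" for b :: "real ^ 'm" and r
  using that by (simp add: emeasure_ball om_def M_def)
 define L where "L = coord_lin (%k. w k a)"
 have linL: "linear L" unfolding L_def by (rule linear_coord_lin)
 define NL where "NL = (SUM k:UNIV. norm (w k a))"
 have NL: "norm (L y) <= NL * norm y" for y unfolding L_def NL_def by (rule norm_coord_lin_le)
 have NL0: "0 <= NL" unfolding NL_def by (rule sum_nonneg) simp
 have [measurable]: "L : BM"
  using linear_continuous_on[of L UNIV] linL by (intro borel_measurable_continuous_onI) (simp add: linear_conv_bounded_linear)
 define v where "v x = u x - u a - L (x - a)" for x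
 have vm [measurable]: "v : BM" unfolding v_def by simp
 define b where "b r = (NN x:ball a r. en (norm (v x)))" for r
 \<comment> \<open>The staircase for displacements below 2 s, starting in the ball of radius s/2,
   remains in the ball of radius C s.\<close>
 define C where "C = 2 * real M + 1"
 define c where "c = e / 2"
 \<comment> \<open>Chosen so that (2 s)^M * 2 s * M * dl * (C s)^M equals (s/2)^M * s^M * c s, the
   error allowed by \<open>step\<close> after the volumes have been multiplied out.\<close>
 define dl where "dl = c / (2 * 4 ^ M * real M * C ^ M)"
 have M: "0 < M" unfolding M_def by simp
 have C: "1 <= C" by (simp add: C_def)
 have dl: "0 < dl" using e M C by (simp add: dl_def c_def)
 obtain R0 where R0: "0 < R0" "ball a R0 <= U" using U by (meson open_contains_ball)
 have "EX r0>0. ALL k. ALL r. 0 < r & r < r0 --> (NN x:ball a r. en (norm (w k x - w k a))) <= en dl * vol (ball a r)"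
 proof -
  have "ALL k. EX r0>0. ALL r. 0 < r & r < r0 --> (NN x:ball a r. en (norm (w k x - w k a))) <= en dl * vol (ball a r)"
   using pw dl unfolding lebesgue_point_def by blast
  from choice[OF this] obtain r0 where r0: "!!k. 0 < r0 k" "!!k r. 0 < r ==> r < r0 k ==> (NN x:ball a r. en (norm (w k x - w k a))) <= en dl * vol (ball a r)"
   by blast
  show ?thesis using r0 by (intro exI[of _ "Min (range r0)"]) auto
 qed
 then obtain R1 where R1: "0 < R1" "!!k r. 0 < r ==> r < R1 ==> (NN x:ball a r. en (norm (w k x - w k a))) <= en (dl * (om * r ^ M))"
  using vol dl by (auto simp: ennreal_mult')
 have bsmall: "EX s0>0. ALL s. 0 < s & s < s0 --> b s <= en (et * (om * s ^ M))" if et: "0 < et" for et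
 proof -
  obtain s1 where s1: "0 < s1" "!!s. 0 < s ==> s < s1 ==> (NN x:ball a s. en (norm (u x - u a))) <= en (et/2) * vol (ball a s)"
   using pu[unfolded lebesgue_point_def, rule_format, of "et/2"] et by auto
  let ?F = "et / (2 * (NL + 1))"
  have "b s <= en (et * (om * s ^ M))" if s: "0 < s" "s < min s1 ?F" for s
  proof -
   have "NL * s <= (NL + 1) * ?F" using s NL0 by (intro mult_mono) auto
   also have "... = et / 2" using NL0 by (simp add: field_simps)
   finally have NLs: "NL * s <= et/2" .
   have "b s <= (NN x. en (norm (u x - u a)) * ind (ball a s) x + en (et/2) * ind (ball a s) x)"
    unfolding b_def
   proof (rule nn_integral_mono)
    fix x
    show "en (norm (v x)) * ind (ball a s) x <= en (norm (u x - u a)) * ind (ball a s) x + en (et/2) * ind (ball a s) x"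
    proof (cases "x : ball a s")
     case True
     have "norm (L (x - a)) <= NL * s"
      using NL[of "x - a"] mult_left_mono[OF _ NL0, of "norm (x - a)" s] True by (simp add: dist_norm norm_minus_commute)
     then have "norm (v x) <= norm (u x - u a) + et/2"
      using norm_triangle_ineq4[of "u x - u a" "L (x - a)"] NLs by (simp add: v_def)
     then have "en (norm (v x)) <= en (norm (u x - u a)) + en (et/2)"
      using et by (subst ennreal_plus[symmetric]) (auto simp del: ennreal_plus intro: ennreal_leI)
     then show ?thesis using True by simp
    qed simp
   qed
   also have "... = (NN x:ball a s. en (norm (u x - u a))) + en (et/2) * en (om * s ^ M)"
    using s by (subst nn_integral_add) (auto simp: nn_integral_cmult vol)
   also have "... <= en (et/2) * en (om * s ^ M) + en (et/2) * en (om * s ^ M)"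
    using s1(2)[of s] s by (intro add_right_mono) (simp add: vol)
   also have "... = en (et * (om * s ^ M))"
    using et om s by (subst ennreal_lincomb[symmetric]) auto
   finally show ?thesis .
  qed
  then show ?thesis using s1(1) et NL0 by (intro exI[of _ "min s1 ?F"]) auto
 qed
 obtain R2 where R2: "0 < R2" "!!s. 0 < s ==> s < R2 ==> b s <= en (1 * (om * s ^ M))" using bsmall[of 1] by auto
 define R where "R = min R2 (min R0 R1 / C)"
 have R: "0 < R" using R0 R1 R2 C by (simp add: R_def)
 define be where "be s = enn2real (b s) / (om * s ^ M)" for s
 have bbe: "b s = en (be s * (om * s ^ M))" if "0 < s" "s < R" for s
 proof -
  have "b s < oo" using R2(2)[of s] that by (auto simp: R_def intro: le_less_trans)
  then show ?thesis using om that by (simp add: be_def)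
 qed
 have be0: "0 <= be s" if "0 < s" for s using om that by (simp add: be_def)
 have step: "be s <= be (s/2) + c * s" if s: "0 < s" "s < R" for s
 proof -
  define W where "W = (SUM k:UNIV. NN x:ball a (C * s). en (norm (w k x - w k a)))"
  have "s * C < min R0 R1 / C * C" using s C by (intro mult_strict_right_mono) (auto simp: R_def)
  then have Cs: "0 < C * s" "C * s < R0" "C * s < R1" using s C by (auto simp: mult.commute)
  let ?A = "real M * (dl * (om * (C * s) ^ M))"
  have W: "W <= en ?A"
  proof -
   have "W <= (SUM k:(UNIV::'m set). en (dl * (om * (C * s) ^ M)))"
    unfolding W_def by (intro sum_mono R1(2) Cs)
   then show ?thesis using dl om Cs C s by (simp add: M_def ennreal_mult' flip: ennreal_of_nat_eq_real_of_nat)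
  qed
  have "ball a (C * s) <= U" using R0(2) Cs by (meson less_imp_le order_trans subset_ball)
  have pair: "(NN x:ball a (s/2). en (norm (v (x + h) - v x))) <= en (2 * s) * W" if h: "norm h < 2 * s" for h
  proof -
   have "real M * norm h <= real M * (2 * s)" using h by (intro mult_left_mono) auto
   moreover have "C * s = real M * (2 * s) + s" by (simp add: C_def algebra_simps)
   ultimately have "s/2 + real CARD('m) * norm h <= C * s" using s unfolding M_def by linarith
   from staircase_L1[OF u w wi der `ball a (C * s) <= U` this, of "%k. w k a"]
   have "(NN x:ball a (s/2). en (norm (u (x + h) - u x - L h))) <= en (norm h) * W"
    by (simp add: L_def W_def)
   also have "... <= en (2 * s) * W" using h by (intro mult_right_mono ennreal_leI) auto
   also have "(%x. u (x + h) - u x - L h) = (%x. v (x + h) - v x)"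
   proof
    fix x
    have "L (x + h - a) = L (x - a) + L h" using linear_add[OF linL, of "x - a" h] by (simp add: algebra_simps)
    then show "u (x + h) - u x - L h = v (x + h) - v x" by (simp add: v_def)
   qed
   finally show ?thesis .
  qed
  let ?B = "be (s/2) * (om * (s/2) ^ M)"
  let ?C = "om * (s/2) ^ M * (om * s ^ M)"
  let ?D = "en (om * s ^ M * ?B + om * (2 * s) ^ M * (2 * s * ?A))"
  let ?E = "2 * s * (real M * (dl * (C * s) ^ M))"
  have "en (om * (s/2) ^ M) * b s <= en (om * s ^ M) * b (s/2) + en (om * (2 * s) ^ M) * (en (2 * s) * W)"
   using doubling_estimate[OF vm s(1) pair] s by (simp add: vol b_def)
  also have "... <= en (om * s ^ M) * b (s/2) + en (om * (2 * s) ^ M) * (en (2 * s) * en ?A)"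
   by (intro add_left_mono mult_left_mono W) auto
  also have "... = ?D"
  proof -
   have "b (s/2) = en ?B" using s by (intro bbe) auto
   then show ?thesis using s om dl C be0[of "s/2"] by (simp add: ennreal_mult[symmetric] ennreal_plus[symmetric] del: ennreal_plus)
  qed
  finally have "en (om * (s/2) ^ M * (be s * (om * s ^ M))) <= ?D"
   using s om be0[of s] by (simp add: bbe ennreal_mult[symmetric] del: ennreal_plus)
  then have "om * (s/2) ^ M * (be s * (om * s ^ M)) <= om * s ^ M * ?B + om * (2 * s) ^ M * (2 * s * ?A)"
   using s om dl C be0[of "s/2"] by (subst (asm) ennreal_le_iff) auto
  also have "om * s ^ M * ?B + om * (2 * s) ^ M * (2 * s * ?A)
    = ?C * (be (s/2) + c * s)"
  proof -
   have "(2 * s) ^ M * ?E = (s/2) ^ M * s ^ M * (c * s)"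
    using M C by (simp add: dl_def power_mult_distrib power_divide field_simps) (simp flip: power_mult_distrib)
   then have "om * om * ((2 * s) ^ M * ?E) = om * om * ((s/2) ^ M * s ^ M * (c * s))" by simp
   then show ?thesis by (simp add: algebra_simps)
  qed
  finally have "?C * be s <= ?C * (be (s/2) + c * s)"
   by (simp add: mult_ac)
  then show ?thesis using om s by (subst (asm) mult_le_cancel_left_pos) auto
 qed
 have bele: "be r <= 2 * c * r" if r: "0 < r" "r < R" for r
 proof (rule halving_series[OF r step])
  show "0 <= c" using e by (simp add: c_def)
  fix et :: real assume et: "0 < et"
  obtain s0 where s0: "0 < s0" "!!s. 0 < s ==> s < s0 ==> b s <= en (et * (om * s ^ M))" using bsmall[OF et] by auto
  have "be s <= et" if s: "0 < s" "s < min s0 R" for s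
  proof -
   have "en (be s * (om * s ^ M)) <= en (et * (om * s ^ M))" using s0(2)[of s] s by (simp add: bbe)
   then have "be s * (om * s ^ M) <= et * (om * s ^ M)" using et om s by (subst (asm) ennreal_le_iff) auto
   then show ?thesis using om s by simp
  qed
  then show "EX s0>0. ALL s. 0 < s & s < s0 --> be s <= et" using s0(1) R by (intro exI[of _ "min s0 R"]) auto
 qed
 have "b r <= en (e * r) * vol (ball a r)" if r: "0 < r" "r < R" for r
 proof -
  have "b r <= en ((e * r) * (om * r ^ M))"
   unfolding bbe[OF r] using bele[OF r] om r by (intro ennreal_leI mult_right_mono) (auto simp: c_def)
  also have "... = en (e * r) * vol (ball a r)"
   using e r om by (simp add: vol ennreal_mult)
  finally show ?thesis .
 qed
 then show ?thesis using R unfolding b_def v_def L_def by blast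
qed

section \<open>Density points and approximate differentiability of Hilbert space valued maps\<close>

text \<open>A form of \<open>density_zero\<close> with open balls and extended real measures, in
  which estimates can be chained without proving finiteness. Both notions agree on Borel sets by the
  two conversion lemmas below.\<close>

definition null_density :: "'a::euclidean_space set => 'a => bool"
 where "null_density S a \<longleftrightarrow> (ALL et>0. EX r0>0. ALL r. 0 < r & r < r0 -->
  vol (S Int ball a r) <= en et * vol (ball a r))"

lemma null_densityE:
 assumes "null_density S a" "0 < et"
 obtains r0 where "0 < r0"
  "!!r. 0 < r ==> r < r0 ==> vol (S Int ball a r) <= en et * vol (ball a r)"
 using assms(1)[unfolded null_density_def, rule_format, OF assms(2)] by auto

lemma null_density_subset:
 assumes "null_density T a" "S <= T" "T : sets borel"
 shows "null_density S a"
 unfolding null_density_def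
proof (intro allI impI)
 fix et :: real assume "0 < et"
 then obtain r0 where r0: "0 < r0" "!!r. 0 < r ==> r < r0 ==> vol (T Int ball a r) <= en et * vol (ball a r)"
  using null_densityE[OF assms(1)] by blast
 have "vol (S Int ball a r) <= vol (T Int ball a r)" for r
  using assms(2,3) by (intro emeasure_mono) auto
 then show "EX r0>0. ALL r. 0 < r & r < r0 --> vol (S Int ball a r) <= en et * vol (ball a r)"
  using r0 by (intro exI[of _ r0]) (auto intro: order_trans)
qed

lemma null_density_Un:
 assumes "null_density S a" "null_density T a" "S : sets borel" "T : sets borel"
 shows "null_density (S Un T) a"
 unfolding null_density_def
proof (intro allI impI)
 fix et :: real assume "0 < et"
 then have h: "0 < et / 2" by simp
 obtain r1 where r1: "0 < r1" "!!r. 0 < r ==> r < r1 ==> vol (S Int ball a r) <= en (et/2) * vol (ball a r)"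
  using null_densityE[OF assms(1) h] by blast
 obtain r2 where r2: "0 < r2" "!!r. 0 < r ==> r < r2 ==> vol (T Int ball a r) <= en (et/2) * vol (ball a r)"
  using null_densityE[OF assms(2) h] by blast
 have "vol ((S Un T) Int ball a r) <= en et * vol (ball a r)" if r: "0 < r" "r < min r1 r2" for r
 proof -
  have "vol ((S Un T) Int ball a r) <= vol (S Int ball a r) + vol (T Int ball a r)"
   unfolding Int_Un_distrib2 using assms by (intro emeasure_subadditive) auto
  also have "... <= en (et/2) * vol (ball a r) + en (et/2) * vol (ball a r)"
   using r by (intro add_mono r1 r2) auto
  also have "... = en et * vol (ball a r)"
   using `0 < et` by (simp flip: distrib_right ennreal_plus)
  finally show ?thesis .
 qed
 then show "EX r0>0. ALL r. 0 < r & r < r0 --> vol ((S Un T) Int ball a r) <= en et * vol (ball a r)"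
  using r1(1) r2(1) by (intro exI[of _ "min r1 r2"]) auto
qed

lemma null_density_UN:
 assumes "finite I" "!!i. i : I ==> null_density (S i) a" "!!i. i : I ==> S i : sets borel"
 shows "null_density (UN i:I. S i) a"
 using assms
proof (induction I)
 case empty
 then show ?case by (auto simp: null_density_def)
next
 case (insert i I)
 have "null_density (S i Un (UN i:I. S i)) a"
  using insert by (intro null_density_Un) auto
 then show ?case by simp
qed

lemma emeasure_lborel_ball_cart:
 "0 <= r ==> vol (ball (a :: real ^ 'm) r) = en (unit_ball_vol (real CARD('m)) * r ^ CARD('m))"
 by (simp add: emeasure_ball)

lemma density_zero_if_null_density:
 fixes S :: "(real ^ 'm) set"
 assumes S [measurable]: "S : sets borel" and d: "null_density S a"
 shows "density_zero S a"
 unfolding density_zero_def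
proof (rule tendstoI)
 define M where "M = CARD('m)"
 define om where "om = unit_ball_vol (real M)"
 have om: "0 < om" by (simp add: om_def)
 fix e :: real assume "0 < e"
 \<comment> \<open>The closed ball of radius r is enclosed in the open ball of radius 2 r; the
   factor 2^M is the price, the remaining 2 makes the inequality strict.\<close>
 define et where "et = e / (2 * 2 ^ M)"
 have et: "0 < et" using `0 < e` by (simp add: et_def)
 obtain r0 where r0: "0 < r0" "!!r. 0 < r ==> r < r0 ==> vol (S Int ball a r) <= en et * vol (ball a r)"
  using null_densityE[OF d et] by blast
 have "dist (measure lebesgue (S Int cball a r) / (unit_ball_vol (real CARD('m)) * r ^ CARD('m))) 0 < e" if r: "0 < r" "r < r0 / 2" for r
 proof -
  have "en (measure lebesgue (S Int cball a r)) <= vol (S Int cball a r)"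
   by (simp add: measure_def ennreal_enn2real_if)
  also have "... <= vol (S Int ball a (2 * r))" using r by (intro emeasure_mono) auto
  also have "... <= en et * vol (ball a (2 * r))" using r by (intro r0) auto
  also have "... = en (et * (om * (2 * r) ^ M))" using r et by (subst emeasure_lborel_ball_cart) (auto simp: om_def M_def ennreal_mult')
  finally have "measure lebesgue (S Int cball a r) <= et * (om * (2 * r) ^ M)"
   using et om r by simp
  also have "... = e / 2 * (om * r ^ M)" by (simp add: et_def)
  also have "... < e * (om * r ^ M)" using `0 < e` om r by simp
  finally show ?thesis using r unfolding om_def M_def by (simp add: pos_divide_less_eq)
 qed
 then show "\<forall>\<^sub>F r in at_right 0. dist (measure lebesgue (S Int cball a r) / (unit_ball_vol (real CARD('m)) * r ^ CARD('m))) 0 < e"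
  unfolding eventually_at_right_field using r0(1) by (intro exI[of _ "r0/2"]) auto
qed

lemma null_density_if_density_zero:
 fixes S :: "(real ^ 'm) set"
 assumes S [measurable]: "S : sets borel" and d: "density_zero S a"
 shows "null_density S a"
 unfolding null_density_def
proof (intro allI impI)
 define M where "M = CARD('m)"
 define om where "om = unit_ball_vol (real M)"
 have om: "0 < om" by (simp add: om_def)
 fix et :: real assume et: "0 < et"
 have "\<forall>\<^sub>F r in at_right 0. measure lebesgue (S Int cball a r) / (om * r ^ M) < et"
  using d et unfolding density_zero_def om_def M_def by (rule order_tendstoD)
 then obtain r0 where r0: "0 < r0" "!!r. 0 < r ==> r < r0 ==> measure lebesgue (S Int cball a r) / (om * r ^ M) < et"
  unfolding eventually_at_right_field by auto
 have "vol (S Int ball a r) <= en et * vol (ball a r)" if r: "0 < r" "r < r0" for r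
 proof -
  let ?A = "S Int cball a r"
  have fin: "vol ?A < oo"
   using emeasure_mono[of "S Int cball a r" "cball a r" lborel] emeasure_lborel_cball_finite[of a r] by simp
  have "vol (S Int ball a r) <= vol ?A" by (intro emeasure_mono) auto
  also have "... = en (measure lborel ?A)" using fin by (simp add: emeasure_eq_ennreal_measure)
  also have "measure lborel ?A = measure lebesgue ?A" by simp
  also have "en (measure lebesgue ?A) <= en (et * (om * r ^ M))"
   using r0(2)[OF r] om r by (intro ennreal_leI) (simp add: pos_divide_less_eq)
  also have "... = en et * vol (ball a r)" using r et by (subst emeasure_lborel_ball_cart) (auto simp: om_def M_def ennreal_mult')
  finally show ?thesis .
 qed
 then show "EX r0>0. ALL r. 0 < r & r < r0 --> vol (S Int ball a r) <= en et * vol (ball a r)"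
  using r0(1) by blast
qed

text \<open>The ball of radius th r has a small share of the volume. Outside of it norm (x - a) is
  at least th r, so membership forces |v x| > eps th r, and Markov's inequality bounds the volume of
  such points by the assumed mean.\<close>

lemma null_density_if_L1_small:
 fixes v :: "real ^ 'm => 'b::hilbert"
 assumes [measurable]: "v : BM" and eps: "0 < eps"
  and L1: "!!e. 0 < e ==> EX r0>0. ALL r. 0 < r & r < r0 -->
   (NN x:ball a r. en (norm (v x))) <= en (e * r) * vol (ball a r)"
 shows "null_density {x. eps * norm (x - a) < norm (v x)} a"
 unfolding null_density_def
proof (intro allI impI)
 let ?S = "{x. eps * norm (x - a) < norm (v x)}"
 define M where "M = CARD('m)"
 define om where "om = unit_ball_vol (real M)"
 have om: "0 < om" by (simp add: om_def)
 have M: "0 < M" unfolding M_def by simp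
 fix et :: real assume et: "0 < et"
 define th where "th = min (1/2) (et/2)"
 have th: "0 < th" "th <= 1" "th <= et/2" using et by (auto simp: th_def)
 have "0 < eps * th * et / 2" using eps th by simp
 then obtain r0 where r0: "0 < r0" "!!r. 0 < r ==> r < r0 ==>
   (NN x:ball a r. en (norm (v x))) <= en (eps * th * et / 2 * r) * vol (ball a r)"
  using L1[of "eps * th * et / 2"] by blast
 have "vol (?S Int ball a r) <= en et * vol (ball a r)" if r: "0 < r" "r < r0" for r
 proof -
  define c where "c = 1 / (eps * th * r)"
  have c: "0 < c" using eps th r by (simp add: c_def)
  let ?V = "{x:ball a r. 1 <= en c * en (norm (v x))}"
  let ?A = "ball a (th * r)"
  have sub: "?S Int ball a r <= ?A Un ?V"
  proof
   fix x assume x: "x : ?S Int ball a r"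
   show "x : ?A Un ?V"
   proof (cases "x : ?A")
    case False
    then have "eps * (th * r) <= eps * norm (x - a)" using eps by (simp add: dist_norm norm_minus_commute)
    also have "... < norm (v x)" using x by simp
    finally have "c * (eps * th * r) <= c * norm (v x)" using c by simp
    then have "1 <= c * norm (v x)" using eps th r by (simp add: c_def)
    then have "1 <= en c * en (norm (v x))" using c by (simp add: ennreal_mult'[symmetric])
    then show ?thesis using x by auto
   qed simp
  qed
  let ?B = "eps * th * et / 2 * r"
  have "vol (?S Int ball a r) <= vol (?A) + vol ?V"
   by (rule order_trans[OF emeasure_mono[OF sub] emeasure_subadditive]) auto
  also have "vol ?V <= en c * (NN x:ball a r. en (norm (v x)))"
   by (rule nn_integral_Markov_inequality) auto
  also have "... <= en c * (en ?B * vol (ball a r))"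
   by (intro mult_left_mono r0 r) auto
  also have "... = en (et/2) * vol (ball a r)"
  proof -
   have "c * ?B = et / 2" using eps th r by (simp add: c_def)
   then have "en c * en ?B = en (et/2)"
    using c by (simp only: ennreal_mult'[symmetric])
   then show ?thesis by (simp only: mult.assoc[symmetric])
  qed
  also have "vol (?A) <= en (et/2) * vol (ball a r)"
  proof -
   have "th ^ M <= th ^ 1" using th M by (intro power_decreasing) auto
   then have "om * (th * r) ^ M <= et/2 * (om * r ^ M)"
    using om r th by (simp add: power_mult_distrib)
   then have "en (om * (th * r) ^ M) <= en (et/2 * (om * r ^ M))" by (rule ennreal_leI)
   also have "... = en (et/2) * en (om * r ^ M)" using et by (intro ennreal_mult') simp
   finally show ?thesis using th r by (simp only: emeasure_lborel_ball_cart om_def M_def mult_nonneg_nonneg)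
  qed
  finally have "vol (?S Int ball a r) <= en (et/2) * vol (ball a r) + en (et/2) * vol (ball a r)"
   by simp
  also have "... = en et * vol (ball a r)"
   using et by (simp flip: distrib_right ennreal_plus)
  finally show ?thesis .
 qed
 then show "EX r0>0. ALL r. 0 < r & r < r0 --> vol (?S Int ball a r) <= en et * vol (ball a r)"
  using r0(1) by blast
qed

theorem AE_density_point:
 assumes X [measurable]: "X : sets borel" and fin: "vol X < oo"
 shows "AA a. a : X --> null_density (- X) a"
proof -
 have "integrable lborel (ind X :: 'a => real)" using fin by simp
 then have "AA a. lebesgue_point (ind X :: 'a => real) a" by (rule AE_lebesgue_point)
 then show ?thesis
 proof eventually_elim
  case (elim a)
  show ?case
  proof
   assume a: "a : X"
   have "(NN x:ball a r. en (norm (ind X x - ind X a :: real))) = vol (- X Int ball a r)" for r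
   proof -
    have "(NN x:ball a r. en (norm (ind X x - ind X a :: real))) = (NN x. ind (- X Int ball a r) x)"
     using a by (intro nn_integral_cong) (auto simp: indicator_def)
    also have "... = vol (- X Int ball a r)" by simp
    finally show ?thesis .
   qed
   then show "null_density (- X) a" using elim unfolding lebesgue_point_def null_density_def by simp
  qed
 qed
qed

text \<open>The linear part at \<open>a\<close> has the values of the directional derivatives as its
  coefficients; it works wherever \<open>a\<close> is a Lebesgue point of the map and of these
  finitely many derivatives.\<close>

theorem hilbert_AE_approx_differentiable:
 fixes u :: "real ^ 'm => 'b::hilbert"
 assumes u[measurable]: "u : BM" and int: "integrable lborel u"
  and U: "open U" "convex U" "vol U < oo" and p: "1 < p" and n: "nik U p K u"
 shows "AA a. a : U --> (EX L. linear L & (ALL eps>0. null_density {x. eps * norm (x - a) < norm (u x - u a - L (x - a))} a))"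
proof -
 have "EX w. w : BM & integrable lborel w &
  (ALL t>0. AA x:U;t *: axis k 1. u (x + t *: axis k 1) - u x = line_int (axis k 1) t w x)" for k
  by (rule hilbert_directional_derivative[OF u int U p n, of "axis k 1"]) blast
 then have "ALL k. EX w. w : BM & integrable lborel w &
  (ALL t>0. AA x:U;t *: axis k 1. u (x + t *: axis k 1) - u x = line_int (axis k 1) t w x)" ..
 from choice[OF this] obtain w where w: "!!k. w k : BM" "!!k. integrable lborel (w k)"
  "!!k t. 0 < t ==> AA x:U;t *: axis k 1. u (x + t *: axis k 1) - u x = line_int (axis k 1) t (w k) x"
  by blast
 have "AA a. ALL k:UNIV. lebesgue_point (w k) a"
  using AE_lebesgue_point[OF w(2)] by (intro AE_finite_allI) auto
 then show ?thesis using AE_lebesgue_point[OF int]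
 proof eventually_elim
  case (elim a)
  show ?case
  proof
   assume a: "a : U"
   let ?L = "coord_lin (%k. w k a)"
   have [measurable]: "?L : BM"
    using linear_continuous_on[of ?L UNIV] linear_coord_lin[of "%k. w k a"] by (intro borel_measurable_continuous_onI) (simp add: linear_conv_bounded_linear)
   have "null_density {x. eps * norm (x - a) < norm (u x - u a - ?L (x - a))} a" if "0 < eps" for eps
   proof (rule null_density_if_L1_small[OF _ that])
    fix e :: real assume "0 < e"
    then show "EX r0>0. ALL r. 0 < r & r < r0 -->
     (NN x:ball a r. en (norm (u x - u a - ?L (x - a)))) <= en (e * r) * vol (ball a r)"
     using elim by (intro hilbert_L1_differentiable[OF u w U(1) a]) auto
   qed measurable
   then show "EX L. linear L & (ALL eps>0. null_density {x. eps * norm (x - a) < norm (u x - u a - L (x - a))} a)"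
    using linear_coord_lin by blast
  qed
 qed
qed

section \<open>Charts: reducing tuple valued maps to Hilbert space valued ones\<close>

text \<open>Near \<open>c\<close> the map \<open>bump c s\<close> is translation by \<open>-c\<close>; away from \<open>c\<close> it vanishes. Summing it over a tuple
 extracts the cluster around \<open>c\<close>.\<close>

definition bump :: "'b::real_normed_vector => real => 'b => 'b"
 where "bump c s v = max 0 (min 1 (2 - norm (v - c) / s)) *: (v - c)"

lemma bump_near: "0 < s ==> norm (v - c) <= s ==> bump c s v = v - c"
 by (simp add: bump_def min_def)

lemma bump_far: "0 < s ==> 2 * s <= norm (v - c) ==> bump c s v = 0"
 by (simp add: bump_def field_simps)

lemma norm_bump_le: "0 < s ==> norm (bump c s v) <= 2 * s"
proof (cases "2 * s <= norm (v - c)")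
 case False
 have "norm (bump c s v) = max 0 (min 1 (2 - norm (v - c) / s)) * norm (v - c)" by (simp add: bump_def)
 also have "... <= 1 * norm (v - c)" by (intro mult_right_mono) auto
 finally show ?thesis using False by simp
qed (simp add: bump_far)

lemma bump_lipschitz:
 assumes s: "0 < s"
 shows "dist (bump c s v) (bump c s w) <= 3 * dist v w"
proof -
 define kp where "kp rh = max 0 (min 1 (2 - rh / s))" for rh
 have kp01: "0 <= kp rh" "kp rh <= 1" for rh by (auto simp: kp_def)
 have kpL: "\<bar>kp rh - kp rh'\<bar> <= \<bar>rh - rh'\<bar> / s" for rh rh'
 proof -
  have "\<bar>kp rh - kp rh'\<bar> <= \<bar>rh / s - rh' / s\<bar>" by (auto simp: kp_def)
  also have "... = \<bar>rh - rh'\<bar> / s" using s by (simp flip: diff_divide_distrib)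
  finally show ?thesis .
 qed
 have main: "norm (kp (norm a) *: a - kp (norm b) *: b) <= 3 * norm (a - b)" if b: "norm b <= 2 * s" for a b :: 'a
 proof -
  have "kp (norm a) *: a - kp (norm b) *: b = kp (norm a) *: (a - b) + (kp (norm a) - kp (norm b)) *: b"
   by (simp add: algebra_simps)
  then have "norm (kp (norm a) *: a - kp (norm b) *: b) <= kp (norm a) * norm (a - b) + \<bar>kp (norm a) - kp (norm b)\<bar> * norm b"
   using norm_triangle_ineq[of "kp (norm a) *: (a - b)" "(kp (norm a) - kp (norm b)) *: b"] kp01 by simp
  also have "... <= 1 * norm (a - b) + norm (a - b) / s * (2 * s)"
  proof (intro add_mono mult_mono)
   show "\<bar>kp (norm a) - kp (norm b)\<bar> <= norm (a - b) / s"
    using kpL[of "norm a" "norm b"] norm_triangle_ineq3[of a b] s by (meson divide_right_mono less_imp_le order_trans)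
  qed (use kp01 b s in auto)
  finally show ?thesis using s by simp
 qed
 have eq: "bump c s x = kp (norm (x - c)) *: (x - c)" for x by (simp add: bump_def kp_def)
 consider "norm (w - c) <= 2 * s" | "norm (v - c) <= 2 * s" | "2 * s <= norm (w - c)" "2 * s <= norm (v - c)" by linarith
 then show ?thesis
 proof cases
  case 1
  then show ?thesis using main[of "w - c" "v - c"] by (simp add: eq dist_norm)
 next
  case 2
  then show ?thesis using main[of "v - c" "w - c"] by (simp add: eq dist_norm norm_minus_commute)
 next
  case 3
  then show ?thesis using s by (simp add: bump_far)
 qed
qed

definition qsum_vec :: "('a => 'b::real_vector) => ('a, 'q::finite) qtuple => 'b"
 where "qsum_vec g S = (SUM i:UNIV. g (rep_qtuple S i))"

lemma qsum_vec_qtuple [simp]: "qsum_vec g (qtuple z) = (SUM i:UNIV. g (z i))"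
proof -
 have "perm_equiv z (rep_qtuple (qtuple z))" by (simp add: qtuple.abs_eq_iff[symmetric])
 then obtain sg where sg: "bij sg" "rep_qtuple (qtuple z) = z \<circ> sg" unfolding perm_equiv_def by auto
 then show ?thesis using sum.reindex_bij_betw[of sg UNIV UNIV "%i. g (z i)"] by (simp add: qsum_vec_def)
qed

lemma qsum_vec_lipschitz:
 fixes S T :: "('a::metric_space, 'q::finite) qtuple" and g :: "'a => 'b::real_normed_vector"
 assumes g: "!!v w. dist (g v) (g w) <= L * dist v w" and "0 <= L"
 shows "dist (qsum_vec g S) (qsum_vec g T) <= (real CARD('q) * L) * dist S T"
proof -
 obtain z where z: "S = qtuple z" by (rule qtuple_exhaust)
 obtain w where w: "qtuple w = T" "!!i. dist (z i) (w i) <= dist S T"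
  by (rule dist_qtuple_attained[of "rep_qtuple T" z]) (auto simp: z)
 have "dist (qsum_vec g S) (qsum_vec g T) = norm (SUM i:UNIV. g (z i) - g (w i))"
  unfolding z w(1)[symmetric] by (simp add: dist_norm sum_subtractf)
 also have "... <= (SUM i:(UNIV::'q set). L * dist S T)"
 proof (rule sum_norm_le)
  fix i
  have "norm (g (z i) - g (w i)) <= L * dist (z i) (w i)" using g by (simp add: dist_norm)
  also have "... <= L * dist S T" using w(2) `0 <= L` by (intro mult_left_mono)
  finally show "norm (g (z i) - g (w i)) <= L * dist S T" .
 qed
 finally show ?thesis by simp
qed

definition multiplicity :: "('q::finite => 'a) => 'q => nat"
 where "multiplicity c i = card {l. c l = c i}"

lemma multiplicity_pos: "1 <= real (multiplicity c i)"
proof -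
 have "0 < card {l. c l = c i}" by (subst card_gt_0_iff) auto
 then show ?thesis by (simp add: multiplicity_def)
qed

text \<open>If the entries of \<open>S\<close> form well separated groups of equal points, the sum
  of the bumps around \<open>c i\<close> is the multiplicity times the offset of that group from
  \<open>c i\<close>, and dividing by the multiplicity recovers the point. On the closed set of
  tuples fixed by \<open>chart c s\<close> a tuple is therefore encoded by finitely many Lipschitz
  functions into the Hilbert space.\<close>

definition chart :: "('q::finite => 'a::real_normed_vector) => real => ('a, 'q) qtuple => ('a, 'q) qtuple"
 where "chart c s S = qtuple (%i. c i + (1 / real (multiplicity c i)) *: qsum_vec (bump (c i) s) S)"

text \<open>With \<open>s\<close> below a quarter of the least gap between distinct entries and
  centres within \<open>s\<close> of them, equal entries share a centre, each bump is a translation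
  on its own entry and vanishes on the others. Centres from a dense set and radii 1/(n+1) leave only
  countably many charts.\<close>

lemma chart_exists:
 assumes D: "!!X. open X ==> X ~= {} ==> EX d:D. d : X"
 shows "EX c n. range c <= D & S = chart c (1 / real (Suc n)) S"
proof -
 obtain z where z: "S = qtuple z" by (rule qtuple_exhaust)
 obtain dl where dl: "0 < dl" "!!i l. z i ~= z l ==> dl <= dist (z i) (z l)"
 proof -
  \<comment> \<open>The extra element keeps the set nonempty, and its minimum positive, when all
    entries coincide.\<close>
  define A where "A = insert 1 ((%(i, l). dist (z i) (z l)) ` {(i, l). z i ~= z l})"
  have A: "finite A" "A ~= {}" by (auto simp: A_def)
  have "0 < Min A" by (subst Min_gr_iff) (auto simp: A_def)
  moreover have "Min A <= dist (z i) (z l)" if "z i ~= z l" for i l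
   using that by (intro Min_le) (auto simp: A_def)
  ultimately show ?thesis using that by blast
 qed
 obtain n where n: "inverse (real (Suc n)) < dl / 4" using reals_Archimedean[of "dl/4"] dl by auto
 define s where "s = 1 / real (Suc n)"
 have s: "0 < s" "4 * s < dl" using n by (auto simp: s_def inverse_eq_divide)
 have "EX d. d : D & dist y d < s" for y using D[of "ball y s"] s by auto
 then obtain d where d: "!!y. d y : D" "!!y. dist y (d y) < s" by metis
 define c where "c i = d (z i)" for i
 have far: "2 * s <= norm (z l - c i)" if "z l ~= z i" for l i
  using dl(2)[OF that] d(2)[of "z i"] s dist_triangle2[of "z l" "z i" "c i"] by (simp add: c_def dist_norm)
 have near: "norm (z l - c i) <= s" if "z l = z i" for l i
  using d(2)[of "z i"] that by (simp add: c_def dist_norm)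
 have ceq: "c l = c i \<longleftrightarrow> z l = z i" for l i
 proof
  assume "c l = c i"
  then show "z l = z i" using near[of l l] far[of l i] s by auto
 qed (simp add: c_def)
 have "c i + (1 / real (multiplicity c i)) *: qsum_vec (bump (c i) s) S = z i" for i
 proof -
  have "qsum_vec (bump (c i) s) S = (SUM l:UNIV. if z l = z i then z i - c i else 0)"
   unfolding z qsum_vec_qtuple using near far s by (intro sum.cong) (auto simp: bump_near bump_far)
  also have "... = real (multiplicity c i) *: (z i - c i)"
   by (simp add: sum.If_cases multiplicity_def ceq sum_constant_scaleR)
  finally show ?thesis using multiplicity_pos[of c i] by simp
 qed
 then have "chart c s S = S" by (simp add: chart_def z)
 then show ?thesis using d(1) by (intro exI[of _ c] exI[of _ n]) (auto simp: c_def s_def)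
qed

lemma nik_cong:
 assumes "!!x. x : U ==> f x = g x"
 shows "nik U p K f \<longleftrightarrow> nik U p K g"
proof -
 have "(NN x:(seg U h). en (dist (f (x + h)) (f x) powr p))
  = (NN x:(seg U h). en (dist (g (x + h)) (g x) powr p))" for h
  using assms by (intro nn_integral_cong) (auto simp: indicator_def)
 then show ?thesis by (simp add: nik_def)
qed

lemma continuous_on_qtuple:
 assumes "!!i. continuous_on S (A i)"
 shows "continuous_on S (%x. qtuple (%i. A i x))"
 unfolding continuous_on_def
proof
 fix x assume x: "x : S"
 show "((%x. qtuple (%i. A i x)) \<longlongrightarrow> qtuple (%i. A i x)) (at x within S)"
 proof (rule metric_tendsto_imp_tendsto)
  show "((%y. SUM i:UNIV. dist (A i y) (A i x)) \<longlongrightarrow> 0) (at x within S)"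
  proof (rule tendsto_null_sum)
   show "((%y. dist (A i y) (A i x)) \<longlongrightarrow> 0) (at x within S)" for i
    using assms[of i] x unfolding continuous_on_def by (blast intro: tendsto_dist_iff[THEN iffD1])
  qed
  show "\<forall>\<^sub>F y in at x within S. dist (qtuple (%i. A i y)) (qtuple (%i. A i x)) <= dist (SUM i:UNIV. dist (A i y) (A i x)) 0"
  proof (intro always_eventually allI)
   fix y
   show "dist (qtuple (%i. A i y)) (qtuple (%i. A i x)) <= dist (SUM i:UNIV. dist (A i y) (A i x)) 0"
    using dist_qtuple_le_sum[of "%i. A i y" "%i. A i x"] by simp
  qed
 qed
qed

lemma continuous_on_affine_map:
 fixes A :: "'v::euclidean_space => 'w::real_normed_vector"
 assumes "affine_map A"
 shows "continuous_on S A"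
proof -
 have "bounded_linear (%x. A x - A 0)" using assms by (simp add: affine_map_def linear_conv_bounded_linear)
 then have "continuous_on S (%x. A x - A 0)" by (rule linear_continuous_on)
 then have "continuous_on S (%x. (A x - A 0) + A 0)" by (intro continuous_on_add continuous_on_const)
 then show ?thesis by simp
qed

text \<open>For one chart, let \<open>X\<close> be the Borel set of points of \<open>U\<close> where
  \<open>f\<close> is fixed by it. At a density point of \<open>X\<close> where all coordinate
  functions \<open>u i\<close> are approximately differentiable, their affine approximations
  assemble into one for \<open>f\<close>: the complement of \<open>X\<close> has density 0 and is
  ignored. Countably many charts cover \<open>U\<close>.\<close>

theorem AE_approx_affine:
 fixes f :: "real ^ 'm => ('b::hilbert, 'q::finite) qtuple"
 assumes f[measurable]: "f : BM"
  and U: "open U" "convex U" "vol U < oo" and p: "1 < p" and n: "nik U p K f"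
 shows "AA a. a : U --> (EX A. approx_affine U f a A)"
proof -
 have Ub [measurable]: "U : sets borel" using U by simp
 obtain D :: "'b set" where D: "countable D" "!!X. open X ==> X ~= {} ==> EX d:D. d : X"
  using countable_dense_exists by blast
 define I where "I = {c :: 'q => 'b. range c <= D} \<times> (UNIV :: nat set)"
 have I: "countable I"
 proof -
  have "{c :: 'q => 'b. range c <= D} = PiE UNIV (%_. D)" by auto
  then show ?thesis using countable_PiE[of "UNIV :: 'q set" "%_. D"] D(1) by (simp add: I_def)
 qed
 let ?C = "real CARD('q) * 3"
 have each: "AA a. a : U & f a = chart c s (f a) --> (EX A. approx_affine U f a A)" if s: "0 < s" for c :: "'q => 'b" and s
 proof -
  define k where "k i = 1 / real (multiplicity c i)" for i
  have k: "0 <= k i" "k i <= 1" for i using multiplicity_pos[of c i] by (auto simp: k_def)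
  define Ph where "Ph i = (qsum_vec (bump (c i) s) :: ('b, 'q) qtuple => 'b)" for i
  have PhL: "dist (Ph i S) (Ph i T) <= ?C * dist S T" for i S T
   unfolding Ph_def by (rule qsum_vec_lipschitz[OF bump_lipschitz[OF s]]) simp
  have [measurable]: "Ph i : BM" for i
  proof -
   have "?C-lipschitz_on UNIV (Ph i)" using PhL by (intro lipschitz_onI) auto
   then show ?thesis by (intro borel_measurable_continuous_onI lipschitz_on_continuous_on)
  qed
  define u where "u i x = ind U x *: Ph i (f x)" for i x
  have um [measurable]: "u i : BM" for i unfolding u_def by simp
  have ub: "norm (Ph i S) <= real CARD('q) * (2 * s)" for i S
  proof -
   have "norm (Ph i S) <= (SUM l:(UNIV::'q set). 2 * s)"
    unfolding Ph_def qsum_vec_def by (intro sum_norm_le norm_bump_le s)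
   then show ?thesis by simp
  qed
  have ui: "integrable lborel (u i)" for i
  proof (rule Bochner_Integration.integrable_bound)
   show "integrable lborel (%x. ind U x *: (real CARD('q) * (2 * s)))"
    using U(3) by simp
   show "AA x. norm (u i x) <= norm (ind U x *: (real CARD('q) * (2 * s)))"
    using ub s by (intro AE_I2) (auto simp: u_def indicator_def)
  qed measurable
  have un: "nik U p (?C powr p * K) (u i)" for i
  proof -
   have "nik U p (?C powr p * K) (%x. Ph i (f x))"
    by (rule nik_comp_lipschitz[OF n PhL _ p f Ub]) simp
   then show ?thesis by (subst nik_cong[where g="%x. Ph i (f x)"]) (auto simp: u_def)
  qed
  define G where "G x = chart c s (f x)" for x
  have Gc: "G x = qtuple (%i. c i + k i *: Ph i (f x))" for x by (simp add: G_def chart_def k_def Ph_def)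
  have Gm [measurable]: "G : BM"
  proof -
   have "continuous_on UNIV (%S. qtuple (%i. c i + k i *: Ph i S))"
    using PhL by (intro continuous_on_qtuple continuous_intros lipschitz_on_continuous_on[where L="real CARD('q) * 3"] lipschitz_onI) auto
   from measurable_compose[OF f borel_measurable_continuous_onI[OF this]] show ?thesis unfolding Gc[abs_def] by simp
  qed
  define X where "X = {x:U. dist (f x) (G x) <= 0}"
  have X [measurable]: "X : sets borel" unfolding X_def by simp
  have Xfin: "vol X < oo"
   using emeasure_mono[of X U lborel] U(3) by (auto simp: X_def)
  have "AA a. ALL i:UNIV. a : U --> (EX L. linear L & (ALL eps>0. null_density {x. eps * norm (x - a) < norm (u i x - u i a - L (x - a))} a))"
   using hilbert_AE_approx_differentiable[OF um ui U p un] by (intro AE_finite_allI) auto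
  then show ?thesis using AE_density_point[OF X Xfin]
  proof eventually_elim
   case (elim a)
   show ?case
   proof
    assume a: "a : U & f a = chart c s (f a)"
    then have "null_density (- X) a" using elim(2) by (auto simp: X_def G_def)
    obtain L where L: "!!i. linear (L i)" "!!i eps. 0 < eps ==> null_density {x. eps * norm (x - a) < norm (u i x - u i a - L i (x - a))} a"
    proof -
     have "ALL i. EX L. linear L & (ALL eps>0. null_density {x. eps * norm (x - a) < norm (u i x - u i a - L (x - a))} a)"
      using elim(1) a by blast
     from choice[OF this] show ?thesis using that by blast
    qed
    define A where "A i x = c i + k i *: (u i a + L i (x - a))" for i x
    have Aaff: "affine_map (A i)" for i
    proof -
     have "(%x. A i x - A i 0) = (%x. k i *: L i x)"
     proof
      fix x
      have "L i x = L i (x - a) - L i (0 - a)" using linear_diff[OF L(1), of i "x - a" "0 - a"] by simp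
      then show "A i x - A i 0 = k i *: L i x" by (simp add: A_def scaleR_diff_right scaleR_add_right)
     qed
     then show ?thesis unfolding affine_map_def using L(1)[of i] by (simp add: linear_compose_scale_right)
    qed
    have Lm [measurable]: "L i : BM" for i
     using linear_continuous_on[of "L i" UNIV] L(1)[of i] by (intro borel_measurable_continuous_onI) (simp add: linear_conv_bounded_linear)
    have Am [measurable]: "(%x. qtuple (%i. A i x)) : BM"
     by (intro borel_measurable_continuous_onI continuous_on_qtuple continuous_on_affine_map Aaff)
    have "density_zero {x:U. dist (f x) (qtuple (%i. A i x)) > eps * norm (x - a)} a" if eps: "0 < eps" for eps
    proof (rule density_zero_if_null_density)
     define eps' where "eps' = eps / real CARD('q)"
     have eps': "0 < eps'" using eps by (simp add: eps'_def)
     let ?N = "%i. {x. eps' * norm (x - a) < norm (u i x - u i a - L i (x - a))}"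
     have Nm: "?N i : sets borel" for i by simp
     let ?B = "UN i:UNIV. ?N i"
     have "null_density (- X Un ?B) a"
      using L(2)[OF eps'] `null_density (- X) a` by (intro null_density_Un null_density_UN) auto
     moreover have "{x:U. dist (f x) (qtuple (%i. A i x)) > eps * norm (x - a)} <= - X Un ?B"
     proof
      fix x assume x: "x : {x:U. dist (f x) (qtuple (%i. A i x)) > eps * norm (x - a)}"
      show "x : - X Un ?B"
      proof (rule ccontr)
       assume "x ~: - X Un ?B"
       then have xX: "x : X" and le: "!!i. norm (u i x - u i a - L i (x - a)) <= eps' * norm (x - a)" by (auto simp: not_less)
       have "f x = qtuple (%i. c i + k i *: u i x)" using xX Gc[of x] by (simp add: X_def u_def)
       then have "dist (f x) (qtuple (%i. A i x)) <= (SUM i:UNIV. dist (c i + k i *: u i x) (A i x))"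
        using dist_qtuple_le_sum[of "%i. c i + k i *: u i x" "%i. A i x"] by simp
       also have "... <= (SUM i:(UNIV::'q set). eps' * norm (x - a))"
       proof (rule sum_mono)
        fix i
        let ?A = "u i x - u i a - L i (x - a)"
        have "dist (c i + k i *: u i x) (A i x) = k i * norm ?A"
        proof -
         have "c i + k i *: u i x - A i x = k i *: ?A"
          by (simp add: A_def algebra_simps)
         then show ?thesis using k[of i] by (simp add: dist_norm)
        qed
        also have "... <= 1 * norm ?A" using k by (intro mult_right_mono) auto
        also have "... <= eps' * norm (x - a)" using le by simp
        finally show "dist (c i + k i *: u i x) (A i x) <= eps' * norm (x - a)" .
       qed
       also have "... = eps * norm (x - a)" by (simp add: eps'_def)
       finally show False using x by simp
      qed
     qed
     moreover have "- X Un ?B : sets borel" by auto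
     ultimately show "null_density {x:U. dist (f x) (qtuple (%i. A i x)) > eps * norm (x - a)} a"
      by (rule null_density_subset)
    qed measurable
    then have "approx_affine U f a A"
     unfolding approx_affine_def using Aaff by (auto intro: measurable_restrict_space1)
    then show "EX A. approx_affine U f a A" by blast
   qed
  qed
 qed
 have "AA a. ALL (c, n):I. a : U & f a = chart c (1 / real (Suc n)) (f a) --> (EX A. approx_affine U f a A)"
  unfolding AE_ball_countable[OF I] using each by auto
 then show ?thesis
 proof eventually_elim
  case (elim a)
  obtain c n where "range c <= D" "f a = chart c (1 / real (Suc n)) (f a)" using chart_exists[OF D(2), of "f a"] by auto
  then show ?case using elim by (auto simp: I_def)
 qed
qed

section \<open>The directional part of the differential as an extremal upper gradient\<close>

lemma abs_dist_diff_le_add: "\<bar>dist a b - dist a' b'\<bar> <= dist a a' + dist b b'"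
 using dist_triangle[of a b a'] dist_triangle[of a' b b'] dist_triangle[of a' b' a] dist_triangle[of a b' b]
 by (simp add: dist_commute)

text \<open>The small ball around a + t v lies in the ball of radius R t around \<open>a\<close> and
  fills the fixed fraction (eps/R)^M of its volume, so density 0 at \<open>a\<close> is inherited by
  these off-centre balls.\<close>

lemma null_density_offset_ball:
 fixes S :: "(real ^ 'm) set"
 assumes d: "null_density S a" and [measurable]: "S : sets borel" and eps: "0 < eps" "eps <= 1" and et: "0 < et"
 shows "EX t0>0. ALL t. 0 < t & t < t0 -->
  vol (S Int ball (a + t *: v) (eps * t)) <= en et * vol (ball (a + t *: v) (eps * t))"
proof -
 define M where "M = CARD('m)"
 define om where "om = unit_ball_vol (real M)"
 have om: "0 < om" by (simp add: om_def)
 have vol: "vol (ball b r) = en (om * r ^ M)" if "0 <= r" for b :: "real ^ 'm" and r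
  using that by (simp add: emeasure_ball om_def M_def)
 define R where "R = norm v + 1"
 have R: "0 < R" by (simp add: R_def add_nonneg_pos)
 define et' where "et' = et * (eps / R) ^ M"
 have et': "0 < et'" using et eps R by (simp add: et'_def)
 obtain r0 where r0: "0 < r0" "!!r. 0 < r ==> r < r0 ==> vol (S Int ball a r) <= en et' * vol (ball a r)"
  using null_densityE[OF d et'] by blast
 have "vol (S Int ball (a + t *: v) (eps * t)) <= en et * vol (ball (a + t *: v) (eps * t))"
  if t: "0 < t" "t < r0 / R" for t
 proof -
  have "ball (a + t *: v) (eps * t) <= ball a (R * t)"
  proof
   fix x assume "x : ball (a + t *: v) (eps * t)"
   moreover have "dist a (a + t *: v) = norm v * t" using t by (simp add: dist_norm)
   moreover have "eps * t <= 1 * t" using eps t by simp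
   moreover have "R * t = norm v * t + t" by (simp add: R_def distrib_right)
   ultimately show "x : ball a (R * t)" using dist_triangle[of a x "a + t *: v"] by simp
  qed
  then have "vol (S Int ball (a + t *: v) (eps * t)) <= vol (S Int ball a (R * t))"
   by (intro emeasure_mono) auto
  also have "... <= en et' * vol (ball a (R * t))"
   using t R by (intro r0) (auto simp: field_simps)
  also have "... = en (et' * (om * (R * t) ^ M))" using t R et' by (simp add: vol ennreal_mult')
  also have "et' * (om * (R * t) ^ M) = et * (om * (eps * t) ^ M)"
   using R by (simp add: et'_def power_mult_distrib power_divide)
  also have "en (et * (om * (eps * t) ^ M)) = en et * vol (ball (a + t *: v) (eps * t))"
   using t eps et by (simp add: vol ennreal_mult')
  finally show ?thesis .
 qed
 then show ?thesis using r0(1) R by (intro exI[of _ "r0 / R"]) auto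
qed

text \<open>For small t a matching that pairs distinct entries of \<open>p\<close> costs at least
  the gap \<open>dl\<close> minus t V, which exceeds t V. Hence an optimal matching only permutes
  equal entries and the distance is exactly that of the identity matching.\<close>

lemma dist_qtuple_direction:
 shows "EX t0>0. ALL t. 0 < t & t < t0 -->
  dist (qtuple (%i. p i + t *: v i)) (qtuple p) = t * sqrt (SUM i:UNIV. (norm (v i))^2)"
proof -
 define V where "V = sqrt (SUM i:UNIV. (norm (v i))^2)"
 have V: "norm (v i) <= V" for i
  unfolding V_def by (rule real_le_rsqrt) (rule member_le_sum, auto)
 have V0: "0 <= V" by (simp add: V_def sum_nonneg)
 obtain dl where dl: "0 < dl" "!!i l. p i ~= p l ==> dl <= dist (p i) (p l)"
 proof -
  define A where "A = insert 1 ((%(i, l). dist (p i) (p l)) ` {(i, l). p i ~= p l})"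
  have A: "finite A" "A ~= {}" by (auto simp: A_def)
  have "0 < Min A" by (subst Min_gr_iff) (auto simp: A_def)
  moreover have "Min A <= dist (p i) (p l)" if "p i ~= p l" for i l
   using that by (intro Min_le) (auto simp: A_def)
  ultimately show ?thesis using that by blast
 qed
 have "dist (qtuple (%i. p i + t *: v i)) (qtuple p) = t * V" if t: "0 < t" "t < dl / (2 * (V + 1))" for t
 proof (rule antisym)
  have "dist (qtuple (%i. p i + t *: v i)) (qtuple p) <= sqrt (SUM i:UNIV. (dist (p i + t *: v i) (p i))^2)"
   by (rule dist_qtuple_le)
  also have "... = t * V"
   using t by (simp add: dist_norm V_def power_mult_distrib flip: sum_distrib_left) (simp add: real_sqrt_mult)
  finally show "dist (qtuple (%i. p i + t *: v i)) (qtuple p) <= t * V" .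
  obtain p' where p': "dist (qtuple (%i. p i + t *: v i)) (qtuple p) = sqrt (SUM i:UNIV. (dist (p i + t *: v i) (p' i))^2)"
   "!!i. dist (p i + t *: v i) (p' i) <= dist (qtuple (%i. p i + t *: v i)) (qtuple p)" "EX sg. bij sg & p' = p \<circ> sg"
   by (rule dist_qtuple_attained[of p "%i. p i + t *: v i"]) blast
  show "t * V <= dist (qtuple (%i. p i + t *: v i)) (qtuple p)"
  proof (cases "ALL i. p' i = p i")
   case True
   then show ?thesis unfolding p'(1)
    using t by (simp add: dist_norm V_def power_mult_distrib flip: sum_distrib_left) (simp add: real_sqrt_mult)
  next
   case False
   then obtain i where "p' i ~= p i" by blast
   moreover obtain sg where "p' = p \<circ> sg" using p'(3) by blast
   ultimately have "dl <= dist (p i) (p' i)" using dl(2)[of i "sg i"] by auto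
   also have "... <= dist (p i) (p i + t *: v i) + dist (p i + t *: v i) (p' i)" by (rule dist_triangle)
   also have "dist (p i) (p i + t *: v i) <= t * V" using V[of i] t by (simp add: dist_norm)
   finally have "dl <= t * V + dist (qtuple (%i. p i + t *: v i)) (qtuple p)" using p'(2)[of i] by simp
   moreover have "2 * (t * V) <= dl"
   proof -
    have "t * (2 * (V + 1)) <= dl" using t V0 by (simp add: pos_less_divide_eq)
    moreover have "t * (2 * (V + 1)) = 2 * (t * V) + 2 * t" by (simp add: algebra_simps)
    ultimately show ?thesis using t by simp
   qed
   ultimately show ?thesis by simp
  qed
 qed
 then show ?thesis using dl(1) V0 unfolding V_def[symmetric] by (intro exI[of _ "dl / (2 * (V + 1))"]) auto
qed

lemma affine_map_lipschitz:
 fixes A :: "'q::finite => 'v::euclidean_space => 'w::real_normed_vector"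
 assumes "!!i. affine_map (A i)"
 shows "EX K>=0. ALL x y. dist (qtuple (%i. A i x)) (qtuple (%i. A i y)) <= K * dist x y"
proof -
 have "EX k>=0. ALL x y. dist (A i x) (A i y) <= k * dist x y" for i
 proof -
  have lin: "linear (%x. A i x - A i 0)" using assms by (simp add: affine_map_def)
  then obtain k where k: "0 <= k" "!!x. norm (A i x - A i 0) <= norm x * k"
   using bounded_linear.nonneg_bounded[of "%x. A i x - A i 0"] by (auto simp: linear_conv_bounded_linear)
  have "dist (A i x) (A i y) <= k * dist x y" for x y
   using k(2)[of "x - y"] linear_diff[OF lin, of x y] by (simp add: dist_norm mult.commute)
  then show ?thesis using k(1) by blast
 qed
 then obtain k where k: "!!i. 0 <= k i" "!!i x y. dist (A i x) (A i y) <= k i * dist x y" by metis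
 have "dist (qtuple (%i. A i x)) (qtuple (%i. A i y)) <= (SUM i:UNIV. k i) * dist x y" for x y
 proof -
  have "dist (qtuple (%i. A i x)) (qtuple (%i. A i y)) <= (SUM i:UNIV. dist (A i x) (A i y))" by (rule dist_qtuple_le_sum)
  also have "... <= (SUM i:UNIV. k i * dist x y)" by (intro sum_mono k)
  finally show ?thesis by (simp add: sum_distrib_right)
 qed
 then show ?thesis using k(1) by (intro exI[of _ "SUM i:UNIV. k i"]) (auto simp: sum_nonneg)
qed

lemma approx_affine_null_density:
 fixes f :: "real ^ 'm => ('b::hilbert, 'q::finite) qtuple"
 assumes f[measurable]: "f : BM" and U[measurable]: "U : sets borel" and A: "approx_affine U f a A" and "0 < eps"
 shows "{x:U. dist (f x) (qtuple (%i. A i x)) > eps * norm (x - a)} : sets borel"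
  and "null_density {x:U. dist (f x) (qtuple (%i. A i x)) > eps * norm (x - a)} a"
proof -
 have [measurable]: "(%x. qtuple (%i. A i x)) : BM"
  using A by (intro borel_measurable_continuous_onI continuous_on_qtuple continuous_on_affine_map) (auto simp: approx_affine_def)
 show *: "{x:U. dist (f x) (qtuple (%i. A i x)) > eps * norm (x - a)} : sets borel" by simp
 show "null_density {x:U. dist (f x) (qtuple (%i. A i x)) > eps * norm (x - a)} a"
  using A `0 < eps` by (intro null_density_if_density_zero *) (auto simp: approx_affine_def)
qed

definition dir_norm :: "('q::finite => 'v::real_vector => 'b::real_normed_vector) => 'v => real"
 where "dir_norm A e = sqrt (SUM i:UNIV. (norm (A i e - A i 0))^2)"

lemma affine_map_add:
 assumes "affine_map A"
 shows "A (x + t *: y) = A x + t *: (A y - A 0)"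
proof -
 have lin: "linear (%x. A x - A 0)" using assms by (simp add: affine_map_def)
 have "A (x + t *: y) - A 0 = (A x - A 0) + t *: (A y - A 0)"
  using linear_add[OF lin, of x "t *: y"] linear_scale[OF lin, of t y] by simp
 then show ?thesis by simp
qed

lemma nonzero_quarter: "c ~= 0 ==> c * (y / (4 * c)) = y / 4" for c y :: real
 by simp

text \<open>Bad points have x or x + t e in the density zero set \<open>S\<close>, and each case
  fills at most a sixth of the ball. Elsewhere \<open>f\<close> is replaced by the affine tuple at
  both ends, and x by the centre \<open>a\<close>, where \<open>dist_qtuple_direction\<close>
  evaluates the distance. The bad set is enclosed in a Borel set of at most a third of the ball,
  leaving room for a second exceptional third in \<open>common_good_point\<close>.\<close>

theorem approx_affine_difference:
 fixes f :: "real ^ 'm => ('b::hilbert, 'q::finite) qtuple"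
 assumes f[measurable]: "f : BM" and U: "open U" "a : U" and A: "approx_affine U f a A" and et: "0 < et"
 shows "EX eps t0. 0 < eps & eps <= 1 & 0 < t0 & (ALL t. 0 < t & t < t0 --> (EX B:sets borel.
  {x:ball a (eps * t). ~ (x : U & x + t *: e : U & \<bar>dist (f (x + t *: e)) (f x) - t * dir_norm A e\<bar> <= et * t)} <= B &
  vol B <= en (1/3) * vol (ball a (eps * t))))"
proof -
 have Ub [measurable]: "U : sets borel" using U by simp
 have aff: "affine_map (A i)" for i using A by (simp add: approx_affine_def)
 obtain K where K: "0 <= K" "!!x y. dist (qtuple (%i. A i x)) (qtuple (%i. A i y)) <= K * dist x y"
  using affine_map_lipschitz[of A] aff by auto
 \<comment> \<open>Both end points are within t (norm e + 1) of \<open>a\<close>, so each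
   replacement of \<open>f\<close> costs at most et t / 4; \<open>eps\<close> is such that moving
   both affine values to the centre costs 2 K eps t, at most et t / 2.\<close>
 define et' where "et' = et / (4 * (norm e + 1))"
 define eps where "eps = min 1 (et / (4 * (K + 1)))"
 have ne: "0 < norm e + 1" by (simp add: add_nonneg_pos)
 have et': "0 < et'" using et ne by (simp add: et'_def)
 have eps: "0 < eps" "eps <= 1" using et K by (auto simp: eps_def)
 have Keps: "2 * K * eps <= et / 2"
 proof -
  have "K * eps <= (K + 1) * (et / (4 * (K + 1)))" using K et by (intro mult_mono) (auto simp: eps_def)
  also have "... = et / 4" using K(1) by (intro nonzero_quarter) simp
  finally show ?thesis by simp
 qed
 define S where "S = {x:U. dist (f x) (qtuple (%i. A i x)) > et' * norm (x - a)}"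
 have S [measurable]: "S : sets borel" and dS: "null_density S a"
  unfolding S_def by (rule approx_affine_null_density[OF f Ub A et'])+
 obtain R0 where R0: "0 < R0" "ball a R0 <= U" using U by (meson open_contains_ball)
 obtain t1 where t1: "0 < t1" "!!t. 0 < t ==> t < t1 ==> vol (S Int ball (a + t *: e) (eps * t)) <= en (1/6) * vol (ball (a + t *: e) (eps * t))"
  using null_density_offset_ball[OF dS S eps, of "1/6" e] by auto
 obtain t2 where t2: "0 < t2" "!!t. 0 < t ==> t < t2 ==> vol (S Int ball (a + t *: 0) (eps * t)) <= en (1/6) * vol (ball (a + t *: 0) (eps * t))"
  using null_density_offset_ball[OF dS S eps, of "1/6" 0] by auto
 let ?E = "qtuple (%i. A i a)"
 obtain t3 where t3: "0 < t3" "!!t. 0 < t ==> t < t3 ==> dist (qtuple (%i. A i a + t *: (A i e - A i 0))) (?E) = t * dir_norm A e"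
  using dist_qtuple_direction[of "%i. A i a" "%i. A i e - A i 0"] unfolding dir_norm_def by auto
 define t0 where "t0 = Min {t1, t2, t3, R0 / (norm e + 1)}"
 have t0: "0 < t0" using t1 t2 t3 R0 ne by (simp add: t0_def)
 have "EX B:sets borel. {x:ball a (eps * t). ~ (x : U & x + t *: e : U & \<bar>dist (f (x + t *: e)) (f x) - t * dir_norm A e\<bar> <= et * t)} <= B &
  vol B <= en (1/3) * vol (ball a (eps * t))" if t: "0 < t" "t < t0" for t
 proof -
  have tt: "t < t1" "t < t2" "t < t3" "t * (norm e + 1) < R0"
   using t ne by (auto simp: t0_def pos_less_divide_eq)
  define B1 where "B1 = S Int ball a (eps * t)"
  let ?A = "ball (a + t *: e) (eps * t)"
  define B2 where "B2 = {x. x + t *: e : S Int ?A}"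
  have [measurable]: "B1 : sets borel" "B2 : sets borel" unfolding B1_def B2_def by auto
  have "vol B2 = (NN x. ind B2 x)" by simp
  also have "... = (NN x. ind (S Int ?A) (x + t *: e))"
   by (intro nn_integral_cong) (simp add: B2_def indicator_def)
  also have "... = vol (S Int ?A)"
   by (subst nn_integral_translate[of "ind (S Int ?A)"]) auto
  also have "... <= en (1/6) * vol (?A)" by (rule t1) (use t tt in auto)
  also have "vol (?A) = vol (ball a (eps * t))"
   using t eps by (simp add: emeasure_lborel_ball_cart)
  finally have B2: "vol B2 <= en (1/6) * vol (ball a (eps * t))" .
  have B1: "vol B1 <= en (1/6) * vol (ball a (eps * t))"
   using t2(2)[of t] t tt by (simp add: B1_def)
  let ?D = "qtuple (%i. A i (a + t *: e))"
  have "vol (B1 Un B2) <= vol B1 + vol B2" by (rule emeasure_subadditive) auto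
  also have "... <= en (1/6) * vol (ball a (eps * t)) + en (1/6) * vol (ball a (eps * t))"
   by (intro add_mono B1 B2)
  also have "... = (en (1/6) + en (1/6)) * vol (ball a (eps * t))" by (rule distrib_right[symmetric])
  also have "en (1/6) + en (1/6) = en (1/3)" by (subst ennreal_plus[symmetric]) auto
  finally have "vol (B1 Un B2) <= en (1/3) * vol (ball a (eps * t))" .
  moreover have "x : B1 Un B2" if x: "x : ball a (eps * t)" "~ (x : U & x + t *: e : U & \<bar>dist (f (x + t *: e)) (f x) - t * dir_norm A e\<bar> <= et * t)" for x
  proof (rule ccontr)
   assume nB: "x ~: B1 Un B2"
   have epst: "eps * t <= 1 * t" using eps t by simp
   have te: "norm (t *: e) = t * norm e" using t by simp
   have dx: "dist x a <= t * (norm e + 1)" "dist (x + t *: e) a <= t * (norm e + 1)"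
   proof -
    have "dist x a <= t" using x(1) epst by (simp add: dist_commute)
    moreover have "0 <= t * norm e" using t by simp
    ultimately show "dist x a <= t * (norm e + 1)" by (simp add: distrib_left)
    have "dist (x + t *: e) a <= dist (x + t *: e) x + dist x a" by (rule dist_triangle)
    also have "dist (x + t *: e) x = t * norm e" using te by (simp add: dist_norm)
    finally show "dist (x + t *: e) a <= t * (norm e + 1)" using `dist x a <= t` by (simp add: distrib_left)
   qed
   have xU: "x : U" "x + t *: e : U" using dx tt(4) R0(2) by (auto simp: dist_commute)
   let ?B = "qtuple (%i. A i (x + t *: e))"
   let ?C = "qtuple (%i. A i x)"
   have "x ~: S" "x + t *: e ~: S"
    using nB x(1) by (auto simp: B1_def B2_def)
   then have le: "dist (f x) (?C) <= et' * norm (x - a)"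
    "dist (f (x + t *: e)) (?B) <= et' * norm (x + t *: e - a)"
    using xU by (auto simp: S_def)
   have et'le: "et' * (t * (norm e + 1)) = et * t / 4"
    using ne by (simp add: et'_def mult.left_commute mult.commute)
   have le': "dist (f x) (?C) <= et * t / 4"
    "dist (f (x + t *: e)) (?B) <= et * t / 4"
    using le dx mult_left_mono[of _ "t * (norm e + 1)" et'] et' unfolding et'le[symmetric] dist_norm
    by (meson less_imp_le order_trans)+
   have dA: "dist (?D) (?E) = t * dir_norm A e"
    using t3(2)[of t] t tt by (simp add: affine_map_add[OF aff])
   have m1: "dist (?C) (?E) <= K * (eps * t)"
    using K(2)[of x a] mult_left_mono[OF _ K(1), of "dist x a" "eps * t"] x(1) by (simp add: dist_commute)
   have m2: "dist (?B) (?D) <= K * (eps * t)"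
    using K(2)[of "x + t *: e" "a + t *: e"] mult_left_mono[OF _ K(1), of "dist x a" "eps * t"] x(1) by (simp add: dist_commute)
   have "2 * (K * (eps * t)) <= et * t / 2" using mult_right_mono[OF Keps, of t] t by simp
   then have "\<bar>dist (f (x + t *: e)) (f x) - t * dir_norm A e\<bar> <= et * t"
    using le' m1 m2
     abs_dist_diff_le_add[of "f (x + t *: e)" "f x" "?B" "?C"]
     abs_dist_diff_le_add[of "?B" "?C" "?D" "?E"]
    unfolding dA[symmetric] by simp
   then show False using x(2) xU by blast
  qed
  ultimately show ?thesis by (intro bexI[of _ "B1 Un B2"]) auto
 qed
 then show ?thesis using eps t0 by blast
qed

text \<open>Markov's inequality for the deviation of the line integral. The factor (eps/R)^M in
  \<open>dl\<close> converts the volume of the ball of radius R t, swept by the segments, into that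
  of the ball of radius eps t.\<close>

lemma line_int_near_lebesgue_point:
 fixes w :: "real ^ 'm => 'b::hilbert"
 assumes w[measurable]: "w : BM" and wi: "integrable lborel w" and leb: "lebesgue_point w a"
  and eps: "0 < eps" "eps <= 1" and et: "0 < et"
 shows "EX t0>0. ALL t. 0 < t & t < t0 --> (EX B:sets borel.
  {x:ball a (eps * t). ~ norm (line_int e t w x - t *: w a) <= et * t} <= B &
  vol B <= en (1/3) * vol (ball a (eps * t)))"
proof -
 define M where "M = CARD('m)"
 define om where "om = unit_ball_vol (real M)"
 have om: "0 < om" by (simp add: om_def)
 have vol: "vol (ball b r) = en (om * r ^ M)" if "0 <= r" for b :: "real ^ 'm" and r
  using that by (simp add: emeasure_ball om_def M_def)
 define R where "R = norm e + 1"
 have R: "0 < R" by (simp add: R_def add_nonneg_pos)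
 define dl where "dl = et / 3 * (eps / R) ^ M"
 have dl: "0 < dl" using et eps R by (simp add: dl_def)
 obtain r0 where r0: "0 < r0" "!!r. 0 < r ==> r < r0 ==> (NN x:ball a r. en (norm (w x - w a))) <= en dl * vol (ball a r)"
  using leb[unfolded lebesgue_point_def, rule_format, OF dl] by auto
 have "EX B:sets borel. {x:ball a (eps * t). ~ norm (line_int e t w x - t *: w a) <= et * t} <= B &
  vol B <= en (1/3) * vol (ball a (eps * t))" if t: "0 < t" "t < r0 / R" for t
 proof -
  define g where "g x = norm (line_int e t w x - t *: w a)" for x
  have [measurable]: "g : BM" unfolding g_def by simp
  define c where "c = 1 / (et * t)"
  have c: "0 < c" using et t by (simp add: c_def)
  let ?B = "{x:ball a (eps * t). 1 <= en c * en (g x)}"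
  have sub: "{x:ball a (eps * t). ~ norm (line_int e t w x - t *: w a) <= et * t} <= ?B"
  proof clarify
   fix x assume "x : ball a (eps * t)" and n: "~ norm (line_int e t w x - t *: w a) <= et * t"
   have "c * (et * t) <= c * g x" using n c by (intro mult_left_mono) (auto simp: g_def)
   then have "1 <= c * g x" using et t by (simp add: c_def)
   then show "1 <= en c * en (g x)" using c by (simp add: ennreal_mult'[symmetric])
  qed
  let ?A = "t * (dl * (om * (R * t) ^ M))"
  let ?C = "om * (eps * t) ^ M"
  have "vol ?B <= en c * (NN x:ball a (eps * t). en (g x))"
   by (rule nn_integral_Markov_inequality) auto
  also have "(NN x:ball a (eps * t). en (g x))
   <= (NN x:ball a (eps * t). NN s:{0..t}. en (norm (w (x + s *: e) - w a)))"
  proof (rule nn_integral_mono_AE)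
   show "AA x. en (g x) * ind (ball a (eps * t)) x
    <= (NN s:{0..t}. en (norm (w (x + s *: e) - w a))) * ind (ball a (eps * t)) x"
    using AE_set_integrable_line[OF w wi, of t e]
   proof eventually_elim
    case (elim x)
    have ci: "set_integrable lborel {0..t} (%s. w a)"
     unfolding set_integrable_def by (intro integrable_scaleR_left) (auto simp: emeasure_lborel_Icc_eq)
    have cI: "t *: w a = (LINT s:{0..t}|lborel. w a)" using t by (simp add: set_lebesgue_integral_def)
    have "line_int e t w x - t *: w a = (LINT s:{0..t}|lborel. w (x + s *: e) - w a)"
     unfolding cI line_int_def by (rule set_integral_diff(2)[OF elim ci, symmetric])
    then have "en (g x) <= (NN s. en (norm (ind {0..t} s *: (w (x + s *: e) - w a))))"
     unfolding g_def using set_integral_diff(1)[OF elim ci] unfolding set_integrable_def set_lebesgue_integral_def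
     by (simp only: integral_norm_bound_ennreal)
    also have "... = (NN s:{0..t}. en (norm (w (x + s *: e) - w a)))"
     by (intro nn_integral_cong) (auto simp: indicator_def)
    finally show ?case by (rule mult_right_mono) simp
   qed
  qed
  also have "... <= en t * (NN x:ball a (R * t). en (norm (w x - w a)))"
  proof (rule nn_integral_line_le)
   fix x s assume x: "x : ball a (eps * t)" "0 <= s" "s <= t"
   have "eps * t <= 1 * t" using eps t by simp
   then have "dist a x < t" using x by simp
   moreover have "dist x (x + s *: e) <= t * norm e" using x by (simp add: dist_norm mult_right_mono)
   ultimately show "x + s *: e : ball a (R * t)"
    using dist_triangle[of a "x + s *: e" x] by (simp add: R_def algebra_simps)
  qed (use t in auto)
  also have "... <= en t * (en dl * vol (ball a (R * t)))"
   using t R by (intro mult_left_mono r0) (auto simp: field_simps)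
  also have "... = en ?A" using t R dl by (simp add: vol ennreal_mult')
  also have "en c * en ?A = en (c * ?A)"
   using c by (simp add: ennreal_mult')
  also have "c * ?A = 1/3 * ?C"
   using R et t by (simp add: c_def dl_def power_mult_distrib power_divide)
  also have "en (1/3 * ?C) = en (1/3) * vol (ball a (eps * t))"
  proof -
   have "en (1/3 * ?C) = en (1/3) * en ?C" by (rule ennreal_mult') simp
   then show ?thesis using t eps by (simp only: vol mult_nonneg_nonneg)
  qed
  finally have "vol ?B <= en (1/3) * vol (ball a (eps * t))" by (simp add: mult_left_mono)
  then show ?thesis using sub by (intro bexI[of _ ?B]) auto
 qed
 then show ?thesis using r0(1) R by (intro exI[of _ "r0 / R"]) auto
qed

text \<open>Two exceptional sets of at most a third of the ball each, together with a null set,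
  cannot exhaust it. This avoids any statement about almost every line: one point at one scale is
  enough for comparing derivatives.\<close>

lemma common_good_point:
 fixes f :: "real ^ 'm => ('b::hilbert, 'q::finite) qtuple"
  and w :: "real ^ 'm => 'c::hilbert"
 assumes f: "f : BM" and U: "open U" "a : U" and A: "approx_affine U f a A" and et: "0 < et"
  and w: "w : BM" "integrable lborel w" "lebesgue_point w a"
  and P: "!!t. 0 < t ==> AA x. P t x"
 shows "EX t>0. EX x. P t x & x : U & x + t *: e : U & \<bar>dist (f (x + t *: e)) (f x) - t * dir_norm A e\<bar> <= et * t &
  norm (line_int e t w x - t *: w a) <= et * t"
proof -
 obtain eps t1 where eps: "0 < eps" "eps <= 1" and t1: "0 < t1" "!!t. 0 < t ==> t < t1 ==> EX B:sets borel.
  {x:ball a (eps * t). ~ (x : U & x + t *: e : U & \<bar>dist (f (x + t *: e)) (f x) - t * dir_norm A e\<bar> <= et * t)} <= B &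
  vol B <= en (1/3) * vol (ball a (eps * t))"
  using approx_affine_difference[OF f U A et, of e] by auto
 obtain t2 where t2: "0 < t2" "!!t. 0 < t ==> t < t2 ==> EX B:sets borel.
  {x:ball a (eps * t). ~ norm (line_int e t w x - t *: w a) <= et * t} <= B &
  vol B <= en (1/3) * vol (ball a (eps * t))"
  using line_int_near_lebesgue_point[OF w eps et, of e] by auto
 define t where "t = min t1 t2 / 2"
 have t: "0 < t" "t < t1" "t < t2" using t1(1) t2(1) by (auto simp: t_def)
 let ?A = "ball a (eps * t)"
 obtain B1 where B1: "B1 : sets borel" "{x:?A. ~ (x : U & x + t *: e : U & \<bar>dist (f (x + t *: e)) (f x) - t * dir_norm A e\<bar> <= et * t)} <= B1"
  "vol B1 <= en (1/3) * vol (?A)" using t1(2)[OF t(1,2)] by auto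
 obtain B2 where B2: "B2 : sets borel" "{x:?A. ~ norm (line_int e t w x - t *: w a) <= et * t} <= B2"
  "vol B2 <= en (1/3) * vol (?A)" using t2(2)[OF t(1,3)] by auto
 obtain N where N: "N : null_sets lborel" "{x. ~ P t x} <= N" using P[OF t(1)] by (auto simp: eventually_ae_filter)
 have "~ ?A <= B1 Un B2 Un N"
 proof
  assume sub: "?A <= B1 Un B2 Un N"
  define V where "V = unit_ball_vol (real CARD('m)) * (eps * t) ^ CARD('m)"
  have V: "0 < V" using eps t by (simp add: V_def)
  have eV: "vol (?A) = en V" using eps t by (simp add: V_def emeasure_lborel_ball_cart)
  have "en V <= vol (B1 Un B2 Un N)" unfolding eV[symmetric] using sub B1 B2 N by (intro emeasure_mono) auto
  also have "... = vol (B1 Un B2)" using N B1 B2 by (intro emeasure_Un_null_set) auto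
  also have "... <= vol B1 + vol B2" using B1 B2 by (intro emeasure_subadditive) auto
  also have "... <= en (1/3) * en V + en (1/3) * en V" using B1(3) B2(3) unfolding eV by (rule add_mono)
  also have "... = en (1/3 * V + 1/3 * V)" using V by (intro ennreal_lincomb[symmetric]) auto
  finally have "V <= 1/3 * V + 1/3 * V" using V by simp
  then show False using V by simp
 qed
 then obtain x where x: "x : ?A" "x ~: B1" "x ~: B2" "x ~: N" by blast
 then show ?thesis using B1(2) B2(2) N(2) t(1) by (intro exI[of _ t]) auto
qed

text \<open>Dividing the inequality by t at a common good point gives the claim up to an arbitrary
  error. With its counterpart \<open>derivative_le_dir_norm\<close> it squeezes the directional part
  of \<open>Df\<close> between derivatives of distance functions from below and arbitrary upper
  gradients from above.\<close>

theorem dir_norm_le_upper_gradient: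
 fixes f :: "real ^ 'm => ('b::hilbert, 'q::finite) qtuple" and w :: "real ^ 'm => real"
 assumes f: "f : BM" and U: "open U" "a : U" and A: "approx_affine U f a A"
  and w: "w : BM" "integrable lborel w" "lebesgue_point w a"
  and ug: "!!t. 0 < t ==> upper_grad U e t f w"
 shows "dir_norm A e <= w a"
proof (rule field_le_epsilon)
 fix et :: real assume "0 < et"
 then have h: "0 < et / 2" by simp
 obtain t x where t: "0 < t" and x: "dist (f (x + t *: e)) (f x) <= line_int e t w x"
  "\<bar>dist (f (x + t *: e)) (f x) - t * dir_norm A e\<bar> <= et/2 * t" "norm (line_int e t w x - t *: w a) <= et/2 * t"
  using common_good_point[OF f U A h w, where e=e and
   P="%t x. x : U & x + t *: e : U --> dist (f (x + t *: e)) (f x) <= line_int e t w x"] ug by auto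
 have "t * dir_norm A e <= dist (f (x + t *: e)) (f x) + et/2 * t" using x(2) by linarith
 moreover have "line_int e t w x <= t * w a + et/2 * t" using x(3) unfolding real_norm_def real_scaleR_def by linarith
 moreover have "t * (w a + et) = t * w a + et/2 * t + et/2 * t" by (simp add: algebra_simps)
 ultimately have "t * dir_norm A e <= t * (w a + et)" using x(1) by simp
 then show "dir_norm A e <= w a + et" using t by simp
qed

theorem derivative_le_dir_norm:
 fixes f :: "real ^ 'm => ('b::hilbert, 'q::finite) qtuple" and w :: "real ^ 'm => real"
 assumes f: "f : BM" and U: "open U" "a : U" and A: "approx_affine U f a A"
  and w: "w : BM" "integrable lborel w" "lebesgue_point w a"
  and der: "!!t. 0 < t ==> AA x:U;t *: e. line_int e t w x <= dist (f (x + t *: e)) (f x)"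
 shows "w a <= dir_norm A e"
proof (rule field_le_epsilon)
 fix et :: real assume "0 < et"
 then have h: "0 < et / 2" by simp
 obtain t x where t: "0 < t" and x: "line_int e t w x <= dist (f (x + t *: e)) (f x)"
  "\<bar>dist (f (x + t *: e)) (f x) - t * dir_norm A e\<bar> <= et/2 * t" "norm (line_int e t w x - t *: w a) <= et/2 * t"
  using common_good_point[OF f U A h w, where e=e and
   P="%t x. x : U & x + t *: e : U --> line_int e t w x <= dist (f (x + t *: e)) (f x)"] der by auto
 have "dist (f (x + t *: e)) (f x) <= t * dir_norm A e + et/2 * t" using x(2) by linarith
 moreover have "t * w a <= line_int e t w x + et/2 * t" using x(3) unfolding real_norm_def real_scaleR_def by linarith
 moreover have "t * (dir_norm A e + et) = t * dir_norm A e + et/2 * t + et/2 * t" by (simp add: algebra_simps)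
 ultimately have "t * w a <= t * (dir_norm A e + et)" using x(1) by simp
 then show "w a <= dir_norm A e + et" using t by simp
qed

section \<open>Uniqueness of the approximate differential\<close>

text \<open>Two density zero sets together fill at most half of the small ball around a + t y; at
  any other point of it both affine tuples are close to \<open>f\<close>, and their Lipschitz
  constants transfer this to the centre.\<close>

lemma approx_affine_pair_close:
 fixes f :: "real ^ 'm => ('b::hilbert, 'q::finite) qtuple"
 assumes f: "f : BM" and U: "open U" "a : U" and A: "approx_affine U f a A" "approx_affine U f a A'" and et: "0 < et"
 shows "EX t0>0. ALL t. 0 < t & t < t0 --> dist (qtuple (%i. A i (a + t *: y))) (qtuple (%i. A' i (a + t *: y))) <= et * t"
proof -
 have Ub: "U : sets borel" using U by simp
 have aff: "affine_map (A i)" "affine_map (A' i)" for i using A by (simp_all add: approx_affine_def)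
 obtain K where K: "0 <= K" "!!x y. dist (qtuple (%i. A i x)) (qtuple (%i. A i y)) <= K * dist x y"
  using affine_map_lipschitz[of A] aff by auto
 obtain K' where K': "0 <= K'" "!!x y. dist (qtuple (%i. A' i x)) (qtuple (%i. A' i y)) <= K' * dist x y"
  using affine_map_lipschitz[of A'] aff by auto
 define k where "k = K + K' + 1"
 have k: "0 < k" using K K' by (simp add: k_def)
 define eps where "eps = min 1 (et / (4 * k))"
 have eps: "0 < eps" "eps <= 1" using et k by (auto simp: eps_def)
 have keps: "k * eps <= et / 4"
 proof -
  have "k * eps <= k * (et / (4 * k))" using k by (intro mult_left_mono) (auto simp: eps_def)
  then show ?thesis using k by simp
 qed
 define R where "R = norm y + 1"
 have R: "0 < R" by (simp add: R_def add_nonneg_pos)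
 define et' where "et' = et / (4 * R)"
 have et': "0 < et'" using et R by (simp add: et'_def)
 define S where "S = {x:U. dist (f x) (qtuple (%i. A i x)) > et' * norm (x - a)}"
 define S' where "S' = {x:U. dist (f x) (qtuple (%i. A' i x)) > et' * norm (x - a)}"
 have S: "S : sets borel" "null_density S a"
  unfolding S_def by (rule approx_affine_null_density[OF f Ub A(1) et'])+
 have S': "S' : sets borel" "null_density S' a"
  unfolding S'_def by (rule approx_affine_null_density[OF f Ub A(2) et'])+
 have T: "S Un S' : sets borel" "null_density (S Un S') a" using S S' by (auto intro: null_density_Un)
 obtain R0 where R0: "0 < R0" "ball a R0 <= U" using U by (meson open_contains_ball)
 obtain t1 where t1: "0 < t1" "!!t. 0 < t ==> t < t1 ==> vol ((S Un S') Int ball (a + t *: y) (eps * t)) <= en (1/2) * vol (ball (a + t *: y) (eps * t))"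
  using null_density_offset_ball[OF T(2,1) eps, of "1/2" y] by auto
 have "dist (qtuple (%i. A i (a + t *: y))) (qtuple (%i. A' i (a + t *: y))) <= et * t" if t: "0 < t" "t < min t1 (R0 / R)" for t
 proof -
  let ?z = "a + t *: y"
  let ?A = "ball ?z (eps * t)"
  have "~ ?A <= S Un S'"
  proof
   assume "?A <= S Un S'"
   then have "(S Un S') Int ?A = ?A" by blast
   then have le: "vol (?A) <= en (1/2) * vol (?A)" using t1(2)[of t] t by simp
   define V where "V = unit_ball_vol (real CARD('m)) * (eps * t) ^ CARD('m)"
   have V: "0 < V" using eps t by (simp add: V_def)
   have eV: "vol (?A) = en V" using eps t by (simp add: V_def emeasure_lborel_ball_cart)
   have "en V <= en (1/2 * V)" using le unfolding eV by (subst ennreal_mult') auto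
   then show False using V by simp
  qed
  then obtain x where x: "x : ?A" "x ~: S" "x ~: S'" by blast
  have epst: "eps * t <= 1 * t" using eps t by simp
  have dx: "dist x a <= R * t"
  proof -
   have "dist x a <= dist x ?z + dist ?z a" by (rule dist_triangle)
   also have "dist ?z a = norm y * t" using t by (simp add: dist_norm)
   also have "dist x ?z <= t" using x(1) epst by (simp add: dist_commute)
   finally show ?thesis by (simp add: R_def algebra_simps)
  qed
  have "t * R < R0" using t R by (simp add: pos_less_divide_eq)
  then have "x : U" using dx R0(2) by (auto simp: dist_commute mult.commute)
  then have le: "dist (f x) (qtuple (%i. A i x)) <= et' * dist x a" "dist (f x) (qtuple (%i. A' i x)) <= et' * dist x a"
   using x by (auto simp: S_def S'_def dist_norm)
  have "et' * dist x a <= et' * (R * t)" using dx et' by simp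
  also have "... = et * t / 4" using R by (simp add: et'_def)
  finally have et'x: "et' * dist x a <= et * t / 4" .
  have xz: "dist x ?z <= eps * t" using x(1) by (simp add: dist_commute)
  have "K * dist x ?z + K' * dist x ?z <= k * (eps * t)"
  proof -
   have "(K + K') * dist x ?z <= k * (eps * t)" using xz k eps t by (intro mult_mono) (auto simp: k_def)
   then show ?thesis by (simp add: distrib_right)
  qed
  also have "... <= et / 4 * t" using mult_right_mono[OF keps, of t] t by simp
  finally have "K * dist x ?z + K' * dist x ?z <= et * t / 4" by simp
  moreover have "0 <= et * t" using et t by simp
  ultimately show ?thesis
   using le et'x K(2)[of x ?z] K'(2)[of x ?z]
    dist_triangle[of "qtuple (%i. A i ?z)" "qtuple (%i. A' i ?z)" "f x"]
    dist_triangle3[of "qtuple (%i. A i ?z)" "f x" "qtuple (%i. A i x)"]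
    dist_triangle3[of "f x" "qtuple (%i. A' i ?z)" "qtuple (%i. A' i x)"]
   unfolding dist_commute[of "qtuple (%i. A i x)" "f x"] dist_commute[of "qtuple (%i. A' i x)" "f x"]
   by simp
 qed
 then show ?thesis using t1(1) R0(1) R by (intro exI[of _ "min t1 (R0 / R)"]) auto
qed

lemma le_0_if_le_inverse_infinite:
 assumes "infinite N" "!!n. n : N ==> x <= c / real (Suc n)" "0 <= c"
 shows "x <= (0::real)"
proof (rule ccontr)
 assume "~ x <= 0"
 obtain m where m: "c / x < real m" using reals_Archimedean2 by blast
 obtain n where n: "n : N" "m <= n" using assms(1) by (meson infinite_nat_iff_unbounded_le)
 have "x * real (Suc n) <= c" using assms(2)[OF n(1)] by (simp add: pos_le_divide_eq)
 moreover have "c < x * real (Suc n)" using m n(2) `~ x <= 0` by (simp add: pos_divide_less_eq mult.commute) (smt (verit) mult_left_mono of_nat_mono)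
 ultimately show False by simp
qed

text \<open>For scales tending to 0 an optimal matching of both tuples at a + t y is recorded. There
  are finitely many permutations, so one occurs for infinitely many scales; for this one the values
  at \<open>a\<close> must agree first, and then the slopes in direction \<open>y\<close>.\<close>

lemma approx_affine_directional_unique:
 fixes f :: "real ^ 'm => ('b::hilbert, 'q::finite) qtuple"
 assumes f: "f : BM" and U: "open U" "a : U" and A: "approx_affine U f a A" "approx_affine U f a A'"
 shows "EX sg. bij sg & (ALL i. A i y - A i 0 = A' (sg i) y - A' (sg i) 0)"
proof -
 have aff: "affine_map (A i)" "affine_map (A' i)" for i using A by (simp_all add: approx_affine_def)
 have "EX t sg. 0 < t & t <= 1 / real (Suc n) & bij sg &
  (ALL i. dist (A i (a + t *: y)) (A' (sg i) (a + t *: y)) <= t / real (Suc n))" for n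
 proof -
  obtain t0 where t0: "0 < t0" "!!t. 0 < t ==> t < t0 ==> dist (qtuple (%i. A i (a + t *: y))) (qtuple (%i. A' i (a + t *: y))) <= (1 / real (Suc n)) * t"
   using approx_affine_pair_close[OF f U A, of "1 / real (Suc n)" y] by auto
  define t where "t = min (t0 / 2) (1 / real (Suc n))"
  have t: "0 < t" "t < t0" "t <= 1 / real (Suc n)" using t0(1) by (auto simp: t_def)
  let ?A = "%i. A' i (a + t *: y)"
  obtain w where w: "!!i. dist (A i (a + t *: y)) (w i) <= dist (qtuple (%i. A i (a + t *: y))) (qtuple ?A)"
   "EX sg. bij sg & w = ?A \<circ> sg"
   by (rule dist_qtuple_attained[of "%i. A' i (a + t *: y)" "%i. A i (a + t *: y)"]) blast
  then obtain sg where sg: "bij sg" "w = ?A \<circ> sg" by blast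
  have "dist (A i (a + t *: y)) (A' (sg i) (a + t *: y)) <= t / real (Suc n)" for i
   using w(1)[of i] t0(2)[OF t(1,2)] by (simp add: sg(2))
  then show ?thesis using t sg(1) by blast
 qed
 then have "ALL n. EX p. 0 < fst p & fst p <= 1 / real (Suc n) & bij (snd p) &
  (ALL i. dist (A i (a + fst p *: y)) (A' (snd p i) (a + fst p *: y)) <= fst p / real (Suc n))" by simp
 from choice[OF this] obtain P where P: "!!n. 0 < fst (P n)" "!!n. fst (P n) <= 1 / real (Suc n)" "!!n. bij (snd (P n))"
  "!!n i. dist (A i (a + fst (P n) *: y)) (A' (snd (P n) i) (a + fst (P n) *: y)) <= fst (P n) / real (Suc n)" by blast
 let ?B = "%n. snd (P n)"
 have "finite (range ?B)" by simp
 then obtain sg where sg: "sg : range ?B" "infinite (?B -` {sg})"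
  using inf_img_fin_domE[of "%n. snd (P n)" UNIV] by auto
 define N where "N = ?B -` {sg}"
 have bij: "bij sg" using sg(1) P(3) by auto
 have "A i y - A i 0 = A' (sg i) y - A' (sg i) 0" for i
 proof -
  define d where "d = A i a - A' (sg i) a"
  define e where "e = (A i y - A i 0) - (A' (sg i) y - A' (sg i) 0)"
  have de: "norm (d + fst (P n) *: e) <= fst (P n) / real (Suc n)" if "n : N" for n
  proof -
   have "d + fst (P n) *: e = A i (a + fst (P n) *: y) - A' (sg i) (a + fst (P n) *: y)"
    by (simp add: d_def e_def affine_map_add[OF aff(1)] affine_map_add[OF aff(2)] algebra_simps)
   then show ?thesis using P(4)[of i n] that by (simp add: N_def dist_norm)
  qed
  have "norm d <= 0"
  proof (rule le_0_if_le_inverse_infinite[where c="norm e + 1"])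
   show "infinite N" using sg(2) by (simp add: N_def)
   fix n assume n: "n : N"
   have "norm d <= norm (d + fst (P n) *: e) + norm (fst (P n) *: e)" using norm_triangle_ineq4[of "d + fst (P n) *: e" "fst (P n) *: e"] by simp
   also have "... <= fst (P n) / real (Suc n) + fst (P n) * norm e" using de[OF n] P(1)[of n] by simp
   also have "fst (P n) / real (Suc n) <= fst (P n) / 1" using P(1)[of n] by (intro divide_left_mono) auto
   finally have "norm d <= fst (P n) * (norm e + 1)" by (simp add: distrib_left)
   also have "... <= 1 / real (Suc n) * (norm e + 1)" using P(2) by (intro mult_right_mono) auto
   finally show "norm d <= (norm e + 1) / real (Suc n)" by simp
  qed simp
  then have d0: "d = 0" by simp
  have "norm e <= 0"
  proof (rule le_0_if_le_inverse_infinite[where c=1])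
   show "infinite N" using sg(2) by (simp add: N_def)
   fix n assume n: "n : N"
   have "fst (P n) * norm e <= fst (P n) * (1 / real (Suc n))" using de[OF n] P(1)[of n] by (simp add: d0)
   then show "norm e <= 1 / real (Suc n)" using P(1)[of n] by (rule mult_left_le_imp_le)
  qed simp
  then show ?thesis by (simp add: e_def)
 qed
 then show ?thesis using bij by blast
qed

text \<open>The permutation found above depends on the direction \<open>y\<close>. The directions
  served by a given permutation form a subspace, and finitely many proper subspaces are negligible
  and cannot cover the space; so one permutation serves all directions.\<close>

theorem approx_affine_unique:
 fixes f :: "real ^ 'm => ('b::hilbert, 'q::finite) qtuple"
 assumes f: "f : BM" and U: "open U" "a : U" and A: "approx_affine U f a A" "approx_affine U f a A'"
 shows "qtuple (%i x. A i x - A i 0) = qtuple (%i x. A' i x - A' i 0)"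
proof -
 have aff: "linear (%x. A i x - A i 0)" "linear (%x. A' i x - A' i 0)" for i using A by (simp_all add: approx_affine_def affine_map_def)
 define V where "V sg = {y. ALL i. A i y - A i 0 = A' (sg i) y - A' (sg i) 0}" for sg
 have sub: "subspace (V sg)" for sg
 proof -
  have "V sg = (\<Inter>i. {y. (A i y - A i 0) - (A' (sg i) y - A' (sg i) 0) = 0})" by (auto simp: V_def)
  moreover have "subspace {y. (A i y - A i 0) - (A' (sg i) y - A' (sg i) 0) = 0}" for i
   by (rule linear_subspace_kernel[OF linear_compose_sub[OF aff(1) aff(2)]])
  ultimately show ?thesis by (auto intro: subspace_Inter)
 qed
 have "EX sg. bij sg & V sg = UNIV"
 proof (rule ccontr)
  assume no: "~ (EX sg. bij sg & V sg = UNIV)"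
  have "negligible (V sg)" if "bij sg" for sg
  proof (rule negligible_lowdim)
   have "V sg ~= UNIV" using no that by blast
   then show "dim (V sg) < DIM(real ^ 'm)" using sub[of sg] by (metis dim_eq_full dim_subset_UNIV le_neq_implies_less span_eq_iff)
  qed
  then have "negligible (UN sg:{sg. bij sg}. V sg)" by auto
  moreover have "(UN sg:{sg. bij sg}. V sg) = UNIV"
   using approx_affine_directional_unique[OF f U A] by (auto simp: V_def)
  ultimately show False by simp
 qed
 then obtain sg where sg: "bij sg" "V sg = UNIV" by blast
 then have "(%i x. A i x - A i 0) = (%i x. A' i x - A' i 0) \<circ> sg" by (auto simp: V_def fun_eq_iff)
 then show ?thesis
  unfolding qtuple.abs_eq_iff using sg(1) by (intro perm_equiv_sym[of "%i x. A' i x - A' i 0"]) (auto simp: perm_equiv_def)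
qed

lemma Df_eq:
 fixes f :: "real ^ 'm => ('b::hilbert, 'q::finite) qtuple"
 assumes "f : BM" "open U" "a : U" "approx_affine U f a A"
 shows "Df U f a = qtuple (%i x. A i x - A i 0)"
 unfolding Df_def
proof (rule the_equality)
 show "EX B. approx_affine U f a B & qtuple (%i x. A i x - A i 0) = qtuple (%i x. B i x - B i 0)"
  using assms(4) by auto
 fix D assume "EX B. approx_affine U f a B & D = qtuple (%i x. B i x - B i 0)"
 then obtain B where B: "approx_affine U f a B" "D = qtuple (%i x. B i x - B i 0)" by auto
 show "D = qtuple (%i x. A i x - A i 0)"
  unfolding B(2) by (rule approx_affine_unique[OF assms(1-3) B(1) assms(4)])
qed

definition dir_deriv :: "(real ^ 'm) set => (real ^ 'm => ('a::real_normed_vector, 'q::finite) qtuple) => real ^ 'm => real ^ 'm => real"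
 where "dir_deriv U f e a = sqrt (qsum (%L. (norm (L e))^2) (Df U f a))"

lemma dir_deriv_eq:
 fixes f :: "real ^ 'm => ('b::hilbert, 'q::finite) qtuple"
 assumes "f : BM" "open U" "a : U" "approx_affine U f a A"
 shows "dir_deriv U f e a = dir_norm A e"
 unfolding dir_deriv_def Df_eq[OF assms] dir_norm_def by (simp add: qsum.abs_eq)

lemma Df_norm_eq:
 fixes f :: "real ^ 'm => ('b::hilbert, 'q::finite) qtuple"
 assumes "f : BM" "open U" "a : U" "approx_affine U f a A"
 shows "Df_norm (Df U f a) = sqrt (SUM k:UNIV. (dir_deriv U f (axis k 1) a)^2)"
proof -
 have "(SUM k:UNIV. (dir_deriv U f (axis k 1) a)^2) = (SUM k:UNIV. SUM i:UNIV. (norm (A i (axis k 1) - A i 0))^2)"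
  unfolding dir_deriv_eq[OF assms] dir_norm_def by (simp add: sum_nonneg)
 also have "... = (SUM i:UNIV. SUM k:UNIV. (norm (A i (axis k 1) - A i 0))^2)" by (rule sum.swap)
 finally show ?thesis unfolding Df_norm_def Df_eq[OF assms] by (simp add: qsum.abs_eq)
qed

lemma dir_deriv_le_Df_norm:
 fixes f :: "real ^ 'm => ('b::hilbert, 'q::finite) qtuple"
 assumes "f : BM" "open U" "a : U" "approx_affine U f a A"
 shows "dir_deriv U f e a <= norm e * Df_norm (Df U f a)"
proof -
 have lin: "linear (%x. A i x - A i 0)" for i using assms(4) by (simp add: approx_affine_def affine_map_def)
 have each: "(norm (A i e - A i 0))^2 <= (norm e)^2 * (SUM k:UNIV. (norm (A i (axis k 1) - A i 0))^2)" for i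
 proof -
  let ?B = "L2_set (%k. norm (A i (axis k 1) - A i 0)) UNIV"
  have "A i e - A i 0 = (SUM k:UNIV. e $ k *: (A i (axis k 1) - A i 0))"
   using linear_sum[OF lin, of i "%k. e $ k *: axis k 1" UNIV] basis_expansion[of e]
   by (simp add: linear_scale[OF lin] scalar_mult_eq_scaleR)
  then have "norm (A i e - A i 0) <= (SUM k:UNIV. \<bar>e $ k\<bar> * norm (A i (axis k 1) - A i 0))"
   using norm_sum[of "%k. e $ k *: (A i (axis k 1) - A i 0)" UNIV] by simp
  also have "... <= L2_set (%k. e $ k) UNIV * ?B"
   using L2_set_mult_ineq[of "%k. e $ k" "%k. norm (A i (axis k 1) - A i 0)" UNIV] by simp
  finally have "(norm (A i e - A i 0))^2 <= (L2_set (%k. e $ k) UNIV * ?B)^2"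
   by simp
  also have "... = (norm e)^2 * (SUM k:UNIV. (norm (A i (axis k 1) - A i 0))^2)"
   by (simp add: power_mult_distrib L2_set_def sum_nonneg norm_vec_def)
  finally show ?thesis .
 qed
 have "(SUM i:UNIV. (norm (A i e - A i 0))^2) <= (SUM i:UNIV. (norm e)^2 * (SUM k:UNIV. (norm (A i (axis k 1) - A i 0))^2))"
  by (intro sum_mono each)
 also have "... = (norm e)^2 * (SUM i:UNIV. SUM k:UNIV. (norm (A i (axis k 1) - A i 0))^2)" by (simp add: sum_distrib_left)
 finally have "dir_norm A e <= sqrt ((norm e)^2 * (SUM i:UNIV. SUM k:UNIV. (norm (A i (axis k 1) - A i 0))^2))"
  unfolding dir_norm_def by simp
 also have "... = norm e * Df_norm (Df U f a)"
  unfolding Df_norm_def Df_eq[OF assms] by (simp add: qsum.abs_eq real_sqrt_mult)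
 finally show ?thesis unfolding dir_deriv_eq[OF assms] .
qed

section \<open>Null sets on lines, Jensen's inequality, almost everywhere convergent
  subsequences\<close>

lemma AE_lborel_translate:
 assumes "AA x. P x"
 shows "AA x. P (x + h :: 'a::euclidean_space)"
proof -
 obtain N where N: "N : null_sets lborel" "{x. ~ P x} <= N" using assms by (auto simp: eventually_ae_filter)
 then have [measurable]: "N : sets borel" by auto
 have "vol {x. x + h : N} = (NN x. ind {x. x + h : N} x)" by simp
 also have "... = (NN x. ind N (x + h))" by (intro nn_integral_cong) (simp add: indicator_def)
 also have "... = (NN x. ind N x)" by (rule nn_integral_translate) simp
 also have "... = 0" using N by auto
 finally have "{x. x + h : N} : null_sets lborel" by auto
 then show ?thesis using N(2) by (intro AE_I'[of "{x. x + h : N}"]) auto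
qed

lemma AE_AE_line:
 assumes "AA x. P (x :: 'a::euclidean_space)"
 shows "AA x. AA s. s : {0..t} --> P (x + s *: e)"
proof (cases "0 <= t")
 case True
 obtain N where N: "N : null_sets lborel" "{x. ~ P x} <= N" using assms by (auto simp: eventually_ae_filter)
 then have [measurable]: "N : sets borel" by auto
 have "(NN x:UNIV. NN s:{0..t}. ind N (x + s *: e)) <= en t * (NN x:UNIV. ind N x)"
  using True by (intro nn_integral_line_le) auto
 also have "... = 0" using N by auto
 finally have "(NN x. (NN s:{0..t}. ind N (x + s *: e))) = 0" by simp
 then have "AA x. (NN s:{0..t}. ind N (x + s *: e)) = 0"
  by (subst (asm) nn_integral_0_iff_AE) auto
 then show ?thesis
 proof eventually_elim
  case (elim x)
  then have "AA s. ind N (x + s *: e) * ind {0..t} s = (0 :: ennreal)"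
   by (subst (asm) nn_integral_0_iff_AE) auto
  then show ?case by eventually_elim (use N(2) in "auto")
 qed
qed simp

lemma AE_line_int_mono_AE:
 fixes a b :: "'a::euclidean_space => real"
 assumes "a : BM" "integrable lborel a" "b : BM" "integrable lborel b"
  and "AA x. a x <= b x"
 shows "AA x. line_int e t a x <= line_int e t b x"
 using AE_set_integrable_line[OF assms(1,2), of t e] AE_set_integrable_line[OF assms(3,4), of t e] AE_AE_line[OF assms(5), of t e]
proof eventually_elim
 case (elim x)
 show ?case unfolding line_int_def set_lebesgue_integral_def
 proof (rule integral_mono_AE)
  show "AA s. ind {0..t} s *: a (x + s *: e) <= ind {0..t} s *: b (x + s *: e)"
   using elim(3) by eventually_elim (auto simp: indicator_def)
 qed (use elim in "auto simp: set_integrable_def")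
qed

lemma AE_line_int_nth:
 assumes "w : BM" "integrable lborel w"
 shows "AA x. line_int e t w x $ k = line_int e t (%x. w x $ k) x"
 using AE_set_integrable_line[OF assms, of t e]
proof eventually_elim
 case (elim x)
 then show ?case
  using integral_bounded_linear[OF bounded_linear_vec_nth[of k], of lborel "%s. ind {0..t} s *: w (x + s *: e)"]
  by (simp add: line_int_def set_lebesgue_integral_def set_integrable_def)
qed

lemma borel_measurable_vec_lambda [measurable]:
 fixes G :: "'n::finite => 'x => real"
 assumes [measurable]: "!!k. G k : borel_measurable M"
 shows "(%x. \<chi> k. G k x) : M \<rightarrow>\<^sub>M (borel :: (real ^ 'n) measure)"
proof -
 have "(\<chi> k. G k x) = (SUM k:UNIV. G k x *: axis k 1)" for x by (simp add: vec_eq_iff axis_def if_distrib cong: if_cong)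
 then show ?thesis by simp
qed

text \<open>The tangent inequality of the p-th power at the mean value, integrated over the
  interval; the linear term drops out.\<close>

lemma Jensen_unit_interval:
 fixes ph :: "real => real"
 assumes [measurable]: "ph : BM" and int: "set_integrable lborel {0..1} ph" and nn: "!!s. 0 <= ph s" and p: "1 < p"
 shows "en ((LINT s:{0..1}|lborel. ph s) powr p) <= (NN s:{0..1}. en (ph s powr p))"
proof (cases "(NN s:{0..1}. en (ph s powr p)) = oo")
 case False
 define m where "m = (LINT s:{0..1}|lborel. ph s)"
 have m: "0 <= m" unfolding m_def set_lebesgue_integral_def using nn by simp
 let ?B = "NN s. en (norm (ind {0..1} s *: ph s powr p))"
 let ?C = "set_integrable lborel"
 have pin: "?C {0..1} (%s. ph s powr p)"
  unfolding set_integrable_def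
 proof (rule integrableI_bounded)
  have "?B = (NN s:{0..1}. en (ph s powr p))"
   by (intro nn_integral_cong) (auto simp: indicator_def)
  then show "?B < oo" using False by (simp add: less_top)
 qed measurable
 have ci: "?C {0..1::real} (%s. c)" for c :: real
  unfolding set_integrable_def by simp
 have cI: "(LINT s:{0..1::real}|lborel. c) = c" for c :: real by (simp add: set_lebesgue_integral_def)
 have li: "?C {0..1} (%s. p * m powr (p - 1) * ph s)" using int by simp
 let ?A = "LINT s:{0..1}|lborel. ph s powr p"
 let ?D = "m powr p - p * m powr (p - 1) * m"
 have "m powr p = (LINT s:{0..1}|lborel. p * m powr (p - 1) * ph s) + (LINT s:{0..1::real}|lborel. m powr p - p * m powr (p - 1) * m)"
  by (simp add: cI m_def[symmetric])
 also have "... = (LINT s:{0..1}|lborel. p * m powr (p - 1) * ph s + ?D)"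
  by (rule set_integral_add(2)[OF li ci, symmetric])
 also have "... <= ?A"
 proof (rule set_integral_mono[OF set_integral_add(1)[OF li ci] pin])
  fix s
  show "p * m powr (p - 1) * ph s + ?D <= ph s powr p"
   using powr_tangent[OF m nn[of s] p] by (simp add: algebra_simps)
 qed
 finally have "m powr p <= ?A" .
 then have "en (m powr p) <= en ?A" by (rule ennreal_leI)
 also have "... = (NN s. en (ind {0..1} s *: ph s powr p))"
  using pin unfolding set_lebesgue_integral_def set_integrable_def by (intro nn_integral_eq_integral[symmetric]) auto
 also have "... = (NN s:{0..1}. en (ph s powr p))"
  by (intro nn_integral_cong) (auto simp: indicator_def)
 finally show ?thesis unfolding m_def .
qed simp

lemma powr_L1_AE_subseq:
 assumes [measurable]: "!!j. d j : borel_measurable M" and nn: "!!j x. 0 <= d j x" and p: "0 < p"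
  and lim: "(%j. \<integral>\<^sup>+x. en (d j x powr p) \<partial>M) ~~> 0"
 obtains r :: "nat => nat" where "strict_mono r" "AE x in M. (%j. d (r j) x) ~~> (0::real)"
proof -
 have "\<forall>\<^sub>F j in sequentially. (\<integral>\<^sup>+x. en (d j x powr p) \<partial>M) < 1" using lim by (rule order_tendstoD) simp
 then obtain N where N: "!!j. N <= j ==> (\<integral>\<^sup>+x. en (d j x powr p) \<partial>M) < 1" by (auto simp: eventually_sequentially)
 \<comment> \<open>The first integrals may be infinite; after dropping \<open>N\<close> of them
   every \<open>u j\<close> is integrable.\<close>
 define u where "u j x = d (j + N) x powr p" for j x
 have [measurable]: "u j : borel_measurable M" for j unfolding u_def by simp
 have ui: "integrable M (u j)" for j
  using N[of "j + N"] by (intro integrableI_bounded) (auto simp: u_def intro: order_less_trans)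
 have "(%j. LINT x|M. norm (u j x)) ~~> 0"
 proof -
  have "(%j. en (LINT x|M. norm (u j x))) ~~> en 0"
  proof -
   have "en (LINT x|M. norm (u j x)) = (\<integral>\<^sup>+x. en (d (j + N) x powr p) \<partial>M)" for j
    using nn_integral_eq_integral[OF integrable_norm[OF ui[of j]]] by (simp add: u_def)
   then show ?thesis using LIMSEQ_ignore_initial_segment[OF lim, of N] by simp
  qed
  then show ?thesis by (subst (asm) tendsto_ennreal_iff) auto
 qed
 from tendsto_L1_AE_subseq[OF ui this] obtain r where r: "strict_mono r" "AE x in M. (%j. u (r j) x) ~~> 0" by blast
 have "AE x in M. (%j. d (r j + N) x) ~~> 0"
  using r(2)
 proof eventually_elim
  case (elim x)
  have "(%j. (u (r j) x) powr (1 / p)) ~~> 0 powr (1 / p)"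
   using p by (intro tendsto_powr'[OF elim tendsto_const]) (auto simp: u_def)
  then show ?case using p nn by (simp add: u_def powr_powr)
 qed
 then show ?thesis using r(1) by (intro that[of "%j. r j + N"]) (auto simp: strict_mono_def)
qed

section \<open>Weak Sobolev maps and their minimal directional upper gradients\<close>

locale sobolev_domain =
 fixes U :: "(real ^ 'm) set" and p :: real
 assumes open_U: "open U" and convex_U: "convex U" and finite_U: "vol U < oo" and p: "1 < p"
begin

lemma U_borel [measurable]: "U : sets borel" using open_U by simp

text \<open>An intrinsic description without approximating sequences, stable under L_p limits with a
  uniform translation constant. On the ball it agrees with \<open>Sobolev\<close> up to the values
  off \<open>U\<close>, by \<open>SobolevD\<close> and \<open>weak_sobolev_Sobolev\<close>;
  integrability of the distances takes the place of membership in L_p.\<close>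

definition weak_sobolev :: "(real ^ 'm => ('b::hilbert, 'q::finite) qtuple) => bool"
 where "weak_sobolev f \<longleftrightarrow> f : BM & (ALL T. integrable lborel (%x. ind U x * dist (f x) T)) & (EX K. nik U p K f)"

lemma weak_sobolevD:
 assumes "weak_sobolev f"
 shows "f : BM" "integrable lborel (%x. ind U x * dist (f x) T)" "EX K. nik U p K f"
 using assms by (auto simp: weak_sobolev_def)

lemma AE_approx: "weak_sobolev f ==> AA a. a : U --> (EX A. approx_affine U f a A)"
 using AE_approx_affine[OF _ open_U convex_U finite_U p] weak_sobolevD by blast

lemma dir_deriv_minimal:
 assumes f: "weak_sobolev f" and w: "w : BM" "integrable lborel w"
  and ug: "!!t. 0 < t ==> upper_grad U e t f w"
 shows "AA a. a : U --> dir_deriv U f e a <= w a"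
 using AE_approx[OF f] AE_lebesgue_point[OF w(2)]
proof eventually_elim
 case (elim a)
 show ?case
 proof
  assume a: "a : U"
  then obtain A where A: "approx_affine U f a A" using elim by blast
  show "dir_deriv U f e a <= w a"
   unfolding dir_deriv_eq[OF weak_sobolevD(1)[OF f] open_U a A]
   by (rule dir_norm_le_upper_gradient[OF weak_sobolevD(1)[OF f] open_U a A w elim(2) ug])
 qed
qed

text \<open>\<open>g\<close> is the supremum, over a countable dense set of \<open>T\<close>, of the
  derivatives of the distance functions to \<open>T\<close>. It lies below \<open>dir_deriv\<close>
  by \<open>derivative_le_dir_norm\<close>; being an upper gradient itself, it also lies above by
  minimality. The result is a sharp upper gradient and at the same time a Borel representative of
  \<open>dir_deriv\<close>, whose measurability is not evident from its definition.\<close>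

theorem dir_deriv_upper_gradient:
 fixes f :: "real ^ 'm => ('b::hilbert, 'q::finite) qtuple"
 assumes f: "weak_sobolev f"
 obtains g :: "real ^ 'm => real" where "g : BM" "integrable lborel g" "!!x. 0 <= g x" "!!x. x ~: U ==> g x = 0"
  "AA a. a : U --> dir_deriv U f e a = g a"
  "!!t. 0 < t ==> upper_grad U e t f g"
proof -
 note fb [measurable] = weak_sobolevD(1)[OF f]
 obtain K where K: "nik U p K f" using weak_sobolevD(3)[OF f] by blast
 obtain w :: "real ^ 'm => real" where w: "w : BM" "integrable lborel w" "!!x. x ~: U ==> w x = 0"
  "!!t. 0 < t ==> upper_grad U e t f w"
  by (rule metric_upper_gradient[where e=e, OF fb weak_sobolevD(2)[OF f] open_U convex_U finite_U p K]) simp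
 let ?A = "%a. dir_deriv U f e a"
 have dw: "AA a. a : U --> (?A a) <= w a" by (rule dir_deriv_minimal[OF f w(1,2,4)])
 obtain D :: "('b, 'q) qtuple set" where D: "countable D" "!!X. open X ==> X ~= {} ==> EX d:D. d : X"
  using countable_dense_exists by blast
 have "EX v :: real ^ 'm => real. v : BM & integrable lborel v & (ALL x. x ~: U --> v x = 0) &
  (ALL t>0. AA x:U;t *: e. dist (f (x + t *: e)) T - dist (f x) T = line_int e t v x)" for T
 proof -
  define u where "u x = ind U x * dist (f x) T" for x
  have um: "u : BM" unfolding u_def by simp
  have ui: "integrable lborel u" unfolding u_def by (rule weak_sobolevD(2)[OF f])
  have nu: "nik U p (1 powr p * K) u"
  proof -
   have "nik U p (1 powr p * K) (%x. dist (f x) T)"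
   proof (rule nik_comp_lipschitz[OF K _ _ p fb U_borel])
    show "dist (dist a T) (dist b T) <= 1 * dist a b" for a b
     using abs_dist_diff_le[of a T b] by (simp add: dist_real_def dist_commute[of T b])
   qed simp
   then show ?thesis by (subst nik_cong[where g="%x. dist (f x) T"]) (auto simp: u_def)
  qed
  obtain v where v: "v : BM" "integrable lborel v" "!!x. x ~: U ==> v x = 0"
   "!!t. 0 < t ==> AA x:U;t *: e. u (x + t *: e) - u x = line_int e t v x"
   by (rule hilbert_directional_derivative[where e=e, OF um ui open_U convex_U finite_U p nu]) simp
  have "AA x:U;t *: e. dist (f (x + t *: e)) T - dist (f x) T = line_int e t v x" if "0 < t" for t
   using v(4)[OF that] by eventually_elim (auto simp: u_def)
  then show ?thesis using v by blast
 qed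
 then have "ALL T. EX v :: real ^ 'm => real. v : BM & integrable lborel v & (ALL x. x ~: U --> v x = 0) &
  (ALL t>0. AA x:U;t *: e. dist (f (x + t *: e)) T - dist (f x) T = line_int e t v x)" ..
 from choice[OF this] obtain v :: "('b, 'q) qtuple => real ^ 'm => real" where v: "!!T. v T : BM" "!!T. integrable lborel (v T)" "!!T x. x ~: U ==> v T x = 0"
  "!!T t. 0 < t ==> AA x:U;t *: e. dist (f (x + t *: e)) T - dist (f x) T = line_int e t (v T) x"
  by blast
 note v(1) [measurable]
 have vd: "AA a. a : U --> v T a <= (?A a)" for T
  using AE_approx[OF f] AE_lebesgue_point[OF v(2)[of T]]
 proof eventually_elim
  case (elim a)
  show ?case
  proof
   assume a: "a : U"
   then obtain A where A: "approx_affine U f a A" using elim by blast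
   show "v T a <= dir_deriv U f e a"
    unfolding dir_deriv_eq[OF fb open_U a A]
   proof (rule derivative_le_dir_norm[OF fb open_U a A v(1,2) elim(2)])
    fix t :: real assume "0 < t"
    from v(4)[OF this, of T] show "AA x:U;t *: e. line_int e t (v T) x <= dist (f (x + t *: e)) (f x)"
    proof eventually_elim
     case (elim x)
     then show ?case using dist_triangle[of "f (x + t *: e)" T "f x"] by auto
    qed
   qed
  qed
 qed
 \<comment> \<open>\<open>en\<close> cuts negative derivatives to 0. The supremum is finite almost
   everywhere since \<open>dir_deriv\<close> bounds every member, so \<open>enn2real\<close> loses
   nothing there.\<close>
 define g where "g x = enn2real (SUP T\<in>D. en (v T x))" for x
 have gm [measurable]: "g : BM" unfolding g_def using D(1) by simp
 have g0: "0 <= g x" for x by (simp add: g_def)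
 have gU: "g x = 0" if "x ~: U" for x
 proof -
  have "(SUP T\<in>D. en (v T x)) <= 0" using v(3)[OF that] by (intro SUP_least) simp
  then show ?thesis by (simp add: g_def)
 qed
 have "AA a. ALL T:D. a : U --> v T a <= (?A a)"
  unfolding AE_ball_countable[OF D(1)] using vd by blast
 then have both: "AA a. (a : U --> g a <= (?A a)) & (ALL T:D. v T a <= g a)"
 proof eventually_elim
  case (elim a)
  show ?case
  proof (cases "a : U")
   case True
   have dd: "0 <= dir_deriv U f e a" by (simp add: dir_deriv_def qsum_def sum_nonneg)
   have le: "(SUP T\<in>D. en (v T a)) <= en (dir_deriv U f e a)"
    using elim True by (intro SUP_least ennreal_leI) auto
   then have "g a <= dir_deriv U f e a" unfolding g_def using dd by (intro enn2real_leI)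
   moreover have "v T a <= g a" if "T : D" for T
   proof -
    have "en (v T a) <= (SUP T\<in>D. en (v T a))" using that by (intro SUP_upper)
    also have "... = en (g a)" unfolding g_def using le by (intro ennreal_enn2real[symmetric]) (auto intro: le_less_trans)
    finally show ?thesis using g0[of a] by simp
   qed
   ultimately show ?thesis by blast
  next
   case False
   then show ?thesis using gU v(3) by simp
  qed
 qed
 have gi: "integrable lborel g"
 proof (rule Bochner_Integration.integrable_bound[OF w(2)])
  show "AA x. norm (g x) <= norm (w x)"
   using both dw
  proof eventually_elim
   case (elim x)
   then show ?case using g0[of x] gU[of x] by auto
  qed
 qed measurable
 have ug: "upper_grad U e t f g" if t: "0 < t" for t
 proof -
  have "AA x. ALL T:D. x : U & x + t *: e : U --> dist (f (x + t *: e)) T - dist (f x) T <= line_int e t g x"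
   unfolding AE_ball_countable[OF D(1)]
  proof
   fix T assume T: "T : D"
   have "AA x. v T x <= g x" using both by eventually_elim (use T in auto)
   from AE_line_int_mono_AE[OF v(1,2) gm gi this, of e t] v(4)[OF t, of T]
   show "AA x:U;t *: e. dist (f (x + t *: e)) T - dist (f x) T <= line_int e t g x"
    by auto
  qed
  then show ?thesis by eventually_elim (use dist_le_if_countable_dense[OF D(2)] in blast)
 qed
 have "AA a. a : U --> (?A a) <= g a" by (rule dir_deriv_minimal[OF f gm gi ug])
 with both have "AA a. a : U --> (?A a) = g a"
  by auto
 then show ?thesis using that[of g] gm gi g0 gU ug by blast
qed

lemma energy_eq:
 "energy U p f = (NN x:U. en (Df_norm (Df U f x) powr p))"
 unfolding energy_def by (subst nn_integral_restrict_space) auto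

lemma Df_norm_AE_eq:
 assumes f: "weak_sobolev f" and g: "!!k. AA a. a : U --> dir_deriv U f (axis k 1) a = g k a"
 shows "AA a. a : U --> Df_norm (Df U f a) = norm (\<chi> k. g k a)"
proof -
 have "AA a. ALL k:UNIV. a : U --> dir_deriv U f (axis k 1) a = g k a" by (intro AE_finite_allI g) auto
 then show ?thesis using AE_approx[OF f]
 proof eventually_elim
  case (elim a)
  then show ?case using Df_norm_eq[OF weak_sobolevD(1)[OF f] open_U] by (auto simp: norm_vec_def L2_set_def)
 qed
qed

text \<open>The sharp upper gradient in the direction \<open>h\<close> itself, with t = 1, is at
  most norm h times the norm of \<open>Df\<close>; Jensen on the segment and Tonelli finish.
  Convexity of \<open>U\<close> keeps the segments inside, and no constant is lost.\<close>

theorem translation_le_energy: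
 fixes f :: "real ^ 'm => ('b::hilbert, 'q::finite) qtuple"
 assumes f: "weak_sobolev f"
 shows "(NN x:(seg U h). en (dist (f (x + h)) (f x) powr p)) <= en (norm h powr p) * energy U p f"
proof -
 note fb [measurable] = weak_sobolevD(1)[OF f]
 obtain g :: "real ^ 'm => real" where g: "g : BM" "integrable lborel g" "!!x. 0 <= g x" "!!x. x ~: U ==> g x = 0"
  "AA a. a : U --> dir_deriv U f h a = g a"
  "!!t. 0 < t ==> upper_grad U h t f g"
  by (rule dir_deriv_upper_gradient[OF f, where e=h]) blast
 note g(1) [measurable]
 let ?Om = "(seg U h)"
 let ?B = "%x. en (Df_norm (Df U f x) powr p)"
 let ?C = "en (norm h powr p)"
 let ?A = "NN x. ?C * ((?B x) * ind U x)"
 have "AA x:U;1 *: h. dist (f (x + 1 *: h)) (f x) <= line_int h 1 g x" by (rule g(6)) simp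
 then have "AA x. en (dist (f (x + h)) (f x) powr p) * ind ?Om x <= (NN s:{0..1}. en (g (x + s *: h) powr p)) * ind ?Om x"
  using AE_set_integrable_line[OF g(1,2), of 1 h]
 proof eventually_elim
  case (elim x)
  show ?case
  proof (cases "x : ?Om")
   case True
   then have "dist (f (x + h)) (f x) <= line_int h 1 g x" using elim(1) by simp
   then have "en (dist (f (x + h)) (f x) powr p) <= en (line_int h 1 g x powr p)"
    using p by (intro ennreal_leI powr_mono2) auto
   also have "... <= (NN s:{0..1}. en (g (x + s *: h) powr p))"
    unfolding line_int_def by (rule Jensen_unit_interval[OF _ elim(2) g(3) p]) simp
   finally show ?thesis using True by simp
  qed simp
 qed
 then have "(NN x:?Om. en (dist (f (x + h)) (f x) powr p))
  <= (NN x:?Om. NN s:{0..1}. en (g (x + s *: h) powr p))"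
  by (rule nn_integral_mono_AE)
 also have "... <= en 1 * (NN x:U. en (g x powr p))"
  by (rule nn_integral_line_le) (use convex_line_mem[OF convex_U, of _ 1 h] in auto)
 also have "(NN x:U. en (g x powr p)) <= ?A"
 proof (rule nn_integral_mono_AE)
  show "AA x. en (g x powr p) * ind U x <= ?C * ((?B x) * ind U x)"
   using g(5) AE_approx[OF f]
  proof eventually_elim
   case (elim x)
   show ?case
   proof (cases "x : U")
    case True
    then obtain A where "approx_affine U f x A" using elim by blast
    then have "g x <= norm h * Df_norm (Df U f x)" using dir_deriv_le_Df_norm[OF fb open_U True, of A h] elim(1) True by simp
    then have "g x powr p <= (norm h * Df_norm (Df U f x)) powr p" using p g(3) by (intro powr_mono2) auto
    also have "... = norm h powr p * Df_norm (Df U f x) powr p" by (simp add: powr_mult)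
    finally show ?thesis using True by (simp add: ennreal_mult'[symmetric])
   qed simp
  qed
 qed
 also have "... = ?C * energy U p f"
  unfolding energy_eq
 proof -
  \<comment> \<open>A constant factor can be moved out of the integral only for a measurable
    integrand, so \<open>Df_norm\<close> is replaced by an almost everywhere equal Borel function
    and back.\<close>
  obtain G :: "'m => real ^ 'm => real" where G: "!!k. G k : BM" "!!k. AA a. a : U --> dir_deriv U f (axis k 1) a = G k a"
  proof -
   have "ALL k. EX g :: real ^ 'm => real. g : BM & (AA a. a : U --> dir_deriv U f (axis k 1) a = g a)"
   proof
    fix k
    show "EX g :: real ^ 'm => real. g : BM & (AA a. a : U --> dir_deriv U f (axis k 1) a = g a)"
     by (rule dir_deriv_upper_gradient[OF f, where e="axis k 1"]) blast
   qed
   from choice[OF this] show ?thesis using that by blast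
  qed
  note G(1) [measurable]
  have ae: "AA a. a : U --> Df_norm (Df U f a) = norm (\<chi> k. G k a)" by (rule Df_norm_AE_eq[OF f G(2)])
  have "?A
   = (NN x. ?C * (en (norm (\<chi> k. G k x) powr p) * ind U x))"
   by (rule nn_integral_cong_AE, use ae in eventually_elim) auto
  also have "... = ?C * (NN x:U. en (norm (\<chi> k. G k x) powr p))"
   by (rule nn_integral_cmult) simp
  also have "(NN x:U. en (norm (\<chi> k. G k x) powr p)) = (NN x:U. (?B x))"
   by (rule nn_integral_cong_AE, use ae in eventually_elim) auto
  finally show "?A
   = ?C * (NN x:U. (?B x))" .
 qed
 finally show ?thesis by simp
qed

end

lemma borel_measurable_vec_nth [measurable]:
 fixes f :: "'x => real ^ 'n"
 assumes [measurable]: "f : borel_measurable M"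
 shows "(%x. f x $ k) : borel_measurable M"
proof -
 have [measurable]: "(%y :: real ^ 'n. y $ k) : BM" by simp
 show ?thesis by simp
qed

section \<open>Stability under limits and lower semicontinuity of the energy\<close>

context sobolev_domain
begin

abbreviation Dp :: "(real ^ 'm => 'c::metric_space) => (real ^ 'm => 'c) => ennreal"
 where "Dp f g \<equiv> (NN x:U. en (dist (f x) (g x) powr p))"

lemma Dp_L1_le:
 fixes f g :: "real ^ 'm => 'c::sep_metric"
 assumes [measurable]: "f : BM" "g : BM" and c: "0 < c"
 shows "(NN x:U. en (dist (f x) (g x))) <= en c * vol U + en (1 / c powr (p - 1)) * Dp f g"
proof -
 let ?A = "en (1 / c powr (p - 1))"
 have "(NN x:U. en (dist (f x) (g x)))
  <= (NN x. en c * ind U x + ?A * (en (dist (f x) (g x) powr p) * ind U x))"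
 proof (intro nn_integral_mono)
  fix x
  show "en (dist (f x) (g x)) * ind U x <= en c * ind U x + ?A * (en (dist (f x) (g x) powr p) * ind U x)"
   using le_add_powr[OF _ c p, of "dist (f x) (g x)"] c
   by (auto simp: indicator_def ennreal_mult[symmetric] ennreal_plus[symmetric] simp del: ennreal_plus intro!: ennreal_leI)
 qed
 also have "... = en c * vol U + ?A * Dp f g"
  by (subst nn_integral_add) (auto simp: nn_integral_cmult nn_integral_cmult_indicator)
 finally show ?thesis .
qed

lemma Dp_L1_tendsto:
 fixes f :: "real ^ 'm => 'c::sep_metric"
 assumes [measurable]: "f : BM" "!!j. F j : BM"
  and lim: "(%j. Dp (F j) f) ~~> 0" and eps: "0 < eps"
 shows "EX N. ALL j>=N. (NN x:U. en (dist (F j x) (f x))) <= en eps"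
proof -
 define m where "m = measure lborel U"
 have m: "vol U = en m" "0 <= m" using finite_U by (auto simp: m_def emeasure_eq_ennreal_measure)
 define c where "c = eps / (2 * (m + 1))"
 have c: "0 < c" "c * m <= eps / 2" using eps m by (auto simp: c_def field_simps)
 define b where "b = eps / 2 * c powr (p - 1)"
 have b: "0 < b" using eps c by (simp add: b_def)
 have "\<forall>\<^sub>F j in sequentially. Dp (F j) f < en b" using lim b by (intro order_tendstoD) auto
 then obtain N where N: "!!j. j >= N ==> Dp (F j) f < en b" by (auto simp: eventually_sequentially)
 show ?thesis
 proof (intro exI[of _ N] allI impI)
  fix j assume j: "N <= j"
  have "(NN x:U. en (dist (F j x) (f x))) <= en c * vol U + en (1 / c powr (p - 1)) * Dp (F j) f"
   by (rule Dp_L1_le[OF _ _ c(1)]) auto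
  also have "... <= en c * en m + en (1 / c powr (p - 1)) * en b"
   using N[OF j] m by (intro add_mono mult_left_mono) auto
  also have "... = en (c * m + eps / 2)" using c m eps by (simp add: ennreal_mult[symmetric] ennreal_plus[symmetric] b_def del: ennreal_plus)
  also have "... <= en eps" using c by (intro ennreal_leI) simp
  finally show "(NN x:U. en (dist (F j x) (f x))) <= en eps" .
 qed
qed

lemma Dp_AE_subseq:
 fixes f :: "real ^ 'm => 'c::sep_metric"
 assumes [measurable]: "f : BM" "!!j. F j : BM"
  and lim: "(%j. Dp (F j) f) ~~> 0"
 shows "EX r :: nat => nat. strict_mono r & (AA x. x : U --> (%j. F (r j) x) ~~> f x)"
proof -
 define d where "d j x = dist (F j x) (f x) * ind U x" for j x
 have [measurable]: "d j : borel_measurable lborel" for j unfolding d_def by simp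
 have "(NN x. en (d j x powr p)) = Dp (F j) f" for j
  unfolding d_def by (intro nn_integral_cong) (auto simp: indicator_def)
 then have "(%j. NN x. en (d j x powr p)) ~~> 0" using lim by simp
 then obtain r :: "nat => nat" where r: "strict_mono r" "AA x. (%j. d (r j) x) ~~> 0"
  using powr_L1_AE_subseq[of d lborel p] p by (auto simp: d_def)
 have "AA x. x : U --> (%j. F (r j) x) ~~> f x"
  using r(2)
 proof eventually_elim
  case (elim x)
  show ?case
  proof
   assume "x : U"
   then show "(%j. F (r j) x) ~~> f x" using elim by (subst tendsto_dist_iff) (simp add: d_def)
  qed
 qed
 then show ?thesis using r(1) by blast
qed

lemma nik_closed:
 fixes f :: "real ^ 'm => 'c::sep_metric"
 assumes fb[measurable]: "f : BM" and Fb[measurable]: "!!j. F j : BM"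
  and lim: "(%j. Dp (F j) f) ~~> 0" and n: "!!j. nik U p c (F j)"
 shows "nik U p c f"
 unfolding nik_def
proof (intro conjI allI)
 show "0 <= c" using n[of 0] by (simp add: nik_def)
 fix h
 let ?Om = "(seg U h)"
 obtain r :: "nat => nat" where r: "strict_mono r" "AA x. x : U --> (%j. F (r j) x) ~~> f x"
  using Dp_AE_subseq[OF fb Fb lim] by blast
 let ?A = "%x. en (dist (f (x + h)) (f x) powr p)"
 let ?B = "en (c * norm h powr p)"
 have "(NN x:?Om. (?A x))
  <= (NN x. liminf (%j. en (dist (F (r j) (x + h)) (F (r j) x) powr p) * ind ?Om x))"
 proof (rule nn_integral_mono_AE)
  show "AA x. (?A x) * ind ?Om x
   <= liminf (%j. en (dist (F (r j) (x + h)) (F (r j) x) powr p) * ind ?Om x)"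
   using r(2) AE_lborel_translate[OF r(2), of h]
  proof eventually_elim
   case (elim x)
   have "(%j. en (dist (F (r j) (x + h)) (F (r j) x) powr p) * ind ?Om x) ~~> en (dist (f (x + h)) (f x) powr p) * ind ?Om x"
   proof (cases "x : ?Om")
    case True
    have "(%j. dist (F (r j) (x + h)) (F (r j) x) powr p) ~~> dist (f (x + h)) (f x) powr p"
     using elim True p by (intro tendsto_powr' tendsto_dist) auto
    then show ?thesis using True by simp
   qed simp
   then show ?case by (simp add: lim_imp_Liminf)
  qed
 qed
 also have "... <= liminf (%j. NN x:?Om. en (dist (F (r j) (x + h)) (F (r j) x) powr p))"
  by (rule nn_integral_liminf) simp
 also have "... <= liminf (%j. ?B)"
  using n by (intro Liminf_mono) (auto simp: nik_def)
 also have "... = ?B" by (simp add: Liminf_const)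
 finally show "(NN x:?Om. (?A x)) <= ?B" .
qed

lemma nik_energy:
 assumes "weak_sobolev f" "energy U p f <= en c" "0 <= c"
 shows "nik U p c f"
 unfolding nik_def
proof (intro conjI allI)
 fix h
 let ?A = "NN x:(seg U h). en (dist (f (x + h)) (f x) powr p)"
 have "?A <= en (norm h powr p) * energy U p f"
  by (rule translation_le_energy[OF assms(1)])
 also have "... <= en (norm h powr p) * en c" using assms by (intro mult_left_mono) auto
 also have "... = en (c * norm h powr p)" using assms by (simp add: ennreal_mult[symmetric])
 finally show "?A <= en (c * norm h powr p)" .
qed (use assms in auto)

lemma integrable_dist_if_Dp_finite:
 fixes f g :: "real ^ 'm => 'c::sep_metric"
 assumes [measurable]: "f : BM" "g : BM"
  and g: "integrable lborel (%x. ind U x * dist (g x) T)" and fin: "Dp f g < oo"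
 shows "integrable lborel (%x. ind U x * dist (f x) T)"
proof (rule Bochner_Integration.integrable_bound)
 have "(NN x. en (norm (ind U x * dist (f x) (g x)))) = (NN x:U. en (dist (f x) (g x)))"
  by (intro nn_integral_cong) (auto simp: indicator_def)
 also have "... <= en 1 * vol U + en (1 / 1 powr (p - 1)) * Dp f g" by (rule Dp_L1_le) auto
 also have "... < oo" using finite_U fin by simp
 finally have "integrable lborel (%x. ind U x * dist (f x) (g x))" by (intro integrableI_bounded) auto
 then show "integrable lborel (%x. ind U x * dist (f x) (g x) + ind U x * dist (g x) T)" using g by simp
 show "AA x. norm (ind U x * dist (f x) T) <= norm (ind U x * dist (f x) (g x) + ind U x * dist (g x) T)"
  by (intro AE_I2) (auto simp: indicator_def dist_triangle)
qed measurable

text \<open>\<open>w j\<close> collects the sharp upper gradients of \<open>F j\<close> along the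
  axes, so that its norm is that of the differential of \<open>F j\<close>. Midpoints of
  \<open>w\<close> converge to some \<open>u\<close>, and \<open>line_limit\<close> shows that each
  component of \<open>u\<close> is an upper gradient of \<open>f\<close>; by minimality the norm of
  \<open>Df\<close> is at most that of \<open>u\<close>. Fatou's lemma and convexity conclude.
  Treating the components as one vector valued sequence, with common midpoints, is what makes the
  Euclidean norm come out.\<close>

theorem weak_sobolev_closed:
 fixes f :: "real ^ 'm => ('b::hilbert, 'q::finite) qtuple"
 assumes F: "!!j. weak_sobolev (F j)" and en: "!!j. energy U p (F j) <= en c" "0 <= c"
  and fb[measurable]: "f : BM" and lim: "(%j. Dp (F j) f) ~~> 0"
 shows "weak_sobolev f" "energy U p f <= en c"
proof -
 note Fb [measurable] = weak_sobolevD(1)[OF F]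
 have nf: "nik U p c f" by (rule nik_closed[OF fb Fb lim nik_energy[OF F en]])
 have "\<forall>\<^sub>F j in sequentially. Dp (F j) f < 1" using lim by (rule order_tendstoD) simp
 then obtain j0 where "Dp (F j0) f < 1" by (auto simp: eventually_sequentially)
 then have "Dp f (F j0) < oo" by (simp add: dist_commute order.strict_trans[OF _ ennreal_one_less_top])
 then show wf: "weak_sobolev f"
  unfolding weak_sobolev_def using nf fb integrable_dist_if_Dp_finite[OF fb Fb weak_sobolevD(2)[OF F]] by blast
 have "ALL j. EX G :: 'm => real ^ 'm => real. ALL k. G k : BM & (ALL x. x ~: U --> G k x = 0) & integrable lborel (G k) &
  (AA a. a : U --> dir_deriv U (F j) (axis k 1) a = G k a) &
  (ALL t>0. AA x:U;t *: axis k 1. dist (F j (x + t *: axis k 1)) (F j x) <= line_int (axis k 1) t (G k) x)"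
  (is "ALL j. EX G. ALL k. ?P j k (G k)")
 proof
  fix j
  have "ALL k. EX g. ?P j k g"
  proof
   fix k :: 'm
   show "EX g. ?P j k g"
    by (rule dir_deriv_upper_gradient[OF F[of j], where e="axis k 1"]) blast
  qed
  from choice[OF this] show "EX G. ALL k. ?P j k (G k)" .
 qed
 from choice[OF this] obtain G where G: "!!j k. ?P j k (G j k)" by blast
 have Gm [measurable]: "G j k : BM" for j k using G by blast
 have Gi: "integrable lborel (G j k)" for j k using G by blast
 define w where "w j x = (\<chi> k. G j k x)" for j x
 have wm [measurable]: "w j : BM" for j unfolding w_def by simp
 have wU: "w j x = 0" if "x ~: U" for j x using G that by (simp add: w_def vec_eq_iff)
 have wen: "(NN x. en (norm (w j x) powr p)) <= en c" for j
 proof -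
  have "AA a. a : U --> Df_norm (Df U (F j) a) = norm (w j a)"
   unfolding w_def using G by (intro Df_norm_AE_eq[OF F]) blast
  then have "AA x. en (norm (w j x) powr p) = en (Df_norm (Df U (F j) x) powr p) * ind U x"
   by eventually_elim (use wU p in "auto simp: indicator_def")
  then have "(NN x. en (norm (w j x) powr p)) = energy U p (F j)" unfolding energy_eq by (rule nn_integral_cong_AE)
  then show ?thesis using en by simp
 qed
 have wi: "integrable lborel (w j)" for j
 proof -
  have "integrable lborel (%x. SUM k:UNIV. G j k x *: (axis k 1 :: real ^ 'm))" by (intro Bochner_Integration.integrable_sum integrable_scaleR_left Gi)
  moreover have "(SUM k:UNIV. G j k x *: (axis k 1 :: real ^ 'm)) = w j x" for x by (simp add: w_def vec_eq_iff axis_def if_distrib cong: if_cong)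
  ultimately show ?thesis by simp
 qed
 obtain v u where v: "!!n. v n : mconv w n" and u: "integrable lborel u" "u : BM"
  and vu: "AA x. (%n. v n x) ~~> u x" and ll: "line_limit w u"
 proof (rule mconv_line_limit[OF U_borel finite_U p wm _ wen])
  show "!!j x. x ~: U ==> w j x = 0" by (rule wU)
 qed (rule that)
 note u(2) [measurable]
 have "AA a. a : U --> dir_deriv U f (axis k 1) a <= u a $ k" for k
 proof (rule dir_deriv_minimal[OF wf])
  show "(%a. u a $ k) : BM" by measurable
  show "integrable lborel (%a. u a $ k)" using integrable_bounded_linear[OF bounded_linear_vec_nth u(1)] .
  fix t :: real assume t: "0 < t"
  let ?e = "axis k 1 :: real ^ 'm"
  let ?Om = "(seg U (t *: ?e))"
  \<comment> \<open>The positive part is convex and 1-Lipschitz in \<open>y\<close>, and vanishes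
    exactly when the k-th component dominates the increment of \<open>f\<close>.\<close>
  define ps where "ps x y = max 0 (dist (f (x + t *: ?e)) (f x) - y $ k)" for x and y :: "real ^ 'm"
  have "AA x. x : ?Om --> ps x (line_int ?e t u x) = 0"
  proof (rule line_limitD[OF ll])
   show "0 <= t" using t by simp
   show "?Om : sets borel" by measurable
   show "0 <= ps x y" for x y by (simp add: ps_def)
   show "ps x y <= ps x z + norm (y - z)" for x y z
    using component_le_norm_cart[of "y - z" k] by (auto simp: ps_def)
   show "ps x ((1/2) *: (y + z)) <= (ps x y + ps x z) / 2" for x y z
    by (auto simp: ps_def max_def field_simps)
   show "(%x. ps x (z x)) : BM" if [measurable]: "z : BM" for z
    unfolding ps_def by measurable
   fix eps :: real assume "0 < eps"
   then have "0 < eps / 2" by simp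
   from Dp_L1_tendsto[OF fb Fb lim this] obtain N where
    N: "!!j. N <= j ==> (NN x:U. en (dist (F j x) (f x))) <= en (eps / 2)" by blast
   show "EX N. ALL j>=N. (NN x:?Om. en (ps x (line_int ?e t (w j) x))) <= en eps"
   proof (intro exI[of _ N] allI impI)
    fix j assume j: "N <= j"
    let ?d = "%x. en (dist (F j x) (f x)) * ind U x"
    have gk: "upper_grad U ?e t (F j) (G j k)"
     using G t by blast
    let ?A = "%x. en (ps x (line_int ?e t (w j) x))"
    have "AA x. line_int ?e t (w j) x $ k = line_int ?e t (%x. w j x $ k) x" by (rule AE_line_int_nth[OF wm wi])
    with gk have "AA x. (?A x) * ind ?Om x <= ?d (x + t *: ?e) + ?d x"
    proof eventually_elim
     case (elim x)
     have "line_int ?e t (w j) x $ k = line_int ?e t (G j k) x" using elim(2) by (simp add: w_def)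
     then have "ps x (line_int ?e t (w j) x) <= dist (F j (x + t *: ?e)) (f (x + t *: ?e)) + dist (F j x) (f x)" if "x : ?Om"
      using that elim(1) abs_dist_diff_le_add[of "f (x + t *: ?e)" "f x" "F j (x + t *: ?e)" "F j x"]
      by (auto simp: ps_def dist_commute)
     then show ?case by (auto simp: indicator_def ennreal_plus[symmetric] simp del: ennreal_plus intro: ennreal_leI)
    qed
    then have "(NN x:?Om. (?A x)) <= (NN x. ?d (x + t *: ?e) + ?d x)"
     by (rule nn_integral_mono_AE)
    also have "... = (NN x. ?d (x + t *: ?e)) + (NN x. ?d x)"
     by (rule nn_integral_add) measurable
    also have "(NN x. ?d (x + t *: ?e)) = (NN x. ?d x)" by (rule nn_integral_translate) measurable
    also have "(NN x. ?d x) + (NN x. ?d x) <= en (eps / 2) + en (eps / 2)" by (intro add_mono N j)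
    also have "... = en eps" using `0 < eps` by (simp add: ennreal_plus[symmetric] del: ennreal_plus)
    finally show "(NN x:?Om. (?A x)) <= en eps" .
   qed
  qed
  with AE_line_int_nth[OF u(2,1), of ?e t k]
  show "upper_grad U ?e t f (%a. u a $ k)"
   by eventually_elim (auto simp: ps_def)
 qed
 then have "AA a. ALL k:UNIV. a : U --> dir_deriv U f (axis k 1) a <= u a $ k" by (intro AE_finite_allI) auto
 then have Du: "AA a. a : U --> Df_norm (Df U f a) <= norm (u a)"
  using AE_approx[OF wf]
 proof eventually_elim
  case (elim a)
  show ?case
  proof
   assume a: "a : U"
   then obtain A where "approx_affine U f a A" using elim by blast
   then have "Df_norm (Df U f a) = sqrt (SUM k:UNIV. (dir_deriv U f (axis k 1) a)^2)" by (rule Df_norm_eq[OF fb open_U a])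
   also have "... <= sqrt (SUM k:UNIV. (u a $ k)^2)"
    using elim(1) a by (intro real_sqrt_le_mono sum_mono power_mono) (auto simp: dir_deriv_def qsum_def sum_nonneg)
   also have "... = norm (u a)" by (simp add: norm_vec_def L2_set_def)
   finally show "Df_norm (Df U f a) <= norm (u a)" .
  qed
 qed
 have mb: "x : borel_measurable lborel & (NN a. en (norm (x a) powr p)) <= en c" if "x : mconv w n" for x n
  using that
 proof induction
  case (mconv_base j)
  then show ?case using wen by simp
 next
  case (mconv_mid a b)
  then have [measurable]: "a : borel_measurable lborel" "b : borel_measurable lborel" by auto
  have "(%x. (1/2) *: (a x + b x)) : borel_measurable lborel" by measurable
  then show ?case using mconv_mid nn_integral_powr_midpoint_le[of a lborel b p c] p en(2) by simp
 qed
 have "energy U p f <= (NN x. liminf (%n. en (norm (v n x) powr p)))"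
  unfolding energy_eq
 proof (rule nn_integral_mono_AE)
  show "AA x. en (Df_norm (Df U f x) powr p) * ind U x <= liminf (%n. en (norm (v n x) powr p))"
   using Du vu
  proof eventually_elim
   case (elim x)
   have "(%n. norm (v n x) powr p) ~~> norm (u x) powr p"
    using elim p by (intro tendsto_powr' tendsto_norm tendsto_const) auto
   then have "(%n. en (norm (v n x) powr p)) ~~> en (norm (u x) powr p)" by (rule tendsto_ennrealI)
   then have l: "liminf (%n. en (norm (v n x) powr p)) = en (norm (u x) powr p)" by (simp add: lim_imp_Liminf)
   show ?case unfolding l using elim p
    by (auto simp: indicator_def Df_norm_def qsum_def sum_nonneg intro!: ennreal_leI powr_mono2)
  qed
 qed
 also have "... <= liminf (%n. NN x. en (norm (v n x) powr p))"
 proof (rule nn_integral_liminf)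
  fix n
  have [measurable]: "v n : borel_measurable lborel" using mb[OF v] by blast
  show "(%x. en (norm (v n x) powr p)) : borel_measurable lborel" by measurable
 qed
 also have "... <= liminf (%n. en c)" using mb[OF v] by (intro Liminf_mono always_eventually allI) blast
 also have "... = en c" by (simp add: Liminf_const)
 finally show "energy U p f <= en c" .
qed

end

section \<open>Contracting tuples towards cluster centres\<close>

lift_definition qmap :: "('a => 'b) => ('a, 'q::finite) qtuple => ('b, 'q) qtuple" is "%ph z. ph \<circ> z"
 by (auto simp: perm_equiv_def comp_assoc)

lemma qmap_qtuple [simp]: "qmap ph (qtuple z) = qtuple (%i. ph (z i))"
 by (simp add: qmap.abs_eq comp_def)

text \<open>The factor 4 is 1 + 2 + 1: two points at distance at most 2 rh, each within rh of an
  entry, must belong to linked entries.\<close>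

definition link :: "('q => 'b::metric_space) => real => ('q \<times> 'q) set"
 where "link t rh = {(i, j). dist (t i) (t j) <= 4 * rh}"

text \<open>The inner choice finds an entry near \<open>v\<close>, the outer one a representative of
  its cluster. Chains of links form an equivalence relation, so linked entries present the same
  predicate to the outer choice and receive the same centre.\<close>

definition cluster_centre :: "('b::metric_space, 'q::finite) qtuple => real => 'b => 'b"
 where "cluster_centre T rh v = rep_qtuple T (SOME j. (SOME i. dist v (rep_qtuple T i) <= rh, j) : (link (rep_qtuple T) rh)\<^sup>*)"

text \<open>Contracting an unordered tuple towards the cluster centres of a reference tuple \<open>T\<close>: near \<open>T\<close>, optimal
 matchings respect the clusters, so that this is Lipschitz although no selection of the entries is made.\<close>

definition pinch :: "('b::real_normed_vector, 'q::finite) qtuple => real => real => ('b, 'q) qtuple => ('b, 'q) qtuple"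
 where "pinch T rh s S = qmap (%v. cluster_centre T rh v + s *: (v - cluster_centre T rh v)) S"

lemma link_chain_eq:
 assumes "(i, j) : (link t rh)\<^sup>*"
 shows "(i, l) : (link t rh)\<^sup>* \<longleftrightarrow> (j, l) : (link t rh)\<^sup>*"
proof -
 have "sym (link t rh)" by (auto simp: sym_def link_def dist_commute)
 then have "(j, i) : (link t rh)\<^sup>*" using assms sym_rtrancl[of "link t rh"] by (auto simp: sym_def)
 then show ?thesis using assms by auto
qed

text \<open>A chain never needs more steps than there are linked pairs, of which there are at most Q
  squared.\<close>

lemma link_chain_dist:
 fixes t :: "'q::finite => 'b::metric_space"
 assumes "(i, j) : (link t rh)\<^sup>*" "0 <= rh"
 shows "dist (t i) (t j) <= (real CARD('q))^2 * (4 * rh)"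
proof -
 have fin: "finite (link t rh)" by simp
 obtain n where n: "n <= card (link t rh)" "(i, j) : link t rh ^^ n"
  using assms(1) rtrancl_finite_eq_relpow[OF fin] by auto
 have "dist (t i) (t j) <= real n * (4 * rh)" using n(2)
 proof (induction n arbitrary: j)
  case (Suc n)
  then obtain l where l: "(i, l) : link t rh ^^ n" "(l, j) : link t rh" by auto
  have "dist (t i) (t j) <= dist (t i) (t l) + dist (t l) (t j)" by (rule dist_triangle)
  also have "... <= real n * (4 * rh) + 4 * rh" using l Suc.IH[OF l(1)] by (auto simp: link_def)
  finally show ?case by (simp add: algebra_simps)
 qed simp
 also have "... <= real (card (link t rh)) * (4 * rh)" using n assms by (intro mult_right_mono) auto
 also have "... <= real (card (UNIV :: ('q \<times> 'q) set)) * (4 * rh)" using assms by (intro mult_right_mono of_nat_mono card_mono) auto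
 finally show ?thesis by (simp add: power2_eq_square)
qed

lemma cluster_centre_dist:
 fixes T :: "('b::metric_space, 'q::finite) qtuple"
 assumes "dist v (rep_qtuple T i) <= rh" "0 <= rh"
 shows "dist v (cluster_centre T rh v) <= (1 + 4 * (real CARD('q))^2) * rh"
proof -
 define t where "t = rep_qtuple T"
 define i' where "i' = (SOME i. dist v (t i) <= rh)"
 have i': "dist v (t i') <= rh" unfolding i'_def t_def using assms(1) by (rule someI)
 define j where "j = (SOME j. (i', j) : (link t rh)\<^sup>*)"
 have j: "(i', j) : (link t rh)\<^sup>*" unfolding j_def by (rule someI[of _ i']) simp
 have "dist v (t j) <= dist v (t i') + dist (t i') (t j)" by (rule dist_triangle)
 also have "... <= rh + (real CARD('q))^2 * (4 * rh)" using i' link_chain_dist[OF j assms(2)] by simp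
 finally show ?thesis by (simp add: cluster_centre_def t_def[symmetric] i'_def[symmetric] j_def[symmetric] algebra_simps)
qed

lemma cluster_centre_eq:
 assumes "dist v (rep_qtuple T i) <= rh" "dist w (rep_qtuple T j) <= rh" "dist v w <= 2 * rh"
 shows "cluster_centre T rh v = cluster_centre T rh w"
proof -
 define t where "t = rep_qtuple T"
 define i' j' where "i' = (SOME i. dist v (t i) <= rh)" and "j' = (SOME i. dist w (t i) <= rh)"
 have "dist v (t i') <= rh" unfolding i'_def t_def using assms(1) by (rule someI)
 moreover have "dist w (t j') <= rh" unfolding j'_def t_def using assms(2) by (rule someI)
 ultimately have "dist (t i') (t j') <= 4 * rh"
  using dist_triangle[of "t i'" "t j'" v] dist_triangle[of v "t j'" w] assms(3) by (simp add: dist_commute)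
 then have "(i', j') : (link t rh)\<^sup>*" by (auto simp: link_def)
 then show ?thesis
  by (simp add: cluster_centre_def t_def[symmetric] i'_def[symmetric] j'_def[symmetric] link_chain_eq[of i' j'])
qed

lemma pinch_1 [simp]: "pinch T rh 1 S = S"
 unfolding pinch_def by (cases S rule: qtuple_exhaust) simp

lemma qtuple_near:
 assumes "dist (qtuple a) T <= rh"
 shows "EX j. dist (a i) (rep_qtuple T j) <= rh"
proof -
 have "dist (qtuple (rep_qtuple T)) (qtuple a) <= rh" using assms by (simp add: dist_commute)
 then obtain a' where a': "qtuple a' = qtuple a" "!!j. dist (rep_qtuple T j) (a' j) <= rh"
  using dist_qtuple_attained[of a "rep_qtuple T"] by (metis order_trans)
 then obtain sg where "bij sg" "a = a' \<circ> sg" unfolding qtuple.abs_eq_iff perm_equiv_def by auto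
 then show ?thesis using a'(2)[of "sg i"] by (auto simp: dist_commute intro!: exI[of _ "sg i"])
qed

text \<open>Optimally matched entries are within 2 rh of each other and hence share a centre, so the
  matching of \<open>S\<close> and \<open>S'\<close> can be kept. The factor \<open>s\<close> in
  front of the distance is essential: in the cone construction it cancels the singularity of the
  radial projection.\<close>

lemma pinch_lipschitz:
 fixes T :: "('b::real_normed_vector, 'q::finite) qtuple"
 assumes S: "dist S T <= rh" "dist S' T <= rh" and s: "0 <= s"
 shows "dist (pinch T rh s S) (pinch T rh s' S') <= s * dist S S' + \<bar>s - s'\<bar> * (real CARD('q) * (1 + 4 * (real CARD('q))^2) * rh)"
proof -
 define M where "M = (1 + 4 * (real CARD('q))^2) * rh"
 have rh: "0 <= rh" using S(1) zero_le_dist order_trans by blast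
 obtain a b0 where a: "S = qtuple a" and b0: "S' = qtuple b0" by (meson qtuple_exhaust)
 obtain b where b': "qtuple b = qtuple b0" "dist (qtuple a) (qtuple b0) = sqrt (SUM i:UNIV. (dist (a i) (b i))^2)"
  "!!i. dist (a i) (b i) <= dist (qtuple a) (qtuple b0)"
  by (rule dist_qtuple_attained[where z=a and w=b0]) simp
 have b: "S' = qtuple b" "dist S S' = sqrt (SUM i:UNIV. (dist (a i) (b i))^2)" "!!i. dist (a i) (b i) <= dist S S'"
  using a b0 b' by auto
 let ?z = "cluster_centre T rh"
 have SS: "dist S S' <= 2 * rh" using S dist_triangle[of S S' T] by (simp add: dist_commute)
 have n: "dist (?z (a i) + s *: (a i - ?z (a i))) (?z (b i) + s' *: (b i - ?z (b i))) <= s * dist (a i) (b i) + \<bar>s - s'\<bar> * M" for i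
 proof -
  obtain j where j: "dist (a i) (rep_qtuple T j) <= rh" using qtuple_near S(1) a by blast
  obtain l where l: "dist (b i) (rep_qtuple T l) <= rh" using qtuple_near S(2) b by blast
  have z: "?z (a i) = ?z (b i)" using b(3)[of i] SS by (intro cluster_centre_eq[OF j l]) simp
  have "?z (a i) + s *: (a i - ?z (a i)) - (?z (b i) + s' *: (b i - ?z (b i))) = s *: (a i - b i) + (s - s') *: (b i - ?z (b i))"
   by (simp add: z algebra_simps)
  then have "dist (?z (a i) + s *: (a i - ?z (a i))) (?z (b i) + s' *: (b i - ?z (b i))) <= s * norm (a i - b i) + \<bar>s - s'\<bar> * norm (b i - ?z (b i))"
   using norm_triangle_ineq[of "s *: (a i - b i)" "(s - s') *: (b i - ?z (b i))"] s by (simp add: dist_norm)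
  also have "... <= s * dist (a i) (b i) + \<bar>s - s'\<bar> * M"
   using cluster_centre_dist[OF l rh] by (intro add_mono mult_left_mono) (auto simp: dist_norm M_def s)
  finally show ?thesis .
 qed
 let ?A = "L2_set (%i::'q. \<bar>s - s'\<bar> * M) UNIV"
 let ?B = "L2_set (%i. s * dist (a i) (b i)) UNIV"
 have "dist (pinch T rh s S) (pinch T rh s' S') <= L2_set (%i. dist (?z (a i) + s *: (a i - ?z (a i))) (?z (b i) + s' *: (b i - ?z (b i)))) UNIV"
  unfolding a b(1) pinch_def qmap_qtuple L2_set_def by (rule dist_qtuple_le)
 also have "... <= L2_set (%i. s * dist (a i) (b i) + \<bar>s - s'\<bar> * M) UNIV" by (intro L2_set_mono n) simp
 also have "... <= ?B + ?A" by (rule L2_set_triangle_ineq)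
 also have "?B = s * dist S S'" unfolding b(2) L2_set_right_distrib[OF s, symmetric] by (simp add: L2_set_def)
 also have "?A <= (SUM i:(UNIV::'q set). \<bar>s - s'\<bar> * M)" using rh by (intro L2_set_le_sum) (simp add: M_def)
 also have "... = \<bar>s - s'\<bar> * (real CARD('q) * (1 + 4 * (real CARD('q))^2) * rh)" by (simp add: M_def)
 finally show ?thesis by simp
qed

section \<open>Extension from the integer lattice to cubes by coning\<close>

definition vertex :: "('m => int) => 'm set => 'm => int"
 where "vertex n J k = (if k : J then n k + 1 else n k)"

definition spread :: "(('m => int) => 'c::metric_space) => ('m => int) => 'm set => real"
 where "spread V n I = Max ((%(J, J'). dist (V (vertex n J)) (V (vertex n J'))) ` (Pow I \<times> Pow I))"

text \<open>The closed face of the unit cube with lower corner \<open>n\<close> in which exactly the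
  coordinates in \<open>I\<close> are free.\<close>

definition cell :: "('m => int) => 'm set => (real ^ 'm) set"
 where "cell n I = {x. ALL k. if k : I then of_int (n k) <= x $ k & x $ k <= of_int (n k) + 1 else x $ k = of_int (n k)}"

definition fl :: "real ^ 'm => 'm => int"
 where "fl x k = \<lfloor>x $ k\<rfloor>"

text \<open>The free directions of the smallest face that contains \<open>x\<close>; its corner is
  \<open>fl x\<close>.\<close>

definition nonint :: "real ^ 'm => 'm set"
 where "nonint x = {k. of_int (fl x k) ~= x $ k}"

definition ctr :: "('m => int) => 'm set => 'm => real"
 where "ctr n I k = of_int (n k) + (if k : I then 1/2 else 0)"

text \<open>The distance from the centre of the face in the maximum norm, scaled to be 1 on the
  relative boundary.\<close>

definition rad :: "('m => int) => 'm set => real ^ 'm => real"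
 where "rad n I x = 2 * Max (range (%k. \<bar>x $ k - ctr n I k\<bar>))"

text \<open>Radial projection from the centre onto the relative boundary of the face. At the centre,
  where it is undefined, the corner serves as default, so that the result is on the boundary in
  every case.\<close>

definition bdp :: "('m => int) => 'm set => real ^ 'm => real ^ 'm"
 where "bdp n I x = (\<chi> k. if rad n I x = 0 then of_int (n k) else ctr n I k + (x $ k - ctr n I k) / rad n I x)"

lemma spread_ge: "J <= I ==> J' <= I ==> dist (V (vertex n J)) (V (vertex n J')) <= spread V n I" for I :: "'m::finite set"
 unfolding spread_def by (rule Max_ge) auto

lemma spread_nonneg: "0 <= spread V n (I :: 'm::finite set)"
 using spread_ge[of "{}" I "{}" V n] by simp

lemma spread_le:
 fixes I :: "'m::finite set"
 assumes "!!J J'. J <= I ==> J' <= I ==> dist (V (vertex n J)) (V (vertex n J')) <= c"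
 shows "spread V n I <= c"
 unfolding spread_def by (subst Max_le_iff) (use assms in auto)

lemma vertex_upd:
 assumes "k : I" "J <= I - {k}" "e = n k | e = n k + 1"
 shows "EX J'<=I. vertex (n(k := e)) J = vertex n J'"
 using assms by (intro exI[of _ "if e = n k then J else insert k J"]) (auto simp: vertex_def fun_eq_iff)

lemma spread_facet:
 fixes I :: "'m::finite set"
 assumes "k : I" "e = n k | e = n k + 1"
 shows "spread V (n(k := e)) (I - {k}) <= spread V n I"
proof (rule spread_le)
 fix J J' assume "J <= I - {k}" "J' <= I - {k}"
 with vertex_upd[where n=n and e=e, OF assms(1) _ assms(2)] obtain K K' where
  "K <= I" "K' <= I" "vertex (n(k := e)) J = vertex n K" "vertex (n(k := e)) J' = vertex n K'" by metis
 then show "dist (V (vertex (n(k := e)) J)) (V (vertex (n(k := e)) J')) <= spread V n I" by (simp add: spread_ge)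
qed

lemma cell_facet:
 assumes "x : cell n I" "x $ k = of_int e"
 shows "x : cell (n(k := e)) (I - {k})"
 using assms by (auto simp: cell_def)

lemma rad_ge: "\<bar>x $ k - ctr n I k\<bar> <= rad n I x / 2" for n :: "'m::finite => int"
 unfolding rad_def by simp

lemma rad_le: "(!!k. \<bar>x $ k - ctr n I k\<bar> <= s / 2) ==> rad n I x <= s" for n :: "'m::finite => int"
 unfolding rad_def using Max_le_iff[of "range (%k. \<bar>x $ k - ctr n I k\<bar>)" "s / 2"] by simp

lemma rad_attained: "EX k. \<bar>x $ k - ctr n I k\<bar> = rad n I x / 2" for n :: "'m::finite => int"
proof -
 let ?A = "range (%k. \<bar>x $ k - ctr n I k\<bar>)"
 have "Max (?A) : ?A" by simp
 then obtain k where "Max (?A) = \<bar>x $ k - ctr n I k\<bar>" by blast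
 then show ?thesis by (intro exI[of _ k]) (simp add: rad_def)
qed

lemma rad_nonneg: "0 <= rad n I x" for n :: "'m::finite => int"
 using rad_ge[of x undefined n I] by linarith

lemma cell_ctr: "x : cell n I \<longleftrightarrow> (ALL k. \<bar>x $ k - ctr n I k\<bar> <= (if k : I then 1/2 else 0))"
 by (force simp: cell_def ctr_def abs_le_iff)

lemma rad_le_1: "x : cell n I ==> rad n I x <= 1" for n :: "'m::finite => int"
 by (rule rad_le) (auto simp: cell_ctr split: if_splits)

lemma bdp_cell:
 assumes x: "x : cell n I" and I: "I ~= {}"
 shows "bdp n I x : cell n I" "EX k:I. bdp n I x $ k = of_int (n k) | bdp n I x $ k = of_int (n k + 1)"
proof -
 let ?s = "rad n I x"
 have "bdp n I x : cell n I & (EX k:I. bdp n I x $ k = of_int (n k) | bdp n I x $ k = of_int (n k + 1))"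
 proof (cases "?s = 0")
  case True
  then show ?thesis using I by (auto simp: bdp_def cell_def)
 next
  case False
  then have s: "0 < ?s" using rad_nonneg[of n I x] by simp
  have b: "\<bar>bdp n I x $ k - ctr n I k\<bar> = \<bar>x $ k - ctr n I k\<bar> / ?s" for k using s by (simp add: bdp_def)
  have "\<bar>bdp n I x $ k - ctr n I k\<bar> <= (if k : I then 1/2 else 0)" for k
   using rad_ge[of x k n I] x s unfolding b by (auto simp: cell_ctr dest: spec[of _ k])
  moreover obtain k where k: "\<bar>x $ k - ctr n I k\<bar> = ?s / 2" using rad_attained by blast
  then have "k : I" using s x by (auto simp: cell_ctr split: if_splits)
  moreover have "\<bar>bdp n I x $ k - ctr n I k\<bar> = 1 / 2" using k s by (simp add: b)
  ultimately show ?thesis unfolding cell_ctr by (auto simp: ctr_def abs_if split: if_splits intro!: bexI[of _ k])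
 qed
 then show "bdp n I x : cell n I" "EX k:I. bdp n I x $ k = of_int (n k) | bdp n I x $ k = of_int (n k + 1)" by auto
qed

lemma rad_bdp_boundary:
 assumes "x : cell n I" "k : I" "x $ k = of_int (n k) | x $ k = of_int (n k + 1)"
 shows "rad n I x = 1" "bdp n I x = x"
proof -
 have "1 / 2 <= rad n I x / 2" using rad_ge[of x k n I] assms(2,3) by (auto simp: ctr_def)
 then show r: "rad n I x = 1" using rad_le_1[OF assms(1)] by simp
 show "bdp n I x = x" by (simp add: bdp_def r)
qed

lemma rad_diff:
 assumes "!!k. \<bar>x $ k - y $ k\<bar> <= r"
 shows "\<bar>rad n I x - rad n I y\<bar> <= 2 * r"
proof -
 have "rad n I x <= rad n I y + 2 * r"
  if "!!k. \<bar>x $ k - y $ k\<bar> <= r" for x y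
 proof (rule rad_le)
  fix k
  show "\<bar>x $ k - ctr n I k\<bar> <= (rad n I y + 2 * r) / 2" using rad_ge[of y k n I] that[of k] by argo
 qed
 from this[of x y] this[of y x] show ?thesis using assms by (simp add: abs_le_iff)
qed

text \<open>Multiplied by the smaller radius, the difference of the projections is the difference of
  the points plus a radial term, each at most r in absolute value. The resulting 1/rad blows up at
  the centre, exactly at the rate that \<open>pinch\<close> compensates.\<close>

lemma bdp_diff:
 assumes r: "!!k. \<bar>x $ k - y $ k\<bar> <= r" and le: "0 < rad n I x" "rad n I x <= rad n I y"
 shows "\<bar>bdp n I x $ k - bdp n I y $ k\<bar> <= 2 * r / rad n I x"
proof -
 let ?s = "rad n I x" and ?s' = "rad n I y" and ?c = "ctr n I k"
 have s': "0 < ?s'" using le by simp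
 have "?s * (bdp n I x $ k - bdp n I y $ k) = (x $ k - y $ k) + (1 - ?s / ?s') * (y $ k - ?c)"
  using le by (simp add: bdp_def field_simps)
 then have "?s * \<bar>bdp n I x $ k - bdp n I y $ k\<bar> = \<bar>(x $ k - y $ k) + (1 - ?s / ?s') * (y $ k - ?c)\<bar>"
  using le by (metis abs_mult abs_of_pos)
 also have "... <= \<bar>x $ k - y $ k\<bar> + (1 - ?s / ?s') * \<bar>y $ k - ?c\<bar>"
  using le by (intro order_trans[OF abs_triangle_ineq]) (simp add: abs_mult)
 also have "... <= r + (1 - ?s / ?s') * (?s' / 2)" using le rad_ge[of y k n I] r by (intro add_mono mult_left_mono) auto
 also have "... = r + (?s' - ?s) / 2" using s' by (simp add: field_simps)
 also have "... <= 2 * r" using rad_diff[OF r, of n I] by simp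
 finally show ?thesis using le by (simp add: field_simps)
qed

lemma cell_fl_nonint: "x : cell (fl x) (nonint x)"
 unfolding cell_def
proof (intro CollectI allI)
 fix k
 show "if k : nonint x then of_int (fl x k) <= x $ k & x $ k <= of_int (fl x k) + 1 else x $ k = of_int (fl x k)"
  by (auto simp: nonint_def fl_def)
qed

lemma nonint_bdp: "nonint x ~= {} ==> nonint (bdp (fl x) (nonint x) x) \<subset> nonint x" for x :: "real ^ 'm"
proof -
 assume I: "nonint x ~= {}"
 let ?b = "bdp (fl x) (nonint x) x"
 note b = bdp_cell[OF cell_fl_nonint I]
 have "nonint ?b <= nonint x"
 proof
  fix k assume k: "k : nonint ?b"
  show "k : nonint x"
  proof (rule ccontr)
   assume "k ~: nonint x"
   then have "?b $ k = of_int (fl x k)" using b(1) by (auto simp: cell_def)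
   then show False using k by (simp add: nonint_def fl_def)
  qed
 qed
 moreover obtain k where "k : nonint x" "?b $ k = of_int (fl x k) | ?b $ k = of_int (fl x k + 1)" using b(2) by blast
 moreover from this(2) have "k ~: nonint ?b" unfolding nonint_def fl_def by (metis (mono_tags) floor_of_int mem_Collect_eq)
 ultimately show ?thesis by blast
qed

text \<open>The recursion of the Lipschitz constant over the face dimension: vertices carry constant
  values, and every cone multiplies by \<open>C\<close> after one vertex distance has been
  added.\<close>

primrec ext_const :: "real => nat => real"
 where "ext_const C 0 = 0" | "ext_const C (Suc k) = C * (ext_const C k + 1)"

text \<open>The 4 is a boundary estimate with factor 2 at projected points that are 2 r / rad apart;
  the other summand is the variation of the contraction factor, at most 2 r, times the cluster
  size.\<close>

abbreviation pinch_const :: "'q itself => real"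
 where "pinch_const q \<equiv> 4 + 2 * (real CARD('q) * (1 + 4 * (real CARD('q))^2))"

text \<open>On the interior of a face the value at the boundary projection is contracted by the
  factor \<open>rad\<close> towards the clusters of the corner value; the recursion ends because the
  projection gains an integer coordinate. The cluster radius bounds the distance of all boundary
  values from \<open>V n\<close>, so that \<open>pinch_lipschitz\<close> applies.\<close>

function cube_ext :: "(('m => int) => ('b::real_normed_vector, 'q::finite) qtuple) => real ^ 'm => ('b, 'q) qtuple"
 where "cube_ext V x = (let n = fl x; I = nonint x in if I = {} then V n else
  pinch (V n) ((ext_const (pinch_const TYPE('q)) (card I - 1) + 1) * spread V n I) (rad n I x) (cube_ext V (bdp n I x)))"
 by auto

termination
 by (relation "Wellfounded.measure (%(V, x). card (nonint x))") (auto intro!: psubset_card_mono nonint_bdp)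

declare cube_ext.simps [simp del]

lemma ext_const_nonneg: "0 <= C ==> 0 <= ext_const C k"
 by (induction k) auto

lemma cell_interior:
 assumes "x : cell n I" "!!k. k : I ==> x $ k ~= of_int (n k) & x $ k ~= of_int (n k + 1)"
 shows "fl x = n" "nonint x = I"
proof -
 have "\<lfloor>x $ k\<rfloor> = n k" for k
  using assms(1) assms(2)[of k] by (auto simp: cell_def floor_eq_iff dest!: spec[of _ k] split: if_splits)
 then show "fl x = n" by (auto simp: fl_def)
 moreover have "x $ k ~= of_int (n k) \<longleftrightarrow> k : I" for k using assms(1) assms(2)[of k] by (auto simp: cell_def split: if_splits)
 ultimately show "nonint x = I" unfolding nonint_def by (intro set_eqI) (simp add: eq_commute)
qed

text \<open>The recursion refers to the smallest face only. On the boundary of a larger face the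
  factor is 1 and the projection fixes the point, so the same formula holds on every closed face and
  neighbouring cubes fit together.\<close>

lemma cube_ext_cell:
 fixes V :: "('m::finite => int) => ('b::real_normed_vector, 'q::finite) qtuple"
 assumes x: "x : cell n I" and I: "I ~= {}"
 shows "cube_ext V x = pinch (V n) ((ext_const (pinch_const TYPE('q)) (card I - 1) + 1) * spread V n I) (rad n I x) (cube_ext V (bdp n I x))"
proof (cases "EX k:I. x $ k = of_int (n k) | x $ k = of_int (n k + 1)")
 case True
 then obtain k where "k : I" "x $ k = of_int (n k) | x $ k = of_int (n k + 1)" by blast
 from rad_bdp_boundary[OF x this] show ?thesis by simp
next
 case False
 then have "fl x = n" "nonint x = I" using cell_interior[OF x] by blast+
 then show ?thesis using I by (subst cube_ext.simps) simp
qed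

lemma cube_ext_vertex: "x : cell n {} ==> cube_ext V x = V n"
 using cell_interior[of x n "{}"] by (subst cube_ext.simps) simp

text \<open>Induction on the face dimension, with distances in the maximum norm. Boundary points on
  one facet are covered by the induction hypothesis, on two facets by a detour through their
  intersection. For general points the factor \<open>rad\<close> of \<open>pinch_lipschitz\<close>
  cancels the 1/rad of \<open>bdp_diff\<close>.\<close>

theorem cube_ext_lipschitz:
 fixes V :: "('m::finite => int) => ('b::real_normed_vector, 'q::finite) qtuple"
 assumes "x : cell n I" "y : cell n I" "!!k. \<bar>x $ k - y $ k\<bar> <= r"
 shows "dist (cube_ext V x) (cube_ext V y) <= ext_const (pinch_const TYPE('q)) (card I) * spread V n I * r"
 using assms
proof (induction "card I" arbitrary: n I x y r)
 case 0
 then have "I = {}" by simp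
 then show ?case using 0 cube_ext_vertex[of _ n V] by simp
next
 case (Suc d)
 let ?A = "ext_const (pinch_const TYPE('q))" and ?D = "spread V n I" and ?E = "%x y. dist (cube_ext V x) (cube_ext V y)"
 have I: "I ~= {}" using Suc(2) by auto
 have A: "0 <= ?A d" by (intro ext_const_nonneg) simp
 note D = spread_nonneg[of V n I]
 define on where "on x k e \<longleftrightarrow> x : cell n I & k : I & (e = n k | e = n k + 1) & x $ k = of_int e" for x k e
 have facet: "?E x y <= ?A d * ?D * r"
  if "on x k e" "on y k e" and r: "!!k. \<bar>x $ k - y $ k\<bar> <= r" for x y k e r
 proof -
  have "0 <= r" using r[of k] by simp
  have "?E x y <= ?A (card (I - {k})) * spread V (n(k := e)) (I - {k}) * r"
   using that Suc(2) by (intro Suc.hyps(1) cell_facet) (auto simp: on_def)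
  also have "card (I - {k}) = d" using that Suc(2) by (simp add: on_def)
  also have "?A d * spread V (n(k := e)) (I - {k}) * r <= ?A d * ?D * r"
   using that A `0 <= r` by (intro mult_right_mono mult_left_mono spread_facet) (auto simp: on_def)
  finally show ?thesis .
 qed
 \<comment> \<open>Compared through the lattice point n(k := e) of the same facet, whose value is
   within the spread of \<open>V n\<close>. This is the radius built into
   \<open>cube_ext\<close>.\<close>
 have near: "dist (cube_ext V x) (V n) <= (?A d + 1) * ?D" if on: "on x k e" for x k e
 proof -
  define y where "y = (\<chi> j. if j = k then real_of_int e else of_int (n j))"
  have y: "on y k e" using on by (auto simp: on_def y_def cell_def)
  have "\<bar>x $ j - y $ j\<bar> <= 1" for j using on by (auto simp: on_def y_def cell_def dest!: spec[of _ j] split: if_splits)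
  then have "?E x y <= ?A d * ?D * 1" by (rule facet[OF on y])
  moreover have "cube_ext V y = V (n(k := e))" by (rule cube_ext_vertex) (auto simp: cell_def y_def)
  moreover have "dist (V (n(k := e))) (V n) <= ?D"
  proof -
   have "n(k := e) = vertex n (if e = n k then {} else {k})" "n = vertex n {}" using on by (auto simp: on_def vertex_def)
   moreover have "(if e = n k then {} else {k}) <= I" using on by (auto simp: on_def)
   ultimately show ?thesis using spread_ge[of "if e = n k then {} else {k}" I "{}" V n] by simp
  qed
  ultimately show ?thesis using dist_triangle[of "cube_ext V x" "V n" "cube_ext V y"] by (simp add: algebra_simps)
 qed
 have bd: "?E x y <= 2 * (?A d + 1) * ?D * r"
  if x: "on x k e" and y: "on y l e'" and r: "!!k. \<bar>x $ k - y $ k\<bar> <= r" for x y k e l e' r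
 proof (cases "1 <= r")
  case True
  have "?E x y <= 2 * (?A d + 1) * ?D"
   using near[OF x] near[OF y] dist_triangle2[of "cube_ext V x" "cube_ext V y" "V n"] by linarith
  also have "... <= 2 * (?A d + 1) * ?D * r" using A D by (intro order_trans[OF _ mult_left_mono[OF True]]) auto
  finally show ?thesis .
 next
  case False
  \<comment> \<open>The point on both facets: \<open>x\<close> with its l-th coordinate moved onto
    the facet of \<open>y\<close>. Opposite facets are ruled out by r < 1; for larger r the bound
    \<open>near\<close> suffices.\<close>
  define w where "w = (\<chi> j. if j = l then real_of_int e' else x $ j)"
  have "e = e'" if "k = l"
  proof -
   have "\<bar>real_of_int (e - e')\<bar> < 1" using r[of k] x y that False by (simp add: on_def)
   then show ?thesis by simp
  qed
  then have w: "on w k e" "on w l e'" using x y by (auto simp: on_def w_def cell_def)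
  have r0: "0 <= r" using r[of k] by simp
  have xw: "\<bar>x $ j - w $ j\<bar> <= r" "\<bar>w $ j - y $ j\<bar> <= r" for j using r[of j] y by (auto simp: w_def on_def)
  have "?E x y <= ?A d * ?D * r + ?A d * ?D * r"
   using facet[OF x w(1) xw(1)] facet[OF w(2) y xw(2)] dist_triangle[of "cube_ext V x" "cube_ext V y" "cube_ext V w"] by linarith
  also have "... <= 2 * (?A d + 1) * ?D * r" using mult_nonneg_nonneg[OF D r0] by (simp add: algebra_simps)
  finally show ?thesis .
 qed
 let ?c = "real CARD('q) * (1 + 4 * (real CARD('q))^2)" and ?rh = "(?A d + 1) * ?D"
 have main: "?E x y <= ?A (Suc d) * ?D * r"
  if x: "x : cell n I" and y: "y : cell n I" and r: "!!k. \<bar>x $ k - y $ k\<bar> <= r" and le: "rad n I x <= rad n I y" for x y r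
 proof -
  let ?s = "rad n I x" and ?b = "cube_ext V (bdp n I x)" and ?b' = "cube_ext V (bdp n I y)"
  obtain k e where k: "on (bdp n I x) k e" using bdp_cell[OF x I] unfolding on_def by blast
  obtain l e' where l: "on (bdp n I y) l e'" using bdp_cell[OF y I] unfolding on_def by blast
  have r0: "0 <= r" using r[of k] by simp
  have d: "card I - 1 = d" using Suc(2) by simp
  have "?E x y <= ?s * dist ?b ?b' + \<bar>?s - rad n I y\<bar> * (?c * ?rh)"
   unfolding cube_ext_cell[OF x I] cube_ext_cell[OF y I] d
   by (rule pinch_lipschitz[OF near[OF k] near[OF l] rad_nonneg])
  also have "?s * dist ?b ?b' <= 2 * (?A d + 1) * ?D * (2 * r)"
  proof (cases "?s = 0")
   case True
   then show ?thesis using A D r0 by simp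
  next
   case False
   then have s: "0 < ?s" using rad_nonneg[of n I x] by simp
   have "dist ?b ?b' <= 2 * (?A d + 1) * ?D * (2 * r / ?s)" by (rule bd[OF k l bdp_diff[OF r s le]])
   then show ?thesis using s by (simp add: field_simps)
  qed
  also have "\<bar>?s - rad n I y\<bar> * (?c * ?rh) <= 2 * r * (?c * ?rh)" using A D by (intro mult_right_mono rad_diff r) auto
  also have "2 * (?A d + 1) * ?D * (2 * r) + 2 * r * (?c * ?rh) = ?A (Suc d) * ?D * r" by (simp add: algebra_simps)
  finally show ?thesis by simp
 qed
 show ?case
  unfolding Suc(2)[symmetric]
 proof (cases "rad n I x <= rad n I y")
  case True
  then show "?E x y <= ?A (Suc d) * ?D * r" using Suc.prems by (intro main)
 next
  case False
  then have "?E y x <= ?A (Suc d) * ?D * r" using Suc.prems by (intro main) (auto simp: abs_minus_commute)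
  then show "?E x y <= ?A (Suc d) * ?D * r" by (simp add: dist_commute)
 qed
qed

section \<open>Good representatives on a shrunken grid\<close>

lemma average_attained:
 assumes [measurable]: "Ph : borel_measurable M" "B : sets M" and B: "emeasure M B ~= 0" "emeasure M B ~= oo"
 shows "EX y:B. Ph y * emeasure M B <= (\<integral>\<^sup>+x. Ph x * ind B x \<partial>M)"
proof (rule ccontr)
 let ?C = "\<integral>\<^sup>+x. Ph x * ind B x \<partial>M"
 assume "~ ?thesis"
 then have lt: "?C < Ph y * emeasure M B" if "y : B" for y using that by auto
 define J where "J = ?C"
 have "B ~= {}" using B by auto
 then have J: "J ~= oo" using lt by (auto simp: J_def)
 have gt: "J / emeasure M B < Ph y" if "y : B" for y
  using lt[OF that] B by (simp add: J_def[symmetric] divide_less_ennreal less_top)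
 let ?A = "\<integral>\<^sup>+x. J / emeasure M B * ind B x \<partial>M"
 have eq: "?A = J"
 proof -
  have "J / emeasure M B * emeasure M B = J * emeasure M B / emeasure M B" by (simp add: mult.commute ennreal_times_divide)
  also have "... = J" using B by (intro mult_divide_eq_ennreal) auto
  finally show ?thesis by (subst nn_integral_cmult_indicator) simp
 qed
 have "?A < ?C"
 proof (rule nn_integral_less)
  show "?A ~= oo" using eq J by simp
  show "AE x in M. J / emeasure M B * ind B x <= Ph x * ind B x"
   using gt by (intro AE_I2) (auto simp: indicator_def less_imp_le)
  show "~ (AE x in M. Ph x * ind B x <= J / emeasure M B * ind B x)"
  proof
   assume "AE x in M. Ph x * ind B x <= J / emeasure M B * ind B x"
   then have "AE x in M. x ~: B" by eventually_elim (use gt in "auto simp: not_le[symmetric]")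
   then have "emeasure M B = 0" by (subst (asm) AE_iff_measurable[of B]) (use sets.sets_into_space[of B M] in auto)
   then show False using B by simp
  qed
 qed measurable
 then show False using eq by (simp add: J_def)
qed

definition grid :: "real => ('m => int) => (real ^ 'm) set"
 where "grid s n = {x. fl ((1/s) *: x) = n}"

lemma grid_iff: "0 < s ==> x : grid s n \<longleftrightarrow> (ALL k. s * of_int (n k) <= x $ k & x $ k < s * (of_int (n k) + 1))"
 by (auto simp: grid_def fl_def fun_eq_iff floor_eq_iff field_simps)

lemma grid_borel [measurable]: "grid s n : sets borel"
proof -
 have "grid s n = (\<Inter>k. {x : space borel. \<lfloor>(1/s) * x $ k\<rfloor> = n k})" by (auto simp: grid_def fl_def)
 also have "... : sets borel" by simp
 finally show ?thesis .
qed

lemma emeasure_grid: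
 fixes n :: "'m::finite => int"
 assumes s: "0 < s"
 shows "vol (grid s n) = en (s ^ CARD('m))"
proof (rule antisym)
 define a b :: "real ^ 'm" where "a = (\<chi> k. s * of_int (n k))" and "b = (\<chi> k. s * (of_int (n k) + 1))"
 have sub: "box a b <= grid s n" "grid s n <= cbox a b"
  using s by (auto simp: grid_iff mem_box_cart a_def b_def less_imp_le)
 have "a : cbox a b" using s by (auto simp: mem_box_cart a_def b_def)
 then have c: "measure lborel (cbox a b) = s ^ CARD('m)"
  by (subst content_cbox_cart) (auto simp: a_def b_def algebra_simps)
 have cb: "vol (cbox a b) = en (s ^ CARD('m))"
  using emeasure_eq_ennreal_measure[of lborel "cbox a b"] emeasure_lborel_cbox_finite[of a b] c by simp
 show "vol (grid s n) <= en (s ^ CARD('m))" unfolding cb[symmetric] by (rule emeasure_mono[OF sub(2)]) simp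
 have "vol (box a b) = vol (cbox a b)" by (simp add: emeasure_lborel_box_eq emeasure_lborel_cbox_eq)
 then show "en (s ^ CARD('m)) <= vol (grid s n)" unfolding cb[symmetric] using emeasure_mono[OF sub(1), of lborel] by simp
qed

lemma norm_le_card:
 assumes "!!k. \<bar>x $ k\<bar> <= r"
 shows "norm (x :: real ^ 'm) <= real CARD('m) * r"
 using norm_le_l1_cart[of x] sum_mono[of UNIV "%k. \<bar>x $ k\<bar>" "%_. r"] assms by simp

lemma finite_bounded_lattice:
 fixes N :: "('m::finite => int) set"
 assumes "!!n k. n : N ==> \<bar>real_of_int (n k)\<bar> <= b"
 shows "finite N"
proof (rule finite_subset)
 let ?A = "PiE UNIV (%_. {-\<lceil>b\<rceil>..\<lceil>b\<rceil>})"
 show "N <= ?A"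
 proof
  fix n assume n: "n : N"
  have "- \<lceil>b\<rceil> <= n k & n k <= \<lceil>b\<rceil>" for k using assms[OF n, of k] by linarith
  then show "n : ?A" by auto
 qed
qed (intro finite_PiE, auto)

locale unit_ball = sobolev_domain U p for U :: "(real ^ 'm) set" and p +
 fixes N :: nat
 assumes N: "N = CARD('m)" and U_ball: "U = ball 0 1"
begin

lemma N_pos: "1 <= real N" by (simp add: N)

definition osc :: "real => (real ^ 'm => 'c::metric_space) => real ^ 'm => ennreal"
 where "osc r f y = (NN x:(U Int cball y r). en (dist (f x) (f y) powr p))"

lemma osc_eq:
 fixes f :: "real ^ 'm => 'c::sep_metric"
 assumes [measurable]: "f : BM"
 shows "osc r f y = (NN h:cball 0 r. en (dist (f (y + h)) (f y) powr p) * ind U (y + h))"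
proof -
 have "osc r f y = (NN x. en (dist (f x) (f y) powr p) * ind U x * ind (cball 0 r) (x - y))"
  unfolding osc_def by (intro nn_integral_cong) (auto simp: indicator_def dist_norm)
 also have "... = (NN h. en (dist (f (h + y)) (f y) powr p) * ind U (h + y) * ind (cball 0 r) (h + y - y))"
  by (rule nn_integral_translate[symmetric]) simp
 finally show ?thesis by (simp add: add.commute)
qed

lemma osc_borel [measurable]:
 fixes f :: "real ^ 'm => 'c::sep_metric"
 assumes [measurable]: "f : BM"
 shows "osc r f : BM"
proof -
 have "(%y. NN h:cball 0 r. en (dist (f (y + h)) (f y) powr p) * ind U (y + h)) : BM"
  by simp
 then show ?thesis by (subst measurable_cong[OF osc_eq]) simp
qed

lemma nn_integral_osc_le:
 fixes f :: "real ^ 'm => 'c::sep_metric"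
 assumes [measurable]: "f : BM" and n: "nik U p K f" and r: "0 <= r"
 shows "(NN y:U. osc r f y) <= en (K * r powr p * (unit_ball_vol (real N) * r ^ N))"
proof -
 have K: "0 <= K" using n by (simp add: nik_def)
 let ?D = "en (K * r powr p)"
 have "(NN y:U. osc r f y)
  = (NN y. (NN h. en (dist (f (y + h)) (f y) powr p) * ind U (y + h) * ind (cball 0 r) h * ind U y))"
  by (intro nn_integral_cong) (simp add: osc_eq nn_integral_multc)
 also have "... = (NN h. (NN y:U. en (dist (f (y + h)) (f y) powr p) * ind U (y + h) * ind (cball 0 r) h))"
  by (rule lborel_pair.Fubini'[symmetric]) simp
 also have "... <= (NN h:cball (0 :: real ^ 'm) r. ?D)"
 proof (rule nn_integral_mono)
  fix h :: "real ^ 'm"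
  let ?B = "%y. en (dist (f (y + h)) (f y) powr p)"
  let ?C = "ind (cball 0 r) h"
  let ?A = "NN y:U. (?B y) * ind U (y + h) * ?C"
  have "?A
   = (NN y. (?B y) * ind (seg U h) y * ?C)"
   by (intro nn_integral_cong) (auto simp: indicator_def)
  also have "... = (NN y:(seg U h). (?B y)) * ?C"
   by (rule nn_integral_multc) simp
  also have "... <= en (K * norm h powr p) * ?C"
   using n by (intro mult_right_mono) (auto simp: nik_def)
  also have "... <= ?D * ?C"
   using K p by (auto simp: indicator_def intro!: mult_left_mono powr_mono2)
  finally show "?A
   <= ?D * ?C" .
 qed
 also have "... = ?D * vol (cball (0 :: real ^ 'm) r)" by (simp add: nn_integral_cmult_indicator)
 also have "... = en (K * r powr p * (unit_ball_vol (real N) * r ^ N))"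
  using r K by (simp add: emeasure_cball ennreal_mult N)
 finally show ?thesis .
qed

text \<open>The gap \<open>1 - shrink dl\<close> is exactly the displacement
  \<open>real N * (2 * dl)\<close> between a point and the nodes around it, so that scaling down
  brings these nodes back into the ball.\<close>

definition shrink :: "real => real"
 where "shrink dl = 1 - 2 * real N * dl"

definition nodes :: "real => ('m => int) set"
 where "nodes dl = {n. grid (shrink dl * dl) n <= U}"

lemma shrink:
 assumes "0 < dl" "dl <= 1 / (4 * real N)"
 shows "1 / 2 <= shrink dl" "shrink dl < 1"
 using assms N_pos by (auto simp: shrink_def field_simps)

lemma shrink_le: "real N * (2 * dl) = 1 - shrink dl" by (simp add: shrink_def)

text \<open>The grid carrying the representatives is shrunk towards the origin, so that all its cells that are
 needed lie inside the ball.\<close>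

lemma grid_close:
 assumes dl: "0 < dl" "dl <= 1 / (4 * real N)" and x: "x : U" "x : grid dl n" and y: "y : grid (shrink dl * dl) (vertex n J)"
 shows "y : U" "dist y x <= 4 * real N * dl"
proof -
 let ?l = "shrink dl"
 have l: "1 / 2 <= ?l" "?l < 1" using shrink[OF dl] by auto
 have nx: "norm x < 1" using x by (simp add: U_ball)
 let ?A = "(1 / ?l) *: y - x"
 have "\<bar>?A $ k\<bar> <= 2 * dl" for k
 proof -
  have "dl * of_int (vertex n J k) <= y $ k / ?l" "y $ k / ?l < dl * (of_int (vertex n J k) + 1)"
   using y l dl grid_iff[of "?l * dl" y] by (auto simp: field_simps)
  moreover have "dl * of_int (n k) <= x $ k" "x $ k < dl * (of_int (n k) + 1)" using x dl grid_iff[of dl x] by auto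
  moreover have "real_of_int (vertex n J k) = of_int (n k) | real_of_int (vertex n J k) = of_int (n k) + 1" by (auto simp: vertex_def)
  ultimately show ?thesis by (auto simp: algebra_simps)
 qed
 from norm_le_card[OF this] have d: "norm ?A <= 1 - ?l" by (simp only: shrink_le[symmetric] N[symmetric])
 have yl: "y = ?l *: ((1 / ?l) *: y)" using l by simp
 have "norm y = ?l * norm ((1 / ?l) *: y)" using l by simp
 also have "... < ?l * (1 + (1 - ?l))"
  using d nx l norm_triangle_sub[of "(1 / ?l) *: y" x] by (intro mult_strict_left_mono) auto
 also have "... <= 1" using sum_squares_ge_zero[of "1 - ?l" 0] by (simp add: algebra_simps)
 finally show "y : U" by (simp add: U_ball)
 have "y - x = ?l *: ?A - (1 - ?l) *: x" using l by (simp add: algebra_simps)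
 then have "norm (y - x) <= ?l * norm ?A + (1 - ?l) * norm x"
  using norm_triangle_ineq4[of "?l *: ?A" "(1 - ?l) *: x"] l by simp
 also have "... <= 1 * (1 - ?l) + (1 - ?l) * 1" using d l nx by (intro add_mono mult_mono) auto
 also have "... = 4 * real N * dl" by (simp add: shrink_def)
 finally show "dist y x <= 4 * real N * dl" by (simp add: dist_norm)
qed

lemma vertex_nodes:
 assumes "0 < dl" "dl <= 1 / (4 * real N)" "x : U" "x : grid dl n"
 shows "vertex n J : nodes dl"
 using grid_close(1)[OF assms] by (auto simp: nodes_def)

lemma finite_nodes:
 assumes dl: "0 < dl" "dl <= 1 / (4 * real N)"
 shows "finite (nodes dl)"
proof (rule finite_bounded_lattice)
 fix n k assume n: "n : nodes dl"
 let ?s = "shrink dl * dl"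
 have s: "0 < ?s" using shrink[OF dl] dl by simp
 define a :: "real ^ 'm" where "a = (\<chi> k. ?s * of_int (n k))"
 have "a : grid ?s n" using s by (simp add: grid_iff a_def algebra_simps)
 then have "a : U" using n by (auto simp: nodes_def)
 then have "norm a < 1" by (simp add: U_ball)
 then have "?s * \<bar>of_int (n k)\<bar> <= 1" using component_le_norm_cart[of a k] by (simp add: a_def)
 then show "\<bar>real_of_int (n k)\<bar> <= 1 / ?s" using s by (simp add: field_simps)
qed

lemma nn_integral_grid_sum:
 assumes [measurable]: "Ph : BM" and Q: "finite Q"
 shows "(SUM n:Q. NN x:(U Int grid s n). Ph x) <= (NN x:U. Ph x)"
  "(!!x. x : U ==> fl ((1/s) *: x) : Q) ==> (NN x:U. Ph x) = (SUM n:Q. NN x:(U Int grid s n). Ph x)"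
proof -
 let ?A = "%n. U Int grid s n"
 have eq: "(SUM n:Q. NN x:(?A n). Ph x) = (NN x. (SUM n:Q. Ph x * ind (?A n) x))"
  by (rule nn_integral_sum[symmetric]) simp
 have s: "(SUM n:Q. Ph x * ind (?A n) x) = (if fl ((1/s) *: x) : Q then Ph x * ind U x else 0)" for x
 proof -
  have "(SUM n:Q. Ph x * ind (?A n) x) = (SUM n:Q. if n = fl ((1/s) *: x) then Ph x * ind U x else 0)"
   by (intro sum.cong) (auto simp: grid_def indicator_def)
  then show ?thesis using Q by simp
 qed
 show "(SUM n:Q. NN x:(?A n). Ph x) <= (NN x:U. Ph x)"
  unfolding eq s by (intro nn_integral_mono) auto
 show "(NN x:U. Ph x) = (SUM n:Q. NN x:(?A n). Ph x)"
  if "!!x. x : U ==> fl ((1/s) *: x) : Q"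
  unfolding eq s using that by (intro nn_integral_cong) (auto simp: indicator_def)
qed

text \<open>The bound of \<open>nn_integral_osc_le\<close> at radius 4 N dl, multiplied by 2^N
  because it is divided by the volume of a shrunken cube, whose side is at least dl/2.\<close>

definition grid_const :: real
 where "grid_const = 2 ^ N * (4 * real N) powr p * (unit_ball_vol (real N) * (4 * real N) ^ N)"

lemma grid_const_nonneg: "0 <= grid_const" by (simp add: grid_const_def)

text \<open>In every shrunken cube a point is chosen at which the oscillation does not exceed its
  mean; the sum over the cubes is then dominated by the integral of the oscillation.\<close>

theorem grid_representatives:
 fixes f :: "real ^ 'm => 'c::sep_metric"
 assumes f[measurable]: "f : BM" and n: "nik U p K f" and dl: "0 < dl" "dl <= 1 / (4 * real N)"
 obtains x where "!!v. v : nodes dl ==> x v : grid (shrink dl * dl) v"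
  "(SUM v:nodes dl. osc (4 * real N * dl) f (x v)) <= en (grid_const * K * dl powr p)"
proof -
 let ?s = "shrink dl * dl" and ?r = "4 * real N * dl"
 have s: "0 < ?s" "dl / 2 <= ?s" using shrink[OF dl] dl by auto
 have K: "0 <= K" using n by (simp add: nik_def)
 have "ALL v. EX y:grid ?s v. osc ?r f y * vol (grid ?s v) <= (NN x:grid ?s v. osc ?r f x)"
  using s by (intro allI average_attained) (auto simp: emeasure_grid)
 from choice[OF this[unfolded Bex_def]] obtain x where x: "!!v. x v : grid ?s v"
  "!!v. osc ?r f (x v) * vol (grid ?s v) <= (NN x:grid ?s v. osc ?r f x)"
  by blast
 let ?A = "SUM v:nodes dl. osc ?r f (x v)"
 let ?B = "en (grid_const * K * dl powr p)"
 have "?A * en (?s ^ N) = (SUM v:nodes dl. osc ?r f (x v) * vol (grid ?s v))"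
  using s by (simp add: sum_distrib_right emeasure_grid N)
 also have "... <= (SUM v:nodes dl. NN x:(U Int grid ?s v). osc ?r f x)"
 proof (rule sum_mono)
  fix v assume "v : nodes dl"
  then have "U Int grid ?s v = grid ?s v" by (auto simp: nodes_def)
  then show "osc ?r f (x v) * vol (grid ?s v) <= (NN x:(U Int grid ?s v). osc ?r f x)" using x(2)[of v] by simp
 qed
 also have "... <= (NN x:U. osc ?r f x)" by (intro nn_integral_grid_sum finite_nodes dl) simp
 also have "... <= en (K * ?r powr p * (unit_ball_vol (real N) * ?r ^ N))"
  using dl by (intro nn_integral_osc_le n f) simp
 also have "... = en (grid_const * K * dl powr p * (dl / 2) ^ N)"
  by (simp add: grid_const_def powr_mult field_simps)
 also have "... <= en (grid_const * K * dl powr p * ?s ^ N)"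
  using s dl K by (intro ennreal_leI mult_left_mono power_mono) (auto simp: grid_const_nonneg)
 also have "... = ?B * en (?s ^ N)" using s K by (intro ennreal_mult) (auto simp: grid_const_nonneg)
 finally have "?A * en (?s ^ N) <= ?B * en (?s ^ N)" .
 then have "?A <= ?B"
  using s by (subst (asm) (1 2) mult.commute, subst (asm) ennreal_mult_le_mult_iff) auto
 then show ?thesis using that[of x] x(1) by blast
qed

end

section \<open>Local Lipschitz bounds for the differential and for the extension\<close>

text \<open>On a ball around \<open>a\<close> the constant La * norm e is an upper gradient, and
  every point of the ball is a Lebesgue point of a constant. Shrinking the domain to the ball does
  not affect approximate affinity at its centre.\<close>

lemma dir_norm_le_local_lipschitz:
 fixes f :: "real ^ 'm => ('b::hilbert, 'q::finite) qtuple"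
 assumes f[measurable]: "f : BM" and [measurable]: "U : sets borel" and A: "approx_affine U f a A"
  and r: "0 < r" "ball a r <= U" and L: "!!x y. x : ball a r ==> y : ball a r ==> dist (f x) (f y) <= La * dist x y"
 shows "dir_norm A e <= La * norm e"
proof -
 let ?B = "ball a r"
 define w where "w x = La * norm e * ind ?B x" for x
 have "dir_norm A e <= w a"
 proof (rule dir_norm_le_upper_gradient[OF f open_ball])
  show "a : ?B" using r by simp
  show "approx_affine ?B f a A"
   unfolding approx_affine_def
  proof (intro conjI allI impI)
   show "f : borel_measurable (restrict_space borel ?B)" by (rule measurable_restrict_space1[OF f])
   show "affine_map (A i)" for i using A by (simp add: approx_affine_def)
   fix eps :: real assume eps: "0 < eps"
   note D = approx_affine_null_density[OF f `U : sets borel` A eps]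
   have eq: "{x:?B. dist (f x) (qtuple (%i. A i x)) > eps * norm (x - a)} = ?B Int {x:U. dist (f x) (qtuple (%i. A i x)) > eps * norm (x - a)}"
    using r(2) by auto
   show "density_zero {x:?B. dist (f x) (qtuple (%i. A i x)) > eps * norm (x - a)} a"
    unfolding eq by (rule density_zero_if_null_density[OF _ null_density_subset[OF D(2) _ D(1)]]) (use D(1) in auto)
  qed
  show "w : BM" unfolding w_def by simp
  show "integrable lborel w" unfolding w_def using emeasure_lborel_ball_finite[of a r]
   by simp
  show "lebesgue_point w a"
   unfolding lebesgue_point_def
  proof (intro allI impI exI[of _ r] conjI)
   fix eps rh :: real assume "0 < eps" "0 < rh & rh < r"
   then have "(NN x:ball a rh. en (norm (w x - w a))) = (\<integral>\<^sup>+x. 0 \<partial>(lborel :: (real ^ 'm) measure))"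
    by (intro nn_integral_cong) (auto simp: indicator_def w_def)
   then show "(NN x:ball a rh. en (norm (w x - w a))) <= en eps * vol (ball a rh)" by simp
  qed (rule r)
  fix t :: real assume t: "0 < t"
  show "AA x. x : ?B & x + t *: e : ?B --> dist (f (x + t *: e)) (f x) <= line_int e t w x"
  proof (intro AE_I2 impI)
   fix x assume x: "x : ?B & x + t *: e : ?B"
   have "line_int e t w x = (LINT s:{0..t}|lborel. La * norm e)"
    unfolding line_int_def
    by (rule set_lebesgue_integral_cong) (use convex_line_mem[OF convex_ball, of x a r t e] x in "auto simp: w_def")
   also have "... = t * (La * norm e)" using t by (simp add: set_lebesgue_integral_def)
   finally show "dist (f (x + t *: e)) (f x) <= line_int e t w x"
    using L[of "x + t *: e" x] x t by (simp add: dist_norm algebra_simps)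
  qed
 qed
 then show ?thesis using r by (simp add: w_def)
qed

lemma Df_norm_le_local_lipschitz:
 fixes f :: "real ^ 'm => ('b::hilbert, 'q::finite) qtuple"
 assumes f: "f : BM" and U: "open U" "a : U" and A: "approx_affine U f a A"
  and r: "0 < r" "ball a r <= U" and L: "!!x y. x : ball a r ==> y : ball a r ==> dist (f x) (f y) <= La * dist x y"
 shows "Df_norm (Df U f a) <= real CARD('m) * La"
proof -
 have le: "dir_deriv U f (axis k 1) a <= La" for k
  using dir_norm_le_local_lipschitz[OF f borel_open[OF U(1)] A r L, of "axis k 1"] unfolding dir_deriv_eq[OF f U A] by simp
 have nn: "0 <= dir_deriv U f (axis k 1) a" for k by (simp add: dir_deriv_def qsum_def sum_nonneg)
 have "Df_norm (Df U f a) = L2_set (%k. dir_deriv U f (axis k 1) a) UNIV"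
  unfolding Df_norm_eq[OF f U A] by (simp add: L2_set_def)
 also have "... <= (SUM k:(UNIV :: 'm set). dir_deriv U f (axis k 1) a)" using nn by (intro L2_set_le_sum)
 also have "... <= (SUM k:(UNIV :: 'm set). La)" by (intro sum_mono le)
 finally show ?thesis by simp
qed

lemma nodal_point: "(\<chi> k. of_int (n k)) : cell n I"
 by (auto simp: cell_def)

lemma closed_cell: "closed (cell n (UNIV :: 'm::finite set))"
proof -
 have "cell n UNIV = cbox (\<chi> k. of_int (n k)) (\<chi> k. of_int (n k) + 1)" by (auto simp: cell_def mem_box_cart)
 then show ?thesis by auto
qed

lemma cell_fl: "x : cell (fl x) UNIV"
 by (auto simp: cell_def fl_def)

abbreviation cube_const :: "'q itself => nat => real"
 where "cube_const q n \<equiv> ext_const (pinch_const q) n"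

text \<open>A segment meets finitely many closed cubes, whose preimages are closed sets covering the
  parameter interval; Lipschitz bounds on finitely many closed pieces of an interval combine without
  loss.\<close>

lemma cube_ext_lipschitz_on:
 fixes V :: "('m::finite => int) => ('b::real_normed_vector, 'q::finite) qtuple"
 assumes B: "!!n. spread V n UNIV <= B"
 shows "(cube_const TYPE('q) CARD('m) * B)-lipschitz_on UNIV (cube_ext V)"
proof (rule lipschitz_onI)
 let ?A = "cube_const TYPE('q) CARD('m)"
 have A: "0 <= ?A" by (intro ext_const_nonneg) simp
 have B0: "0 <= B" using spread_nonneg[of V "%_. 0" UNIV] B order_trans by blast
 show "0 <= ?A * B" using A B0 by simp
 fix x y :: "real ^ 'm"
 define ga where "ga t = x + t *: (y - x)" for t :: real
 let ?N = "{n :: 'm => int. ALL k. \<bar>real_of_int (n k)\<bar> <= norm x + norm y + 1}"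
 have c: "continuous_on UNIV ga" unfolding ga_def by (intro continuous_intros)
 have "(?A * B * dist x y)-lipschitz_on {0..1} (%t. cube_ext V (ga t))"
 proof (rule lipschitz_on_closed_Union[where I="?N" and U="%n. ga -` cell n UNIV"])
  show "(?A * B * dist x y)-lipschitz_on (ga -` cell n UNIV) (%t. cube_ext V (ga t))" for n
  proof (rule lipschitz_onI)
   fix s t assume st: "s : ga -` cell n UNIV" "t : ga -` cell n UNIV"
   have "ga s - ga t = (s - t) *: (y - x)" by (simp add: ga_def algebra_simps)
   then have d: "norm (ga s - ga t) = \<bar>s - t\<bar> * dist x y" by (simp add: dist_norm norm_minus_commute)
   let ?B = "dist (cube_ext V (ga s)) (cube_ext V (ga t))"
   have "?B <= ?A * spread V n UNIV * (\<bar>s - t\<bar> * dist x y)"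
    using st component_le_norm_cart[of "ga s - ga t"] d by (intro cube_ext_lipschitz) auto
   also have "... <= ?A * B * (\<bar>s - t\<bar> * dist x y)" using A B by (intro mult_right_mono mult_left_mono) auto
   finally show "?B <= ?A * B * dist x y * dist s t" by (simp add: dist_real_def mult.commute mult.left_commute)
  qed (use A B0 in simp)
  show "closed (ga -` cell n UNIV)" for n using c closed_cell continuous_on_closed_vimage[of UNIV ga] by auto
  show "finite ?N" by (rule finite_bounded_lattice[of _ "norm x + norm y + 1"]) auto
  show "0 <= ?A * B * dist x y" using A B0 by simp
  show "{0..1} <= (UN n:?N. ga -` cell n UNIV)"
  proof
   fix t :: real assume t: "t : {0..1}"
   have "ga t = (1 - t) *: x + t *: y" by (simp add: ga_def algebra_simps)
   then have "norm (ga t) <= (1 - t) * norm x + t * norm y" using norm_triangle_ineq[of "(1 - t) *: x" "t *: y"] t by simp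
   also have "... <= 1 * norm x + 1 * norm y" using t by (intro add_mono mult_right_mono) auto
   finally have g: "norm (ga t) <= norm x + norm y" by simp
   have "\<bar>real_of_int (fl (ga t) k)\<bar> <= norm x + norm y + 1" for k
    using component_le_norm_cart[of "ga t" k] g unfolding fl_def by linarith
   then show "t : (UN n:?N. ga -` cell n UNIV)" using cell_fl[of "ga t"] by blast
  qed
 qed
 from lipschitz_onD[OF this, of 0 1] show "dist (cube_ext V x) (cube_ext V y) <= ?A * B * dist x y"
  by (simp add: ga_def)
qed

section \<open>From translation bounds to Lipschitz approximation\<close>

context unit_ball
begin

lemma lipschitz_borel: "L-lipschitz_on UNIV (f :: real ^ 'm => 'c::metric_space) ==> f : BM"
 by (intro borel_measurable_continuous_onI lipschitz_on_continuous_on)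

lemma lipschitz_weak_sobolev:
 fixes f :: "real ^ 'm => ('b::hilbert, 'q::finite) qtuple"
 assumes L: "L-lipschitz_on UNIV f"
 shows "weak_sobolev f"
 unfolding weak_sobolev_def
proof (intro conjI allI)
 show f[measurable]: "f : BM" by (rule lipschitz_borel[OF L])
 have L0: "0 <= L" by (rule lipschitz_on_nonneg[OF L])
 have iU: "integrable lborel (ind U :: real ^ 'm => real)" using finite_U by simp
 show "integrable lborel (%x. ind U x * dist (f x) T)" for T
 proof (rule Bochner_Integration.integrable_bound)
  show "integrable lborel (%x. (L + dist (f 0) T) * ind U x :: real)" using iU by simp
  show "AA x. norm (ind U x * dist (f x) T) <= norm ((L + dist (f 0) T) * ind U x :: real)"
  proof (intro AE_I2)
   fix x
   have "dist (f x) T <= L + dist (f 0) T" if "x : U"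
   proof -
    have "dist (f x) (f 0) <= L * norm x" using lipschitz_onD[OF L, of x 0] by simp
    also have "... <= L * 1" using that L0 by (intro mult_left_mono) (auto simp: U_ball)
    finally show ?thesis using dist_triangle[of "f x" T "f 0"] by simp
   qed
   then show "norm (ind U x * dist (f x) T) <= norm ((L + dist (f 0) T) * ind U x :: real)" by (auto simp: indicator_def)
  qed
 qed measurable
 have "nik U p (L powr p * measure lborel U) f"
  unfolding nik_def
 proof (intro conjI allI)
  fix h
  let ?A = "%x. en (dist (f (x + h)) (f x) powr p)"
  let ?B = "en (L powr p * measure lborel U * norm h powr p)"
  let ?C = "en ((L * norm h) powr p)"
  have "(NN x:(seg U h). (?A x)) <= (NN x:U. ?C)"
  proof (rule nn_integral_mono)
   fix x
   have "dist (f (x + h)) (f x) <= L * norm h" using lipschitz_onD[OF L, of "x + h" x] by (simp add: dist_norm)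
   then show "(?A x) * ind (seg U h) x <= ?C * ind U x"
    using p by (auto simp: indicator_def intro!: powr_mono2)
  qed
  also have "... = ?C * vol U" by (simp add: nn_integral_cmult_indicator)
  also have "... = ?B"
   using finite_U by (simp add: emeasure_eq_ennreal_measure ennreal_mult[symmetric] powr_mult)
  finally show "(NN x:(seg U h). (?A x)) <= ?B" .
 qed simp
 then show "EX K. nik U p K f" by blast
qed

lemma spread_attained: "EX J J'. spread V n I = dist (V (vertex n J)) (V (vertex n J')) & J <= I & J' <= I" for I :: "'m set"
proof -
 have "spread V n I : (%(J, J'). dist (V (vertex n J)) (V (vertex n J'))) ` (Pow I \<times> Pow I)"
  unfolding spread_def by (rule Max_in) auto
 then show ?thesis by auto
qed

text \<open>The spread is the distance of two representative values. Both representatives are within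
  4 N dl of each point y of one shrunken cube, so integrating the triangle inequality through f y
  over it yields two oscillations; the factor 2^N accounts for the side of the shrunken
  cube.\<close>

lemma spread_le_osc:
 fixes f :: "real ^ 'm => 'c::sep_metric"
 assumes [measurable]: "f : BM" and dl: "0 < dl" "dl <= 1 / (4 * real N)"
  and n: "!!J. vertex n J : nodes dl" and x: "!!v. v : nodes dl ==> x v : grid (shrink dl * dl) v" and V: "!!v. v : nodes dl ==> V v = f (x v)"
 shows "en (spread V n UNIV powr p * dl ^ N) <= en (2 ^ N * 2 powr p * 2) * (SUM J:UNIV. osc (4 * real N * dl) f (x (vertex n J)))"
proof -
 let ?s = "shrink dl * dl" and ?r = "4 * real N * dl"
 let ?e = "%J. osc ?r f (x (vertex n J))"
 have s: "0 < ?s" "?s <= dl" "dl <= 2 * ?s" using shrink[OF dl] dl by auto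
 obtain J J' where J: "spread V n UNIV = dist (V (vertex n J)) (V (vertex n J'))" using spread_attained by blast
 let ?D = "spread V n UNIV"
 have v0: "vertex n {} = n" by (auto simp: vertex_def)
 have sub: "grid ?s n <= U" using n[of "{}"] by (simp add: v0 nodes_def)
 have near: "y : cball (x (vertex n K)) ?r" if "y : grid ?s n" for y K
 proof -
  have "\<bar>(x (vertex n K) - y) $ k\<bar> <= 2 * ?s" for k
  proof -
   have "?s * of_int (vertex n K k) <= x (vertex n K) $ k" "x (vertex n K) $ k < ?s * (of_int (vertex n K k) + 1)"
    "?s * of_int (n k) <= y $ k" "y $ k < ?s * (of_int (n k) + 1)"
    using x[OF n[of K]] that s by (auto simp: grid_iff)
   moreover have "real_of_int (vertex n K k) = of_int (n k) | real_of_int (vertex n K k) = of_int (n k) + 1" by (auto simp: vertex_def)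
   ultimately show ?thesis by (auto simp: algebra_simps)
  qed
  from norm_le_card[OF this] have "norm (x (vertex n K) - y) <= real N * (2 * ?s)" by (simp only: N)
  also have "... <= real N * (4 * dl)" using s dl by (intro mult_left_mono) auto
  finally show ?thesis by (simp add: dist_norm)
 qed
 let ?C = "SUM J:UNIV. ?e J"
 let ?E = "x (vertex n J)"
 let ?F = "en (?D powr p)"
 let ?G = "x (vertex n J')"
 have "?F * en (?s ^ N) = (NN y:grid ?s n. ?F)"
  using s by (simp add: nn_integral_cmult_indicator emeasure_grid N)
 also have "... <= (NN y. en (2 powr p) * (en (dist (f y) (f ?E) powr p) * ind (U Int cball ?E ?r) y
  + en (dist (f y) (f ?G) powr p) * ind (U Int cball ?G ?r) y))"
 proof (rule nn_integral_mono)
  fix y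
  let ?A = "dist (f y) (f ?G)"
  let ?B = "dist (f y) (f ?E)"
  show "?F * ind (grid ?s n) y <= en (2 powr p) * (en (?B powr p) * ind (U Int cball ?E ?r) y
  + en (?A powr p) * ind (U Int cball ?G ?r) y)"
  proof (cases "y : grid ?s n")
   case True
   have "?D <= ?B + ?A"
    unfolding J V[OF n] by (rule dist_triangle3)
   then have "?D powr p <= (?B + ?A) powr p"
    using p spread_nonneg by (intro powr_mono2) auto
   also have "... <= 2 powr p * (?B powr p + ?A powr p)"
    by (rule powr_add_le) (use p in auto)
   finally show ?thesis using True near sub
    by (auto simp: indicator_def ennreal_plus[symmetric] ennreal_mult[symmetric] simp del: ennreal_plus intro!: ennreal_leI)
  qed simp
 qed
 also have "... = en (2 powr p) * (?e J + ?e J')"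
  unfolding osc_def by (subst nn_integral_cmult) (auto simp: nn_integral_add)
 also have "... <= en (2 powr p) * (?C + ?C)"
  by (intro mult_left_mono add_mono member_le_sum) auto
 also have "... = en (2 powr p * 2) * ?C" by (simp add: ennreal_mult mult_2[symmetric] mult.assoc)
 finally have main: "?F * en (?s ^ N) <= en (2 powr p * 2) * ?C" .
 have "?D powr p * dl ^ N <= ?D powr p * (2 * ?s) ^ N" using s dl by (intro mult_left_mono power_mono) auto
 then have "en (?D powr p * dl ^ N) <= en (2 ^ N) * (?F * en (?s ^ N))"
  using s by (simp add: power_mult_distrib ennreal_mult[symmetric] mult_ac del: ennreal_le_iff) (simp add: ennreal_leI)
 also have "... <= en (2 ^ N) * (en (2 powr p * 2) * ?C)" by (intro mult_left_mono main) simp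
 also have "... = en (2 ^ N * 2 powr p * 2) * ?C" by (simp add: ennreal_mult mult.assoc)
 finally show ?thesis .
qed

text \<open>For a fixed \<open>J\<close> the vertex map is injective in the corner, and there are
  2^N sets \<open>J\<close>: a lattice point belongs to at most that many cubes.\<close>

lemma sum_vertex_le:
 fixes e :: "('m => int) => ennreal"
 assumes "finite M" "!!n J. n : Q ==> vertex n J : M"
 shows "(SUM n:Q. SUM J:UNIV. e (vertex n J)) <= en (2 ^ N) * (SUM v:M. e v)"
proof -
 have "(SUM n:Q. SUM J:UNIV. e (vertex n J)) = (SUM J:UNIV. SUM n:Q. e (vertex n J))" by (rule sum.swap)
 also have "... <= (SUM J:(UNIV :: 'm set set). SUM v:M. e v)"
 proof (rule sum_mono)
  fix J :: "'m set"
  have inj: "inj_on (%n. vertex n J) Q"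
  proof (rule inj_onI)
   fix n n' assume "vertex n J = vertex n' J"
   then have "vertex n J k = vertex n' J k" for k by simp
   then have "n k = n' k" for k by (cases "k : J") (auto simp: vertex_def dest: meta_spec[of _ k])
   then show "n = n'" by blast
  qed
  have "(SUM n:Q. e (vertex n J)) = (SUM v:(%n. vertex n J) ` Q. e v)" by (simp add: sum.reindex[OF inj])
  also have "... <= (SUM v:M. e v)" using assms by (intro sum_mono2) auto
  finally show "(SUM n:Q. e (vertex n J)) <= (SUM v:M. e v)" .
 qed
 also have "... = en (2 ^ N) * (SUM v:M. e v)"
  by (simp add: N card_Pow) (simp add: ennreal_power[symmetric])
 finally show ?thesis .
qed

end

context unit_ball
begin

text \<open>A single crude majorant for both the energy and the distance estimate, independent of
  the grid width.\<close>

definition approx_const :: "'q::finite itself => real"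
 where "approx_const q = 2 powr p * ((cube_const TYPE('q) N * real N) powr p + cube_const TYPE('q) N powr p + 1)
  * (2 ^ N * 2 powr p * 2 + 1) * 2 ^ N * grid_const"

lemma approx_const_nonneg: "0 <= approx_const TYPE('q::finite)"
 by (simp add: approx_const_def grid_const_nonneg)

text \<open>\<open>F\<close> extends the representative values cubically at scale \<open>dl\<close>.
  On the cube with corner n its Lipschitz constant is a multiple of D n / dl, and the sum of the
  terms D n powr p * dl ^ N is at most a multiple of K dl powr p. Division by dl powr p gives an
  energy bound free of \<open>dl\<close>, while the distance to \<open>f\<close> keeps that
  factor.\<close>

theorem lipschitz_approximation_step:
 fixes f :: "real ^ 'm => ('b::hilbert, 'q::finite) qtuple"
 assumes f[measurable]: "f : BM" and n: "nik U p K f" and dl: "0 < dl" "dl <= 1 / (4 * real N)"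
 obtains F L where "L-lipschitz_on UNIV F" "energy U p F <= en (approx_const TYPE('q) * K)"
  "Dp F f <= en (approx_const TYPE('q) * K * dl powr p)"
proof -
 let ?A = "cube_const TYPE('q) N" and ?r = "4 * real N * dl"
 have A: "0 <= ?A" by (intro ext_const_nonneg) simp
 have K: "0 <= K" using n by (simp add: nik_def)
 obtain x where x: "!!v. v : nodes dl ==> x v : grid (shrink dl * dl) v"
  "(SUM v:nodes dl. osc ?r f (x v)) <= en (grid_const * K * dl powr p)"
  by (rule grid_representatives[OF f n dl]) auto
 \<comment> \<open>The default is taken at lattice points without representative. No cube that meets
   \<open>U\<close> uses it, but it leaves finitely many values in all, so that the spreads are
   bounded and \<open>F\<close> is Lipschitz on the whole space.\<close>
 define V where "V v = (if v : nodes dl then f (x v) else qconst 0)" for v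
 define D where "D n = spread V n UNIV" for n
 define F where "F z = cube_ext V ((1/dl) *: z)" for z
 define Q where "Q = (%z. fl ((1/dl) *: z)) ` U"
 define E where "E n = (SUM J:UNIV. osc ?r f (x (vertex n J)))" for n
 let ?c = "2 ^ N * 2 powr p * 2 :: real"
 note fin = finite_nodes[OF dl]
 have Qv: "vertex n J : nodes dl" if "n : Q" for n J
 proof -
  from that obtain z where "z : U" "n = fl ((1/dl) *: z)" by (auto simp: Q_def)
  then show ?thesis using vertex_nodes[OF dl, of z n J] by (simp add: grid_def)
 qed
 have v0: "vertex n {} = n" for n :: "'m => int" by (auto simp: vertex_def)
 have "Q <= nodes dl" using Qv[of _ "{}"] by (auto simp: v0)
 then have Qf: "finite Q" using fin finite_subset by blast
 have D0: "0 <= D n" for n unfolding D_def by (rule spread_nonneg)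
 have DE: "en (D n powr p * dl ^ N) <= en ?c * E n" if "n : Q" for n
  unfolding D_def E_def by (rule spread_le_osc[OF f dl Qv[OF that] x(1)]) (auto simp: V_def)
 let ?D = "en (2 ^ N * grid_const * K * dl powr p)"
 have EQ: "(SUM n:Q. E n) <= ?D"
 proof -
  have "(SUM n:Q. E n) <= en (2 ^ N) * (SUM v:nodes dl. osc ?r f (x v))"
   unfolding E_def by (rule sum_vertex_le[OF fin Qv])
  also have "... <= en (2 ^ N) * en (grid_const * K * dl powr p)" by (intro mult_left_mono x) simp
  also have "... = ?D" using K grid_const_nonneg by (simp add: ennreal_mult[symmetric])
  finally show ?thesis .
 qed
 let ?B = "en (approx_const TYPE('q) * K * dl powr p)"
 let ?J = "2 ^ N * grid_const"
 have total: "(SUM n:Q. en b * E n) <= ?B"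
  if "0 <= b" "b * ?J <= approx_const TYPE('q)" for b
 proof -
  have "(SUM n:Q. en b * E n) = en b * (SUM n:Q. E n)" by (simp add: sum_distrib_left)
  also have "... <= en b * ?D" by (intro mult_left_mono EQ) simp
  also have "... = en (b * ?J * (K * dl powr p))" using that K grid_const_nonneg by (simp add: ennreal_mult[symmetric])
  also have "... <= en (approx_const TYPE('q) * (K * dl powr p))" using K by (intro ennreal_leI mult_right_mono that) auto
  finally show ?thesis by (simp add: mult.assoc)
 qed
 have "EX B. ALL n. D n <= B"
 proof -
  let ?R = "insert (qconst 0) ((%v. f (x v)) ` nodes dl)"
  have VR: "V v : ?R" for v by (auto simp: V_def)
  have "D n <= diameter ?R" for n unfolding D_def
   by (rule spread_le) (intro diameter_bounded_bound VR, use fin in auto)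
  then show ?thesis by blast
 qed
 then obtain B where B: "!!n. D n <= B" by blast
 have FL: "(?A * B / dl)-lipschitz_on UNIV F"
 proof (rule lipschitz_onI)
  have B0: "0 <= B" using D0 B order_trans by blast
  then show "0 <= ?A * B / dl" using A dl by simp
  fix y z
  have "dist (F y) (F z) <= ?A * B * dist ((1/dl) *: y) ((1/dl) *: z)"
   unfolding F_def using lipschitz_onD[OF cube_ext_lipschitz_on[of V B]] B by (simp add: N D_def)
  also have "dist ((1/dl) *: y) ((1/dl) *: z) = dist y z / dl" using dl by (simp add: dist_norm flip: scaleR_diff_right)
  finally show "dist (F y) (F z) <= ?A * B / dl * dist y z" by simp
 qed
 have local: "dist (F y) (F z) <= ?A * D n / dl * dist y z" if "(1/dl) *: y : cell n UNIV" "(1/dl) *: z : cell n UNIV" for y z n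
 proof -
  have "\<bar>((1/dl) *: y) $ k - ((1/dl) *: z) $ k\<bar> <= dist y z / dl" for k
  proof -
   have "((1/dl) *: y) $ k - ((1/dl) *: z) $ k = (y - z) $ k / dl" by (simp add: diff_divide_distrib)
   then have "\<bar>((1/dl) *: y) $ k - ((1/dl) *: z) $ k\<bar> = \<bar>(y - z) $ k\<bar> / dl" by (simp only: abs_divide abs_of_pos[OF dl(1)])
   also have "... <= norm (y - z) / dl" using dl by (intro divide_right_mono component_le_norm_cart) simp
   finally show ?thesis by (simp add: dist_norm)
  qed
  from cube_ext_lipschitz[OF that this, of V] show ?thesis by (simp add: F_def D_def N)
 qed
 have node: "dist (F z) (V n) <= ?A * D n" if "z : grid dl n" for z n
 proof -
  let ?a = "(\<chi> k. of_int (n k)) :: real ^ 'm"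
  have zc: "(1/dl) *: z : cell n UNIV" using that cell_fl[of "(1/dl) *: z"] by (simp add: grid_def)
  have "\<bar>((1/dl) *: z) $ k - ?a $ k\<bar> <= 1" for k using zc by (auto simp: cell_def dest: spec[of _ k])
  from cube_ext_lipschitz[OF zc nodal_point this, of V] cube_ext_vertex[OF nodal_point, of V n]
  show ?thesis by (simp add: F_def D_def N)
 qed
 have [measurable]: "F : BM" by (rule lipschitz_borel[OF FL])
 let ?F = "(?A * real N) powr p + ?A powr p + 1"
 let ?L = "?A powr p * ?c + 1"
 let ?G = "en (2 powr p * ?L)"
 have "Dp F f = (SUM n:Q. NN z:(U Int grid dl n). en (dist (F z) (f z) powr p))"
 proof (rule nn_integral_grid_sum(2)[OF _ Qf])
  show "fl ((1/dl) *: z) : Q" if "z : U" for z using that by (simp add: Q_def)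
 qed measurable
 also have "... <= (SUM n:Q. ?G * E n)"
 proof (rule sum_mono)
  fix n assume nQ: "n : Q"
  have nn: "n : nodes dl" using Qv[OF nQ, of "{}"] by (simp add: v0)
  let ?E = "en (?A powr p * D n powr p)"
  let ?I = "NN z:(U Int grid dl n). en (dist (F z) (f z) powr p)"
  have "?I
   <= (NN z. en (2 powr p) * (?E * ind (grid dl n) z + en (dist (f z) (f (x n)) powr p) * ind (U Int cball (x n) ?r) z))"
  proof (rule nn_integral_mono)
   fix z
   let ?H = "dist (f z) (f (x n))"
   show "en (dist (F z) (f z) powr p) * ind (U Int grid dl n) z
    <= en (2 powr p) * (?E * ind (grid dl n) z + en (?H powr p) * ind (U Int cball (x n) ?r) z)"
   proof (cases "z : U Int grid dl n")
    case True
    have zc: "z : U Int cball (x n) ?r" using True grid_close(2)[OF dl, of z n "x n" "{}"] x(1)[OF nn] by (simp add: v0)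
    have "dist (F z) (f z) <= ?A * D n + ?H"
     using node[of z n] True nn dist_triangle2[of "F z" "f z" "f (x n)"] by (simp add: V_def)
    then have "dist (F z) (f z) powr p <= (?A * D n + ?H) powr p" using p by (intro powr_mono2) auto
    also have "... <= 2 powr p * ((?A * D n) powr p + ?H powr p)" by (rule powr_add_le) (use A D0 p in auto)
    also have "(?A * D n) powr p = ?A powr p * D n powr p" by (simp add: powr_mult)
    finally show ?thesis using True zc
     by (auto simp: indicator_def ennreal_plus[symmetric] ennreal_mult[symmetric] simp del: ennreal_plus intro!: ennreal_leI)
   qed simp
  qed
  also have "... = en (2 powr p) * (?E * vol (grid dl n) + osc ?r f (x n))"
   unfolding osc_def by (subst nn_integral_cmult) (auto simp: nn_integral_add nn_integral_cmult_indicator)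
  also have "?E * vol (grid dl n) = en (?A powr p) * en (D n powr p * dl ^ N)"
   using dl by (simp add: emeasure_grid N ennreal_mult[symmetric] mult.assoc)
  also have "en (2 powr p) * (... + osc ?r f (x n)) <= en (2 powr p) * (en (?A powr p) * (en ?c * E n) + E n)"
   using member_le_sum[of "{}" UNIV "%J. osc ?r f (x (vertex n J))"]
   by (intro mult_left_mono add_mono DE nQ) (auto simp: E_def v0)
  also have "... = ?G * E n"
   by (simp add: ennreal_mult ennreal_plus[symmetric] algebra_simps del: ennreal_plus) (simp add: ennreal_mult algebra_simps)
  finally show "?I <= ?G * E n" .
 qed
 also have "... <= ?B"
 proof (rule total)
  have "2 powr p * ?L <= 2 powr p * ?F * (?c + 1)"
   by (simp add: algebra_simps add_increasing)
  then show "2 powr p * ?L * ?J <= approx_const TYPE('q)"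
   unfolding approx_const_def mult.assoc[of _ "2 ^ N" grid_const] using grid_const_nonneg by (intro mult_right_mono) auto
 qed simp
 finally have Dp: "Dp F f <= ?B" .
 let ?g = "%n. (real N * (?A * D n / dl)) powr p"
 define a b where "a n = (\<chi> k. dl * of_int (n k) :: real ^ 'm)" and "b n = (\<chi> k. dl * (of_int (n k) + 1) :: real ^ 'm)" for n :: "'m => int"
 have cbox: "(1/dl) *: z : cell n UNIV" if "z : box (a n) (b n)" for z n
  using that dl by (auto simp: cell_def mem_box_cart a_def b_def field_simps less_imp_le)
 have gridc: "grid dl n <= cbox (a n) (b n)" for n
  using dl by (auto simp: grid_iff mem_box_cart a_def b_def less_imp_le)
 \<comment> \<open>Almost every point is interior to its cube, where the local Lipschitz constant of
   a single cube controls the differential.\<close>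
 have "AA z. ALL n:Q. z ~: cbox (a n) (b n) - box (a n) (b n)"
  by (intro AE_finite_allI Qf AE_lborel_if_negligible) (simp only: not_not Collect_mem_eq negligible_frontier_interval)
 then have dens: "AA z. en (Df_norm (Df U F z) powr p) * ind U z <= (SUM n:Q. en (?g n) * ind (grid dl n) z)"
  using AE_approx[OF lipschitz_weak_sobolev[OF FL]]
 proof eventually_elim
  case (elim z)
  show ?case
  proof (cases "z : U")
   case True
   define n where "n = fl ((1/dl) *: z)"
   have nQ: "n : Q" using True by (auto simp: n_def Q_def)
   have zn: "z : grid dl n" by (simp add: grid_def n_def)
   have "open (box (a n) (b n) Int U)" using open_U by (simp add: open_box open_Int)
   moreover have "z : box (a n) (b n) Int U" using elim(1) nQ zn gridc[of n] True by auto
   ultimately obtain r where r: "0 < r" "ball z r <= box (a n) (b n) Int U" using open_contains_ball by blast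
   obtain A where A': "approx_affine U F z A" using elim(2) True by blast
   have "Df_norm (Df U F z) <= real CARD('m) * (?A * D n / dl)"
   proof (rule Df_norm_le_local_lipschitz[OF _ open_U True A' r(1)])
    fix y y' assume "y : ball z r" "y' : ball z r"
    then show "dist (F y) (F y') <= ?A * D n / dl * dist y y'" using r(2) by (intro local cbox) auto
   qed (use r(2) in auto)
   then have "Df_norm (Df U F z) powr p <= ?g n" using p by (intro powr_mono2) (auto simp: N Df_norm_def qsum_def sum_nonneg)
   then have "en (Df_norm (Df U F z) powr p) * ind U z <= en (?g n) * ind (grid dl n) z"
    using True zn by (simp add: ennreal_leI)
   also have "... <= (SUM n:Q. en (?g n) * ind (grid dl n) z)" using nQ Qf by (intro member_le_sum) auto
   finally show ?thesis .
  qed simp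
 qed
 let ?C = "en ((?A * real N) powr p * ?c / dl powr p)"
 let ?K = "en ((?A * real N) powr p / dl powr p)"
 have "energy U p F <= (NN z. (SUM n:Q. en (?g n) * ind (grid dl n) z))"
  unfolding energy_eq by (rule nn_integral_mono_AE[OF dens])
 also have "... = (SUM n:Q. en (?g n) * vol (grid dl n))"
  by (subst nn_integral_sum) (auto simp: nn_integral_cmult_indicator)
 also have "... <= (SUM n:Q. ?C * E n)"
 proof (rule sum_mono)
  fix n assume nQ: "n : Q"
  have "?g n = (?A * real N) powr p / dl powr p * D n powr p"
  proof -
   have "real N * (?A * D n / dl) = (?A * real N) * D n / dl" by simp
   then show ?thesis using A dl D0 by (simp only: powr_divide powr_mult) (simp add: powr_divide powr_mult)
  qed
  then have "en (?g n) * vol (grid dl n) = ?K * en (D n powr p * dl ^ N)"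
   using dl by (simp add: emeasure_grid N ennreal_mult[symmetric])
  also have "... <= ?K * (en ?c * E n)" by (intro mult_left_mono DE nQ) simp
  also have "... = ?C * E n" by (simp add: ennreal_mult[symmetric] mult.assoc[symmetric])
  finally show "en (?g n) * vol (grid dl n) <= ?C * E n" .
 qed
 also have "... = en (1 / dl powr p) * (SUM n:Q. en ((?A * real N) powr p * ?c) * E n)"
  by (simp add: sum_distrib_left mult.assoc[symmetric] ennreal_mult[symmetric])
 also have "... <= en (1 / dl powr p) * ?B"
 proof (intro mult_left_mono total)
  have "(?A * real N) powr p * ?c <= 1 * ?F * (?c + 1)"
   by (simp add: algebra_simps add_increasing)
  also have "... <= 2 powr p * ?F * (?c + 1)"
   using p by (intro mult_right_mono ge_one_powr_ge_zero) auto
  finally show "(?A * real N) powr p * ?c * ?J <= approx_const TYPE('q)"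
   unfolding approx_const_def mult.assoc[of _ "2 ^ N" grid_const] using grid_const_nonneg by (intro mult_right_mono) auto
 qed auto
 also have "... = en (approx_const TYPE('q) * K)"
  using dl K approx_const_nonneg[where ?'q='q] by (simp add: ennreal_mult[symmetric])
 finally have "energy U p F <= en (approx_const TYPE('q) * K)" .
 then show ?thesis using that[OF FL _ Dp] by blast
qed

theorem lipschitz_approximation:
 fixes f :: "real ^ 'm => ('b::hilbert, 'q::finite) qtuple"
 assumes f: "f : BM" and n: "nik U p K f"
 obtains F where "!!j. EX L. L-lipschitz_on UNIV (F j)" "!!j. energy U p (F j) <= en (approx_const TYPE('q) * K)"
  "(%j::nat. Dp (F j) f) ~~> 0"
proof -
 define dl where "dl j = 1 / (4 * real N) * (1 / real (Suc j))" for j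
 have dl: "0 < dl j" "dl j <= 1 / (4 * real N)" for j
  using N_pos mult_left_le[of "1 / real (Suc j)" "1 / (4 * real N)"] by (auto simp: dl_def)
 let ?A = "%j. en (approx_const TYPE('q) * K * dl j powr p)"
 let ?B = "en (approx_const TYPE('q) * K)"
 have "ALL j. EX F. (EX L. L-lipschitz_on UNIV F) & energy U p F <= ?B &
  Dp F f <= (?A j)"
 proof
  fix j
  show "EX F. (EX L. L-lipschitz_on UNIV F) & energy U p F <= ?B &
   Dp F f <= en (approx_const TYPE('q) * K * dl j powr p)"
   by (rule lipschitz_approximation_step[OF f n dl, of j]) blast
 qed
 from choice[OF this] obtain F where F: "!!j. EX L. L-lipschitz_on UNIV (F j)" "!!j. energy U p (F j) <= ?B"
  "!!j. Dp (F j) f <= (?A j)" by blast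
 have "dl ~~> 1 / (4 * real N) * 0" unfolding dl_def by (intro tendsto_mult tendsto_const lim_1_over_n[THEN LIMSEQ_Suc])
 then have "(%j. approx_const TYPE('q) * K * dl j powr p) ~~> approx_const TYPE('q) * K * (0 powr p)"
  using p dl(1) by (intro tendsto_mult tendsto_powr') (auto intro!: always_eventually less_imp_le)
 then have "(%j. (?A j)) ~~> en 0" by (intro tendsto_ennrealI) simp
 then have lim0: "(%j. (?A j)) ~~> 0" by simp
 have "(%j. Dp (F j) f) ~~> 0"
 proof (rule tendsto_sandwich[OF _ _ tendsto_const lim0])
  show "\<forall>\<^sub>F j in sequentially. Dp (F j) f <= (?A j)" by (intro always_eventually allI F(3))
 qed simp
 then show ?thesis using that F(1,2) by blast
qed

end

section \<open>Hausdorff measure of spherical caps\<close>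

lemma sets_hausdorff_measure [simp, measurable_cong]: "sets (hausdorff_measure k) = sets borel"
 using sets.sigma_sets_eq[of borel] by (simp add: hausdorff_measure_def)

lemma space_hausdorff_measure [simp]: "space (hausdorff_measure k) = UNIV"
 by (simp add: hausdorff_measure_def)

text \<open>The value of \<open>measure_of\<close> is either that of the outer measure or its
  default 0, and the inequality is true in both cases. The trace estimates use the boundary measure
  through upper bounds of this kind.\<close>

lemma emeasure_hausdorff_le: "emeasure (hausdorff_measure k) E <= hausdorff_outer k E"
 unfolding hausdorff_measure_def by (subst emeasure_measure_of_conv) auto

text \<open>A labelling with finitely many values is a covering in disguise: its fibres are the
  covering sets and the number of labels is their number.\<close>

lemma hausdorff_content_le_fibres:
 assumes La: "finite La" "lab ` E <= La" and D: "!!x y. x : E ==> y : E ==> lab x = lab y ==> dist x y <= D" and "0 <= D" "D <= dl"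
 shows "hausdorff_content k dl E <= en (real (card La) * (unit_ball_vol (real k) * (D / 2) ^ k))"
proof -
 obtain e where e: "bij_betw e {..<card La} La" using ex_bij_betw_nat_finite[OF La(1)] by (auto simp: atLeast0LessThan)
 define A where "A i = (if i < card La then {x:E. lab x = e i} else {})" for i
 have bd: "bounded (A i)" for i
 proof (cases "A i = {}")
  case False
  then obtain x where "x : A i" by blast
  then show ?thesis unfolding bounded_def using D by (intro exI[of _ x] exI[of _ D]) (auto simp: A_def)
 qed simp
 have dA: "diameter (A i) <= D" for i
  unfolding diameter_def using assms(4) D by (auto simp: A_def intro!: cSUP_least)
 let ?A = "unit_ball_vol (real k) * (D / 2) ^ k"
 have "E <= (UN i. A i)"
 proof
  fix x assume x: "x : E"
  then have "lab x : e ` {..<card La}" using La(2) e by (auto simp: bij_betw_def)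
  then show "x : (UN i. A i)" using x by (auto simp: A_def)
 qed
 then have "hausdorff_content k dl E <= (\<Sum>i. hausdorff_gauge k (A i))"
  unfolding hausdorff_content_def using bd dA assms(5) by (intro INF_lower) (auto intro: order_trans)
 also have "... = (SUM i<card La. hausdorff_gauge k (A i))"
  by (intro suminf_finite) (auto simp: A_def hausdorff_gauge_def)
 also have "... <= (SUM i<card La. en ?A)"
  using dA bd by (intro sum_mono) (auto simp: hausdorff_gauge_def diameter_ge_0 intro!: ennreal_leI power_mono)
 also have "... = en (real (card La) * ?A)"
  using assms(4) by (simp add: ennreal_mult ennreal_of_nat_eq_real_of_nat)
 finally show ?thesis .
qed

text \<open>Where one coordinate is at least 1/m in absolute value with a fixed sign, the sphere is
  a graph over the others: subtracting the two sphere equations bounds |x_j^2 - y_j^2|, and |x_j +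
  y_j| >= 2/m divides out.\<close>

lemma sphere_patch_dist:
 fixes x y :: "real ^ 'm"
 assumes s: "norm x = 1" "norm y = 1" and j: "1 / real CARD('m) <= sg * x $ j" "1 / real CARD('m) <= sg * y $ j" "\<bar>sg\<bar> = 1"
  and h: "!!i. i ~= j ==> \<bar>x $ i - y $ i\<bar> <= h" "0 <= h"
 shows "dist x y <= real CARD('m) ^ 3 * h"
proof -
 let ?m = "real CARD('m)"
 have m: "1 <= ?m" by simp
 have sq: "(SUM i:UNIV. (z $ i)^2) = 1" if "norm z = 1" for z :: "real ^ 'm"
  using that by (simp add: norm_vec_def L2_set_def)
 have "(x $ j)^2 - (y $ j)^2 = (SUM i:UNIV - {j}. (y $ i)^2 - (x $ i)^2)"
  using sq[OF s(1)] sq[OF s(2)] by (simp add: sum.remove[of UNIV j] sum_subtractf)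
 then have "\<bar>(x $ j)^2 - (y $ j)^2\<bar> <= (SUM i:UNIV - {j}. \<bar>(y $ i)^2 - (x $ i)^2\<bar>)" by simp
 also have "... <= (SUM i:UNIV - {j}. 2 * h)"
 proof (rule sum_mono)
  fix i assume i: "i : UNIV - {j}"
  have "\<bar>(y $ i)^2 - (x $ i)^2\<bar> = \<bar>y $ i + x $ i\<bar> * \<bar>x $ i - y $ i\<bar>"
   by (simp add: power2_eq_square square_diff_square_factored abs_mult abs_minus_commute)
  also have "... <= 2 * h"
   using component_le_norm_cart[of x i] component_le_norm_cart[of y i] s h i by (intro mult_mono) auto
  finally show "\<bar>(y $ i)^2 - (x $ i)^2\<bar> <= 2 * h" .
 qed
 also have "... <= (SUM i:(UNIV :: 'm set). 2 * h)" using h by (intro sum_mono2) auto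
 finally have 1: "\<bar>(x $ j)^2 - (y $ j)^2\<bar> <= ?m * (2 * h)" by simp
 have "2 / ?m <= \<bar>x $ j + y $ j\<bar>" using j by (auto simp: abs_if split: if_splits)
 then have "2 / ?m * \<bar>x $ j - y $ j\<bar> <= \<bar>x $ j + y $ j\<bar> * \<bar>x $ j - y $ j\<bar>" by (rule mult_right_mono) simp
 also have "... = \<bar>(x $ j)^2 - (y $ j)^2\<bar>" by (simp add: power2_eq_square square_diff_square_factored abs_mult)
 also note 1
 finally have "\<bar>x $ j - y $ j\<bar> <= ?m^2 * h" by (simp add: field_simps power2_eq_square)
 moreover have "h <= ?m^2 * h" using h by (simp add: mult_le_cancel_right1)
 ultimately have "\<bar>(x - y) $ i\<bar> <= ?m^2 * h" for i using h(1)[of i] by (cases "i = j") auto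
 from norm_le_card[OF this] show ?thesis by (simp add: dist_norm power3_eq_cube power2_eq_square)
qed

lemma sphere_large_coordinate:
 fixes x :: "real ^ 'm"
 assumes "norm x = 1"
 shows "EX j. 1 / real CARD('m) <= \<bar>x $ j\<bar>"
proof (rule ccontr)
 assume "~ ?thesis"
 then have "\<bar>x $ j\<bar> < 1 / real CARD('m)" for j by (auto simp: not_le)
 then have "(SUM j:UNIV. \<bar>x $ j\<bar>) < (SUM j:(UNIV :: 'm set). 1 / real CARD('m))" by (intro sum_strict_mono) auto
 then show False using norm_le_l1_cart[of x] assms by simp
qed

text \<open>Two signs, n choices of the large coordinate, (4 M)^(n-1) lattice positions, and fibres
  of diameter n^3 r / M; the powers of M cancel.\<close>

definition sphere_const :: "nat => real"
 where "sphere_const n = 2 * real n * 4 ^ (n - 1) * unit_ball_vol (real (n - 1)) * (real n ^ 3 / 2) ^ (n - 1)"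

text \<open>A cap of radius r is labelled at scale h = r / M. The number of labels grows like
  M^(m-1) while the gauge of a fibre decays like M^(1-m), so the bound is the same for every M, and
  a large M makes the covering as fine as required.\<close>

theorem hausdorff_sphere_ball_le:
 fixes a :: "real ^ 'm"
 assumes r: "0 < r"
 shows "emeasure (hausdorff_measure (CARD('m) - 1)) (sphere 0 1 Int ball a r) <= en (sphere_const CARD('m) * r ^ (CARD('m) - 1))"
proof -
 let ?m = "CARD('m)" and ?E = "sphere 0 1 Int ball a r"
 let ?k = "?m - 1"
 have m: "1 <= real ?m" by simp
 have "hausdorff_content ?k dl ?E <= en (sphere_const ?m * r ^ ?k)" if dl: "0 < dl" for dl
 proof -
  obtain M :: nat where M: "real ?m ^ 3 * r / dl < real M" using reals_Archimedean2 by blast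
  moreover have "0 < real ?m ^ 3 * r / dl" using r dl by simp
  ultimately have M0: "0 < real M" by simp
  define h where "h = r / real M"
  have h: "0 < h" using r M0 by (simp add: h_def)
  define J where "J x = (SOME j. 1 / real ?m <= \<bar>x $ j\<bar>)" for x :: "real ^ 'm"
  have J: "1 / real ?m <= \<bar>x $ J x\<bar>" if "x : ?E" for x
   unfolding J_def by (rule someI_ex, rule sphere_large_coordinate) (use that in simp)
  \<comment> \<open>The floor of the large coordinate is erased; the sphere equation determines it
    from the others and its sign, so only m - 1 coordinates are counted.\<close>
  define lab where "lab x = (J x, 0 < x $ J x, (fl ((1/h) *: x))(J x := 0))" for x
  define P where "P j = PiE UNIV (%i. if i = j then {0} else {\<lfloor>(a $ i - r) / h\<rfloor>..\<lfloor>(a $ i + r) / h\<rfloor>})" for j :: 'm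
  define La where "La = (SIGMA j:(UNIV :: 'm set). (UNIV :: bool set) \<times> P j)"
  have Pf: "finite (P j)" for j unfolding P_def by (intro finite_PiE) auto
  have card: "card La <= 2 * ?m * (4 * M) ^ ?k"
  proof -
   have P: "card (P j) <= (4 * M) ^ ?k" for j
   proof -
    have "card {\<lfloor>(a $ i - r) / h\<rfloor>..\<lfloor>(a $ i + r) / h\<rfloor>} <= 4 * M" for i
    proof -
     have "(a $ i + r) / h = (a $ i - r) / h + 2 * real M" using r by (simp add: h_def field_simps)
     then have "\<lfloor>(a $ i + r) / h\<rfloor> <= \<lfloor>(a $ i - r) / h\<rfloor> + 2 * int M" by linarith
     then show ?thesis using M0 by simp
    qed
    then have "(PROD i:UNIV. card (if i = j then {0} else {\<lfloor>(a $ i - r) / h\<rfloor>..\<lfloor>(a $ i + r) / h\<rfloor>})) <= (PROD i:UNIV. if i = j then 1 else 4 * M)"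
     by (intro prod_mono) auto
    also have "... = (4 * M) ^ ?k" by (simp add: prod.remove[of UNIV j])
    finally show ?thesis by (simp add: P_def card_PiE)
   qed
   have "card La = (SUM j:(UNIV :: 'm set). 2 * card (P j))"
    unfolding La_def using Pf by simp
   also have "... <= (SUM j:(UNIV :: 'm set). 2 * (4 * M) ^ ?k)" by (intro sum_mono mult_le_mono2 P)
   finally show ?thesis by simp
  qed
  let ?A = "unit_ball_vol (real ?k) * (real ?m ^ 3 * h / 2) ^ ?k"
  have "hausdorff_content ?k dl ?E <= en (real (card La) * ?A)"
  proof (rule hausdorff_content_le_fibres[where lab=lab])
   show "finite La" unfolding La_def using Pf by auto
   show "lab ` ?E <= La"
   proof
    fix l assume "l : lab ` ?E"
    then obtain x where x: "x : ?E" "l = lab x" by blast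
    have "\<bar>x $ i - a $ i\<bar> <= r" for i using component_le_norm_cart[of "x - a" i] x by (simp add: dist_norm norm_minus_commute)
    then have "(a $ i - r) / h <= x $ i / h" "x $ i / h <= (a $ i + r) / h" for i
     using h by (auto intro!: divide_right_mono simp: abs_le_iff algebra_simps)
    then show "l : La" unfolding x(2) lab_def La_def P_def by (auto simp: fl_def intro!: floor_mono)
   qed
   show "dist x y <= real ?m ^ 3 * h" if x: "x : ?E" and y: "y : ?E" and l: "lab x = lab y" for x y
   proof (rule sphere_patch_dist)
    let ?sg = "if 0 < x $ J x then 1 else - 1 :: real"
    have l': "J x = J y" "0 < x $ J x \<longleftrightarrow> 0 < y $ J y" "(fl ((1/h) *: x))(J x := 0) = (fl ((1/h) *: y))(J y := 0)"
     using l unfolding lab_def prod.inject by blast+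
    show "1 / real ?m <= ?sg * x $ J x" "1 / real ?m <= ?sg * y $ J x" using J[OF x] J[OF y] l'(1,2) by auto
    fix i assume "i ~= J x"
    then have "\<lfloor>x $ i / h\<rfloor> = \<lfloor>y $ i / h\<rfloor>" using fun_cong[OF l'(3), of i] l'(1) by (simp add: fl_def)
    then have "\<bar>x $ i / h - y $ i / h\<bar> <= 1" by linarith
    then show "\<bar>x $ i - y $ i\<bar> <= h" using h by (simp add: diff_divide_distrib[symmetric])
   qed (use x y h in auto)
   show "real ?m ^ 3 * h <= dl" using M M0 dl by (simp add: h_def field_simps)
  qed (use h in simp)
  also have "... <= en (real (2 * ?m * (4 * M) ^ ?k) * ?A)"
   using h card by (intro ennreal_leI mult_right_mono of_nat_mono) auto
  also have "real (2 * ?m * (4 * M) ^ ?k) * ?A = sphere_const ?m * r ^ ?k"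
   using M0 by (simp add: sphere_const_def h_def power_mult_distrib power_divide)
  finally show ?thesis .
 qed
 then have "hausdorff_outer ?k ?E <= en (sphere_const ?m * r ^ ?k)" unfolding hausdorff_outer_def by (intro SUP_least) auto
 then show ?thesis using emeasure_hausdorff_le order_trans by blast
qed

section \<open>The trace inequality for real functions\<close>

text \<open>The constant on the first power is close to 1 for small \<open>s\<close>. The inequality
  is iterated along an infinite chain, where a fixed factor 2 powr p at every step would
  diverge.\<close>

lemma powr_add_weighted:
 fixes a b p s :: real
 assumes "0 <= a" "0 <= b" "1 < p" "0 < s" "s < 1"
 shows "(a + b) powr p <= (1 - s) powr (1 - p) * a powr p + s powr (1 - p) * b powr p"
 using powr_convex_combination[of "a / (1 - s)" "b / s" p s] assms
 by (simp add: powr_divide powr_diff)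

context unit_ball
begin

abbreviation bd :: "(real ^ 'm) measure"
 where "bd \<equiv> bd_measure U"

lemma frontier_U: "frontier U = sphere 0 1"
 by (simp add: U_ball)

lemma space_bd: "space bd = sphere 0 1"
 by (simp add: frontier_U)

lemma measurable_bd: "f : measurable borel M ==> f : measurable bd M"
 by (intro measurable_restrict_space1) simp

lemma emeasure_bd_ball:
 assumes "0 < r"
 shows "emeasure bd (sphere 0 1 Int ball a r) <= en (sphere_const N * r ^ (N - 1))"
proof -
 have "emeasure bd (sphere 0 1 Int ball a r) = emeasure (hausdorff_measure (N - 1)) (sphere 0 1 Int ball a r)"
  unfolding N frontier_U by (rule emeasure_restrict_space) auto
 then show ?thesis using hausdorff_sphere_ball_le[OF assms, of a] by (simp add: N)
qed

lemma finite_bd: "finite_measure bd"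
proof
 have "space bd = sphere 0 1 Int ball 0 2" unfolding space_bd by auto
 then have "emeasure bd (space bd) = emeasure bd (sphere 0 1 Int ball 0 2)" by simp
 also have "... <= en (sphere_const N * 2 ^ (N - 1))" by (rule emeasure_bd_ball) simp
 finally show "emeasure bd (space bd) ~= oo" by (metis ennreal_neq_top infinity_ennreal_def top_unique)
qed

text \<open>Centred at depth r below the boundary point with radius r/2, these balls stay inside
  \<open>U\<close> and approach \<open>xi\<close> without touching the sphere.\<close>

definition inner_ball :: "real => real ^ 'm => (real ^ 'm) set"
 where "inner_ball r xi = ball ((1 - r) *: xi) (r / 2)"

lemma inner_ball:
 assumes r: "0 < r" "r <= 1" and xi: "xi : sphere 0 1" and x: "x : inner_ball r xi"
 shows "x : U" "dist xi x < 3 / 2 * r"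
proof -
 let ?A = "x - (1 - r) *: xi"
 have d: "norm ?A < r / 2" using x by (simp add: inner_ball_def dist_norm norm_minus_commute)
 have "norm x <= norm ?A + norm ((1 - r) *: xi)" using norm_triangle_ineq[of "x - (1 - r) *: xi" "(1 - r) *: xi"] by simp
 also have "... < 1" using d r xi by simp
 finally show "x : U" by (simp add: U_ball)
 have "xi - x = r *: xi - ?A" by (simp add: algebra_simps)
 then have "norm (xi - x) <= norm (r *: xi) + norm ?A" by (simp only: norm_triangle_ineq4)
 then show "dist xi x < 3 / 2 * r" using d r xi by (simp add: dist_norm)
qed

lemma indicator_inner_ball [measurable]:
 "(%x. ind (inner_ball r (fst x)) (snd x) :: ennreal) : borel_measurable (bd \<Otimes>\<^sub>M borel)"
proof -
 let ?A = "borel_measurable (bd \<Otimes>\<^sub>M borel)"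
 have "(%xi. (1 - r) *: xi) : bd \<rightarrow>\<^sub>M borel" by (rule measurable_bd) simp
 from borel_measurable_dist[OF measurable_compose[OF measurable_fst this] measurable_snd]
 have "(%x. dist ((1 - r) *: fst x) (snd x)) : ?A" .
 from measurable_compose[OF this borel_measurable_indicator[of "{..<r / 2}"]]
 have "(%x. ind {..<r / 2} (dist ((1 - r) *: fst x) (snd x)) :: ennreal) : ?A" by simp
 moreover have "(ind (inner_ball r (fst x)) (snd x) :: ennreal) = ind {..<r / 2} (dist ((1 - r) *: fst x) (snd x))" for x
  by (simp add: inner_ball_def indicator_def)
 ultimately show ?thesis by simp
qed

text \<open>After exchanging the integrals, a given x counts only those \<open>xi\<close> in a cap
  of radius 2 r around it, whose measure is of order r^(N-1).\<close>

lemma nn_integral_inner_ball_le: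
 assumes Ph[measurable]: "Ph : BM" and r: "0 < r" "r <= 1"
 shows "(\<integral>\<^sup>+xi. (NN x:inner_ball r xi. Ph x) \<partial>bd)
  <= en (sphere_const N * (2 * r) ^ (N - 1)) * (NN x:U. Ph x)"
proof -
 interpret finite_measure bd by (rule finite_bd)
 interpret pair_sigma_finite bd lborel by unfold_locales
 let ?A = "en (sphere_const N * (2 * r) ^ (N - 1))"
 have "(\<integral>\<^sup>+xi. (NN x:inner_ball r xi. Ph x) \<partial>bd) = (NN x. (\<integral>\<^sup>+xi. Ph x * ind (inner_ball r xi) x \<partial>bd))"
  by (rule Fubini'[symmetric]) simp
 also have "... <= (NN x. ?A * (Ph x * ind U x))"
 proof (rule nn_integral_mono, goal_cases)
  case (1 x)
  have "(\<integral>\<^sup>+xi. Ph x * ind (inner_ball r xi) x \<partial>bd) <= (\<integral>\<^sup>+xi. Ph x * ind U x * ind (sphere 0 1 Int ball x (2 * r)) xi \<partial>bd)"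
  proof (rule nn_integral_mono, goal_cases)
   case (1 xi)
   then have xi: "xi : sphere 0 1" by (simp add: frontier_U)
   show ?case using inner_ball[OF r xi, of x] xi r by (auto simp: indicator_def dist_commute)
  qed
  also have "... = Ph x * ind U x * emeasure bd (sphere 0 1 Int ball x (2 * r))"
   by (rule nn_integral_cmult_indicator) (auto simp: sets_restrict_space frontier_U)
  also have "... <= Ph x * ind U x * ?A"
   using r by (intro mult_left_mono emeasure_bd_ball) auto
  finally show ?case by (simp add: mult_ac)
 qed
 also have "... = ?A * (NN x:U. Ph x)"
  by (rule nn_integral_cmult) simp
 finally show ?thesis .
qed

lemma emeasure_inner_ball: "0 < r ==> vol (inner_ball r xi) = en (unit_ball_vol (real N) * (r / 2) ^ N)"
 by (simp add: inner_ball_def emeasure_ball N)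

lemma inner_ball_borel [measurable]: "inner_ball r xi : sets borel"
 by (simp add: inner_ball_def)

text \<open>The weights \<open>t i\<close> decay slower than the oscillations \<open>d i\<close>, but are summable, so that the products of
 the convexity constants \<open>(1 - t i) powr (1 - p)\<close> stay bounded.\<close>

lemma pointwise_trace_bound:
 fixes u :: "real ^ 'm => real"
 assumes L: "L-lipschitz_on UNIV u" and u0: "!!x. 0 <= u x" and xi: "xi : sphere 0 1" and ta: "0 < ta" "ta <= 1"
 defines "r \<equiv> %i::nat. ta / 2 ^ i" and "t \<equiv> %i::nat. (3 / 4) ^ i / 8"
 defines "v \<equiv> %i. unit_ball_vol (real N) * (r i / 2) ^ N"
 shows "en (u xi powr p) <= en (4 powr p) * (en (1 / v 0) * (NN x:inner_ball (r 0) xi. en (u x powr p))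
  + (\<Sum>i. en (t i powr (1 - p) / (v i * v (Suc i))) * (NN x. osc (3 * r i) u x * ind (inner_ball (r (Suc i)) xi) x)))"
proof -
 have [measurable]: "u : BM" by (rule lipschitz_borel[OF L])
 have r: "0 < r i" "r i <= 1" "r (Suc i) <= r i" for i
 proof -
  have "ta / 2 ^ i <= 1 / 1" using ta by (intro frac_le) auto
  then show "0 < r i" "r i <= 1" "r (Suc i) <= r i" using ta by (auto simp: r_def field_simps)
 qed
 have t: "0 < t i" "t i <= 1 / 8" for i by (auto simp: t_def power_le_one)
 have v: "0 < v i" for i using r by (simp add: v_def)
 let ?B = "%i. inner_ball (r i) xi"
 have eB: "vol (?B i) = en (v i)" for i using r by (simp add: emeasure_inner_ball v_def)
 define I where "I n = (NN x:?B n. en (u x powr p))" for n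
 define Os where "Os n = (NN x:?B (Suc n). osc (3 * r n) u x)" for n
 define a where "a n = en (1 / v n) * I n" for n
 define d where "d n = en (t n powr (1 - p) / (v n * v (Suc n))) * Os n" for n
 have step: "a (Suc n) <= en ((1 - t n) powr (1 - p)) * a n + d n" for n
 proof -
  let ?A = "en (t n powr (1 - p))"
  have 1: "en (v n) * en (u x powr p) <= en ((1 - t n) powr (1 - p)) * I n + ?A * osc (3 * r n) u x"
   if x: "x : ?B (Suc n)" for x
  proof -
   have "en (v n) * en (u x powr p) = (NN y:?B n. en (u x powr p))"
    by (simp add: nn_integral_cmult_indicator eB mult.commute)
   also have "... <= (NN y. en ((1 - t n) powr (1 - p)) * (en (u y powr p) * ind (?B n) y)
    + ?A * (en (dist (u y) (u x) powr p) * ind (U Int cball x (3 * r n)) y))"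
   proof (rule nn_integral_mono, goal_cases)
    case (1 y)
    show ?case
    proof (cases "y : ?B n")
     case True
     have "dist x y <= 3 * r n"
      using inner_ball(2)[OF r(1,2) xi True] inner_ball(2)[OF r(1,2) xi x] r(3)[of n] dist_triangle3[of x y xi] by simp
     then have y: "y : U Int cball x (3 * r n)" using inner_ball(1)[OF r(1,2) xi True] by simp
     have "u x powr p <= (u y + dist (u y) (u x)) powr p"
      using p u0 by (intro powr_mono2) (auto simp: dist_real_def)
     also have "... <= (1 - t n) powr (1 - p) * u y powr p + t n powr (1 - p) * dist (u y) (u x) powr p"
      using u0 p t[of n] by (intro powr_add_weighted) auto
     finally show ?thesis using True y
      by (simp add: ennreal_plus[symmetric] ennreal_mult[symmetric] del: ennreal_plus)
    qed simp
   qed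
   also have "... = en ((1 - t n) powr (1 - p)) * I n + ?A * osc (3 * r n) u x"
    unfolding I_def osc_def by (subst nn_integral_add) (auto simp: nn_integral_cmult)
   finally show ?thesis .
  qed
  let ?D = "en (1 / (v n * v (Suc n)))"
  let ?F = "en ((1 - t n) powr (1 - p)) * I n * en (v (Suc n)) + ?A * Os n"
  let ?H = "(1 - t n) powr (1 - p) * v (Suc n)"
  have "en (v n) * I (Suc n) = (NN x:?B (Suc n). en (v n) * en (u x powr p))"
   unfolding I_def by (subst nn_integral_cmult[symmetric]) (auto simp: mult.assoc)
  also have "... <= (NN x. (en ((1 - t n) powr (1 - p)) * I n) * ind (?B (Suc n)) x + ?A * (osc (3 * r n) u x * ind (?B (Suc n)) x))"
   using 1 by (intro nn_integral_mono) (auto simp: indicator_def)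
  also have "... = en ((1 - t n) powr (1 - p)) * I n * en (v (Suc n)) + ?A * Os n"
   unfolding Os_def by (subst nn_integral_add) (auto simp: nn_integral_cmult eB)
  finally have "?D * (en (v n) * I (Suc n))
   <= ?D * ?F"
   by (rule mult_left_mono) simp
  also have "?D * (en (v n) * I (Suc n)) = a (Suc n)"
   using v[of n] v[of "Suc n"] by (simp add: a_def mult.assoc[symmetric] ennreal_mult[symmetric])
  also have "?D * ?F
   = en (1 / (v n * v (Suc n)) * ?H) * I n + en (1 / (v n * v (Suc n)) * t n powr (1 - p)) * Os n"
  proof -
   have "en a * (en b * X * en w + en c * Y) = en (a * (b * w)) * X + en (a * c) * Y"
    if "0 <= a" "0 <= b" "0 <= c" "0 <= w" for a b c w X Y
    using that by (simp add: distrib_left ennreal_mult mult_ac)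
   then show ?thesis using v[of n] v[of "Suc n"] by simp
  qed
  also have "1 / (v n * v (Suc n)) * ?H = (1 - t n) powr (1 - p) * (1 / v n)"
   using v[of "Suc n"] by simp
  finally show ?thesis using v[of n] by (simp add: a_def d_def ennreal_mult[symmetric] mult.assoc[symmetric])
 qed
 \<comment> \<open>Multiplication by P n powr (p - 1) telescopes the factors of \<open>step\<close>.
   The weights sum to at most 1/2, so that \<open>P n >= 1/2\<close> and the products cost at most 2
   powr p.\<close>
 define P where "P n = (PROD i<n. 1 - t i)" for n
 have t1: "t i <= 1" for i using t(2)[of i] by simp
 have P: "1 / 2 <= P n" "P n <= 1" for n
 proof -
  have "(SUM i<n. t i) = (1 - (3/4) ^ n) / 2" by (simp add: t_def sum_divide_distrib[symmetric] sum_gp_strict)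
  then have "1 / 2 <= 1 - (SUM i<n. t i)" by simp
  also have "... <= P n" unfolding P_def using t by (intro Weierstrass_prod_ineq) (auto intro!: less_imp_le t1)
  finally show "1 / 2 <= P n" .
  show "P n <= 1" unfolding P_def using t by (intro prod_le_1) (auto intro!: less_imp_le t1)
 qed
 have chain: "en (P n powr (p - 1)) * a n <= a 0 + (SUM i<n. d i)" for n
 proof (induction n)
  case 0
  then show ?case by (simp add: P_def)
 next
  case (Suc n)
  have tn: "0 < 1 - t n" using t[of n] by simp
  have "P (Suc n) powr (p - 1) * (1 - t n) powr (1 - p) = P n powr (p - 1) * ((1 - t n) powr (p - 1) * (1 - t n) powr (1 - p))"
   by (simp add: P_def powr_mult)
  also have "... = P n powr (p - 1)" using tn by (simp add: powr_add[symmetric])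
  finally have e: "P (Suc n) powr (p - 1) * (1 - t n) powr (1 - p) = P n powr (p - 1)" .
  let ?C = "en (P (Suc n) powr (p - 1))"
  have "P (Suc n) powr (p - 1) <= 1 powr (p - 1)" using P[of "Suc n"] p by (intro powr_mono2) auto
  then have P1: "?C <= 1" by simp
  have "?C * a (Suc n) <= ?C * (en ((1 - t n) powr (1 - p)) * a n + d n)"
   by (intro mult_left_mono step) simp
  also have "... = en (P n powr (p - 1)) * a n + ?C * d n"
   unfolding e[symmetric] by (simp add: distrib_left ennreal_mult mult.assoc)
  also have "... <= (a 0 + (SUM i<n. d i)) + 1 * d n" by (intro add_mono Suc mult_right_mono P1) simp
  finally show ?case by (simp add: add.assoc)
 qed
 let ?W = "a 0 + (\<Sum>i. d i)"
 let ?E = "en (u xi powr p)"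
 \<comment> \<open>The chain stops at the n-th inner ball, and the Lipschitz constant of
   \<open>u\<close> bridges the gap to \<open>xi\<close>. This error vanishes as n grows, so
   \<open>L\<close> leaves no trace in the result; the comparison contributes the second factor 2
   powr p.\<close>
 have bound: "?E <= en (4 powr p) * ?W + en (2 powr p * (2 * L * r n) powr p)" for n
 proof -
  have L0: "0 <= L" by (rule lipschitz_on_nonneg[OF L])
  let ?G = "en ((2 * L * r n) powr p)"
  have "en (v n) * ?E = (NN x:?B n. ?E)"
   by (simp add: nn_integral_cmult_indicator eB mult.commute)
  also have "... <= (NN x. en (2 powr p) * (en (u x powr p) * ind (?B n) x + ?G * ind (?B n) x))"
  proof (rule nn_integral_mono, goal_cases)
   case (1 x)
   show ?case
   proof (cases "x : ?B n")
    case True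
    have "dist (u xi) (u x) <= L * dist xi x" by (rule lipschitz_onD[OF L]) auto
    also have "... <= L * (2 * r n)" using inner_ball(2)[OF r(1,2) xi True] r(1)[of n] L0 by (intro mult_left_mono) auto
    finally have "u xi <= u x + 2 * L * r n" by (simp add: dist_real_def)
    then have "u xi powr p <= (u x + 2 * L * r n) powr p" using p u0 by (intro powr_mono2) auto
    also have "... <= 2 powr p * (u x powr p + (2 * L * r n) powr p)" using u0 L0 r(1)[of n] p by (intro powr_add_le) auto
    finally show ?thesis using True
     by (simp add: ennreal_plus[symmetric] ennreal_mult[symmetric] del: ennreal_plus)
   qed simp
  qed
  also have "... = en (2 powr p) * (I n + ?G * en (v n))"
   unfolding I_def by (subst nn_integral_cmult) (auto simp: nn_integral_add nn_integral_cmult_indicator eB)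
  finally have "en (1 / v n) * (en (v n) * ?E) <= en (1 / v n) * (en (2 powr p) * (I n + ?G * en (v n)))"
   by (rule mult_left_mono) simp
  then have "?E <= en (2 powr p) * a n + en (2 powr p * (2 * L * r n) powr p)"
  proof -
   have "en (1 / w) * (en w * X) = X" if "0 < w" for w X
    using that by (simp add: mult.assoc[symmetric] ennreal_mult[symmetric])
   moreover have "en (1 / w) * (en c * (X + en e * en w)) = en c * (en (1 / w) * X) + en (c * e)"
    if "0 < w" "0 <= c" "0 <= e" for w c e X
    using that by (simp add: distrib_left mult.assoc[symmetric] ennreal_mult[symmetric])
   ultimately show ?thesis using `en (1 / v n) * _ <= _` v[of n] by (simp add: a_def)
  qed
  also have "a n <= en (2 powr p) * ?W"
  proof -
   have "(1/2) powr p <= P n powr (p - 1)"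
   proof -
    have "(1/2) powr p <= (1/2 :: real) powr (p - 1)" by (rule powr_mono') auto
    also have "... <= P n powr (p - 1)" using P[of n] p by (intro powr_mono2) auto
    finally show ?thesis .
   qed
   then have "en (2 powr p) * (en ((1/2) powr p) * a n) <= en (2 powr p) * (en (P n powr (p - 1)) * a n)"
    by (intro mult_left_mono mult_right_mono) auto
   also have "en (2 powr p) * (en ((1/2) powr p) * a n) = a n"
    by (simp add: mult.assoc[symmetric] ennreal_mult[symmetric] powr_mult[symmetric])
   also have "en (P n powr (p - 1)) * a n <= ?W"
    using chain[of n] sum_le_suminf[of d "{..<n}"] by (auto intro: order_trans)
   finally show ?thesis by (simp add: mult_left_mono)
  qed
  then have "en (2 powr p) * a n <= en (2 powr p) * (en (2 powr p) * ?W)" by (rule mult_left_mono) simp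
  also have "... = en (4 powr p) * ?W" using powr_mult[of 2 2 p] by (simp add: mult.assoc[symmetric] ennreal_mult[symmetric])
  finally show ?thesis by simp
 qed
 have "r ~~> 0" unfolding r_def by (rule LIMSEQ_divide_realpow_zero) simp
 then have "(%n. 2 * L * r n) ~~> 2 * L * 0" by (intro tendsto_mult tendsto_const)
 then have "(%n. (2 * L * r n) powr p) ~~> (2 * L * 0) powr p"
  by (rule tendsto_powr'[OF _ tendsto_const]) (use p r(1) lipschitz_on_nonneg[OF L] in "auto simp: less_imp_le")
 then have "(%n. 2 powr p * (2 * L * r n) powr p) ~~> 2 powr p * (2 * L * 0) powr p" by simp
 then have "(%n. en (4 powr p) * ?W + en (2 powr p * (2 * L * r n) powr p)) ~~> en (4 powr p) * ?W + en 0"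
  by (intro tendsto_add tendsto_const tendsto_ennrealI) simp
 then have "?E <= en (4 powr p) * ?W + en 0" by (rule LIMSEQ_le_const) (use bound in blast)
 then show ?thesis by (simp add: a_def I_def d_def Os_def)
qed

text \<open>The last quotient is the sum of a geometric series: r i / t i equals 8 ta (2/3)^i, and
  its power p - 1 is summed over i.\<close>

definition trace_const :: real
 where "trace_const = 4 powr p * (sphere_const N * 4 ^ N / unit_ball_vol (real N)
  + sphere_const N * 3 powr p * 24 ^ N / unit_ball_vol (real N) * (8 powr (p - 1) / (1 - (2 / 3) powr (p - 1))))"

text \<open>In the integrated pointwise bound, ball volumes, cap measures and oscillation integrals
  combine to the powers (r i / t i) powr (p - 1), a convergent series because the radii halve while
  the weights shrink only by 3/4. The free scale \<open>ta\<close> trades a large factor 1/ta on the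
  function against a small factor ta powr (p - 1) on the translation constant, which is the shape of
  the estimate in \<open>is_trace\<close>.\<close>

theorem trace_inequality:
 fixes u :: "real ^ 'm => real"
 assumes L: "L-lipschitz_on UNIV u" and u0: "!!x. 0 <= u x" and n: "nik U p K u" and ta: "0 < ta" "ta <= 1"
 shows "(\<integral>\<^sup>+xi. en (u xi powr p) \<partial>bd) <= en (trace_const / ta) * (NN x:U. en (u x powr p))
  + en (trace_const * ta powr (p - 1) * K)"
proof -
 obtain M where M: "N = Suc M" using N_pos by (cases N) auto
 define r where "r i = ta / 2 ^ i" for i :: nat
 define t where "t i = (3 / 4) ^ i / (8 :: real)" for i :: nat
 define om where "om = unit_ball_vol (real N)"
 define v where "v i = om * (r i / 2) ^ N" for i
 define s where "s = sphere_const N"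
 have om: "0 < om" by (simp add: om_def)
 have s: "0 <= s" by (simp add: s_def sphere_const_def)
 have K: "0 <= K" using n by (simp add: nik_def)
 have [measurable]: "u : BM" by (rule lipschitz_borel[OF L])
 have r: "0 < r i" "r i <= 1" "r (Suc i) = r i / 2" for i
 proof -
  have "ta / 2 ^ i <= 1 / 1" using ta by (intro frac_le) auto
  then show "0 < r i" "r i <= 1" "r (Suc i) = r i / 2" using ta by (auto simp: r_def)
 qed
 define q where "q = (2 / 3 :: real) powr (p - 1)"
 have q: "0 < q" "q < 1" using p powr_less_mono2[of "p - 1" "2/3" 1] by (auto simp: q_def)
 let ?I = "%Ph i xi. NN x:inner_ball (r i) xi. Ph x"
 let ?Iu = "NN x:U. en (u x powr p)"
 have meas [measurable]: "?I Ph i : borel_measurable bd" if [measurable]: "Ph : BM" for Ph i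
  by simp
 let ?C = "%i. en (s * 3 powr p * 24 ^ N / om * (8 * ta) powr (p - 1) * K * q ^ i)"
 let ?E = "s * (2 * r 0) ^ (N - 1)"
 let ?F = "s * 3 powr p * 24 ^ N / om * (8 * ta) powr (p - 1) * K * (1 / (1 - q))"
 let ?G = "%x. en (u x powr p)"
 let ?H = "\<integral>\<^sup>+xi. ?I ?G 0 xi \<partial>bd"
 let ?J = "en (s * 4 ^ N / om / ta)"
 have "(\<integral>\<^sup>+xi. en (u xi powr p) \<partial>bd) <= (\<integral>\<^sup>+xi. en (4 powr p) * (en (1 / v 0) * ?I ?G 0 xi
  + (\<Sum>i. en (t i powr (1 - p) / (v i * v (Suc i))) * ?I (osc (3 * r i) u) (Suc i) xi)) \<partial>bd)"
 proof (rule nn_integral_mono, goal_cases)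
  case (1 xi)
  then have "xi : sphere 0 1" by (simp add: frontier_U)
  from pointwise_trace_bound[OF L u0 this ta] show ?case by (simp only: r_def t_def v_def om_def)
 qed
 also have "... = en (4 powr p) * (en (1 / v 0) * ?H
  + (\<Sum>i. en (t i powr (1 - p) / (v i * v (Suc i))) * (\<integral>\<^sup>+xi. ?I (osc (3 * r i) u) (Suc i) xi \<partial>bd)))"
  by (simp add: nn_integral_cmult nn_integral_add nn_integral_suminf)
 also have "... <= en (4 powr p) * (?J * ?Iu
  + (\<Sum>i. (?C i)))"
 proof (intro mult_left_mono add_mono suminf_le)
  have "?H <= en ?E * ?Iu"
   unfolding s_def by (rule nn_integral_inner_ball_le) (use r in auto)
  then have "en (1 / v 0) * ?H <= en (1 / v 0) * (en ?E * ?Iu)"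
   by (rule mult_left_mono) simp
  also have "... = en (1 / v 0 * ?E) * ?Iu"
  proof -
   have "0 <= 1 / v 0" "0 <= s * (2 * r 0) ^ (N - 1)" using s r(1)[of 0] om by (simp_all add: v_def)
   from ennreal_mult[OF this] show ?thesis by (simp only: mult.assoc)
  qed
  also have "... <= ?J * ?Iu"
  proof (intro mult_right_mono ennreal_leI)
   have "1 / v 0 * ?E = s * (4 ^ N / 2) / om / ta"
   proof -
    have "(4 :: real) ^ M = 2 ^ M * 2 ^ M" by (simp flip: power_mult_distrib)
    then show ?thesis by (simp add: v_def r_def M power_divide)
   qed
   also have "... <= s * 4 ^ N / om / ta" using s om ta by (intro divide_right_mono) auto
   finally show "1 / v 0 * ?E <= s * 4 ^ N / om / ta" .
  qed simp
  finally show "en (1 / v 0) * ?H <= ?J * ?Iu" .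
  fix i
  have tr: "t i powr (1 - p) * r i powr (p - 1) = (8 * ta) powr (p - 1) * q ^ i"
  proof -
   have "t i powr (1 - p) = (1 / t i) powr (p - 1)" using powr_minus_divide[of "t i" "p - 1"] by (simp add: powr_divide)
   then have "t i powr (1 - p) * r i powr (p - 1) = (r i / t i) powr (p - 1)"
    by (simp add: powr_mult[symmetric])
   also have "r i / t i = (8 * ta) * (2/3) ^ i" by (simp add: r_def t_def field_simps flip: power_mult_distrib)
   also have "... powr (p - 1) = (8 * ta) powr (p - 1) * q ^ i"
    by (simp add: powr_mult q_def powr_powr powr_realpow[symmetric] mult.commute)
   finally show ?thesis .
  qed
  let ?A = "\<integral>\<^sup>+xi. ?I (osc (3 * r i) u) (Suc i) xi \<partial>bd"
  let ?B = "en (t i powr (1 - p) / (v i * v (Suc i)))"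
  let ?D = "K * (3 * r i) powr p * (om * (3 * r i) ^ N)"
  let ?K = "en (s * (2 * r (Suc i)) ^ (N - 1))"
  let ?L = "s * (2 * r (Suc i)) ^ (N - 1) * ?D"
  have "?A <= ?K * (NN x:U. osc (3 * r i) u x)"
   unfolding s_def by (rule nn_integral_inner_ball_le) (use r in auto)
  also have "... <= ?K * en ?D"
   unfolding om_def using r(1)[of i] by (intro mult_left_mono nn_integral_osc_le n) auto
  finally have "?B * ?A
   <= ?B * (?K * en ?D)"
   by (rule mult_left_mono) simp
  also have "... = en (t i powr (1 - p) / (v i * v (Suc i)) * ?L)"
   using s K om r by (simp add: ennreal_mult[symmetric] v_def less_imp_le)
  also have "t i powr (1 - p) / (v i * v (Suc i)) * ?L
   = s * 3 powr p * 24 ^ N / om * (t i powr (1 - p) * r i powr (p - 1)) * K"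
  proof -
   have rp: "(3 * r i) powr p = 3 powr p * (r i powr (p - 1) * r i)"
    using r(1)[of i] powr_add[of "r i" "p - 1" 1] by (simp add: powr_mult)
   have vv: "v i * v (Suc i) = om^2 * (r i ^ N) ^ 2 / 8 ^ N"
    by (simp add: v_def r(3) power2_eq_square field_simps flip: power_mult_distrib)
   have rn: "(2 * r (Suc i)) ^ (N - 1) * r i = r i ^ N"
   proof -
    have "2 * r (Suc i) = r i" using r(3)[of i] by simp
    then show ?thesis unfolding M by simp
   qed
   have alg: "T / V * (s * X * (K * (c * (R * y)) * (om * (d * Z)))) = s * c * (d * e) / om * (T * R) * K"
    if "V = om^2 * Z^2 / e" "X * y = Z" "0 < Z" "0 < e" for T V X R y Z c d e :: real
   proof -
    have "T / V * (s * X * (K * (c * (R * y)) * (om * (d * Z)))) = T * s * K * c * R * d * om * Z * (X * y) / V" by simp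
    then show ?thesis unfolding that(1,2) using that(3,4) by (simp add: power2_eq_square)
   qed
   have "(24 :: real) ^ N = 3 ^ N * 8 ^ N" by (simp flip: power_mult_distrib)
   then show ?thesis unfolding rp power_mult_distrib[of 3 "r i" N] using r(1)[of i] alg[OF vv rn] by simp
  qed
  also have "... = s * 3 powr p * 24 ^ N / om * (8 * ta) powr (p - 1) * K * q ^ i" unfolding tr by simp
  finally show "?B * ?A
   <= en (s * 3 powr p * 24 ^ N / om * (8 * ta) powr (p - 1) * K * q ^ i)" .
 qed auto
 also have "(\<Sum>i. (?C i)) = en ?F"
 proof (rule suminf_ennreal_eq)
  show "(%i. s * 3 powr p * 24 ^ N / om * (8 * ta) powr (p - 1) * K * q ^ i) sums ?F"
   using q by (intro sums_mult geometric_sums) simp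
 qed (use s om K q in simp)
 also have "en (4 powr p) * (?J * ?Iu + ...)
  = en (4 powr p * (s * 4 ^ N / om) / ta) * ?Iu + en (4 powr p * (s * 3 powr p * 24 ^ N / om * (8 powr (p - 1) / (1 - q))) * ta powr (p - 1) * K)"
 proof -
  have e: "en a * (en b * I + en c) = en (a * b) * I + en (a * c)" if "0 <= a" "0 <= b" "0 <= c" for a b c I
   using that by (simp add: distrib_left ennreal_mult mult.assoc)
  show ?thesis using s om K q ta by (subst e) (auto simp: powr_mult)
 qed
 also have "... <= en (trace_const / ta) * ?Iu + en (trace_const * ta powr (p - 1) * K)"
  unfolding trace_const_def om_def[symmetric] s_def[symmetric] q_def[symmetric] using s om K q ta
  by (intro add_mono mult_right_mono ennreal_leI divide_right_mono mult_left_mono) auto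
 finally show ?thesis .
qed

lemma trace_const_nonneg: "0 <= trace_const"
 using p powr_less_mono2[of "p - 1" "2/3" 1] by (simp add: trace_const_def sphere_const_def)

end

section \<open>Completeness and convergence for p-th power distances\<close>

abbreviation dist_int :: "'x measure => real => ('x => 'c::metric_space) => ('x => 'c) => ennreal"
 where "dist_int M p f g \<equiv> (\<integral>\<^sup>+x. en (dist (f x) (g x) powr p) \<partial>M)"

lemma dist_int_commute: "dist_int M p f g = dist_int M p g f"
 by (simp add: dist_commute)

lemma dist_int_triangle3:
 fixes a b c d :: "'x => 'c::sep_metric"
 assumes [measurable]: "a : borel_measurable M" "b : borel_measurable M" "c : borel_measurable M" "d : borel_measurable M" and p: "1 < p"
 shows "dist_int M p a d <= en (4 powr p) * (dist_int M p a b + dist_int M p b c + dist_int M p c d)"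
proof -
 have "dist_int M p a d <= (\<integral>\<^sup>+x. en (4 powr p) * (en (dist (a x) (b x) powr p) + en (dist (b x) (c x) powr p) + en (dist (c x) (d x) powr p)) \<partial>M)"
 proof (rule nn_integral_mono, goal_cases)
  case (1 x)
  let ?a = "dist (a x) (b x)" and ?b = "dist (b x) (c x)" and ?c = "dist (c x) (d x)"
  have "dist (a x) (d x) powr p <= (?a + (?b + ?c)) powr p"
   using p dist_triangle[of "a x" "d x" "b x"] dist_triangle[of "b x" "d x" "c x"] by (intro powr_mono2) auto
  also have "... <= 2 powr p * (?a powr p + (?b + ?c) powr p)" by (rule powr_add_le) (use p in auto)
  also have "... <= 2 powr p * (2 powr p * ?a powr p + 2 powr p * (?b powr p + ?c powr p))"
   using p ge_one_powr_ge_zero[of 2 p] by (intro mult_left_mono add_mono powr_add_le) (auto simp: mult_le_cancel_right1)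
  also have "... = 4 powr p * (?a powr p + ?b powr p + ?c powr p)" using powr_mult[of 2 2 p] by (simp add: algebra_simps)
  finally show ?case by (simp add: ennreal_plus[symmetric] ennreal_mult[symmetric] del: ennreal_plus)
 qed
 also have "... = en (4 powr p) * (dist_int M p a b + dist_int M p b c + dist_int M p c d)"
  by (simp add: nn_integral_cmult nn_integral_add)
 finally show ?thesis .
qed

text \<open>Along a fast subsequence the p-th powers of the consecutive distances, weighted by 2^k,
  have a summable integral. Almost everywhere these distances are therefore eventually below 2^(-k),
  and Fatou's lemma identifies the limit.\<close>

lemma dist_int_complete:
 fixes f :: "nat => 'x => 'c::{complete_space, sep_metric}"
 assumes f[measurable]: "!!j. f j : borel_measurable M" and p: "1 < p"
  and Cau: "!!eps. 0 < eps ==> EX K. ALL i>=K. ALL j>=K. dist_int M p (f i) (f j) <= en eps"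
 obtains g where "g : borel_measurable M" "(%j. dist_int M p (f j) g) ~~> 0"
proof -
 \<comment> \<open>The second factor cancels the weight (2 ^ k) powr p in \<open>d\<close>, the
   first remains for summation.\<close>
 have "ALL k. EX K. ALL i>=K. ALL j>=K. dist_int M p (f i) (f j) <= en ((1/2) ^ k * ((1/2) ^ k) powr p)"
  by (intro allI Cau) simp
 from choice[OF this] obtain K where K: "!!k i j. K k <= i ==> K k <= j ==> dist_int M p (f i) (f j) <= en ((1/2) ^ k * ((1/2) ^ k) powr p)" by blast
 define r where "r k = (SUM i<=k. K i) + k" for k
 have rK: "K k <= r k" for k using member_le_sum[of k "{..k}" K] by (simp add: r_def)
 have rk: "k <= r k" "r k <= r (Suc k)" for k by (auto simp: r_def)
 define d where "d k x = (2 ^ k * dist (f (r k) x) (f (r (Suc k)) x)) powr p" for k x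
 have d0: "0 <= d k x" for k x by (simp add: d_def)
 have dm [measurable]: "(%x. d k x) : borel_measurable M" for k unfolding d_def by simp
 have "(\<integral>\<^sup>+x. (\<Sum>k. en (d k x)) \<partial>M) = (\<Sum>k. \<integral>\<^sup>+x. en (d k x) \<partial>M)" by (rule nn_integral_suminf) simp
 also have "... <= (\<Sum>k. en ((1/2) ^ k))"
 proof (intro suminf_le)
  fix k
  let ?A = "(1/2) ^ k * ((1/2) ^ k) powr p"
  let ?B = "\<integral>\<^sup>+x. en (d k x) \<partial>M"
  have "?B = en ((2 ^ k) powr p) * dist_int M p (f (r k)) (f (r (Suc k)))"
   unfolding d_def by (subst nn_integral_cmult[symmetric]) (auto simp: powr_mult ennreal_mult)
  also have "... <= en ((2 ^ k) powr p) * en ?A"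
   using rK[of k] rk(2)[of k] by (intro mult_left_mono K) auto
  also have "... = en ((1/2) ^ k)"
  proof -
   have "(2 ^ k * (1/2 :: real) ^ k) powr p = 1" by (subst power_mult_distrib[symmetric]) simp
   then have "(2 ^ k) powr p * ((1/2 :: real) ^ k * ((1/2) ^ k) powr p) = (1/2) ^ k" unfolding powr_mult by simp
   moreover have "en ((2 ^ k) powr p) * en ?A = en ((2 ^ k) powr p * ?A)"
    by (rule ennreal_mult[symmetric]) auto
   ultimately show ?thesis by simp
  qed
  finally show "?B <= en ((1/2) ^ k)" .
 qed auto
 also have "... = en (1 / (1 - 1/2))" by (intro suminf_ennreal_eq geometric_sums) auto
 finally have "(\<integral>\<^sup>+x. (\<Sum>k. en (d k x)) \<partial>M) ~= oo" by (auto simp: top_unique)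
 then have "AE x in M. (\<Sum>k. en (d k x)) ~= oo" by (intro nn_integral_noteq_infinite) simp
 then have ae: "AE x in M. Cauchy (%k. f (r k) x)"
 proof eventually_elim
  case (elim x)
  have "summable (%k. d k x)" by (rule summable_suminf_not_top) (use elim d0 in auto)
  then have "(%k. d k x) ~~> 0" by (rule summable_LIMSEQ_zero)
  then have "\<forall>\<^sub>F k in sequentially. d k x < 1" by (rule order_tendstoD) simp
  then obtain n where n: "!!k. n <= k ==> d k x < 1" by (auto simp: eventually_sequentially)
  have "Cauchy (%k. f (r (k + n)) x)"
  proof (rule Cauchy_geometric)
   fix k
   let ?C = "dist (f (r (k + n)) x) (f (r (Suc k + n)) x)"
   have "2 ^ (k + n) * dist (f (r (k + n)) x) (f (r (Suc (k + n))) x) <= 1"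
   proof (rule ccontr)
    assume "~ ?thesis"
    then have "1 powr p <= d (k + n) x" unfolding d_def using p by (intro powr_mono2) auto
    then show False using n[of "k + n"] by simp
   qed
   then have "?C <= (1/2) ^ (k + n)" by (simp add: field_simps)
   also have "... <= (1/2) ^ k" by simp
   finally show "?C <= (1/2) ^ k" .
  qed
  then have "convergent (%k. f (r (k + n)) x)" by (simp add: Cauchy_convergent_iff)
  then show ?case using convergent_ignore_initial_segment[of "%k. f (r k) x" n] by (simp add: Cauchy_convergent_iff)
 qed
 \<comment> \<open>Where the subsequence is not Cauchy it is replaced by a constant sequence:
   convergence everywhere is needed for the limit to be Borel.\<close>
 define h where "h k x = (if Cauchy (%k. f (r k) x) then f (r k) x else undefined)" for k x
 define g where "g x = lim (%k. h k x)" for x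
 have hg: "(%k. h k x) ~~> g x" for x
  unfolding g_def convergent_LIMSEQ_iff[symmetric] by (cases "Cauchy (%k. f (r k) x)") (auto simp: h_def Cauchy_convergent_iff convergent_const)
 have hm: "h k : borel_measurable M" for k unfolding h_def by simp
 have g[measurable]: "g : borel_measurable M" by (rule borel_measurable_LIMSEQ_metric[OF hm hg])
 have "(%j. dist_int M p (f j) g) ~~> 0"
 proof (rule tendsto_zero_ennreal)
  fix e :: real assume e: "0 < e"
  then have "0 < e / 2" by simp
  from Cau[OF this] obtain k0 where k0: "!!i j. k0 <= i ==> k0 <= j ==> dist_int M p (f i) (f j) <= en (e / 2)" by blast
  have "dist_int M p (f j) g < en e" if j: "k0 <= j" for j
  proof -
   have "dist_int M p (f j) g <= (\<integral>\<^sup>+x. liminf (%k. en (dist (f j x) (f (r k) x) powr p)) \<partial>M)"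
   proof (rule nn_integral_mono_AE, use ae in eventually_elim)
    case (elim x)
    then have "(%k. f (r k) x) ~~> g x" using hg[of x] by (simp add: h_def)
    then have "(%k. en (dist (f j x) (f (r k) x) powr p)) ~~> en (dist (f j x) (g x) powr p)"
     using p by (intro tendsto_ennrealI tendsto_powr' tendsto_dist) auto
    from lim_imp_Liminf[OF _ this] show ?case by simp
   qed
   also have "... <= liminf (%k. dist_int M p (f j) (f (r k)))" by (rule nn_integral_liminf) simp
   also have "... <= liminf (%k. en (e / 2))"
   proof (rule Liminf_mono)
    show "\<forall>\<^sub>F k in sequentially. dist_int M p (f j) (f (r k)) <= en (e / 2)"
     using eventually_ge_at_top[of k0] by eventually_elim (use k0[OF j] rk(1) order_trans in blast)
   qed
   also have "... < en e" using e by (simp add: Liminf_const ennreal_lessI)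
   finally show ?thesis .
  qed
  then show "\<forall>\<^sub>F j in sequentially. dist_int M p (f j) g < en e" by (auto simp: eventually_sequentially)
 qed
 then show ?thesis using that g by blast
qed

lemma Lp_dist_tendsto_iff:
 assumes "0 < p"
 shows "(%j. Lp_dist M p (f j) (g j)) ~~> 0 \<longleftrightarrow> (%j. dist_int M p (f j) (g j)) ~~> 0"
proof -
 let ?I = "%j. dist_int M p (f j) (g j)" and ?D = "%j. Lp_dist M p (f j) (g j)"
 have lt: "?D j < en e \<longleftrightarrow> ?I j < en (e powr p)" if "0 < e" for j e
 proof (cases "?I j" rule: ennreal_cases)
  case (real r)
  have "r powr (1 / p) < e \<longleftrightarrow> r < e powr p"
  proof
   assume "r powr (1 / p) < e"
   then have "(r powr (1 / p)) powr p < e powr p" using assms by (intro powr_less_mono2) auto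
   then show "r < e powr p" using assms by (simp add: powr_powr)
  next
   assume "r < e powr p"
   then have "r powr (1 / p) < (e powr p) powr (1 / p)" using assms real by (intro powr_less_mono2) auto
   then show "r powr (1 / p) < e" using that assms by (simp add: powr_powr)
  qed
  then show ?thesis using real by (simp add: Lp_dist_def ennreal_less_iff)
 qed (simp add: Lp_dist_def)
 have "(ALL e>0. \<forall>\<^sub>F j in sequentially. ?D j < en e) \<longleftrightarrow> (ALL e>0. \<forall>\<^sub>F j in sequentially. ?I j < en e)"
 proof safe
  fix e :: real assume a: "ALL e>0. \<forall>\<^sub>F j in sequentially. ?D j < en e" "0 < e"
  then have "\<forall>\<^sub>F j in sequentially. ?D j < en (e powr (1 / p))" by simp
  then show "\<forall>\<^sub>F j in sequentially. ?I j < en e" using lt[of "e powr (1 / p)"] a(2) assms by (simp add: powr_powr)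
 next
  fix e :: real assume a: "ALL e>0. \<forall>\<^sub>F j in sequentially. ?I j < en e" "0 < e"
  then show "\<forall>\<^sub>F j in sequentially. ?D j < en e" using lt[of e] by simp
 qed
 moreover have "(F ~~> 0) \<longleftrightarrow> (ALL e>0. \<forall>\<^sub>F j in sequentially. F j < en e)" for F :: "nat => ennreal"
  using tendsto_zero_ennreal[of F] order_tendstoD(2)[of F 0] by auto
 ultimately show ?thesis by simp
qed

lemma approx_affine_cong:
 assumes "!!x. x : U ==> f x = g x"
 shows "approx_affine U f a A \<longleftrightarrow> approx_affine U g a A"
proof -
 let ?A = "borel_measurable (restrict_space borel U)"
 have "f : ?A \<longleftrightarrow> g : ?A"
  using assms by (intro measurable_cong) (simp add: space_restrict_space)
 moreover have "{x:U. dist (f x) (qtuple (%i. A i x)) > eps * norm (x - a)} = {x:U. dist (g x) (qtuple (%i. A i x)) > eps * norm (x - a)}" for eps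
  using assms by auto
 ultimately show ?thesis by (simp add: approx_affine_def)
qed

lemma energy_cong: "(!!x. x : U ==> f x = g x) ==> energy U p f = energy U p g"
 using approx_affine_cong[of U f g] by (simp add: energy_def Df_def)

section \<open>Membership in the Sobolev class and boundary estimates\<close>

context unit_ball
begin

text \<open>A map prescribed on \<open>U\<close> only becomes Borel on the whole space, as
  \<open>weak_sobolev\<close> demands; energy and distances do not see the change.\<close>

definition hat :: "(real ^ 'm => ('b::real_normed_vector, 'q::finite) qtuple) => real ^ 'm => ('b, 'q) qtuple"
 where "hat f x = (if x : U then f x else qconst 0)"

lemma Dp_eq: "Dp f g = dist_int (dom_measure U) p f g"
 by (simp add: nn_integral_restrict_space)

lemma Dp_hat [simp]: "Dp (hat f) (hat g) = dist_int (dom_measure U) p f g" "Dp F (hat g) = dist_int (dom_measure U) p F g"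
 "Dp (hat f) G = dist_int (dom_measure U) p f G"
 by (auto simp: nn_integral_restrict_space hat_def intro!: nn_integral_cong)

lemma energy_hat [simp]: "energy U p (hat f) = energy U p f"
 by (rule energy_cong) (simp add: hat_def)

text \<open>The definition of \<open>weak_sobolev\<close> mentions translations only. The Lipschitz
  approximations have uniformly bounded energy, and lower semicontinuity transfers the
  bound.\<close>

lemma energy_finite:
 fixes f :: "real ^ 'm => ('b::hilbert, 'q::finite) qtuple"
 assumes f: "weak_sobolev f"
 shows "energy U p f < oo"
proof -
 obtain K where n: "nik U p K f" using weak_sobolevD(3)[OF f] by blast
 obtain F where F: "!!j. EX L. L-lipschitz_on UNIV (F j)" "!!j. energy U p (F j) <= en (approx_const TYPE('q) * K)"
  "(%j::nat. Dp (F j) f) ~~> 0"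
  by (rule lipschitz_approximation[OF weak_sobolevD(1)[OF f] n]) auto
 have "0 <= approx_const TYPE('q) * K" using n by (simp add: nik_def approx_const_nonneg)
 moreover have "weak_sobolev (F j)" for j using F(1) lipschitz_weak_sobolev by blast
 ultimately have "energy U p f <= en (approx_const TYPE('q) * K)"
  by (intro weak_sobolev_closed(2)[OF _ F(2) _ weak_sobolevD(1)[OF f] F(3)])
 then show ?thesis by (simp add: le_less_trans)
qed

lemma SobolevD:
 assumes "f : Sobolev U p"
 shows "weak_sobolev (hat f)"
proof -
 obtain F where f: "f : borel_measurable (dom_measure U)" and F: "!!j. EX L. L-lipschitz_on UNIV (F j)"
  "(SUP j. energy U p (F j)) < oo" "(%j::nat. Lp_dist (dom_measure U) p f (F j)) ~~> 0"
  using assms by (auto simp: Sobolev_def Lp_def)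
 have fb: "hat f : BM"
  using f unfolding hat_def by (subst (asm) measurable_restrict_space_iff[where c="qconst 0"]) auto
 obtain c where c: "(SUP j. energy U p (F j)) = en c" "0 <= c" using F(2) by (cases "SUP j. energy U p (F j)") auto
 have "energy U p (F j) <= en c" for j unfolding c(1)[symmetric] by (rule SUP_upper) simp
 moreover have "(%j. Dp (F j) (hat f)) ~~> 0"
  using F(3) p by (simp add: Lp_dist_tendsto_iff dist_int_commute[of _ _ f])
 moreover have "weak_sobolev (F j)" for j using F(1) lipschitz_weak_sobolev by blast
 ultimately show ?thesis by (intro weak_sobolev_closed(1)[OF _ _ c(2) fb])
qed

lemma SobolevI:
 fixes f :: "real ^ 'm => ('b::hilbert, 'q::finite) qtuple"
 assumes f: "weak_sobolev f" and fin: "Dp f (%_. qconst 0) < oo"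
 shows "f : Sobolev U p"
proof -
 obtain K where n: "nik U p K f" using weak_sobolevD(3)[OF f] by blast
 obtain F where F: "!!j. EX L. L-lipschitz_on UNIV (F j)" "!!j. energy U p (F j) <= en (approx_const TYPE('q) * K)"
  "(%j::nat. Dp (F j) f) ~~> 0"
  by (rule lipschitz_approximation[OF weak_sobolevD(1)[OF f] n]) auto
 have "(SUP j. energy U p (F j)) <= en (approx_const TYPE('q) * K)" by (intro SUP_least F)
 then have "(SUP j. energy U p (F j)) < oo" by (simp add: le_less_trans)
 moreover have "(%j. Lp_dist (dom_measure U) p f (F j)) ~~> 0"
  using F(3) p by (simp add: Lp_dist_tendsto_iff Dp_eq dist_int_commute[of _ _ f])
 moreover have "f : Lp (dom_measure U) p"
  using fin weak_sobolevD(1)[OF f] by (simp add: Lp_def Dp_eq measurable_restrict_space1)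
 ultimately show ?thesis using F(1) unfolding Sobolev_def by blast
qed

lemma lipschitz_Sobolev:
 fixes f :: "real ^ 'm => ('b::hilbert, 'q::finite) qtuple"
 assumes L: "L-lipschitz_on UNIV f"
 shows "f : Sobolev U p"
proof (rule SobolevI[OF lipschitz_weak_sobolev[OF L]])
 define c where "c = L + dist (f 0) (qconst 0)"
 have L0: "0 <= L" by (rule lipschitz_on_nonneg[OF L])
 have "dist (f x) (qconst 0) <= c" if "x : U" for x
 proof -
  have "dist (f x) (f 0) <= L * norm x" using lipschitz_onD[OF L, of x 0] by simp
  also have "... <= L * 1" using that L0 by (intro mult_left_mono) (auto simp: U_ball)
  finally show ?thesis using dist_triangle[of "f x" "qconst 0" "f 0"] by (simp add: c_def)
 qed
 then have "Dp f (%_. qconst 0) <= (NN x:U. en (c powr p))"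
  using p by (intro nn_integral_mono) (auto simp: indicator_def intro!: ennreal_leI powr_mono2)
 also have "... < oo" using finite_U by (simp add: nn_integral_cmult_indicator ennreal_mult_less_top)
 finally show "Dp f (%_. qconst 0) < oo" .
qed

text \<open>The scalar trace inequality is applied to dist (F x) (G x), a Lipschitz function whose
  increments are bounded by the sum of those of \<open>F\<close> and \<open>G\<close>.\<close>

lemma boundary_dist_le:
 fixes F G :: "real ^ 'm => ('b::hilbert, 'q::finite) qtuple"
 assumes F: "L-lipschitz_on UNIV F" "energy U p F <= en a" "0 <= a"
  and G: "M-lipschitz_on UNIV G" "energy U p G <= en b" "0 <= b" and ta: "0 < ta" "ta <= 1"
 shows "dist_int bd p F G <= en (trace_const / ta) * Dp F G + en (trace_const * ta powr (p - 1) * (2 powr p * (a + b)))"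
proof (rule trace_inequality[OF _ _ _ ta])
 note [measurable] = lipschitz_borel[OF F(1)] lipschitz_borel[OF G(1)]
 let ?u = "%x. dist (F x) (G x)"
 have u: "dist (?u x) (?u y) <= dist (F x) (F y) + dist (G x) (G y)" for x y
  using abs_dist_diff_le_add[of "F x" "G x" "F y" "G y"] by (simp add: dist_real_def)
 show "(L + M)-lipschitz_on UNIV ?u"
 proof (rule lipschitz_onI)
  show "dist (?u x) (?u y) <= (L + M) * dist x y" for x y
   using u[of x y] lipschitz_onD[OF F(1), of x y] lipschitz_onD[OF G(1), of x y] by (simp add: algebra_simps)
 qed (use lipschitz_on_nonneg[OF F(1)] lipschitz_on_nonneg[OF G(1)] in simp)
 note nF = nik_energy[OF lipschitz_weak_sobolev[OF F(1)] F(2,3)] and nG = nik_energy[OF lipschitz_weak_sobolev[OF G(1)] G(2,3)]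
 show "nik U p (2 powr p * (a + b)) ?u"
  unfolding nik_def
 proof (intro conjI allI)
  fix h
  let ?d = "%H x. en (dist (H (x + h)) (H x) powr p) * ind (seg U h) x"
  let ?A = "en (2 powr p * (a + b) * norm h powr p)"
  have "(NN x. ?d ?u x) <= (NN x. en (2 powr p) * (?d F x + ?d G x))"
  proof (rule nn_integral_mono, goal_cases)
   case (1 x)
   have "dist (?u (x + h)) (?u x) powr p <= (dist (F (x + h)) (F x) + dist (G (x + h)) (G x)) powr p"
    using p u by (intro powr_mono2) auto
   also have "... <= 2 powr p * (dist (F (x + h)) (F x) powr p + dist (G (x + h)) (G x) powr p)" by (rule powr_add_le) (use p in auto)
   finally show ?case
    by (auto simp: indicator_def ennreal_plus[symmetric] ennreal_mult[symmetric] simp del: ennreal_plus intro!: ennreal_leI)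
  qed
  also have "... = en (2 powr p) * ((NN x. ?d F x) + (NN x. ?d G x))"
   by (subst nn_integral_cmult) (auto simp: nn_integral_add)
  also have "... <= en (2 powr p) * (en (a * norm h powr p) + en (b * norm h powr p))"
   using nF nG unfolding nik_def by (intro mult_left_mono add_mono) auto
  also have "... = ?A"
   using F(3) G(3) by (simp add: ennreal_plus[symmetric] ennreal_mult[symmetric] algebra_simps del: ennreal_plus)
  finally show "(NN x. ?d ?u x) <= ?A" .
 qed (use F(3) G(3) in simp)
qed simp

lemma tau_exists: "0 < eps ==> 0 <= c ==> EX ta>0. ta <= 1 & c * ta powr (p - 1) <= eps" for c eps :: real
proof (intro exI conjI)
 assume a: "0 < eps" "0 <= c"
 define b where "b = (eps / (c + 1)) powr (1 / (p - 1))"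
 have b: "0 < b" "b powr (p - 1) = eps / (c + 1)" using a p by (auto simp: b_def powr_powr)
 show "0 < min 1 b" "min 1 b <= 1" using b by auto
 have "c * min 1 b powr (p - 1) <= c * (eps / (c + 1))"
  unfolding b(2)[symmetric] using a b p by (intro mult_left_mono powr_mono2) auto
 also have "... <= eps" using a by (simp add: field_simps)
 finally show "c * min 1 b powr (p - 1) <= eps" .
qed

lemma boundary_dist_small:
 assumes "0 <= c" "0 < eps"
 shows "EX et>0. ALL F G :: real ^ 'm => ('b::hilbert, 'q::finite) qtuple.
  (EX L. L-lipschitz_on UNIV F) & (EX L. L-lipschitz_on UNIV G) & energy U p F <= en c & energy U p G <= en c & Dp F G <= en et -->
  dist_int bd p F G <= en eps"
proof -
 let ?A = "2 powr p * (c + c)"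
 have "0 < eps / 2" "0 <= trace_const * ?A" using assms trace_const_nonneg by auto
 from tau_exists[OF this] obtain ta where ta: "0 < ta" "ta <= 1" "trace_const * ?A * ta powr (p - 1) <= eps / 2" by blast
 define T where "T = trace_const / ta"
 \<comment> \<open>The added 1 permits division also when \<open>T\<close> is 0.\<close>
 define W where "W = T + 1"
 define et where "et = eps / 2 / W"
 have t0: "0 <= T" using ta trace_const_nonneg by (simp add: T_def)
 then have "0 < W" by (simp add: W_def)
 then have et: "0 < et" "W * et = eps / 2" using assms by (simp_all add: et_def)
 show ?thesis
 proof (intro exI[of _ et] conjI allI impI et(1), elim conjE exE)
  fix F G :: "real ^ 'm => ('b, 'q) qtuple" and L M
  assume a: "L-lipschitz_on UNIV F" "M-lipschitz_on UNIV G" "energy U p F <= en c" "energy U p G <= en c" "Dp F G <= en et"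
  have "dist_int bd p F G <= en (trace_const / ta) * Dp F G + en (trace_const * ta powr (p - 1) * ?A)"
   by (rule boundary_dist_le[OF a(1,3) assms(1) a(2,4) assms(1) ta(1,2)])
  also have "... <= en (trace_const / ta) * en et + en (eps / 2)"
   using a(5) ta(3) by (intro add_mono mult_left_mono ennreal_leI) (auto simp: mult_ac)
  also have "... = en (T * et + eps / 2)" using t0 et(1) assms(2) by (simp add: T_def[symmetric] ennreal_mult)
  also have "... <= en eps" using et by (intro ennreal_leI) (simp add: W_def distrib_right)
  finally show "dist_int bd p F G <= en eps" .
 qed
qed

end

section \<open>Construction of a trace operator\<close>

context unit_ball
begin

lemma lipschitz_extend:
 assumes "L-lipschitz_on (closure U) f"
 obtains F where "L-lipschitz_on UNIV F" "!!x. x : closure U ==> F x = f x"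
proof
 let ?\<pi> = "closest_point (closure U)"
 have cl: "closure U = cball 0 1" by (simp add: U_ball)
 show "L-lipschitz_on UNIV (%x. f (?\<pi> x))"
 proof (rule lipschitz_onI)
  fix x y
  have "dist (f (?\<pi> x)) (f (?\<pi> y)) <= L * dist (?\<pi> x) (?\<pi> y)"
   unfolding cl by (intro lipschitz_onD[OF assms[unfolded cl]] closest_point_in_set) auto
  also have "... <= L * dist x y"
   unfolding cl using lipschitz_on_nonneg[OF assms] by (intro mult_left_mono closest_point_lipschitz) auto
  finally show "dist (f (?\<pi> x)) (f (?\<pi> y)) <= L * dist x y" .
 qed (rule lipschitz_on_nonneg[OF assms])
 show "f (?\<pi> x) = f x" if "x : closure U" for x using that by (simp add: closest_point_self)
qed

lemma approximants:
 fixes f :: "real ^ 'm => ('b::hilbert, 'q::finite) qtuple"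
 assumes f: "weak_sobolev f"
 obtains G where "!!j. EX L. L-lipschitz_on UNIV (G j)" "(%j::nat. Dp (G j) f) ~~> 0"
  "!!j. energy U p (G j) <= en (approx_const TYPE('q) * enn2real (energy U p f))"
 by (rule lipschitz_approximation[OF weak_sobolevD(1)[OF f] nik_energy[OF f, of "enn2real (energy U p f)"]])
  (use energy_finite[OF f] that in auto)

text \<open>Besides convergence, the energies of the approximating maps are bounded by a fixed
  multiple of that of \<open>f\<close>. Mere boundedness would define the limit, but the estimate in
  \<open>is_trace\<close> has the energy of \<open>f\<close> on its right side.\<close>

definition bd_limit :: "(real ^ 'm => ('b::real_normed_vector, 'q::finite) qtuple) => (real ^ 'm => ('b, 'q) qtuple) => bool"
 where "bd_limit f t \<longleftrightarrow> t : borel_measurable bd & (EX G. (ALL j. EX L. L-lipschitz_on UNIV (G j)) & (%j::nat. Dp (G j) f) ~~> 0 &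
  (ALL j. energy U p (G j) <= en (approx_const TYPE('q) * enn2real (energy U p f))) & (%j. dist_int bd p (G j) t) ~~> 0)"

lemma boundary_tendsto:
 fixes F G :: "nat => real ^ 'm => ('b::hilbert, 'q::finite) qtuple"
 assumes "0 <= c" "!!j. EX L. L-lipschitz_on UNIV (F j)" "!!j. EX L. L-lipschitz_on UNIV (G j)"
  "!!j. energy U p (F j) <= en c" "!!j. energy U p (G j) <= en c" and lim: "(%j. Dp (F j) (G j)) ~~> 0"
 shows "(%j. dist_int bd p (F j) (G j)) ~~> 0"
proof (rule tendsto_zero_ennreal)
 fix eps :: real assume "0 < eps"
 then have "0 < eps / 2" by simp
 from boundary_dist_small[OF assms(1) this] obtain et where et: "0 < et"
  "!!F G :: real ^ 'm => ('b, 'q) qtuple. (EX L. L-lipschitz_on UNIV F) & (EX L. L-lipschitz_on UNIV G) & energy U p F <= en c & energy U p G <= en c & Dp F G <= en et ==>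
   dist_int bd p F G <= en (eps / 2)" by blast
 have "\<forall>\<^sub>F j in sequentially. Dp (F j) (G j) < en et" using lim et(1) by (intro order_tendstoD) auto
 then show "\<forall>\<^sub>F j in sequentially. dist_int bd p (F j) (G j) < en eps"
 proof eventually_elim
  case (elim j)
  have "dist_int bd p (F j) (G j) <= en (eps / 2)" using assms elim by (intro et(2)) auto
  also have "... < en eps" using `0 < eps` by (simp add: ennreal_lessI)
  finally show ?case .
 qed
qed

lemma bd_limit_exists:
 fixes f :: "real ^ 'm => ('b::hilbert, 'q::finite) qtuple"
 assumes f: "weak_sobolev f"
 shows "EX t. bd_limit f t"
proof -
 let ?c = "approx_const TYPE('q) * enn2real (energy U p f)"
 have c: "0 <= ?c" by (simp add: approx_const_nonneg)
 obtain G where G: "!!j. EX L. L-lipschitz_on UNIV (G j)" "(%j::nat. Dp (G j) f) ~~> 0" "!!j. energy U p (G j) <= en ?c"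
  by (rule approximants[OF f]) auto
 note [measurable] = weak_sobolevD(1)[OF f]
 have Gm: "G j : BM" for j using G(1) lipschitz_borel by blast
 have Gb: "G j : borel_measurable bd" for j using Gm by (rule measurable_bd)
 obtain t where "t : borel_measurable bd" "(%j. dist_int bd p (G j) t) ~~> 0"
 proof (rule dist_int_complete[OF Gb p])
  fix eps :: real assume "0 < eps"
  from boundary_dist_small[OF c this] obtain et where et: "0 < et"
   "!!F G :: real ^ 'm => ('b, 'q) qtuple. (EX L. L-lipschitz_on UNIV F) & (EX L. L-lipschitz_on UNIV G) & energy U p F <= en ?c & energy U p G <= en ?c & Dp F G <= en et ==>
    dist_int bd p F G <= en eps" by blast
  define et' where "et' = et / (2 * 4 powr p)"
  have "0 < et'" using et(1) by (simp add: et'_def)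
  then have "\<forall>\<^sub>F j in sequentially. Dp (G j) f < en et'" using G(2) by (intro order_tendstoD) auto
  then obtain K where K: "!!j. K <= j ==> Dp (G j) f < en et'" by (auto simp: eventually_sequentially)
  have "dist_int bd p (G i) (G j) <= en eps" if ij: "K <= i" "K <= j" for i j
  proof (rule et(2), intro conjI G)
   have m: "h : borel_measurable (dom_measure U)" if "h : BM" for h :: "real ^ 'm => ('b, 'q) qtuple"
    using that by (simp add: measurable_restrict_space1)
   have "Dp (G i) (G j) <= en (4 powr p) * (Dp (G i) f + Dp f f + Dp f (G j))"
    unfolding Dp_eq using Gm by (intro dist_int_triangle3 m p) auto
   also have "... <= en (4 powr p) * (en et' + en 0 + en et')"
    using K ij by (intro mult_left_mono add_mono) (auto simp: dist_commute[of "f _"] less_imp_le)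
   also have "... = en et" using `0 < et'` by (simp add: et'_def ennreal_plus[symmetric] ennreal_mult[symmetric])
   finally show "Dp (G i) (G j) <= en et" .
  qed
  then show "EX K. ALL i>=K. ALL j>=K. dist_int bd p (G i) (G j) <= en eps" by blast
 qed (rule that)
 then show ?thesis unfolding bd_limit_def using G by blast
qed

lemma bd_limit_lipschitz:
 fixes f :: "real ^ 'm => ('b::hilbert, 'q::finite) qtuple"
 assumes L: "L-lipschitz_on (closure U) f" and f: "weak_sobolev (hat f)"
 shows "bd_limit (hat f) f"
proof -
 let ?c = "approx_const TYPE('q) * enn2real (energy U p (hat f))"
 obtain F where F: "L-lipschitz_on UNIV F" "!!x. x : closure U ==> F x = f x" by (rule lipschitz_extend[OF L]) simp
 have FU: "F x = hat f x" if "x : U" for x using F(2) that closure_subset by (auto simp: hat_def)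
 have FS: "F x = f x" if "x : space bd" for x using F(2) that by (simp add: frontier_def)
 obtain G where G: "!!j. EX L. L-lipschitz_on UNIV (G j)" "(%j::nat. Dp (G j) (hat f)) ~~> 0" "!!j. energy U p (G j) <= en ?c"
  by (rule approximants[OF f]) auto
 let ?A = "max ?c (enn2real (energy U p F))"
 have "(%j. dist_int bd p (G j) F) ~~> 0"
 proof (rule boundary_tendsto[where c="?A"])
  show "energy U p (G j) <= en (?A)" for j
   by (rule order_trans[OF G(3)]) (simp add: ennreal_leI)
  show "energy U p F <= en (?A)"
   using energy_finite[OF lipschitz_weak_sobolev[OF F(1)]] by (cases "energy U p F") auto
  have "Dp (G j) F = Dp (G j) (hat f)" for j using FU by (intro nn_integral_cong) (auto simp: indicator_def)
  then show "(%j. Dp (G j) F) ~~> 0" using G(2) by simp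
 qed (use G F in "auto simp: le_max_iff_disj")
 moreover have "dist_int bd p (G j) F = dist_int bd p (G j) f" for j using FS by (intro nn_integral_cong) auto
 moreover have "f : borel_measurable bd"
  using measurable_bd[OF lipschitz_borel[OF F(1)]] FS by (subst measurable_cong[where g=F]) auto
 ultimately show ?thesis unfolding bd_limit_def using G by auto
qed

definition bd_const :: "'q::finite itself => real"
 where "bd_const q = 4 powr p * trace_const * (4 powr p + 2 powr p * approx_const TYPE('q))"

lemma bd_const_nonneg: "0 <= bd_const TYPE('q::finite)"
 by (simp add: bd_const_def approx_const_nonneg trace_const_nonneg)

text \<open>The limit of \<open>boundary_dist_le\<close> along both approximating sequences; the
  excess of their energies is the factor \<open>approx_const\<close> inside \<open>bd_const\<close>,
  and the quasi-triangle inequalities contribute the powers of 4.\<close>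

lemma bd_limit_dist:
 fixes f g :: "real ^ 'm => ('b::hilbert, 'q::finite) qtuple"
 assumes f: "weak_sobolev f" "bd_limit f s" and g: "weak_sobolev g" "bd_limit g t" and ta: "0 < ta" "ta <= 1"
 shows "dist_int bd p s t <= en (bd_const TYPE('q) / ta) * Dp f g + en (bd_const TYPE('q) * ta powr (p - 1)) * (energy U p f + energy U p g)"
proof -
 let ?C = "approx_const TYPE('q)"
 note C = approx_const_nonneg[where ?'q='q] and T = trace_const_nonneg
 obtain a b where ab: "energy U p f = en a" "0 <= a" "energy U p g = en b" "0 <= b"
  using energy_finite[OF f(1)] energy_finite[OF g(1)] by (cases "energy U p f"; cases "energy U p g") auto
 obtain F where F: "!!j. EX L. L-lipschitz_on UNIV (F j)" "(%j::nat. Dp (F j) f) ~~> 0"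
  "!!j. energy U p (F j) <= en (?C * a)" "(%j. dist_int bd p (F j) s) ~~> 0" and sm: "s : borel_measurable bd"
  using f(2) ab unfolding bd_limit_def by auto
 obtain G where G: "!!j. EX L. L-lipschitz_on UNIV (G j)" "(%j::nat. Dp (G j) g) ~~> 0"
  "!!j. energy U p (G j) <= en (?C * b)" "(%j. dist_int bd p (G j) t) ~~> 0" and tm: "t : borel_measurable bd"
  using g(2) ab unfolding bd_limit_def by auto
 have m: "F j : BM" "G j : BM" for j using F(1) G(1) lipschitz_borel by blast+
 have md: "h : borel_measurable (dom_measure U)" if "h : BM" for h :: "real ^ 'm => ('b, 'q) qtuple"
  using that by (simp add: measurable_restrict_space1)
 let ?e = "trace_const * ta powr (p - 1) * (2 powr p * (?C * a + ?C * b))"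
 let ?D = "en (trace_const / ta)"
 let ?R = "%j. en (4 powr p) * (dist_int bd p (F j) s + (?D * (en (4 powr p) * (Dp (F j) f + Dp f g + Dp (G j) g)) + en ?e) + dist_int bd p (G j) t)"
 have le: "dist_int bd p s t <= ?R j" for j
 proof -
  obtain L M where L: "L-lipschitz_on UNIV (F j)" "M-lipschitz_on UNIV (G j)" using F(1) G(1) by blast
  have "dist_int bd p s t <= en (4 powr p) * (dist_int bd p s (F j) + dist_int bd p (F j) (G j) + dist_int bd p (G j) t)"
   by (intro dist_int_triangle3 sm tm measurable_bd m p)
  also have "dist_int bd p (F j) (G j) <= ?D * Dp (F j) (G j) + en ?e"
   using boundary_dist_le[OF L(1) F(3) _ L(2) G(3) _ ta] C ab by simp
  also have "Dp (F j) (G j) <= en (4 powr p) * (Dp (F j) f + Dp f g + Dp g (G j))"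
   unfolding Dp_eq by (intro dist_int_triangle3 md m p weak_sobolevD f g)
  finally show ?thesis by (simp add: dist_int_commute[of _ _ s] dist_commute[of "g _"] mult_left_mono)
 qed
 let ?A = "0 + (?D * (en (4 powr p) * (0 + Dp f g + 0)) + en ?e) + 0"
 let ?B = "en (4 powr p * trace_const * (2 powr p * ?C) * ta powr (p - 1))"
 have "?R ~~> en (4 powr p) * ?A"
  by (intro tendsto_add ennreal_tendsto_cmult F G) auto
 then have "dist_int bd p s t <= en (4 powr p) * ?A"
  by (rule LIMSEQ_le_const) (use le in blast)
 also have "... = en (4 powr p * trace_const * 4 powr p / ta) * Dp f g + ?B * (en a + en b)"
 proof -
  have 1: "en x * (en y * (en x * D) + en e) = en (x * y * x) * D + en (x * e)" if "0 <= x" "0 <= y" "0 <= e" for x y e D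
   using that by (simp add: distrib_left ennreal_mult mult.assoc)
  have "en x * (en a + en b) = en (x * (a + b))" if "0 <= x" for x
   using that ab by (simp add: ennreal_mult)
  then have 2: "?B * (en a + en b)
   = en (4 powr p * trace_const * (2 powr p * ?C) * ta powr (p - 1) * (a + b))" using C T by simp
  have 3: "4 powr p * trace_const * (2 powr p * ?C) * ta powr (p - 1) * (a + b) = 4 powr p * ?e" by (simp add: algebra_simps)
  show ?thesis unfolding 2 3 using 1[of "4 powr p" "trace_const / ta" ?e "Dp f g"] C T ta ab by simp
 qed
 also have "... <= en (bd_const TYPE('q) / ta) * Dp f g + en (bd_const TYPE('q) * ta powr (p - 1)) * (en a + en b)"
  unfolding bd_const_def using C T ta
  by (intro add_mono mult_right_mono ennreal_leI divide_right_mono mult_left_mono) auto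
 finally show ?thesis by (simp add: ab)
qed

theorem is_trace_exists: "EX T :: (real ^ 'm => ('b::hilbert, 'q::finite) qtuple) => _. is_trace U p T"
proof
 let ?lip = "%f. EX L. L-lipschitz_on (closure U) f"
 \<comment> \<open>A map that is Lipschitz on the closed ball must be its own trace, and this
   involves its values on the sphere, which \<open>hat\<close> forgets. Both branches yield a
   \<open>bd_limit\<close> of \<open>hat f\<close>, so the estimates treat them alike.\<close>
 define T :: "(real ^ 'm => ('b, 'q) qtuple) => _" where "T f = (if ?lip f then f else (SOME t. bd_limit (hat f) t))" for f
 have T: "bd_limit (hat f) (T f)" if f: "f : Sobolev U p" for f :: "real ^ 'm => ('b, 'q) qtuple"
 proof (cases "?lip f")
  case True
  then show ?thesis using bd_limit_lipschitz SobolevD[OF f] by (auto simp: T_def)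
 next
  case False
  then show ?thesis using someI_ex[OF bd_limit_exists[OF SobolevD[OF f]]] by (simp add: T_def)
 qed
 have "T f : Lp bd p" if f: "f : Sobolev U p" for f :: "real ^ 'm => ('b, 'q) qtuple"
 proof -
  obtain G where tm: "T f : borel_measurable bd" and G: "!!j. EX L. L-lipschitz_on UNIV (G j)" "(%j::nat. dist_int bd p (G j) (T f)) ~~> 0"
   using T[OF f] unfolding bd_limit_def by auto
  have "\<forall>\<^sub>F j in sequentially. dist_int bd p (G j) (T f) < 1" using G(2) by (rule order_tendstoD) simp
  then obtain j where j: "dist_int bd p (G j) (T f) < 1" by (auto simp: eventually_sequentially)
  obtain L where L: "L-lipschitz_on UNIV (G j)" using G(1) by blast
  let ?c = "L + dist (G j 0) (qconst 0)"
  have Gm: "G j : borel_measurable bd" by (intro measurable_bd lipschitz_borel[OF L])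
  let ?A = "dist_int bd p (G j) (%_. qconst 0)"
  have "?A <= (\<integral>\<^sup>+x. en (?c powr p) \<partial>bd)"
  proof (rule nn_integral_mono, goal_cases)
   case (1 x)
   then have "norm x = 1" by (simp add: frontier_U)
   then have "dist (G j x) (qconst 0) <= ?c"
    using lipschitz_onD[OF L, of x 0] dist_triangle[of "G j x" "qconst 0" "G j 0"] by simp
   then show ?case using p by (intro ennreal_leI powr_mono2) auto
  qed
  also have "... < oo" using finite_measure.emeasure_finite[OF finite_bd] by (simp add: ennreal_mult_less_top less_top)
  finally have G0: "?A < oo" .
  have "dist_int bd p (T f) (%_. qconst 0) <= en (4 powr p) * (dist_int bd p (T f) (G j) + ?A + dist_int bd p (%_. qconst 0 :: ('b, 'q) qtuple) (%_. qconst 0))"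
   by (rule dist_int_triangle3[OF tm Gm _ _ p]) auto
  also have "... < oo" using G0 j by (simp add: ennreal_mult_less_top dist_int_commute[of _ _ "T f"] less_trans[OF _ ennreal_one_less_top])
  finally show ?thesis using tm by (simp add: Lp_def)
 qed
 moreover have "AE x in bd. T f x = f x" if "L-lipschitz_on (closure U) f" for f :: "real ^ 'm => ('b, 'q) qtuple" and L using that by (auto simp: T_def)
 moreover have "EX th>0. ALL f : Sobolev U p. ALL g : Sobolev U p. dist_int bd p (T f) (T g) <= en th * dist_int (dom_measure U) p f g + en eps * (energy U p f + energy U p g)"
  if eps: "0 < eps" for eps
 proof -
  obtain ta where ta: "0 < ta" "ta <= 1" "bd_const TYPE('q) * ta powr (p - 1) <= eps" using tau_exists[OF eps bd_const_nonneg] by blast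
  have th: "0 <= bd_const TYPE('q) / ta" using ta bd_const_nonneg[where ?'q='q] by simp
  show ?thesis
  \<comment> \<open>A positive factor is required, whereas \<open>bd_const\<close> is only known to
    be nonnegative.\<close>
  proof (intro exI[of _ "bd_const TYPE('q) / ta + 1"] conjI ballI)
   fix f g :: "real ^ 'm => ('b, 'q) qtuple" assume f: "f : Sobolev U p" and g: "g : Sobolev U p"
   have "dist_int bd p (T f) (T g) <= en (bd_const TYPE('q) / ta) * Dp (hat f) (hat g) + en (bd_const TYPE('q) * ta powr (p - 1)) * (energy U p (hat f) + energy U p (hat g))"
    by (rule bd_limit_dist[OF SobolevD[OF f] T[OF f] SobolevD[OF g] T[OF g] ta(1,2)])
   also have "... <= en (bd_const TYPE('q) / ta + 1) * dist_int (dom_measure U) p f g + en eps * (energy U p f + energy U p g)"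
    unfolding Dp_hat energy_hat using ta(3) by (intro add_mono mult_right_mono ennreal_leI) auto
   finally show "dist_int bd p (T f) (T g) <= en (bd_const TYPE('q) / ta + 1) * dist_int (dom_measure U) p f g + en eps * (energy U p f + energy U p g)" .
  qed (use th in simp)
 qed
 ultimately show "is_trace U p T" unfolding is_trace_def by blast
qed

end

section \<open>Compactness under translation bounds\<close>

definition totally_bdd :: "'c::metric_space set => bool"
 where "totally_bdd S \<longleftrightarrow> (ALL et>0. EX E. finite E & (ALL x:S. EX e:E. dist x e < et))"

context unit_ball
begin

lemma borel_dom: "h : BM ==> h : borel_measurable (dom_measure U)"
 by (simp add: measurable_restrict_space1)

text \<open>On a fixed grid, \<open>grid_representatives\<close> brings every admissible map close
  to the step function of its representative values, and these values can be moved into a finite net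
  of \<open>S\<close>. Finitely many nodes and values leave finitely many step functions.\<close>

lemma finite_step_net:
 fixes S :: "'c::sep_metric set"
 assumes S: "totally_bdd S" and eps: "0 < eps" and K: "0 <= K"
 shows "EX SS :: (real ^ 'm => 'c) set. finite SS & (ALL s:SS. s : BM) &
  (ALL h. h : BM & nik U p K h & h ` U <= S --> (EX s:SS. Dp h s <= en eps))"
proof -
 define u where "u = measure lborel U"
 have u: "vol U = en u" "0 <= u" using finite_U by (auto simp: u_def emeasure_eq_ennreal_measure)
 let ?c = "2 powr p * (grid_const * K + u)"
 have "0 < p - 1" "0 < p" using p by auto
 have c: "0 <= ?c" using grid_const_nonneg K u by simp
 obtain ta where ta: "0 < ta" "ta <= 1" "?c * ta powr (p - 1) <= eps" using tau_exists[OF eps c] by blast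
 define dl where "dl = ta / (4 * real N)"
 have dl: "0 < dl" "dl <= 1 / (4 * real N)" "dl <= ta"
  using ta N_pos by (auto simp: dl_def divide_le_eq)
 from S[unfolded totally_bdd_def, rule_format, OF dl(1)] obtain E where E: "finite E" "!!x. x : S ==> EX e:E. dist x e < dl" by blast
 define step where "step sg x = sg (fl ((1/dl) *: x))" for sg :: "('m => int) => 'c" and x
 have "(%x :: real ^ 'm. fl ((1/dl) *: x)) : borel \<rightarrow>\<^sub>M count_space UNIV"
 proof (subst measurable_count_space_eq2_countable, intro conjI ballI)
  fix n :: "'m => int"
  have "(%x. fl ((1/dl) *: x)) -` {n} Int space borel = grid dl n" by (auto simp: grid_def)
  then show "(%x. fl ((1/dl) *: x)) -` {n} Int space borel : sets borel" by simp
 qed simp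
 then have sm [measurable]: "step sg : BM" for sg
  unfolding step_def by simp
 let ?A = "PiE (nodes dl) (%_. E)"
 let ?B = "en (dl powr p)"
 show ?thesis
 proof (intro exI[of _ "step ` ?A"] conjI ballI allI impI)
  show "finite (step ` ?A)" using E finite_nodes[OF dl(1,2)] by (intro finite_imageI finite_PiE)
  fix h :: "real ^ 'm => 'c" assume "h : BM & nik U p K h & h ` U <= S"
  then have h[measurable]: "h : BM" and n: "nik U p K h" and hS: "h ` U <= S" by auto
  let ?r = "4 * real N * dl"
  obtain x where x: "!!v. v : nodes dl ==> x v : grid (shrink dl * dl) v"
   "(SUM v:nodes dl. osc ?r h (x v)) <= en (grid_const * K * dl powr p)"
   by (rule grid_representatives[OF h n dl(1,2)]) auto
  have "EX e:E. dist (h (x v)) e < dl" if "v : nodes dl" for v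
   using x(1)[OF that] that hS by (intro E) (auto simp: nodes_def)
  then obtain sg0 where sg0: "!!v. v : nodes dl ==> sg0 v : E & dist (h (x v)) (sg0 v) < dl" by metis
  define sg where "sg = restrict sg0 (nodes dl)"
  have sg: "sg : ?A" "!!v. v : nodes dl ==> dist (h (x v)) (sg v) < dl" using sg0 by (auto simp: sg_def)
  have "Dp h (step sg) <= (NN z. en (2 powr p) * ((SUM v:nodes dl. en (dist (h z) (h (x v)) powr p) * ind (U Int cball (x v) ?r) z) + ?B * ind U z))"
  proof (rule nn_integral_mono, goal_cases)
   case (1 z)
   show ?case
   proof (cases "z : U")
    case True
    define v where "v = fl ((1/dl) *: z)"
    have zv: "z : grid dl v" by (simp add: v_def grid_def)
    have v0: "vertex v {} = v" by (auto simp: vertex_def)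
    have v: "v : nodes dl" using vertex_nodes[OF dl(1,2) True zv, of "{}"] by (simp add: v0)
    have zc: "z : U Int cball (x v) ?r" using True grid_close(2)[OF dl(1,2) True zv, of "x v" "{}"] x(1)[OF v] by (simp add: v0)
    have "dist (h z) (step sg z) powr p <= (dist (h z) (h (x v)) + dl) powr p"
     using p sg(2)[OF v] dist_triangle[of "h z" "sg v" "h (x v)"] by (intro powr_mono2) (auto simp: step_def v_def[symmetric])
    also have "... <= 2 powr p * (dist (h z) (h (x v)) powr p + dl powr p)" by (rule powr_add_le) (use p dl in auto)
    finally have "en (dist (h z) (step sg z) powr p) <= en (2 powr p) * (en (dist (h z) (h (x v)) powr p) * ind (U Int cball (x v) ?r) z + ?B)"
     using zc by (simp add: ennreal_plus[symmetric] ennreal_mult[symmetric] del: ennreal_plus)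
    also have "... <= en (2 powr p) * ((SUM v:nodes dl. en (dist (h z) (h (x v)) powr p) * ind (U Int cball (x v) ?r) z) + ?B)"
     using v finite_nodes[OF dl(1,2)] by (intro mult_left_mono add_right_mono member_le_sum) auto
    finally show ?thesis using True by simp
   qed simp
  qed
  also have "... = en (2 powr p) * ((SUM v:nodes dl. osc ?r h (x v)) + ?B * en u)"
   unfolding osc_def by (subst nn_integral_cmult) (auto simp: nn_integral_add nn_integral_sum nn_integral_cmult_indicator u(1))
  also have "... <= en (2 powr p) * (en (grid_const * K * dl powr p) + ?B * en u)"
   by (intro mult_left_mono add_right_mono x(2)) simp
  also have "... = en (?c * dl powr p)"
   using K u grid_const_nonneg by (simp add: ennreal_plus[symmetric] ennreal_mult[symmetric] algebra_simps del: ennreal_plus)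
  also have "... <= en (?c * ta powr (p - 1))"
  proof (intro ennreal_leI mult_left_mono c)
   have "dl powr p <= ta powr p" using dl p by (intro powr_mono2) auto
   also have "... <= ta powr (p - 1)" using ta by (intro powr_mono') auto
   finally show "dl powr p <= ta powr (p - 1)" .
  qed
  also have "... <= en eps" by (rule ennreal_leI[OF ta(3)])
  finally show "EX s:step ` ?A. Dp h s <= en eps" using sg(1) by blast
 qed (use sm in auto)
qed

text \<open>For each accuracy infinitely many terms share an approximating step function. The
  diagonal subsequence is then Cauchy and converges by completeness; total boundedness of the set of
  values is indispensable for the finite nets.\<close>

theorem Rellich:
 fixes h :: "nat => real ^ 'm => 'c::{complete_space, sep_metric}"
 assumes S: "totally_bdd S" and h: "!!j. h j : BM" "!!j. nik U p K (h j)" "!!j. h j ` U <= S"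
 obtains r f where "strict_mono (r :: nat => nat)" "f : BM" "(%j. Dp (h (r j)) f) ~~> 0"
proof -
 have K: "0 <= K" using h(2) by (simp add: nik_def)
 \<comment> \<open>All pairs of the subsequence, not only late ones, are required to be close; such
   a property passes to further subsequences.\<close>
 define P where "P n s \<longleftrightarrow> (ALL i j. Dp (h (s i)) (h (s j)) <= en ((1/2) ^ n))" for n :: nat and s :: "nat => nat"
 have PD: "Dp (h (s i)) (h (s j)) <= en ((1/2) ^ n)" if "P n s" for n s i j using that by (simp add: P_def)
 interpret subseqs P
 proof
  fix n :: nat and s :: "nat => nat" assume "strict_mono s"
  define eps where "eps = (1/2) ^ n / (2 * 4 powr p)"
  have eps: "0 < eps" by (simp add: eps_def)
  from finite_step_net[OF S this K] obtain SS :: "(real ^ 'm => 'c) set" where SS: "finite SS" "!!s. s : SS ==> s : BM"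
   "!!h. h : BM & nik U p K h & h ` U <= S ==> EX s:SS. Dp h s <= en eps" by blast
  have "ALL j. EX c. c : SS & Dp (h (s j)) c <= en eps" using SS(3) h by blast
  from choice[OF this] obtain c where c: "!!j. c j : SS" "!!j. Dp (h (s j)) (c j) <= en eps" by blast
  have "finite (range c)" using c(1) SS(1) by (intro finite_subset[of "range c" SS]) auto
  from pigeonhole_infinite[OF infinite_UNIV_nat this] obtain j0 where "infinite {j. c j = c j0}" by auto
  from infinite_enumerate[OF this] obtain r :: "nat => nat" where r: "strict_mono r" "!!i. r i : {j. c j = c j0}" by blast
  have "P n (s \<circ> r)"
   unfolding P_def
  proof (intro allI)
   fix i j
   have "Dp (h (s (r i))) (h (s (r j))) <= en (4 powr p) * (Dp (h (s (r i))) (c j0) + Dp (c j0) (c j0) + Dp (c j0) (h (s (r j))))"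
    unfolding Dp_eq by (intro dist_int_triangle3 borel_dom h SS(2) c p)
   also have "... <= en (4 powr p) * (en eps + en 0 + en eps)"
    using c(2)[of "r i"] c(2)[of "r j"] r(2)[of i] r(2)[of j] by (intro mult_left_mono add_mono) (auto simp: dist_commute[of "c j0 _"])
   also have "... = en ((1/2) ^ n)" by (simp add: eps_def ennreal_plus[symmetric] ennreal_mult[symmetric])
   finally show "Dp (h ((s \<circ> r) i)) (h ((s \<circ> r) j)) <= en ((1/2) ^ n)" by simp
  qed
  then show "EX r'. strict_mono r' & P n (s \<circ> r')" using r(1) by blast
 qed
 have hold: "P k (diagseq \<circ> ((+) (Suc k)))" for k by (rule diagseq_holds) (simp add: P_def)
 let ?A = "dom_measure U"
 have hm: "h (diagseq j) : borel_measurable ?A" for j by (intro borel_dom h)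
 obtain f where f: "f : borel_measurable ?A" "(%j. dist_int ?A p (h (diagseq j)) f) ~~> 0"
 proof (rule dist_int_complete[OF hm p])
  fix eps :: real assume "0 < eps"
  then obtain k where k: "(1/2) ^ k < eps" using real_arch_pow_inv[of eps "1/2"] by auto
  have "Dp (h (diagseq i)) (h (diagseq j)) <= en eps" if "Suc k <= i" "Suc k <= j" for i j
  proof -
   have "Dp (h (diagseq i)) (h (diagseq j)) <= en ((1/2) ^ k)"
    using PD[OF hold[of k], of "i - Suc k" "j - Suc k"] that by simp
   also have "... <= en eps" using k by (intro ennreal_leI) simp
   finally show ?thesis .
  qed
  then show "EX K. ALL i>=K. ALL j>=K. dist_int ?A p (h (diagseq i)) (h (diagseq j)) <= en eps" unfolding Dp_eq by blast
 qed (rule that)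
 define f' where "f' x = (if x : U then f x else undefined)" for x
 have "f' : BM" using f(1) unfolding f'_def by (subst (asm) measurable_restrict_space_iff[where c=undefined]) auto
 moreover have "Dp (h (diagseq j)) f' = dist_int ?A p (h (diagseq j)) f" for j
  by (auto simp: nn_integral_restrict_space f'_def intro!: nn_integral_cong)
 ultimately show ?thesis using that[of diagseq f'] f(2) subseq_diagseq by simp
qed

end

section \<open>Compact convex hulls and nearest point maps\<close>

lemma totally_bdd_compact: "compact S ==> totally_bdd S"
 unfolding totally_bdd_def
proof (intro allI impI)
 fix et :: real assume "compact S" "0 < et"
 then obtain E where "finite E" "S <= (UN x:E. ball x et)" by (auto simp: compact_eq_totally_bounded)
 then show "EX E. finite E & (ALL x:S. EX e:E. dist x e < et)" by (intro exI[of _ E]) (force simp: dist_commute)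
qed

lemma totally_bdd_near:
 assumes S: "!!et. 0 < et ==> EX T. totally_bdd T & (ALL x:S. EX y:T. dist x y < et)"
 shows "totally_bdd S"
 unfolding totally_bdd_def
proof (intro allI impI)
 fix et :: real assume "0 < et"
 then have et: "0 < et / 2" by simp
 from S[OF this] obtain T where T: "totally_bdd T" "ALL x:S. EX y:T. dist x y < et / 2" by blast
 from T(1)[unfolded totally_bdd_def, rule_format, OF et] obtain E where E: "finite E" "ALL y:T. EX e:E. dist y e < et / 2" by blast
 have "EX e:E. dist x e < et" if x: "x : S" for x
 proof -
  obtain y where y: "y : T" "dist x y < et / 2" using T(2) x by blast
  obtain e where e: "e : E" "dist y e < et / 2" using E(2) y(1) by blast
  then show ?thesis using y(2) dist_triangle[of x e y] by (intro bexI[OF _ e(1)]) simp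
 qed
 then show "EX E. finite E & (ALL x:S. EX e:E. dist x e < et)" using E(1) by blast
qed

text \<open>Mazur's argument: the hull lies in the neighbourhood of the hull of a finite net, since
  a convex set plus a ball is convex, and the hull of finitely many points is compact.\<close>

lemma compact_closure_convex_hull:
 fixes B :: "'b::{real_normed_vector, complete_space} set"
 assumes B: "totally_bdd B"
 shows "compact (closure (convex hull B))"
proof -
 have hull: "totally_bdd (convex hull B)"
 proof (rule totally_bdd_near)
  fix et :: real assume et: "0 < et"
  from B[unfolded totally_bdd_def, rule_format, OF et] obtain E where E: "finite E" "ALL x:B. EX e:E. dist x e < et" by blast
  let ?T = "convex hull E"
  have "convex (UN x:?T. UN y:ball 0 et. {x + y})" by (intro convex_sums convex_convex_hull convex_ball)
  moreover have "B <= (UN x:?T. UN y:ball 0 et. {x + y})"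
  proof
   fix x assume "x : B"
   then obtain e where "e : E" "dist x e < et" using E(2) by blast
   then have "e : ?T" "x - e : ball 0 et" "x = e + (x - e)" by (auto simp: hull_inc dist_norm norm_minus_commute)
   then show "x : (UN x:?T. UN y:ball 0 et. {x + y})" by blast
  qed
  ultimately have "convex hull B <= (UN x:?T. UN y:ball 0 et. {x + y})" by (rule hull_minimal[rotated])
  then have "EX y:?T. dist x y < et" if "x : convex hull B" for x
  proof -
   from `convex hull B <= _` that obtain y z where "y : ?T" "z : ball 0 et" "x = y + z" by blast
   then show ?thesis by (intro bexI[of _ y]) (auto simp: dist_norm)
  qed
  then show "EX T. totally_bdd T & (ALL x:convex hull B. EX y:T. dist x y < et)"
   using totally_bdd_compact[OF finite_imp_compact_convex_hull[OF E(1)]] by blast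
 qed
 let ?A = "closure (convex hull B)"
 have "totally_bdd (?A)"
  by (rule totally_bdd_near) (use hull closure_approachable[of _ "convex hull B"] in "auto simp: dist_commute")
 show ?thesis unfolding compact_eq_totally_bounded
 proof (intro conjI allI impI)
  fix et :: real assume "0 < et"
  from `totally_bdd (closure _)`[unfolded totally_bdd_def, rule_format, OF this]
  obtain E where E: "finite E" "ALL x:?A. EX e:E. dist x e < et" by blast
  then have "?A <= (UN x:E. ball x et)" by (auto simp: dist_commute)
  then show "EX k. finite k & ?A <= (UN x:k. ball x et)" using E(1) by blast
 qed (simp add: complete_eq_closed)
qed

definition nearest :: "'b::metric_space set => 'b => 'b"
 where "nearest C a = (SOME x. x : C & (ALL z:C. dist a x <= dist a z))"

lemma nearest:
 assumes "compact C" "C ~= {}"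
 shows "nearest C a : C" "!!z. z : C ==> dist a (nearest C a) <= dist a z"
proof -
 have "EX x. x : C & (ALL z:C. dist a x <= dist a z)"
  using continuous_attains_inf[OF assms, of "dist a"] continuous_on_dist[OF continuous_on_const continuous_on_id, of C a] by auto
 from someI_ex[OF this] show "nearest C a : C" "!!z. z : C ==> dist a (nearest C a) <= dist a z" by (auto simp: nearest_def)
qed

lemma nearest_self: "compact C ==> a : C ==> nearest C a = a"
 using nearest(2)[of C a a] by (cases "C = {}") auto

text \<open>The obtuse angle inequalities at both nearest points are added, and Cauchy-Schwarz
  finishes.\<close>

lemma nearest_lipschitz:
 fixes C :: "'b::real_inner set"
 assumes C: "compact C" "convex C" "C ~= {}"
 shows "dist (nearest C a) (nearest C b) <= dist a b"
proof -
 let ?x = "nearest C a" and ?y = "nearest C b"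
 have "inner (a - ?x) (?y - ?x) <= 0" "inner (b - ?y) (?x - ?y) <= 0"
  by (rule any_closest_point_dot[OF C(2) compact_imp_closed[OF C(1)]]; use nearest[OF C(1,3)] in blast)+
 then have "inner (?x - ?y) (?x - ?y) <= inner (a - b) (?x - ?y)" by (simp add: inner_diff)
 also have "... <= norm (a - b) * norm (?x - ?y)" by (rule norm_cauchy_schwarz)
 finally have "norm (?x - ?y) * norm (?x - ?y) <= norm (a - b) * norm (?x - ?y)" by (simp add: power2_norm_eq_inner[symmetric] power2_eq_square)
 then show ?thesis by (cases "?x = ?y") (auto simp: dist_norm)
qed

lemma qmap_lipschitz:
 fixes ph :: "'a::metric_space => 'b::metric_space"
 assumes "!!a b. dist (ph a) (ph b) <= dist a b"
 shows "dist (qmap ph S) (qmap ph T :: ('b, 'q::finite) qtuple) <= dist S T"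
proof -
 obtain a b0 where ab: "S = qtuple a" "T = qtuple b0" by (meson qtuple_exhaust)
 obtain b where b: "qtuple b = qtuple b0" "dist (qtuple a) (qtuple b0) = sqrt (SUM i:UNIV. (dist (a i) (b i))^2)"
  by (rule dist_qtuple_attained[where z=a and w=b0])
 have "dist (qmap ph S) (qmap ph T) <= sqrt (SUM i:UNIV. (dist (ph (a i)) (ph (b i)))^2)"
  unfolding ab b(1)[symmetric] qmap_qtuple by (rule dist_qtuple_le)
 also have "... <= sqrt (SUM i:UNIV. (dist (a i) (b i))^2)" by (intro real_sqrt_le_mono sum_mono power_mono assms) simp
 finally show ?thesis using b ab by simp
qed

lemma totally_bdd_qtuples:
 assumes C: "totally_bdd C"
 shows "totally_bdd {qtuple z | z :: 'q::finite => 'b::metric_space. ALL i. z i : C}"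
 unfolding totally_bdd_def
proof (intro allI impI)
 fix et :: real assume et: "0 < et"
 then have "0 < et / real CARD('q)" by simp
 from C[unfolded totally_bdd_def, rule_format, OF this] obtain E where E: "finite E" "ALL x:C. EX e:E. dist x e < et / real CARD('q)" by blast
 show "EX E. finite E & (ALL x:{qtuple z | z :: 'q => 'b. ALL i. z i : C}. EX e:E. dist x e < et)"
 proof (intro exI[of _ "qtuple ` PiE UNIV (%_. E)"] conjI ballI)
  show "finite (qtuple ` PiE UNIV (%_::'q. E))" using E(1) by (intro finite_imageI finite_PiE) auto
  fix x assume "x : {qtuple z | z :: 'q => 'b. ALL i. z i : C}"
  then obtain z where z: "x = qtuple z" "!!i. z i : C" by blast
  have "ALL i. EX e. e : E & dist (z i) e < et / real CARD('q)" using E(2) z(2) by blast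
  from choice[OF this] obtain w where w: "!!i. w i : E" "!!i. dist (z i) (w i) < et / real CARD('q)" by blast
  have "dist x (qtuple w) <= (SUM i:UNIV. dist (z i) (w i))" unfolding z(1) by (rule dist_qtuple_le_sum)
  also have "... < (SUM i:(UNIV::'q set). et / real CARD('q))" by (intro sum_strict_mono w) auto
  finally show "EX e:qtuple ` PiE UNIV (%_. E). dist x e < et" using w(1) by auto
 qed
qed

lemma totally_bdd_entries:
 fixes S :: "('b::metric_space, 'q::finite) qtuple set"
 assumes S: "totally_bdd S"
 shows "totally_bdd {rep_qtuple s i | s i. s : S}"
 unfolding totally_bdd_def
proof (intro allI impI)
 fix et :: real assume "0 < et"
 from S[unfolded totally_bdd_def, rule_format, OF this] obtain E where E: "finite E" "ALL x:S. EX e:E. dist x e < et" by blast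
 let ?A = "%(e, i). rep_qtuple e i"
 show "EX E. finite E & (ALL x:{rep_qtuple s i | s i. s : S}. EX e:E. dist x e < et)"
 proof (intro exI[of _ "?A ` (E \<times> UNIV)"] conjI ballI)
  show "finite (?A ` (E \<times> (UNIV :: 'q set)))" using E(1) by simp
  fix x assume "x : {rep_qtuple s i | s i. s : S}"
  then obtain s i where s: "x = rep_qtuple s i" "s : S" by blast
  obtain e where e: "e : E" "dist s e < et" using E(2) s(2) by blast
  then obtain j where "dist (rep_qtuple s i) (rep_qtuple e j) <= dist s e" using qtuple_near[of "rep_qtuple s" e "dist s e" i] by auto
  then show "EX y:?A ` (E \<times> UNIV). dist x y < et" using e s(1) by (intro bexI[of _ "rep_qtuple e j"]) auto
 qed
qed

section \<open>Existence of a minimizer\<close>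

lemma dist_int_limit_unique:
 fixes s t :: "'x => 'c::sep_metric"
 assumes m[measurable]: "!!j. F j : borel_measurable M" "s : borel_measurable M" "t : borel_measurable M" and p: "1 < p"
  and lim: "(%j::nat. dist_int M p (F j) s) ~~> 0" "(%j. dist_int M p (F j) t) ~~> 0"
 shows "AE x in M. s x = t x"
proof -
 have le: "dist_int M p s t <= en (4 powr p) * (dist_int M p (F j) s + 0 + dist_int M p (F j) t)" for j
  using dist_int_triangle3[OF m(2) m(1) m(1) m(3) p, of j j] by (simp add: dist_int_commute[of _ _ s])
 have "(%j. en (4 powr p) * (dist_int M p (F j) s + 0 + dist_int M p (F j) t)) ~~> en (4 powr p) * (0 + 0 + 0)"
  by (intro ennreal_tendsto_cmult tendsto_add tendsto_const lim) simp
 then have "dist_int M p s t <= en (4 powr p) * (0 + 0 + 0)" by (rule LIMSEQ_le_const) (use le in blast)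
 then have "dist_int M p s t = 0" by simp
 then have "AE x in M. en (dist (s x) (t x) powr p) = 0" by (subst (asm) nn_integral_0_iff_AE) auto
 then show ?thesis by simp
qed

context unit_ball
begin

lemma weak_sobolev_Sobolev:
 fixes f :: "real ^ 'm => ('b::hilbert, 'q::finite) qtuple"
 assumes f: "weak_sobolev f"
 shows "f : Sobolev U p"
proof (rule SobolevI[OF f])
 obtain G where G: "!!j. EX L. L-lipschitz_on UNIV (G j)" "(%j::nat. Dp (G j) f) ~~> 0"
  by (rule approximants[OF f]) auto
 have "\<forall>\<^sub>F j in sequentially. Dp (G j) f < 1" using G(2) by (rule order_tendstoD) simp
 then obtain j where j: "Dp (G j) f < 1" by (auto simp: eventually_sequentially)
 obtain L where L: "L-lipschitz_on UNIV (G j)" using G(1) by blast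
 let ?A = "%_. qconst 0"
 have G0: "Dp (G j) ?A < oo" using lipschitz_Sobolev[OF L] by (simp add: Sobolev_def Lp_def Dp_eq)
 have "Dp f ?A <= en (4 powr p) * (Dp f (G j) + Dp (G j) ?A + Dp (%_. qconst 0 :: ('b, 'q) qtuple) ?A)"
  unfolding Dp_eq by (intro dist_int_triangle3 borel_dom weak_sobolevD[OF f] lipschitz_borel[OF L] p) auto
 also have "... < oo" using G0 j by (simp add: ennreal_mult_less_top dist_commute[of "f _"] less_trans[OF _ ennreal_one_less_top])
 finally show "Dp f ?A < oo" .
qed

text \<open>A 1-Lipschitz map does not increase distances, so every upper gradient of
  \<open>f\<close> is one of the composition; minimality compares the directional parts along each
  axis and hence the norms of the differentials.\<close>

lemma weak_sobolev_comp:
 fixes f :: "real ^ 'm => ('b::hilbert, 'q::finite) qtuple"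
  and ph :: "('b, 'q) qtuple => ('b, 'q) qtuple"
 assumes f: "weak_sobolev f" and ph: "!!S T. dist (ph S) (ph T) <= dist S T"
 shows "weak_sobolev (%x. ph (f x))" "energy U p (%x. ph (f x)) <= energy U p f"
proof -
 note fb [measurable] = weak_sobolevD(1)[OF f]
 have phL: "1-lipschitz_on UNIV ph" using ph by (intro lipschitz_onI) auto
 then have [measurable]: "ph : BM" by (intro borel_measurable_continuous_onI lipschitz_on_continuous_on)
 let ?A = "%x. ph (f x)"
 have [measurable]: "?A : BM" by simp
 show w: "weak_sobolev ?A"
  unfolding weak_sobolev_def
 proof (intro conjI allI)
  show "integrable lborel (%x. ind U x * dist (ph (f x)) T)" for T
  proof (rule Bochner_Integration.integrable_bound)
   show "integrable lborel (%x. ind U x * dist (f x) T + dist (ph T) T * ind U x)"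
    using weak_sobolevD(2)[OF f] finite_U by simp
   show "AA x. norm (ind U x * dist (ph (f x)) T) <= norm (ind U x * dist (f x) T + dist (ph T) T * ind U x)"
   proof (intro AE_I2)
    fix x
    have "dist (ph (f x)) T <= dist (f x) T + dist (ph T) T" using ph[of "f x" T] dist_triangle[of "ph (f x)" T "ph T"] by simp
    then show "norm (ind U x * dist (ph (f x)) T) <= norm (ind U x * dist (f x) T + dist (ph T) T * ind U x)" by (auto simp: indicator_def)
   qed
  qed measurable
  obtain K where "nik U p K f" using weak_sobolevD(3)[OF f] by blast
  then show "EX K. nik U p K ?A" using nik_comp_lipschitz[of U p K f ph 1, OF _ _ _ p fb U_borel] ph by auto
 qed measurable
 have "AA a. a : U --> dir_deriv U ?A (axis k 1) a <= dir_deriv U f (axis k 1) a" for k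
 proof -
  obtain g :: "real ^ 'm => real" where g: "g : BM" "integrable lborel g"
   "AA a. a : U --> dir_deriv U f (axis k 1) a = g a"
   "!!t. 0 < t ==> AA x:U;t *: axis k 1. dist (f (x + t *: axis k 1)) (f x) <= line_int (axis k 1) t g x"
   by (rule dir_deriv_upper_gradient[OF f, where e="axis k 1"]) simp
  have "AA a. a : U --> dir_deriv U ?A (axis k 1) a <= g a"
  proof (rule dir_deriv_minimal[OF w g(1,2)])
   fix t :: real assume "0 < t"
   from g(4)[OF this] show "AA x:U;t *: axis k 1. dist (ph (f (x + t *: axis k 1))) (ph (f x)) <= line_int (axis k 1) t g x"
    by eventually_elim (use ph order_trans in blast)
  qed
  with g(3) show ?thesis by auto
 qed
 then have "AA a. ALL k:UNIV. a : U --> dir_deriv U ?A (axis k 1) a <= dir_deriv U f (axis k 1) a" by (intro AE_finite_allI) auto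
 then have "AA a. en (Df_norm (Df U ?A a) powr p) * ind U a <= en (Df_norm (Df U f a) powr p) * ind U a"
  using AE_approx[OF w] AE_approx[OF f]
 proof eventually_elim
  case (elim a)
  show ?case
  proof (cases "a : U")
   case True
   then obtain A B where AB: "approx_affine U ?A a A" "approx_affine U f a B" using elim by blast
   have "Df_norm (Df U ?A a) <= Df_norm (Df U f a)"
    unfolding Df_norm_eq[OF weak_sobolevD(1)[OF w] open_U True AB(1)] Df_norm_eq[OF fb open_U True AB(2)]
    using elim(1) True by (intro real_sqrt_le_mono sum_mono) (auto simp: dir_deriv_def qsum_def sum_nonneg)
   then show ?thesis using p by (auto simp: indicator_def Df_norm_def qsum_def sum_nonneg intro!: powr_mono2)
  qed simp
 qed
 then show "energy U p ?A <= energy U p f" unfolding energy_eq by (rule nn_integral_mono_AE)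
qed

text \<open>With bounded energies the second term of the trace estimate is small by the choice of
  \<open>eps\<close>, after which convergence in L_p makes the first one small.\<close>

lemma trace_tendsto:
 assumes T: "is_trace U p T" and f: "f : Sobolev U p" "!!j. F j : Sobolev U p" and c: "energy U p f <= en c" "!!j. energy U p (F j) <= en c" "0 <= c"
  and lim: "(%j. Dp (F j) f) ~~> 0"
 shows "(%j. dist_int bd p (T (F j)) (T f)) ~~> 0"
proof (rule tendsto_zero_ennreal)
 fix e :: real assume e: "0 < e"
 define eps where "eps = e / (4 * (c + 1))"
 have eps: "0 < eps" "eps * (c + c) <= e / 2" using e c by (auto simp: eps_def field_simps)
 obtain th where th: "0 < th" "!!f g. f : Sobolev U p ==> g : Sobolev U p ==>
  dist_int bd p (T f) (T g) <= en th * dist_int (dom_measure U) p f g + en eps * (energy U p f + energy U p g)"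
  using T eps(1) unfolding is_trace_def by blast
 have "\<forall>\<^sub>F j in sequentially. Dp (F j) f < en (e / (4 * th))" using lim e th(1) by (intro order_tendstoD) auto
 then show "\<forall>\<^sub>F j in sequentially. dist_int bd p (T (F j)) (T f) < en e"
 proof eventually_elim
  case (elim j)
  have "dist_int bd p (T (F j)) (T f) <= en th * Dp (F j) f + en eps * (energy U p (F j) + energy U p f)"
   unfolding Dp_eq by (rule th(2)[OF f(2,1)])
  also have "... <= en th * en (e / (4 * th)) + en eps * (en c + en c)"
   using elim c by (intro add_mono mult_left_mono) auto
  also have "... = en (e / 4 + eps * (c + c))"
   using th eps c e by (simp add: ennreal_plus[symmetric] ennreal_mult[symmetric] del: ennreal_plus)
  also have "... < en e" using eps(2) e by (intro ennreal_lessI) auto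
  finally show ?case .
 qed
qed

text \<open>For Lipschitz maps the trace is restriction and the claim is immediate. In general both
  sides are limits along Lipschitz approximations \<open>G j\<close>, whose compositions with
  \<open>ph\<close> stay Lipschitz and bounded in energy, and limits are unique almost
  everywhere.\<close>

lemma trace_comp:
 fixes h :: "real ^ 'm => ('b::hilbert, 'q::finite) qtuple"
  and ph :: "('b, 'q) qtuple => ('b, 'q) qtuple"
 assumes T: "is_trace U p T" and h: "h : Sobolev U p" and ph: "!!S T. dist (ph S) (ph T) <= dist S T"
 shows "AE x in bd. T (%x. ph (hat h x)) x = ph (T h x)"
proof -
 note wh = SobolevD[OF h]
 let ?B = "energy U p (hat h)"
 let ?C = "approx_const TYPE('q) * enn2real (?B)"
 let ?c = "max ?C (enn2real (?B))"
 have c0: "0 <= ?c" by (simp add: le_max_iff_disj)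
 obtain G where G: "!!j. EX L. L-lipschitz_on UNIV (G j)" "(%j::nat. Dp (G j) (hat h)) ~~> 0"
  "!!j. energy U p (G j) <= en ?C"
  by (rule approximants[OF wh]) auto
 have Gc: "energy U p (G j) <= en ?c" for j by (rule order_trans[OF G(3)]) (simp add: ennreal_leI)
 have hc: "?B <= en ?c" using energy_finite[OF wh] by (cases "?B") auto
 have GL: "EX L. L-lipschitz_on UNIV (%x. ph (G j x))" for j
 proof -
  obtain L where L: "L-lipschitz_on UNIV (G j)" using G(1) by blast
  have "L-lipschitz_on UNIV (%x. ph (G j x))"
   using order_trans[OF ph lipschitz_onD[OF L]] lipschitz_on_nonneg[OF L] by (intro lipschitz_onI)
  then show ?thesis by blast
 qed
 have Tlip: "AE x in bd. T F x = F x" if F: "EX L. L-lipschitz_on UNIV F" for F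
 proof -
  obtain L where "L-lipschitz_on (closure U) F" using F lipschitz_on_subset by blast
  then show ?thesis using T unfolding is_trace_def by blast
 qed
 have gb: "F : borel_measurable bd" if F: "EX L. L-lipschitz_on UNIV F" for F :: "real ^ 'm => ('b, 'q) qtuple"
  using F lipschitz_borel measurable_bd by blast
 have Tb: "T f : borel_measurable bd" if "f : Sobolev U p" for f using T that unfolding is_trace_def Lp_def by blast
 have di: "dist_int bd p F t = dist_int bd p (T F) t" if "EX L. L-lipschitz_on UNIV F" for F t
  by (rule nn_integral_cong_AE, use Tlip[OF that] in eventually_elim) simp
 note wG = lipschitz_weak_sobolev and wc = weak_sobolev_comp[OF _ ph]
 have wGj: "weak_sobolev (G j)" for j using G(1) lipschitz_weak_sobolev by blast
 have "(%j. dist_int bd p (T (G j)) (T h)) ~~> 0"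
 proof (rule trace_tendsto[OF T h _ _ Gc c0])
  show "G j : Sobolev U p" for j by (rule weak_sobolev_Sobolev[OF wGj])
  show "energy U p h <= en ?c" using hc by simp
  show "(%j. Dp (G j) h) ~~> 0" using G(2) by (simp add: Dp_eq)
 qed
 then have 1: "(%j. dist_int bd p (G j) (T h)) ~~> 0" unfolding di[OF G(1)] .
 let ?A = "%x. ph (hat h x)"
 have "(%j. dist_int bd p (%x. ph (G j x)) (%x. ph (T h x))) ~~> 0"
  by (rule tendsto_sandwich[OF _ always_eventually tendsto_const 1]) (use ph p in "auto intro!: nn_integral_mono powr_mono2")
 moreover have "(%j. dist_int bd p (T (%x. ph (G j x))) (T ?A)) ~~> 0"
 proof (rule trace_tendsto[OF T _ _ _ _ c0])
  show "?A : Sobolev U p" "(%x. ph (G j x)) : Sobolev U p" for j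
   by (intro weak_sobolev_Sobolev wc wh wGj)+
  show "energy U p ?A <= en ?c" by (rule order_trans[OF wc(2)[OF wh] hc])
  show "energy U p (%x. ph (G j x)) <= en ?c" for j by (rule order_trans[OF wc(2)[OF wGj] Gc])
  show "(%j. Dp (%x. ph (G j x)) ?A) ~~> 0"
  proof (rule tendsto_sandwich[OF _ always_eventually tendsto_const G(2)])
   show "ALL j. Dp (%x. ph (G j x)) ?A <= Dp (G j) (hat h)"
    using ph p by (intro allI nn_integral_mono mult_right_mono ennreal_leI powr_mono2) auto
  qed simp
 qed
 then have "(%j. dist_int bd p (%x. ph (G j x)) (T ?A)) ~~> 0" unfolding di[OF GL] .
 moreover have "(%x. ph (T h x)) : borel_measurable bd"
 proof -
  have "1-lipschitz_on UNIV ph" using ph by (intro lipschitz_onI) auto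
  then have "ph : BM" by (intro borel_measurable_continuous_onI lipschitz_on_continuous_on)
  from measurable_compose[OF Tb[OF h] this] show ?thesis .
 qed
 ultimately show ?thesis
  by (intro dist_int_limit_unique[OF gb[OF GL] Tb[OF weak_sobolev_Sobolev[OF wc(1)[OF wh]]] _ p])
qed

text \<open>The competitor class has to be nonempty. The boundary map is coned: \<open>pinch\<close>
  contracts its values towards the clusters of one value g e by the factor \<open>norm x\<close>.
  The radius 2 L exceeds all distances to g e, so a single cluster decomposition serves the whole
  sphere, and the factor \<open>norm x\<close> absorbs the singularity of the radial projection at
  0.\<close>

lemma sphere_lipschitz_extend:
 fixes g :: "real ^ 'm => ('b::real_normed_vector, 'q::finite) qtuple"
 assumes g: "L-lipschitz_on (frontier U) g"
 shows "EX F M. M-lipschitz_on UNIV F & (ALL x:frontier U. F x = g x)"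
proof -
 define e where "e = (axis undefined 1 :: real ^ 'm)"
 define sg where "sg x = (if x = 0 then e else sgn x)" for x :: "real ^ 'm"
 have sgS: "sg x : frontier U" for x by (auto simp: sg_def e_def frontier_U norm_sgn)
 have L0: "0 <= L" by (rule lipschitz_on_nonneg[OF g])
 let ?rh = "2 * L"
 define F where "F x = pinch (g e) ?rh (norm x) (g (sg x))" for x
 have near: "dist (g (sg x)) (g e) <= ?rh" for x
 proof -
  have "dist (g (sg x)) (g e) <= L * dist (sg x) e" by (rule lipschitz_onD[OF g sgS]) (simp add: frontier_U e_def)
  also have "... <= L * 2"
   using sgS[of x] norm_triangle_ineq4[of "sg x" e] L0 by (intro mult_left_mono) (auto simp: frontier_U dist_norm e_def)
  finally show ?thesis by simp
 qed
 define c where "c = real CARD('q) * (1 + 4 * (real CARD('q))^2) * ?rh"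
 have c0: "0 <= c" using L0 by (simp add: c_def)
 have main: "dist (F x) (F y) <= (2 * L + c) * dist x y" if le: "norm x <= norm y" for x y
 proof -
  have d: "\<bar>norm x - norm y\<bar> <= dist x y" by (simp add: dist_norm norm_triangle_ineq3)
  let ?A = "1 - norm x / norm y"
  let ?B = "dist (sg x) (sg y)"
  have "norm x * ?B <= 2 * dist x y"
  proof (cases "x = 0")
   case False
   then have y: "y ~= 0" "0 < norm y" using le by auto
   have "norm x *: (sg x - sg y) = (x - y) + ?A *: y"
    using y by (simp add: sg_def sgn_div_norm algebra_simps divide_inverse)
   then have "norm x * ?B = norm ((x - y) + ?A *: y)" by (metis abs_norm_cancel dist_norm norm_scaleR)
   also have "... <= norm (x - y) + norm (?A *: y)" by (rule norm_triangle_ineq)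
   also have "norm (?A *: y) = norm y - norm x" using le y(2) by (simp add: field_simps)
   finally show ?thesis using d by (simp add: dist_norm)
  qed simp
  then have "L * (norm x * ?B) <= L * (2 * dist x y)" using L0 by (rule mult_left_mono)
  moreover have "norm x * dist (g (sg x)) (g (sg y)) <= norm x * (L * ?B)"
   by (intro mult_left_mono lipschitz_onD[OF g sgS sgS]) simp
  moreover have "dist (F x) (F y) <= norm x * dist (g (sg x)) (g (sg y)) + \<bar>norm x - norm y\<bar> * c"
   unfolding F_def c_def by (rule pinch_lipschitz[OF near near]) simp
  moreover have "\<bar>norm x - norm y\<bar> * c <= dist x y * c" using d c0 by (rule mult_right_mono)
  ultimately show ?thesis by (simp add: algebra_simps)
 qed
 have "(2 * L + c)-lipschitz_on UNIV F"
 proof (rule lipschitz_onI)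
  show "dist (F x) (F y) <= (2 * L + c) * dist x y" for x y
   using main[of x y] main[of y x] by (cases "norm x <= norm y") (auto simp: dist_commute)
 qed (use L0 c0 in simp)
 moreover have "F x = g x" if "x : frontier U" for x
  using that by (auto simp: F_def sg_def frontier_U sgn_div_norm)
 ultimately show ?thesis by blast
qed

theorem minimizer_exists:
 fixes g :: "real ^ 'm => ('b::hilbert, 'q::finite) qtuple"
 assumes T: "is_trace U p T" and g: "L-lipschitz_on (frontier U) g"
 shows "EX f : Sobolev U p. (AE x in bd. T f x = g x) & (ALL h : Sobolev U p. (AE x in bd. T h x = g x) --> energy U p f <= energy U p h)"
proof -
 define A where "A = {h : Sobolev U p. AE x in bd. T h x = g x}"
 \<comment> \<open>This extension is a competitor of finite energy, which makes the infimum
   \<open>I\<close> a real number.\<close>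
 obtain F0 M where F0: "M-lipschitz_on UNIV F0" "!!x. x : frontier U ==> F0 x = g x" using sphere_lipschitz_extend[OF g] by blast
 have "AE x in bd. T F0 x = F0 x" using T lipschitz_on_subset[OF F0(1), of "closure U"] unfolding is_trace_def by blast
 then have "AE x in bd. T F0 x = g x" using AE_space by eventually_elim (simp add: F0(2))
 then have F0A: "F0 : A" using lipschitz_Sobolev[OF F0(1)] by (simp add: A_def)
 define I where "I = (INF h\<in>A. energy U p h)"
 have "I <= energy U p F0" unfolding I_def by (rule INF_lower[OF F0A])
 also have "... < oo" by (rule energy_finite[OF lipschitz_weak_sobolev[OF F0(1)]])
 finally obtain i where i: "I = en i" "0 <= i" by (cases I) auto
 have "ALL j. EX h. h : A & energy U p h < en (i + 1 / real (Suc j))"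
 proof
  fix j
  have "I < en (i + 1 / real (Suc j))" unfolding i(1) using i(2) by simp
  then show "EX h. h : A & energy U p h < en (i + 1 / real (Suc j))" unfolding I_def INF_less_iff by blast
 qed
 from choice[OF this] obtain h where h: "!!j. h j : A" "!!j. energy U p (h j) < en (i + 1 / real (Suc j))" by blast
 \<comment> \<open>All entries of boundary values. Projection onto \<open>C\<close> fixes these
   entries, so truncation preserves the trace, while all values of the truncated maps lie in a
   compact set.\<close>
 define B where "B = {rep_qtuple s k | s k. s : g ` frontier U}"
 define C where "C = closure (convex hull B)"
 have "compact (g ` frontier U)"
  by (rule compact_continuous_image[OF lipschitz_on_continuous_on[OF g]]) (simp add: frontier_U)
 then have C: "compact C" unfolding C_def B_def by (intro compact_closure_convex_hull totally_bdd_entries totally_bdd_compact)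
 have cC: "convex C" by (simp add: C_def)
 have BC: "B <= C" unfolding C_def by (rule subset_trans[OF hull_subset closure_subset])
 have "axis undefined 1 : frontier U" by (simp add: frontier_U)
 then have "C ~= {}" using BC by (auto simp: B_def)
 define ph where "ph S = qmap (nearest C) S" for S :: "('b, 'q) qtuple"
 have ph: "dist (ph S) (ph S') <= dist S S'" for S S' unfolding ph_def by (intro qmap_lipschitz nearest_lipschitz C cC `C ~= {}`)
 have phg: "ph (g x) = g x" if x: "x : frontier U" for x
 proof -
  have "nearest C (rep_qtuple (g x) k) = rep_qtuple (g x) k" for k using BC x by (intro nearest_self[OF C]) (auto simp: B_def)
  then have "ph (qtuple (rep_qtuple (g x))) = qtuple (rep_qtuple (g x))" unfolding ph_def qmap_qtuple by simp
  then show ?thesis by simp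
 qed
 let ?K = "{qtuple z | z :: 'q => 'b. ALL k. z k : C}"
 have phK: "ph S : ?K" for S
 proof -
  obtain a where "S = qtuple a" by (rule qtuple_exhaust)
  then show ?thesis using nearest(1)[OF C `C ~= {}`] by (auto simp: ph_def)
 qed
 define k where "k j x = ph (hat (h j) x)" for j x
 have hS: "h j : Sobolev U p" for j using h(1) by (simp add: A_def)
 have kw: "weak_sobolev (k j)" and ke: "energy U p (k j) <= en (i + 1 / real (Suc j))" for j
  using weak_sobolev_comp[OF SobolevD[OF hS[of j]] ph] h(2)[of j] by (auto simp: k_def[abs_def])
 have ke': "energy U p (k j) <= en (i + 1 / real (Suc n))" if "n <= j" for j n
  by (rule order_trans[OF ke]) (use that in "auto intro!: ennreal_leI divide_left_mono")
 have kT: "AE x in bd. T (k j) x = g x" for j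
 proof -
  have "AE x in bd. T (h j) x = g x" using h(1) by (simp add: A_def)
  with trace_comp[OF T hS[of j] ph] show ?thesis unfolding k_def[abs_def]
   using AE_space by eventually_elim (simp add: phg)
 qed
 obtain r f where r: "strict_mono (r :: nat => nat)" and f: "f : BM" "(%j. Dp (k (r j)) f) ~~> 0"
 proof (rule Rellich[of ?K k "i + 1"])
  show "totally_bdd ?K" by (rule totally_bdd_qtuples[OF totally_bdd_compact[OF C]])
  show "k j : BM" for j by (rule weak_sobolevD(1)[OF kw])
  show "nik U p (i + 1) (k j)" for j using ke'[of 0 j] i(2) by (intro nik_energy[OF kw]) auto
  show "k j ` U <= ?K" for j using phK by (auto simp: k_def)
 qed (rule that)
 \<comment> \<open>Lower semicontinuity is stated for a uniform energy bound, so it is applied to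
   every tail of the minimizing subsequence, with a bound tending to \<open>I\<close>.\<close>
 have fw: "weak_sobolev f" "energy U p f <= en (i + 1 / real (Suc n))" for n
 proof -
  have l: "(%j. Dp (k (r (j + n))) f) ~~> 0" using LIMSEQ_ignore_initial_segment[OF f(2), of n] .
  have e: "energy U p (k (r (j + n))) <= en (i + 1 / real (Suc n))" for j
   using seq_suble[OF r, of "j + n"] by (intro ke') simp
  have "0 <= i + 1 / real (Suc n)" using i by simp
  from weak_sobolev_closed[where F="%j. k (r (j + n))", OF kw e this f(1) l]
  show "weak_sobolev f" "energy U p f <= en (i + 1 / real (Suc n))" .
 qed
 have "(%n. en (i + 1 / real (Suc n))) ~~> en (i + 0)"
  by (intro tendsto_ennrealI tendsto_add tendsto_const lim_1_over_n[THEN LIMSEQ_Suc])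
 then have "energy U p f <= en (i + 0)" by (rule LIMSEQ_le_const) (use fw(2) in blast)
 then have fI: "energy U p f <= I" by (simp add: i)
 have fS: "f : Sobolev U p" by (rule weak_sobolev_Sobolev[OF fw(1)])
 have Tb: "T f : borel_measurable bd" if "f : Sobolev U p" for f using T that unfolding is_trace_def Lp_def by blast
 have "(%j. dist_int bd p (T (k (r j))) (T f)) ~~> 0"
 proof (rule trace_tendsto[OF T fS])
  show "k (r j) : Sobolev U p" for j by (rule weak_sobolev_Sobolev[OF kw])
  show "energy U p f <= en (i + 1)" using fw(2)[of 0] by simp
  show "energy U p (k (r j)) <= en (i + 1)" for j using ke'[of 0] by simp
 qed (use i f in auto)
 \<comment> \<open>All traces equal \<open>g\<close> almost everywhere, so the convergent sequence
   of traces is constant and its limit is the trace of \<open>f\<close>.\<close>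
 moreover have "dist_int bd p (T (k (r j))) t = dist_int bd p (T (k 0)) t" for j t
  by (rule nn_integral_cong_AE, use kT[of "r j"] kT[of 0] in eventually_elim) simp
 ultimately have "(%j::nat. dist_int bd p (T (k 0)) (T f)) ~~> 0" by simp
 then have "AE x in bd. T (k 0) x = T f x"
  by (intro dist_int_limit_unique[of "%_. T (k 0)" bd _ _ p] Tb weak_sobolev_Sobolev kw fw(1) p) auto
 then have "AE x in bd. T f x = g x" using kT[of 0] by eventually_elim simp
 moreover have "energy U p f <= energy U p h" if "h : Sobolev U p" "AE x in bd. T h x = g x" for h
  using fI INF_lower[of h A "energy U p"] that by (auto simp: I_def A_def intro: order_trans)
 ultimately show ?thesis using fS by blast
qed

end

theorem theorem4p9p2:
 fixes U :: "(real ^ 'm) set" and p L :: real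
  and g :: "real ^ 'm \<Rightarrow> (l2, 'q::finite) qtuple"
 assumes "U = ball 0 1"
  and "1 < p"
  and "L-lipschitz_on (frontier U) g"
 shows "\<exists>f \<in> Sobolev U p. (AE x in bd_measure U. sobolev_trace U p f x = g x) \<and>
  (\<forall>h \<in> Sobolev U p. (AE x in bd_measure U. sobolev_trace U p h x = g x) \<longrightarrow>
   energy U p f \<le> energy U p h)"
proof -
 interpret unit_ball U p "CARD('m)"
  by unfold_locales (use assms emeasure_lborel_ball_finite[of 0 1] in simp_all)
 have "is_trace U p (sobolev_trace U p :: (real ^ 'm => (l2, 'q) qtuple) => _)"
  unfolding sobolev_trace_def by (rule someI_ex[OF is_trace_exists])
 then show ?thesis using assms(3) by (rule minimizer_exists)
qed

end
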